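(* Let $\Omega\subset\mathbb R^N$ be a bounded open set with sufficiently smooth boundary, and let $1\le p<\frac{N+2}{N-2}$ if $N\ge3$, $1\le p<\infty$ if $N=1,2$. Let $g:\Omega\times\mathbb R\to\mathbb R$ be measurable and satisfy: (a) there is $C>0$ with $|g(x,t)|\le C(1+|t|^p)$ for a.e. $(x,t)\in\Omega\times\mathbb R$; (b) $g(x,0)=0$ and $\lim_{\varepsilon\searrow0}\operatorname{ess\,sup}\left\{\left|\frac{g(x,t)}{t}\right|:\ (x,t)\in\Omega\times[-\varepsilon,\varepsilon]\right\}<\lambda_1$; (c) there exist $\mu>2$ and $r\ge0$ such that $\mu G(x,t)\le t\,\underline g(x,t)$ for a.e. $x\in\Omega$ and $t\ge r$; $\mu G(x,t)\le t\,\overline g(x,t)$ for a.e. $x\in\Omega$ and $t\le-r$; and $g(x,t)\ge1$ for a.e. $x\in\Omega$ and $t\ge r$. Let $0<C_1<\lambda_1$ and $C_2>0$ be constants such that $|g(x,t)|\le C_1|t|+C_2|t|^p$ for a.e. $(x,t)\in\Omega\times\mathbb R$ (such constants exist by (a) and (b)), and put $\alpha=\frac{\lambda_1}{\lambda_1-C_1}>1$. Let $a\in L^\infty(\Omega)$ be such that the operator $-\Delta+\alpha a$ is coercive (on $H^1_0(\Omega)$). Let $q$ be the conjugate exponent of $p+1$. Then there exists $\delta>0$ such that for every $b\in L^q(\Omega)$ with $\|b\|_{L^\infty(\Omega)}<\delta$, the problem $$-\Delta u(x)+a(x)u(x)+b(x)\in[\underline g(x,u(x)),\overline g(x,u(x))]\quad\text{for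 a.e. }x\in\Omega$$ has a solution $u\in H^1_0(\Omega)$.
   Context: $\lambda_1$ is the first eigenvalue of $-\Delta$ in $H^1_0(\Omega)$. $G(x,t)=\int_0^tg(x,s)\,ds$. $\underline g(x,t)=\lim_{\varepsilon\searrow0}\operatorname{ess\,inf}\{g(x,s):|t-s|<\varepsilon\}$ and $\overline g(x,t)=\lim_{\varepsilon\searrow0}\operatorname{ess\,sup}\{g(x,s):|t-s|<\varepsilon\}$. *)

theory Defs
  imports "HOL-Analysis.Analysis" "HOL-Probability.Essential_Supremum"
begin

section \<open>Differentiability classes, test functions and domains\<close>

definition partial_deriv :: "'a::euclidean_space \<Rightarrow> ('a \<Rightarrow> real) \<Rightarrow> 'a \<Rightarrow> real" where
  "partial_deriv i f x = frechet_derivative f (at x) i"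

definition grad :: "('a::euclidean_space \<Rightarrow> real) \<Rightarrow> 'a \<Rightarrow> 'a" where
  "grad f x = (\<Sum>i\<in>Basis. partial_deriv i f x *\<^sub>R i)"

definition laplacian :: "('a::euclidean_space \<Rightarrow> real) \<Rightarrow> 'a \<Rightarrow> real" where
  "laplacian f x = (\<Sum>i\<in>Basis. partial_deriv i (partial_deriv i f) x)"

text \<open>Meant for open sets \<open>S\<close>.\<close>
fun Ck_on :: "nat \<Rightarrow> 'a::euclidean_space set \<Rightarrow> ('a \<Rightarrow> real) \<Rightarrow> bool" where
  "Ck_on 0 S f \<longleftrightarrow> continuous_on S f"
| "Ck_on (Suc k) S f \<longleftrightarrow>
     f differentiable_on S \<and> (\<forall>i\<in>Basis. Ck_on k S (partial_deriv i f))"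

definition test_function :: "'a::euclidean_space set \<Rightarrow> ('a \<Rightarrow> real) \<Rightarrow> bool" where
  "test_function \<Omega> \<phi> \<longleftrightarrow> (\<forall>k. Ck_on k UNIV \<phi>) \<and>
     compact (closure {x. \<phi> x \<noteq> 0}) \<and> closure {x. \<phi> x \<noteq> 0} \<subseteq> \<Omega>"

text \<open>Near each boundary point \<open>\<Omega>\<close> is the sublevel set of a \<open>C\<^sup>k\<close> function with
  nonvanishing gradient there. For \<open>k \<ge> 1\<close> the implicit function theorem shows that the
  boundary is locally a \<open>C\<^sup>k\<close> graph with \<open>\<Omega>\<close> on one side of it.\<close>
definition Ck_boundary :: "nat \<Rightarrow> 'a::euclidean_space set \<Rightarrow> bool" where
  "Ck_boundary k \<Omega> \<longleftrightarrow> (\<forall>x\<^sub>0\<in>frontier \<Omega>. \<exists>U \<psi>. open U \<and> x\<^sub>0 \<in> U \<and>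
     Ck_on k U \<psi> \<and> grad \<psi> x\<^sub>0 \<noteq> 0 \<and> \<Omega> \<inter> U = {x\<in>U. \<psi> x < 0})"


section \<open>Lebesgue spaces\<close>

text \<open>Elements of function spaces are functions rather than almost-everywhere classes;
  their values outside \<open>\<Omega>\<close> are irrelevant.\<close>

definition Lp :: "real \<Rightarrow> 'a::euclidean_space set \<Rightarrow> ('a \<Rightarrow> 'b::euclidean_space) set" where
  "Lp p \<Omega> = {f \<in> borel_measurable (lebesgue_on \<Omega>).
     integrable (lebesgue_on \<Omega>) (\<lambda>x. norm (f x) powr p)}"

definition L1loc :: "'a::euclidean_space set \<Rightarrow> ('a \<Rightarrow> 'b::euclidean_space) set" where
  "L1loc \<Omega> = {f. \<forall>K. compact K \<and> K \<subseteq> \<Omega> \<longrightarrow> f absolutely_integrable_on K}"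

definition Linf_norm :: "'a::euclidean_space set \<Rightarrow> ('a \<Rightarrow> real) \<Rightarrow> ereal" where
  "Linf_norm \<Omega> f = esssup (lebesgue_on \<Omega>) (\<lambda>x. ereal \<bar>f x\<bar>)"

definition Linf :: "'a::euclidean_space set \<Rightarrow> ('a \<Rightarrow> real) set" where
  "Linf \<Omega> = {f \<in> borel_measurable (lebesgue_on \<Omega>). Linf_norm \<Omega> f < \<infinity>}"


section \<open>Weak derivatives and Sobolev spaces\<close>

definition has_weak_gradient ::
    "'a::euclidean_space set \<Rightarrow> ('a \<Rightarrow> real) \<Rightarrow> ('a \<Rightarrow> 'a) \<Rightarrow> bool" where
  "has_weak_gradient \<Omega> u v \<longleftrightarrow> u \<in> L1loc \<Omega> \<and> v \<in> L1loc \<Omega> \<and>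
     (\<forall>\<phi>. test_function \<Omega> \<phi> \<longrightarrow> (\<forall>i\<in>Basis.
        (LINT x|lebesgue_on \<Omega>. u x * partial_deriv i \<phi> x) =
        - (LINT x|lebesgue_on \<Omega>. (v x \<bullet> i) * \<phi> x)))"

text \<open>The distributional Laplacian of \<open>u\<close> on \<open>\<Omega>\<close> is the locally integrable function \<open>w\<close>.\<close>
definition has_weak_laplacian ::
    "'a::euclidean_space set \<Rightarrow> ('a \<Rightarrow> real) \<Rightarrow> ('a \<Rightarrow> real) \<Rightarrow> bool" where
  "has_weak_laplacian \<Omega> u w \<longleftrightarrow> u \<in> L1loc \<Omega> \<and> w \<in> L1loc \<Omega> \<and>
     (\<forall>\<phi>. test_function \<Omega> \<phi> \<longrightarrow>
        (LINT x|lebesgue_on \<Omega>. u x * laplacian \<phi> x) =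
        (LINT x|lebesgue_on \<Omega>. w x * \<phi> x))"

text \<open>The weak gradient is unique up to null sets, so the choice is harmless below.\<close>
definition weak_grad :: "'a::euclidean_space set \<Rightarrow> ('a \<Rightarrow> real) \<Rightarrow> 'a \<Rightarrow> 'a" where
  "weak_grad \<Omega> u = (SOME v. has_weak_gradient \<Omega> u v)"

definition H1 :: "'a::euclidean_space set \<Rightarrow> ('a \<Rightarrow> real) set" where
  "H1 \<Omega> = {u \<in> Lp 2 \<Omega>. \<exists>v\<in>Lp 2 \<Omega>. has_weak_gradient \<Omega> u v}"

definition H1_norm :: "'a::euclidean_space set \<Rightarrow> ('a \<Rightarrow> real) \<Rightarrow> real" where
  "H1_norm \<Omega> u = sqrt ((LINT x|lebesgue_on \<Omega>. (u x)\<^sup>2) +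
     (LINT x|lebesgue_on \<Omega>. (norm (weak_grad \<Omega> u x))\<^sup>2))"

definition H10 :: "'a::euclidean_space set \<Rightarrow> ('a \<Rightarrow> real) set" where
  "H10 \<Omega> = {u \<in> H1 \<Omega>. \<forall>\<epsilon>>0. \<exists>\<phi>. test_function \<Omega> \<phi> \<and> H1_norm \<Omega> (\<lambda>x. u x - \<phi> x) < \<epsilon>}"


section \<open>The operator \<open>-\<Delta> + c\<close> on \<open>H\<^sup>1\<^sub>0\<close>\<close>

definition dirichlet_eigenvalue :: "'a::euclidean_space set \<Rightarrow> real \<Rightarrow> bool" where
  "dirichlet_eigenvalue \<Omega> l \<longleftrightarrow> (\<exists>u\<in>H10 \<Omega>. \<not> (AE x in lebesgue_on \<Omega>. u x = 0) \<and>
     has_weak_laplacian \<Omega> u (\<lambda>x. - l * u x))"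

definition lambda1 :: "'a::euclidean_space set \<Rightarrow> real" where
  "lambda1 \<Omega> = (LEAST l. dirichlet_eigenvalue \<Omega> l)"

text \<open>The left-hand side is the duality pairing of \<open>-\<Delta>u + cu\<close> with \<open>u\<close>.\<close>
definition coercive_op :: "'a::euclidean_space set \<Rightarrow> ('a \<Rightarrow> real) \<Rightarrow> bool" where
  "coercive_op \<Omega> c \<longleftrightarrow> (\<exists>\<kappa>>0. \<forall>u\<in>H10 \<Omega>.
     (LINT x|lebesgue_on \<Omega>. (norm (weak_grad \<Omega> u x))\<^sup>2) +
     (LINT x|lebesgue_on \<Omega>. c x * (u x)\<^sup>2) \<ge> \<kappa> * (H1_norm \<Omega> u)\<^sup>2)"


section \<open>The nonlinearity\<close>

definition essinf :: "'a measure \<Rightarrow> ('a \<Rightarrow> ereal) \<Rightarrow> ereal" where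
  "essinf M f = - esssup M (\<lambda>x. - f x)"

text \<open>The limits below are monotone in \<open>\<epsilon>\<close>, hence they exist in \<^typ>\<open>ereal\<close>.\<close>

definition lower_env :: "('a \<Rightarrow> real \<Rightarrow> real) \<Rightarrow> 'a \<Rightarrow> real \<Rightarrow> ereal" where
  "lower_env g x t =
     Lim (at_right 0) (\<lambda>\<epsilon>::real. essinf (lebesgue_on {s. \<bar>t - s\<bar> < \<epsilon>}) (\<lambda>s. ereal (g x s)))"

definition upper_env :: "('a \<Rightarrow> real \<Rightarrow> real) \<Rightarrow> 'a \<Rightarrow> real \<Rightarrow> ereal" where
  "upper_env g x t =
     Lim (at_right 0) (\<lambda>\<epsilon>::real. esssup (lebesgue_on {s. \<bar>t - s\<bar> < \<epsilon>}) (\<lambda>s. ereal (g x s)))"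

text \<open>The integral is oriented. It is taken with respect to \<^term>\<open>lebesgue\<close> because the
  sections of \<open>g\<close> need only be Lebesgue measurable.\<close>
definition primitive :: "('a \<Rightarrow> real \<Rightarrow> real) \<Rightarrow> 'a \<Rightarrow> real \<Rightarrow> real" where
  "primitive g x t = (LINT s=0..ereal t|lebesgue. g x s)"

end

theory Submission
  imports Defs "HOL-Complex_Analysis.Great_Picard" "HOL-Probability.Distributions"
begin

text \<open>
  Only a solution of small supremum norm is sought, so only the values of \<open>g\<close> near \<open>0\<close> matter and
  no Sobolev embedding is needed. Superquadratic growth of the primitive forces \<open>p > 1\<close>; hence
  \<open>\<bar>g(x,t)\<bar> \<le> C \<bar>t\<bar>\<close> for \<open>\<bar>t\<bar> \<le> \<epsilon>\<close>, with \<open>C\<close> so close to \<open>C\<^sub>1\<close> that \<open>-\<Delta> + a - C\<close> is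
  still coercive on \<open>H\<^sup>1\<^sub>0\<close>. Set \<open>g\<close> to \<open>0\<close> for \<open>\<bar>t\<bar> > \<epsilon>\<close> and let \<open>\<Gamma>\<close> be the primitive in \<open>t\<close> of
  the result. By Rellich's theorem the Lipschitz functional \<open>\<integral> \<bar>\<nabla>u\<bar>\<^sup>2 / 2 + a u\<^sup>2 / 2 + b u - \<Gamma>(x,u)\<close>
  attains its minimum at some \<open>u\<close>. Minimality makes \<open>\<psi> \<mapsto> \<integral> \<nabla>u \<bullet> \<nabla>\<psi> + (a u + b) \<psi>\<close> continuous in \<open>L\<^sup>2\<close>, so
  it is represented by some \<open>w\<close>, that is \<open>-\<Delta>u + a u + b = w\<close>; and \<open>w(x)\<close> lies between the
  one-sided derivatives of \<open>\<Gamma>(x,\<cdot>)\<close> at \<open>u(x)\<close>, hence between the envelopes of the truncated \<open>g\<close>.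
  Coercivity gives \<open>\<parallel>u\<parallel>\<^sub>2 = O(\<delta>)\<close>. As \<open>\<bar>w\<bar> \<le> C \<bar>u\<bar>\<close>, Kato's inequality
  \<open>-\<Delta>\<bar>u\<bar> \<le> \<Lambda> \<bar>u\<bar> + \<delta>\<close> holds on the whole space, and testing it with the heat kernel turns the
  integral bound into \<open>\<bar>u\<bar> < \<epsilon>\<close> almost everywhere, where the truncation is invisible.
\<close>

section \<open>Smooth functions and test functions\<close>

text \<open>The lower-order part of the functional is neither convex nor differentiable. Existence
  rests on its continuity in L2: once Rellich's theorem has made a minimising sequence Cauchy in L2,
  the parallelogram identity makes the gradients Cauchy as well, so the minimiser is a strong limit.
  In place of an Euler equation there are one-sided inequalities that confine \<open>w\<close> to an
  interval, which is all that the set-valued right-hand side asks for. All competitors are test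
  functions with classical gradients. Elements of \<open>H10\<close> occur as L2 limits of pairs
  (function, gradient), because \<open>weak_grad\<close> is a choice, fixed only up to null sets.
  The same minimisation identifies \<open>lambda1\<close> with the infimum of the Rayleigh quotient;
  this turns coercivity of -\<Delta> + \<alpha> a into coercivity of -\<Delta> + a -
  \<open>C\<^sub>1\<close>. Since \<open>g\<close> is merely Lebesgue measurable and its bounds hold
  almost everywhere, it is exchanged for a Borel version that is set to 0 also where the linear
  bound fails. Then \<Gamma> is jointly Borel and satisfies its bounds at every point.\<close>

definition smooth :: "('a::euclidean_space \<Rightarrow> real) \<Rightarrow> bool" where
  "smooth f \<longleftrightarrow> (\<forall>k. Ck_on k UNIV f)"

lemma partial_deriv_eq:
  "(f has_derivative f') (at x) \<Longrightarrow> partial_deriv i f x = f' i"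
  unfolding partial_deriv_def using frechet_derivative_at[of f f' x] by simp

lemma Ck_on_SucI:
  assumes "\<And>x. f differentiable (at x)" "\<And>i. i \<in> Basis \<Longrightarrow> Ck_on k UNIV (partial_deriv i f)"
  shows "Ck_on (Suc k) UNIV f"
  using assms by (auto simp: differentiable_on_def)

lemma Ck_on_Suc_differentiable: "Ck_on (Suc k) UNIV f \<Longrightarrow> f differentiable (at x)"
  by (auto simp: differentiable_on_def)

lemma Ck_on_Suc_D: "Ck_on (Suc k) S f \<Longrightarrow> Ck_on k S f"
proof (induction k arbitrary: f)
  case 0
  then show ?case by (auto intro: differentiable_imp_continuous_on)
next
  case (Suc k)
  then show ?case by auto
qed

lemma smooth_differentiable: "smooth f \<Longrightarrow> f differentiable (at x)"
  unfolding smooth_def using Ck_on_Suc_differentiable[of 0 f x] by blast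

lemma smooth_partial_deriv: "smooth f \<Longrightarrow> i \<in> Basis \<Longrightarrow> smooth (partial_deriv i f)"
  unfolding smooth_def by (metis Ck_on.simps(2))

lemma smooth_continuous_on: "smooth f \<Longrightarrow> continuous_on S f"
  unfolding smooth_def by (metis Ck_on.simps(1) continuous_on_subset subset_UNIV)

lemma smooth_has_derivative:
  assumes "smooth f" shows "(f has_derivative (\<lambda>h. grad f x \<bullet> h)) (at x)"
proof -
  let ?D = "frechet_derivative f (at x)"
  have D: "(f has_derivative ?D) (at x)"
    using smooth_differentiable[OF assms] frechet_derivative_works by blast
  have lin: "linear ?D" using D has_derivative_linear by blast
  have "?D h = grad f x \<bullet> h" for h
  proof -
    have "?D h = ?D (\<Sum>i\<in>Basis. (h \<bullet> i) *\<^sub>R i)" by (simp add: euclidean_representation)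
    also have "\<dots> = (\<Sum>i\<in>Basis. (h \<bullet> i) * ?D i)"
      by (simp add: linear_sum[OF lin] linear_cmul[OF lin])
    finally show ?thesis
      by (simp add: grad_def partial_deriv_def inner_sum_right inner_commute mult.commute)
  qed
  then have "?D = (\<lambda>h. grad f x \<bullet> h)" by (rule ext)
  with D show ?thesis by simp
qed

lemma grad_inner_Basis: "i \<in> Basis \<Longrightarrow> grad f x \<bullet> i = partial_deriv i f x"
  by (simp add: grad_def inner_sum_left inner_Basis if_distrib sum.delta cong: if_cong)

lemma partial_deriv_const: "partial_deriv i (\<lambda>x. c) = (\<lambda>x. 0)"
  by (simp add: partial_deriv_def fun_eq_iff)

lemma Ck_on_const: "Ck_on k UNIV (\<lambda>x. c)"
proof (induction k arbitrary: c)
  case (Suc k)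
  then show ?case by (simp add: partial_deriv_const differentiable_on_def)
qed (simp add: continuous_on_const)

lemma partial_deriv_add:
  fixes f g :: "'a::euclidean_space \<Rightarrow> real"
  assumes "f differentiable (at x)" "g differentiable (at x)"
  shows "partial_deriv i (\<lambda>x. f x + g x) x = partial_deriv i f x + partial_deriv i g x"
  using assms partial_deriv_eq[OF has_derivative_add]
  unfolding partial_deriv_def frechet_derivative_works by blast

lemma Ck_on_add: "Ck_on k UNIV f \<Longrightarrow> Ck_on k UNIV g \<Longrightarrow> Ck_on k UNIV (\<lambda>x. f x + g x)"
proof (induction k arbitrary: f g)
  case (Suc k)
  note d = Suc.prems[THEN Ck_on_Suc_differentiable]
  have "partial_deriv i (\<lambda>x. f x + g x) = (\<lambda>x. partial_deriv i f x + partial_deriv i g x)" for i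
    using d by (auto simp: fun_eq_iff partial_deriv_add)
  with Suc d show ?case by (intro Ck_on_SucI) auto
qed (simp add: continuous_on_add)

lemma partial_deriv_mult:
  fixes f g :: "'a::euclidean_space \<Rightarrow> real"
  assumes "f differentiable (at x)" "g differentiable (at x)"
  shows "partial_deriv i (\<lambda>x. f x * g x) x = f x * partial_deriv i g x + partial_deriv i f x * g x"
  using assms partial_deriv_eq[OF has_derivative_mult] 
  unfolding partial_deriv_def frechet_derivative_works by blast

lemma Ck_on_mult: "Ck_on k UNIV f \<Longrightarrow> Ck_on k UNIV g \<Longrightarrow> Ck_on k UNIV (\<lambda>x. f x * g x)"
proof (induction k arbitrary: f g)
  case (Suc k)
  note d = Suc.prems[THEN Ck_on_Suc_differentiable]
  have "partial_deriv i (\<lambda>x. f x * g x) = (\<lambda>x. f x * partial_deriv i g x + partial_deriv i f x * g x)" for i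
    using d by (auto simp: fun_eq_iff partial_deriv_mult)
  with Suc d show ?case using Ck_on_Suc_D[OF Suc.prems(1)] Ck_on_Suc_D[OF Suc.prems(2)]
    by (intro Ck_on_SucI) (auto intro!: Ck_on_add)
qed (simp add: continuous_on_mult)

lemma smooth_const: "smooth (\<lambda>x. c)" by (simp add: smooth_def Ck_on_const)

lemma smooth_add: "smooth f \<Longrightarrow> smooth g \<Longrightarrow> smooth (\<lambda>x. f x + g x)"
  by (simp add: smooth_def Ck_on_add)

lemma smooth_mult: "smooth f \<Longrightarrow> smooth g \<Longrightarrow> smooth (\<lambda>x. f x * g x)"
  by (simp add: smooth_def Ck_on_mult)

lemma smooth_sum: "finite I \<Longrightarrow> (\<And>i. i \<in> I \<Longrightarrow> smooth (f i)) \<Longrightarrow> smooth (\<lambda>x. \<Sum>i\<in>I. f i x)"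
  by (induction I rule: finite_induct) (auto intro: smooth_add smooth_const)

lemma smooth_prod: "finite I \<Longrightarrow> (\<And>i. i \<in> I \<Longrightarrow> smooth (f i)) \<Longrightarrow> smooth (\<lambda>x. \<Prod>i\<in>I. f i x)"
  by (induction I rule: finite_induct) (auto intro: smooth_mult smooth_const)

lemma smoothI:
  assumes "\<And>x. f differentiable (at x)" "\<And>i. i \<in> Basis \<Longrightarrow> smooth (partial_deriv i f)"
  shows "smooth f"
  unfolding smooth_def
proof
  fix k show "Ck_on k UNIV f"
    using assms by (cases k) (auto simp: smooth_def differentiable_on_def
      intro!: differentiable_imp_continuous_on[unfolded differentiable_on_def] elim!: allE)
qed

lemma smooth_inner: "smooth (\<lambda>x. x \<bullet> c)"
proof (rule smoothI)
  have D: "((\<lambda>x. x \<bullet> c) has_derivative (\<lambda>h. h \<bullet> c)) (at x)" for x :: 'a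
    by (auto intro!: derivative_eq_intros)
  show "(\<lambda>x. x \<bullet> c) differentiable at x" for x using D differentiable_def by blast
  show "smooth (partial_deriv i (\<lambda>x. x \<bullet> c))" for i
  proof -
    have "partial_deriv i (\<lambda>x. x \<bullet> c) = (\<lambda>x. i \<bullet> c)"
      by (rule ext) (rule partial_deriv_eq[OF D])
    then show ?thesis by (simp add: smooth_const)
  qed
qed

lemma partial_deriv_chain:
  assumes "f differentiable (at x)" "(F has_real_derivative D) (at (f x))"
  shows "partial_deriv i (\<lambda>x. F (f x)) x = D * partial_deriv i f x"
    "(\<lambda>x. F (f x)) differentiable (at x)"
proof -
  have "(f has_derivative frechet_derivative f (at x)) (at x)"
    using assms(1) frechet_derivative_works by blast
  then have *: "((\<lambda>x. F (f x)) has_derivative (\<lambda>h. D * frechet_derivative f (at x) h)) (at x)"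
    using has_derivative_compose[of f _ x UNIV F "(*) D"] assms(2)
    by (simp add: has_field_derivative_def)
  then show "partial_deriv i (\<lambda>x. F (f x)) x = D * partial_deriv i f x"
    using partial_deriv_eq[OF *, of i] by (simp add: partial_deriv_def[of _ f])
  show "(\<lambda>x. F (f x)) differentiable (at x)" using * differentiable_def by blast
qed

lemma grad_chain:
  assumes "f differentiable (at x)" "(F has_real_derivative D) (at (f x))"
  shows "grad (\<lambda>x. F (f x)) x = D *\<^sub>R grad f x"
  by (simp add: grad_def partial_deriv_chain[OF assms] scaleR_sum_right)

lemma grad_mult:
  assumes "f differentiable (at x)" "g differentiable (at x)"
  shows "grad (\<lambda>x. f x * g x) x = f x *\<^sub>R grad g x + g x *\<^sub>R grad f x"
  by (simp add: grad_def partial_deriv_mult[OF assms] scaleR_sum_right algebra_simps sum.distrib)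

lemma grad_add:
  assumes "f differentiable (at x)" "g differentiable (at x)"
  shows "grad (\<lambda>x. f x + g x) x = grad f x + grad g x"
  by (simp add: grad_def partial_deriv_add[OF assms] algebra_simps sum.distrib)

lemma grad_cmult:
  assumes "f differentiable (at x)"
  shows "grad (\<lambda>x. c * f x) x = c *\<^sub>R grad f x"
  using grad_mult[OF differentiable_const[of c] assms]
  by (simp add: grad_def partial_deriv_const)

text \<open>The derivative of \<open>F \<circ> f\<close> is again built from \<open>F \<circ> f\<close> and derivatives of \<open>f\<close>, so
  smoothness follows by induction on the order without a chain rule for higher derivatives.\<close>

lemma smooth_exp: assumes "smooth f" shows "smooth (\<lambda>x. exp (f x))"
proof -
  have d: "f differentiable (at x)" for x using smooth_differentiable assms by blast
  have p: "partial_deriv i (\<lambda>x. exp (f x)) = (\<lambda>x. exp (f x) * partial_deriv i f x)" for i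
    using partial_deriv_chain(1)[OF d DERIV_exp] by auto
  have "Ck_on k UNIV (\<lambda>x. exp (f x))" for k
  proof (induction k)
    case 0
    then show ?case using smooth_continuous_on[OF assms] by (auto intro: continuous_intros)
  next
    case (Suc k)
    show ?case using partial_deriv_chain(2)[OF d DERIV_exp] Suc smooth_partial_deriv[OF assms]
      by (intro Ck_on_SucI) (auto simp: p smooth_def intro: Ck_on_mult)
  qed
  then show ?thesis by (simp add: smooth_def)
qed

lemma smooth_tanh: assumes "smooth f" shows "smooth (\<lambda>x. tanh (f x))"
proof -
  have d: "f differentiable (at x)" for x using smooth_differentiable assms by blast
  have D: "(tanh has_real_derivative (1 - tanh y * tanh y)) (at y)" for y :: real
    by (auto intro!: derivative_eq_intros simp: power2_eq_square)
  have p: "partial_deriv i (\<lambda>x. tanh (f x)) =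
      (\<lambda>x. (1 + (-1) * (tanh (f x) * tanh (f x))) * partial_deriv i f x)" for i
    using partial_deriv_chain(1)[OF d D] by auto
  have "Ck_on k UNIV (\<lambda>x. tanh (f x))" for k
  proof (induction k)
    case 0
    then show ?case using smooth_continuous_on[OF assms] by (auto intro!: continuous_intros)
  next
    case (Suc k)
    show ?case using partial_deriv_chain(2)[OF d D] Suc smooth_partial_deriv[OF assms]
      by (intro Ck_on_SucI) (auto simp only: p smooth_def intro!: Ck_on_mult Ck_on_add Ck_on_const)
  qed
  then show ?thesis by (simp add: smooth_def)
qed

lemma has_derivative_ln_cosh: "((\<lambda>y. ln (cosh y)) has_real_derivative tanh y) (at y)"
  by (auto intro!: derivative_eq_intros simp: tanh_def cosh_real_pos)

text \<open>\<open>ln (cosh t)\<close> is a smooth stand-in for \<bar>t\<bar> that vanishes at 0.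
  Its derivative is \<open>tanh\<close>, so one differentiation reduces the claim to
  \<open>smooth_tanh\<close>.\<close>

lemma smooth_ln_cosh: assumes "smooth f" shows "smooth (\<lambda>x. ln (cosh (f x)))"
proof (rule smoothI)
  have d: "f differentiable (at x)" for x using smooth_differentiable assms by blast
  show "(\<lambda>x. ln (cosh (f x))) differentiable (at x)" for x
    using partial_deriv_chain(2)[OF d has_derivative_ln_cosh] .
  show "smooth (partial_deriv i (\<lambda>x. ln (cosh (f x))))" if "i \<in> Basis" for i
  proof -
    have "partial_deriv i (\<lambda>x. ln (cosh (f x))) = (\<lambda>x. tanh (f x) * partial_deriv i f x)"
      using partial_deriv_chain(1)[OF d has_derivative_ln_cosh] by auto
    then show ?thesis
      using smooth_mult[OF smooth_tanh[OF assms] smooth_partial_deriv[OF assms that]] by simp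
  qed
qed

subsection \<open>Bumps\<close>

text \<open>\<open>bump 0\<close> is the classical flat function exp(-1/t). The powers of 1/t make
  the family closed under differentiation, so that one induction on the order, uniform in
  \<open>j\<close>, proves smoothness of all members.\<close>

definition bump :: "nat \<Rightarrow> real \<Rightarrow> real" where
  "bump j t = (if t > 0 then exp (- (1 / t)) / t ^ j else 0)"

lemma bump_tendsto_0: "(bump j \<longlongrightarrow> 0) (at 0)"
proof -
  have "((\<lambda>y::real. y ^ j / exp y) \<longlongrightarrow> 0) at_top" by (rule tendsto_power_div_exp_0)
  then have "((\<lambda>t::real. inverse t ^ j / exp (inverse t)) \<longlongrightarrow> 0) (at_right 0)"
    by (rule filterlim_compose[OF _ filterlim_inverse_at_top_right])
  moreover have "eventually (\<lambda>t::real. inverse t ^ j / exp (inverse t) = bump j t) (at_right 0)"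
    unfolding eventually_at_right_field
    by (rule exI[of _ 1]) (auto simp: bump_def exp_minus field_simps)
  ultimately have r: "(bump j \<longlongrightarrow> 0) (at_right 0)" by (rule Lim_transform_eventually)
  have l: "(bump j \<longlongrightarrow> 0) (at_left 0)"
    by (rule Lim_transform_eventually[OF tendsto_const])
      (auto simp: eventually_at_left_field bump_def intro!: exI[of _ "-1"])
  show ?thesis using l r by (simp add: filterlim_split_at)
qed

lemma bump_has_derivative:
  "(bump j has_real_derivative (bump (j + 2) t + (- real j) * bump (j + 1) t)) (at t)"
proof -
  consider "t > 0" | "t < 0" | "t = 0" by linarith
  then show ?thesis
  proof cases
    case 1
    have "((\<lambda>t. exp (- (1 / t)) / t ^ j) has_real_derivative
        (bump (j + 2) t + (- real j) * bump (j + 1) t)) (at t)"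
      using 1 by (auto intro!: derivative_eq_intros simp: bump_def field_simps power_add power2_eq_square)
       (cases j; simp add: field_simps)
    then show ?thesis
    proof (rule has_field_derivative_transform_within_open[of _ _ _ "{0<..}"])
      show "exp (- (1 / x)) / x ^ j = bump j x" if "x \<in> {0<..}" for x using that by (simp add: bump_def)
    qed (use 1 in auto)
  next
    case 2
    have "((\<lambda>t. 0) has_real_derivative (bump (j + 2) t + (- real j) * bump (j + 1) t)) (at t)"
      using 2 by (simp add: bump_def)
    then show ?thesis
      by (rule has_field_derivative_transform_within_open[of _ _ _ "{..<0}"]) (use 2 in \<open>auto simp: bump_def\<close>)
  next
    case 3
    \<comment> \<open>The difference quotient at 0 is \<open>bump (j + 1)\<close> itself, so the
      limit known for every index gives derivative 0.\<close>
    have "((\<lambda>h. bump j h / h) \<longlongrightarrow> 0) (at 0)"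
    proof (rule Lim_transform_eventually[OF bump_tendsto_0[of "j + 1"]])
      show "eventually (\<lambda>h. bump (j + 1) h = bump j h / h) (at 0)"
        by (auto simp: bump_def mult.commute)
    qed
    then show ?thesis using 3 by (simp add: DERIV_def bump_def)
  qed
qed

lemma smooth_bump: assumes "smooth f" shows "smooth (\<lambda>x. bump j (f x))"
proof -
  have d: "f differentiable (at x)" for x using smooth_differentiable assms by blast
  have p: "partial_deriv i (\<lambda>x. bump j (f x)) =
      (\<lambda>x. (bump (j + 2) (f x) + (- real j) * bump (j + 1) (f x)) * partial_deriv i f x)" for i j
    using partial_deriv_chain(1)[OF d bump_has_derivative] by auto
  have D: "(\<lambda>x. bump j (f x)) differentiable (at x)" for j x
    by (rule partial_deriv_chain(2)[OF d bump_has_derivative])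
  have "Ck_on k UNIV (\<lambda>x. bump j (f x))" for k
  proof (induction k arbitrary: j)
    case 0
    then show ?case using D by (auto intro!: differentiable_imp_continuous_on simp: differentiable_on_def)
  next
    case (Suc k)
    show ?case using D Suc smooth_partial_deriv[OF assms]
      by (intro Ck_on_SucI) (auto simp only: p smooth_def intro!: Ck_on_mult Ck_on_add Ck_on_const)
  qed
  then show ?thesis by (simp add: smooth_def)
qed

text \<open>The scale \<open>k > 0\<close> leaves the support alone and only steepens the profile:
  exp(-1/(k s)) tends to 1 for every s > 0. Growing \<open>k\<close> thus yields test functions with
  values in [0,1] that converge pointwise to the indicator of an open box.\<close>

definition box_bump :: "real \<Rightarrow> 'a::euclidean_space \<Rightarrow> 'a \<Rightarrow> 'a \<Rightarrow> real" where
  "box_bump k a b x = (\<Prod>i\<in>Basis. bump 0 (k * (x \<bullet> i - a \<bullet> i)) * bump 0 (k * (b \<bullet> i - x \<bullet> i)))"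

lemma bump_0_bounds: "0 \<le> bump 0 t" "bump 0 t \<le> 1"
  by (auto simp: bump_def)

lemma box_bump_bounds: "0 \<le> box_bump k a b x" "box_bump k a b x \<le> 1"
  unfolding box_bump_def by (auto intro!: prod_nonneg prod_le_1 mult_nonneg_nonneg mult_le_one bump_0_bounds)

lemma box_bump_eq_0: "k > 0 \<Longrightarrow> x \<notin> box a b \<Longrightarrow> box_bump k a b x = 0"
  unfolding box_bump_def by (auto simp: mem_box bump_def zero_less_mult_iff)

lemma smooth_box_bump: "smooth (box_bump k a b)"
proof -
  have 1: "smooth (\<lambda>x. k * (x \<bullet> i - a \<bullet> i))" for i :: 'a
    using smooth_mult[OF smooth_const[of k] smooth_add[OF smooth_inner[of i] smooth_const[of "- (a \<bullet> i)"]]]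
    by simp
  have 2: "smooth (\<lambda>x. k * (b \<bullet> i - x \<bullet> i))" for i :: 'a
    using smooth_mult[OF smooth_const[of "- k"] smooth_add[OF smooth_inner[of i] smooth_const[of "- (b \<bullet> i)"]]]
    by (simp add: algebra_simps)
  show ?thesis unfolding box_bump_def[abs_def]
    by (intro smooth_prod smooth_mult smooth_bump 1 2) simp
qed

lemma box_bump_tendsto: "(\<lambda>n. box_bump (real (Suc n)) a b x) \<longlonglongrightarrow> indicator (box a b) x"
proof (cases "x \<in> box a b")
  case True
  have *: "(\<lambda>n. bump 0 (real (Suc n) * t)) \<longlonglongrightarrow> 1" if "t > 0" for t
  proof -
    have "(\<lambda>n. exp (- (1 / t * (1 / real (Suc n))))) \<longlonglongrightarrow> exp (- (1 / t * 0))"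
      by (intro tendsto_intros LIMSEQ_Suc lim_1_over_n)
    with that show ?thesis by (simp add: bump_def mult.commute)
  qed
  have "(\<lambda>n. box_bump (real (Suc n)) a b x) \<longlonglongrightarrow> (\<Prod>i\<in>(Basis::'a set). 1 * 1)"
    unfolding box_bump_def using True by (intro tendsto_prod tendsto_mult *) (auto simp: mem_box)
  with True show ?thesis by simp
next
  case False
  then have "\<And>n. box_bump (real (Suc n)) a b x = 0" by (intro box_bump_eq_0) auto
  with False show ?thesis by simp
qed

lemma box_bump_pos:
  assumes "k > 0" "x \<in> box a b" shows "0 < box_bump k a b x"
  unfolding box_bump_def using assms by (intro prod_pos) (auto simp: mem_box bump_def)

subsection \<open>Test functions\<close>

lemma test_functionI:
  assumes "smooth f" "bounded {x. f x \<noteq> 0}" "closure {x. f x \<noteq> 0} \<subseteq> S"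
  shows "test_function S f"
  using assms by (simp add: test_function_def smooth_def compact_closure)

lemma test_smooth: "test_function S f \<Longrightarrow> smooth f"
  by (simp add: test_function_def smooth_def)

lemma test_bounded_support: "test_function S f \<Longrightarrow> bounded {x. f x \<noteq> 0}"
  by (simp add: test_function_def compact_closure)

lemma test_outside: "test_function S f \<Longrightarrow> x \<notin> S \<Longrightarrow> f x = 0"
  unfolding test_function_def using closure_subset[of "{x. f x \<noteq> 0}"] by blast

text \<open>Meant for smooth compositions F(f) with F(0) = 0, and for products with
  \<open>f\<close>: the support cannot grow.\<close>

lemma test_function_mono_support:
  assumes "test_function S f" "smooth g" "\<And>x. f x = 0 \<Longrightarrow> g x = 0"
  shows "test_function S g"
proof -
  have sub: "{x. g x \<noteq> 0} \<subseteq> {x. f x \<noteq> 0}" using assms(3) by auto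
  show ?thesis
    using assms(1) closure_mono[OF sub]
    by (intro test_functionI[OF assms(2) bounded_subset[OF test_bounded_support[OF assms(1)] sub]])
       (auto simp: test_function_def)
qed

lemma test_mult: "test_function S f \<Longrightarrow> smooth g \<Longrightarrow> test_function S (\<lambda>x. f x * g x)"
  by (rule test_function_mono_support[of S f]) (auto intro: smooth_mult test_smooth)

lemma test_cmult: "test_function S f \<Longrightarrow> test_function S (\<lambda>x. c * f x)"
  using test_mult[OF _ smooth_const[of c], of S f] by (simp add: mult.commute)

lemma test_add: assumes "test_function S f" "test_function S g"
  shows "test_function S (\<lambda>x. f x + g x)"
proof -
  have sub: "{x. f x + g x \<noteq> 0} \<subseteq> {x. f x \<noteq> 0} \<union> {x. g x \<noteq> 0}" by auto
  from closure_mono[OF this] show ?thesis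
    using assms bounded_subset[OF _ sub]
    by (intro test_functionI smooth_add)
       (auto simp: test_function_def smooth_def compact_closure)
qed

lemma test_zero: "test_function S (\<lambda>x. 0)"
  by (rule test_functionI) (auto intro: smooth_const)

lemma test_diff: "test_function S f \<Longrightarrow> test_function S g \<Longrightarrow> test_function S (\<lambda>x. f x - g x)"
  using test_add[OF _ test_cmult[of S g "-1"], of f] by simp

lemma partial_deriv_zero_outside:
  fixes f :: "'a::euclidean_space \<Rightarrow> real"
  assumes "x \<notin> closure {x. f x \<noteq> 0}" shows "partial_deriv i f x = 0"
proof -
  have "((\<lambda>x. 0) has_derivative (\<lambda>h. 0)) (at x)" by simp
  then have "(f has_derivative (\<lambda>h. 0)) (at x)"
  proof (rule has_derivative_transform_within_open[of _ _ _ _ "- closure {x. f x \<noteq> 0}"])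
    show "0 = f y" if "y \<in> - closure {x. f x \<noteq> 0}" for y
      using that closure_subset[of "{x. f x \<noteq> 0}"] by auto
  qed (use assms in auto)
  then show ?thesis by (simp add: partial_deriv_eq)
qed

lemma test_partial_deriv:
  assumes "test_function S f" "i \<in> Basis" shows "test_function S (partial_deriv i f)"
proof (rule test_functionI)
  have sub: "{x. partial_deriv i f x \<noteq> 0} \<subseteq> closure {x. f x \<noteq> 0}"
    using partial_deriv_zero_outside by blast
  show "smooth (partial_deriv i f)" using assms smooth_partial_deriv test_smooth by blast
  show "bounded {x. partial_deriv i f x \<noteq> 0}"
    using bounded_subset[OF _ sub] assms(1) compact_imp_bounded unfolding test_function_def by blast
  show "closure {x. partial_deriv i f x \<noteq> 0} \<subseteq> S"
    using closure_minimal[OF sub] assms(1) unfolding test_function_def by auto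
qed

lemma test_grad_outside:
  assumes "test_function S f" "x \<notin> S" shows "grad f x = 0"
  unfolding grad_def using test_outside[OF test_partial_deriv[OF assms(1)] assms(2)] by simp

lemma test_box_bump:
  assumes "cbox a b \<subseteq> S" "k > 0" shows "test_function S (box_bump k a b)"
proof (rule test_functionI[OF smooth_box_bump])
  have sub: "{x. box_bump k a b x \<noteq> 0} \<subseteq> cbox a b"
    using box_bump_eq_0[OF assms(2)] box_subset_cbox by blast
  show "bounded {x. box_bump k a b x \<noteq> 0}" using bounded_subset[OF bounded_cbox sub] .
  show "closure {x. box_bump k a b x \<noteq> 0} \<subseteq> S"
    using closure_minimal[OF sub closed_cbox] assms(1) by auto
qed

lemma smooth_borel_measurable: "smooth f \<Longrightarrow> f \<in> borel_measurable borel"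
  using smooth_continuous_on borel_measurable_continuous_onI by blast

lemma smooth_grad_continuous_on: "smooth f \<Longrightarrow> continuous_on S (grad f)"
  unfolding grad_def[abs_def]
  by (intro continuous_on_sum continuous_on_scaleR continuous_on_const)
     (metis smooth_continuous_on smooth_partial_deriv)

lemma smooth_grad_measurable: "smooth f \<Longrightarrow> grad f \<in> borel_measurable borel"
  using smooth_grad_continuous_on borel_measurable_continuous_onI by blast

lemma continuous_bounded_on:
  fixes f :: "'a::euclidean_space \<Rightarrow> 'b::real_normed_vector"
  assumes "continuous_on UNIV f" "bounded S"
  obtains B where "B > 0" "\<And>x. x \<in> S \<Longrightarrow> norm (f x) \<le> B"
proof -
  have "compact (f ` closure S)"
    using assms by (intro compact_continuous_image) (auto intro: continuous_on_subset simp: compact_closure)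
  then have "bounded (f ` closure S)" by (rule compact_imp_bounded)
  then obtain B where "B > 0" "\<And>y. y \<in> f ` closure S \<Longrightarrow> norm y \<le> B" by (auto simp: bounded_pos)
  then show ?thesis using closure_subset by (intro that) auto
qed

lemma test_bounded:
  assumes "test_function S f"
  obtains B where "B > 0" "\<And>x. \<bar>f x\<bar> \<le> B"
proof -
  obtain B where B: "B > 0" "\<And>x. x \<in> {x. f x \<noteq> 0} \<Longrightarrow> norm (f x) \<le> B"
    using continuous_bounded_on[OF smooth_continuous_on[OF test_smooth[OF assms]] test_bounded_support[OF assms]] by metis
  show ?thesis
  proof (rule that[OF B(1)])
    show "\<bar>f x\<bar> \<le> B" for x using B by (cases "f x = 0") auto
  qed
qed

lemma test_integrable: assumes "test_function S f" shows "integrable lborel f"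
proof -
  obtain B where B: "B > 0" "\<And>x. \<bar>f x\<bar> \<le> B" using test_bounded[OF assms] by metis
  obtain a b where ab: "{x. f x \<noteq> 0} \<subseteq> cbox a b"
    using bounded_subset_cbox_symmetric[OF test_bounded_support[OF assms]] by metis
  show ?thesis
  proof (rule Bochner_Integration.integrable_bound[of _ "\<lambda>x. B * indicator (cbox a b) x"])
    show "f \<in> borel_measurable lborel" using smooth_borel_measurable[OF test_smooth[OF assms]] by simp
    show "AE x in lborel. norm (f x) \<le> norm (B * indicator (cbox a b) x)"
      using B ab by (intro AE_I2) (auto simp: indicator_def)
  qed (auto intro!: integrable_mult_right integrable_real_indicator emeasure_lborel_cbox_finite)
qed

text \<open>Translation invariance of Lebesgue measure makes the integral of every difference
  quotient vanish, and dominated convergence passes to the derivative. The mean value theorem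
  supplies the bound.\<close>

lemma test_integral_partial_deriv:
  assumes f: "test_function S f" and i: "i \<in> Basis"
  shows "(LINT x|lborel. partial_deriv i f x) = 0"
proof -
  obtain B where B: "B > 0" "\<And>x. \<bar>partial_deriv i f x\<bar> \<le> B"
    using test_bounded[OF test_partial_deriv[OF assms]] by metis
  obtain r where r: "\<And>x. f x \<noteq> 0 \<Longrightarrow> norm x \<le> r"
    using test_bounded_support[OF f] by (auto simp: bounded_iff)
  let ?h = "\<lambda>n. 1 / real (Suc n)"
  let ?q = "\<lambda>n x. (f (x + ?h n *\<^sub>R i) - f x) / ?h n"
  have fi: "integrable lborel f" by (rule test_integrable[OF f])
  have sh: "integrable lborel (\<lambda>x. f (x + c))" "(LINT x|lborel. f (x + c)) = (LINT x|lborel. f x)" for c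
  proof -
    have "integrable (distr lborel borel ((+) c)) f" "(LINT x|distr lborel borel ((+) c). f x) = (LINT x|lborel. f x)"
      using fi by (simp_all add: lborel_distr_plus)
    then show "integrable lborel (\<lambda>x. f (x + c))" "(LINT x|lborel. f (x + c)) = (LINT x|lborel. f x)"
      using smooth_borel_measurable[OF test_smooth[OF f]]
      by (simp_all add: integrable_distr_eq integral_distr add.commute)
  qed
  have D: "((\<lambda>t. f (x + t *\<^sub>R i)) has_real_derivative partial_deriv i f (x + t *\<^sub>R i)) (at t)" for x t
  proof -
    have "((\<lambda>t. f (x + t *\<^sub>R i)) has_derivative (\<lambda>h. grad f (x + t *\<^sub>R i) \<bullet> (h *\<^sub>R i))) (at t)"
      by (rule has_derivative_compose[OF _ smooth_has_derivative[OF test_smooth[OF f]]])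
         (auto intro!: derivative_eq_intros)
    then show ?thesis
      by (simp add: has_field_derivative_def grad_inner_Basis[OF i] mult_commute_abs)
  qed
  have q0: "(LINT x|lborel. ?q n x) = 0" for n
    using fi sh by simp
  have "(\<lambda>n. LINT x|lborel. ?q n x) \<longlonglongrightarrow> (LINT x|lborel. partial_deriv i f x)"
  proof (rule integral_dominated_convergence[where w = "\<lambda>x. B * indicator (cball 0 (r + 1)) x"])
    \<comment> \<open>The steps have length at most 1, so all difference quotients vanish outside
      the ball of radius \<open>r + 1\<close>.\<close>
    show "integrable lborel (\<lambda>x. B * indicator (cball (0::'a) (r + 1)) x)"
      by (intro integrable_mult_right integrable_real_indicator) (use emeasure_bounded_finite[OF bounded_cball, of 0 "r + 1"] in auto)
    show "AE x in lborel. (\<lambda>n. ?q n x) \<longlonglongrightarrow> partial_deriv i f x"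
    proof (rule AE_I2)
      fix x
      have "((\<lambda>h. (f (x + h *\<^sub>R i) - f x) / h) \<longlongrightarrow> partial_deriv i f x) (at 0)"
        using D[of x 0] by (simp add: DERIV_def)
      moreover have "filterlim ?h (at 0) sequentially"
        unfolding filterlim_at using LIMSEQ_Suc[OF lim_1_over_n] by (auto intro: always_eventually)
      ultimately show "(\<lambda>n. ?q n x) \<longlonglongrightarrow> partial_deriv i f x"
        by (rule filterlim_compose)
    qed
    show "AE x in lborel. norm (?q n x) \<le> B * indicator (cball 0 (r + 1)) x" for n
    proof (rule AE_I2)
      fix x
      have h: "0 < ?h n" "?h n \<le> 1" by auto
      show "norm (?q n x) \<le> B * indicator (cball 0 (r + 1)) x"
      proof (cases "x \<in> cball 0 (r + 1)")
        case True
        obtain t where t: "f (x + ?h n *\<^sub>R i) - f (x + 0 *\<^sub>R i) = (?h n - 0) * partial_deriv i f (x + t *\<^sub>R i)"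
          using MVT2[OF h(1), of "\<lambda>t. f (x + t *\<^sub>R i)" "\<lambda>t. partial_deriv i f (x + t *\<^sub>R i)"] D by blast
        then have "?q n x = partial_deriv i f (x + t *\<^sub>R i)" by simp
        with B(2) True show ?thesis by simp
      next
        case False
        have "norm x \<le> norm (x + ?h n *\<^sub>R i) + norm (?h n *\<^sub>R i)"
          by (metis add_diff_cancel norm_triangle_ineq4)
        moreover have "norm (?h n *\<^sub>R i) \<le> 1" using i h by simp
        ultimately have "norm x \<le> norm (x + ?h n *\<^sub>R i) + 1" by linarith
        with False have "f x = 0" "f (x + ?h n *\<^sub>R i) = 0" using r[of x] r[of "x + ?h n *\<^sub>R i"] by auto
        with B show ?thesis by (simp add: indicator_def)
      qed
    qed
  next
    have [measurable]: "f \<in> borel_measurable borel" using test_smooth[OF f] by (rule smooth_borel_measurable)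
    show "?q n \<in> borel_measurable lborel" for n by measurable
    show "partial_deriv i f \<in> borel_measurable lborel"
      using smooth_borel_measurable[OF smooth_partial_deriv[OF test_smooth[OF f] i]] by simp
  qed
  then have "(\<lambda>n::nat. 0::real) \<longlonglongrightarrow> (LINT x|lborel. partial_deriv i f x)" unfolding q0 .
  then show ?thesis using LIMSEQ_unique[OF tendsto_const] by metis
qed

lemma integral_by_parts:
  assumes f: "test_function S f" and g: "smooth g" and i: "i \<in> Basis"
  shows "(LINT x|lborel. f x * partial_deriv i g x) = - (LINT x|lborel. partial_deriv i f x * g x)"
proof -
  have "partial_deriv i (\<lambda>x. f x * g x) = (\<lambda>x. f x * partial_deriv i g x + partial_deriv i f x * g x)"
    using partial_deriv_mult smooth_differentiable test_smooth[OF f] g by blast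
  then have "(LINT x|lborel. f x * partial_deriv i g x + partial_deriv i f x * g x) = 0"
    using test_integral_partial_deriv[OF test_mult[OF f g] i] by simp
  then show ?thesis
    using Bochner_Integration.integral_add[OF test_integrable[OF test_mult[OF f smooth_partial_deriv[OF g i]]]
       test_integrable[OF test_mult[OF test_partial_deriv[OF f i] g]]] by simp
qed

text \<open>Translations, scalings and product measures are treated over \<open>lborel\<close>, the
  function spaces over \<open>lebesgue_on\<close>. This identity carries Borel integrands that
  vanish off the domain from one to the other.\<close>

lemma integral_lebesgue_on_eq_lborel:
  fixes f :: "'a::euclidean_space \<Rightarrow> real"
  assumes "f \<in> borel_measurable borel" "\<And>x. x \<notin> S \<Longrightarrow> f x = 0" "S \<in> sets lebesgue"
  shows "(LINT x|lebesgue_on S. f x) = (LINT x|lborel. f x)"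
proof -
  have "(LINT x|lebesgue_on S. f x) = (LINT x|lebesgue. indicator S x *\<^sub>R f x)"
    using assms(3) by (intro integral_restrict_space) auto
  also have "\<dots> = (LINT x|lebesgue. f x)"
    by (intro Bochner_Integration.integral_cong) (use assms(2) in \<open>auto simp: indicator_def\<close>)
  also have "\<dots> = (LINT x|lborel. f x)" using assms(1) by (simp add: integral_completion)
  finally show ?thesis .
qed

section \<open>Square integrable functions\<close>

text \<open>Restates \<open>Lp 2\<close> with a square in place of \<open>powr\<close>. The codomain
  stays general because scalar functions, gradients and pairs of the two all occur.\<close>

definition L2 :: "'x measure \<Rightarrow> ('x \<Rightarrow> 'b::euclidean_space) set" where
  "L2 M = {f \<in> borel_measurable M. integrable M (\<lambda>x. (norm (f x))\<^sup>2)}"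

definition l2norm :: "'x measure \<Rightarrow> ('x \<Rightarrow> 'b::euclidean_space) \<Rightarrow> real" where
  "l2norm M f = sqrt (LINT x|M. (norm (f x))\<^sup>2)"

lemma L2_measurable: "f \<in> L2 M \<Longrightarrow> f \<in> borel_measurable M" by (simp add: L2_def)

lemma L2_integrable: "f \<in> L2 M \<Longrightarrow> integrable M (\<lambda>x. (norm (f x))\<^sup>2)" by (simp add: L2_def)

lemma l2norm_nonneg [simp]: "0 \<le> l2norm M f"
  by (simp add: l2norm_def)

lemma l2norm_power2: "(l2norm M f)\<^sup>2 = (LINT x|M. (norm (f x))\<^sup>2)"
  by (simp add: l2norm_def)

lemma l2norm_cong_AE:
  assumes "f \<in> borel_measurable M" "g \<in> borel_measurable M" "AE x in M. f x = g x"
  shows "l2norm M f = l2norm M g"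
  unfolding l2norm_def using assms
  by (intro arg_cong[where f = sqrt] integral_cong_AE) (auto elim: eventually_mono)

lemma L2_norm: "f \<in> L2 M \<Longrightarrow> (\<lambda>x. norm (f x)) \<in> L2 M"
  by (auto simp: L2_def)

lemma l2norm_norm: "l2norm M (\<lambda>x. norm (f x)) = l2norm M f"
  by (simp add: l2norm_def)

lemma L2_dominated:
  assumes "f \<in> borel_measurable M" "g \<in> L2 M" "AE x in M. norm (f x) \<le> norm (g x)"
  shows "f \<in> L2 M" "l2norm M f \<le> l2norm M g"
proof -
  have [measurable]: "f \<in> borel_measurable M" "g \<in> borel_measurable M"
    using assms by (auto simp: L2_def)
  have ae: "AE x in M. (norm (f x))\<^sup>2 \<le> (norm (g x))\<^sup>2"
    using assms(3) by eventually_elim (simp add: power_mono)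
  have "integrable M (\<lambda>x. (norm (f x))\<^sup>2)"
    by (rule Bochner_Integration.integrable_bound[OF L2_integrable[OF assms(2)]]) (use ae in auto)
  then show "f \<in> L2 M" by (simp add: L2_def)
  show "l2norm M f \<le> l2norm M g"
    unfolding l2norm_def
    by (rule real_sqrt_le_mono, rule integral_mono_AE) (use ae \<open>integrable M (\<lambda>x. (norm (f x))\<^sup>2)\<close> L2_integrable[OF assms(2)] in auto)
qed

lemma L2_cmult: assumes "f \<in> L2 M" shows "(\<lambda>x. c *\<^sub>R f x) \<in> L2 M"
  using assms by (auto simp: L2_def power_mult_distrib)

lemma l2norm_cmult: "l2norm M (\<lambda>x. c *\<^sub>R f x) = \<bar>c\<bar> * l2norm M f"
  by (simp add: l2norm_def power_mult_distrib real_sqrt_mult)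

lemma L2_norm_mult_integrable:
  assumes "f \<in> L2 M" "g \<in> L2 M" shows "integrable M (\<lambda>x. norm (f x) * norm (g x))"
proof (rule Bochner_Integration.integrable_bound)
  show "integrable M (\<lambda>x. (norm (f x))\<^sup>2 + (norm (g x))\<^sup>2)"
    using assms by (intro Bochner_Integration.integrable_add L2_integrable)
  show "(\<lambda>x. norm (f x) * norm (g x)) \<in> borel_measurable M"
    using assms[THEN L2_measurable] by measurable
  have "u * v \<le> u\<^sup>2 + v\<^sup>2" if "u \<ge> 0" "v \<ge> 0" for u v :: real
    using that sum_squares_bound[of u v] mult_nonneg_nonneg[OF that] by linarith
  then show "AE x in M. norm (norm (f x) * norm (g x)) \<le> norm ((norm (f x))\<^sup>2 + (norm (g x))\<^sup>2)"
    by (intro AE_I2) (simp add: abs_mult)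
qed

lemma L2_inner_integrable:
  assumes "f \<in> L2 M" "g \<in> L2 M" shows "integrable M (\<lambda>x. f x \<bullet> g x)"
  by (rule Bochner_Integration.integrable_bound[OF L2_norm_mult_integrable[OF assms]])
     (use assms in \<open>auto simp: L2_def abs_mult Cauchy_Schwarz_ineq2 borel_measurable_inner\<close>)

lemma L2_mult_integrable:
  fixes f g :: "'x \<Rightarrow> real"
  shows "f \<in> L2 M \<Longrightarrow> g \<in> L2 M \<Longrightarrow> integrable M (\<lambda>x. f x * g x)"
  using L2_inner_integrable[of f M g] by simp

lemma L2_add: assumes "f \<in> L2 M" "g \<in> L2 M" shows "(\<lambda>x. f x + g x) \<in> L2 M"
proof -
  have "integrable M (\<lambda>x. (norm (f x))\<^sup>2 + (norm (g x))\<^sup>2 + 2 * (f x \<bullet> g x))"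
    using assms by (intro Bochner_Integration.integrable_add L2_integrable integrable_mult_right L2_inner_integrable)
  then have "integrable M (\<lambda>x. (norm (f x + g x))\<^sup>2)"
    by (simp add: power2_norm_eq_inner inner_add_left inner_add_right inner_commute algebra_simps)
  then show ?thesis using assms by (auto simp: L2_def)
qed

lemma L2_diff: assumes "f \<in> L2 M" "g \<in> L2 M" shows "(\<lambda>x. f x - g x) \<in> L2 M"
  using L2_add[OF assms(1) L2_cmult[OF assms(2), of "-1"]] by simp

lemma l2norm_add_power2:
  assumes "f \<in> L2 M" "g \<in> L2 M"
  shows "(l2norm M (\<lambda>x. f x + g x))\<^sup>2 = (l2norm M f)\<^sup>2 + 2 * (LINT x|M. f x \<bullet> g x) + (l2norm M g)\<^sup>2"
proof -
  have "(l2norm M (\<lambda>x. f x + g x))\<^sup>2 = (LINT x|M. (norm (f x))\<^sup>2 + 2 * (f x \<bullet> g x) + (norm (g x))\<^sup>2)"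
    unfolding l2norm_power2
    by (simp add: power2_norm_eq_inner inner_add_left inner_add_right inner_commute algebra_simps)
  then show ?thesis
    using assms by (simp add: l2norm_power2 L2_integrable L2_inner_integrable)
qed

lemma L2_Cauchy_Schwarz_norm:
  assumes "f \<in> L2 M" "g \<in> L2 M"
  shows "(LINT x|M. norm (f x) * norm (g x)) \<le> l2norm M f * l2norm M g"
proof -
  let ?I = "LINT x|M. norm (f x) * norm (g x)"
  have zero: "?I = 0" if "f \<in> L2 M" "l2norm M f = 0 \<or> l2norm M g = 0"
  proof -
    have "AE x in M. norm (f x) * norm (g x) = 0"
    proof (cases "l2norm M f = 0")
      case True
      then have "AE x in M. (norm (f x))\<^sup>2 = 0"
        using integral_nonneg_eq_0_iff_AE[OF L2_integrable[OF assms(1)]] by (simp add: l2norm_def)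
      then show ?thesis by eventually_elim simp
    next
      case False
      with that have "AE x in M. (norm (g x))\<^sup>2 = 0"
        using integral_nonneg_eq_0_iff_AE[OF L2_integrable[OF assms(2)]] by (simp add: l2norm_def)
      then show ?thesis by eventually_elim simp
    qed
    then show ?thesis using integral_eq_zero_AE by fast
  qed
  show ?thesis
  proof (cases "l2norm M f = 0 \<or> l2norm M g = 0")
    case True
    with zero[OF assms(1)] show ?thesis by auto
  next
    case False
    define s where "s = l2norm M f"
    define t where "t = l2norm M g"
    have pos: "s > 0" "t > 0" using False l2norm_nonneg[of M f] l2norm_nonneg[of M g]
      by (auto simp: s_def t_def less_le)
    \<comment> \<open>Integrates the square of \<open>t * norm (f x) - s * norm (g x)\<close>. The
      weights are the norms themselves, crosswise, so that both squares contribute the same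
      amount.\<close>
    have "2 * (s * t) * ?I = (LINT x|M. 2 * (s * t) * (norm (f x) * norm (g x)))" by simp
    also have "\<dots> \<le> (LINT x|M. t\<^sup>2 * (norm (f x))\<^sup>2 + s\<^sup>2 * (norm (g x))\<^sup>2)"
    proof (rule integral_mono)
      show "integrable M (\<lambda>x. 2 * (s * t) * (norm (f x) * norm (g x)))"
        using L2_norm_mult_integrable[OF assms] by simp
      show "integrable M (\<lambda>x. t\<^sup>2 * (norm (f x))\<^sup>2 + s\<^sup>2 * (norm (g x))\<^sup>2)"
        using assms by (intro Bochner_Integration.integrable_add integrable_mult_right L2_integrable)
      show "2 * (s * t) * (norm (f x) * norm (g x)) \<le> t\<^sup>2 * (norm (f x))\<^sup>2 + s\<^sup>2 * (norm (g x))\<^sup>2" for x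
        using zero_le_power2[of "t * norm (f x) - s * norm (g x)"]
        by (simp add: power2_diff power_mult_distrib algebra_simps)
    qed
    also have "\<dots> = 2 * (s * t) * (s * t)"
    proof -
      have "(LINT x|M. t\<^sup>2 * (norm (f x))\<^sup>2 + s\<^sup>2 * (norm (g x))\<^sup>2) = t\<^sup>2 * s\<^sup>2 + s\<^sup>2 * t\<^sup>2"
        using assms by (simp add: L2_integrable s_def t_def l2norm_power2)
      then show ?thesis by (simp add: power2_eq_square)
    qed
    finally show ?thesis using pos by (simp add: s_def t_def)
  qed
qed

lemma L2_Cauchy_Schwarz:
  assumes "f \<in> L2 M" "g \<in> L2 M"
  shows "\<bar>LINT x|M. f x \<bullet> g x\<bar> \<le> l2norm M f * l2norm M g"
proof -
  have "\<bar>LINT x|M. f x \<bullet> g x\<bar> \<le> (LINT x|M. norm (f x \<bullet> g x))"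
    using integral_norm_bound[of M "\<lambda>x. f x \<bullet> g x"] by simp
  also have "\<dots> \<le> (LINT x|M. norm (f x) * norm (g x))"
    by (rule integral_mono) (use assms in \<open>auto intro!: L2_inner_integrable L2_norm_mult_integrable simp: Cauchy_Schwarz_ineq2\<close>)
  also note L2_Cauchy_Schwarz_norm[OF assms]
  finally show ?thesis .
qed

lemma l2norm_triangle:
  assumes "f \<in> L2 M" "g \<in> L2 M"
  shows "l2norm M (\<lambda>x. f x + g x) \<le> l2norm M f + l2norm M g"
proof (rule power2_le_imp_le)
  show "(l2norm M (\<lambda>x. f x + g x))\<^sup>2 \<le> (l2norm M f + l2norm M g)\<^sup>2"
    unfolding l2norm_add_power2[OF assms] power2_sum using L2_Cauchy_Schwarz[OF assms] by linarith
qed simp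

lemma l2norm_minus_commute: "l2norm M (\<lambda>x. f x - g x) = l2norm M (\<lambda>x. g x - f x)"
  by (simp add: l2norm_def norm_minus_commute)

lemma l2norm_triangle3:
  assumes "f \<in> L2 M" "g \<in> L2 M" "h \<in> L2 M"
  shows "l2norm M (\<lambda>x. f x - h x) \<le> l2norm M (\<lambda>x. f x - g x) + l2norm M (\<lambda>x. g x - h x)"
  using l2norm_triangle[OF L2_diff[OF assms(1,2)] L2_diff[OF assms(2,3)]] by simp

lemma l2norm_diff_le:
  assumes "f \<in> L2 M" "g \<in> L2 M"
  shows "\<bar>l2norm M f - l2norm M g\<bar> \<le> l2norm M (\<lambda>x. f x - g x)"
  using l2norm_triangle[OF L2_diff[OF assms] assms(2)] l2norm_triangle[OF L2_diff[OF assms(2,1)] assms(1)]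
    l2norm_minus_commute[of M f g] by simp

lemma l2norm_tendsto:
  assumes "\<And>n. F n \<in> L2 M" "f \<in> L2 M" "(\<lambda>n. l2norm M (\<lambda>x. F n x - f x)) \<longlonglongrightarrow> 0"
  shows "(\<lambda>n. l2norm M (F n)) \<longlonglongrightarrow> l2norm M f"
proof -
  have "(\<lambda>n. l2norm M (F n) - l2norm M f) \<longlonglongrightarrow> 0"
    by (rule Lim_null_comparison[OF _ assms(3)]) (use l2norm_diff_le[OF assms(1,2)] in auto)
  then show ?thesis by (simp add: LIM_zero_iff)
qed

lemma L2_inner_tendsto:
  assumes "\<And>n. F n \<in> L2 M" "f \<in> L2 M" "g \<in> L2 M" "(\<lambda>n. l2norm M (\<lambda>x. F n x - f x)) \<longlonglongrightarrow> 0"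
  shows "(\<lambda>n. LINT x|M. F n x \<bullet> g x) \<longlonglongrightarrow> (LINT x|M. f x \<bullet> g x)"
proof -
  have null: "(\<lambda>n. l2norm M (\<lambda>x. F n x - f x) * l2norm M g) \<longlonglongrightarrow> 0"
    by (rule tendsto_mult_left_zero[OF assms(4)])
  have "norm ((LINT x|M. F n x \<bullet> g x) - (LINT x|M. f x \<bullet> g x)) \<le> l2norm M (\<lambda>x. F n x - f x) * l2norm M g" for n
    using L2_Cauchy_Schwarz[OF L2_diff[OF assms(1,2)] assms(3), of n]
      Bochner_Integration.integral_diff[OF L2_inner_integrable[OF assms(1,3)] L2_inner_integrable[OF assms(2,3)], of n]
    by (simp add: inner_diff_left)
  then have "(\<lambda>n. (LINT x|M. F n x \<bullet> g x) - (LINT x|M. f x \<bullet> g x)) \<longlonglongrightarrow> 0"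
    by (intro Lim_null_comparison[OF always_eventually null] allI)
  then show ?thesis by (simp add: LIM_zero_iff)
qed

context finite_measure
begin

lemma L2_bounded:
  assumes "f \<in> borel_measurable M" "AE x in M. norm (f x) \<le> B"
  shows "f \<in> L2 M"
proof -
  have "integrable M (\<lambda>x. (norm (f x))\<^sup>2)"
  proof (rule integrable_const_bound)
    show "AE x in M. norm ((norm (f x))\<^sup>2) \<le> B\<^sup>2"
      using assms(2) by eventually_elim (simp add: power_mono)
  qed (use assms in auto)
  with assms(1) show ?thesis by (simp add: L2_def)
qed

lemma L2_const: "(\<lambda>x. c) \<in> L2 M"
  by (rule L2_bounded[of _ "norm c"]) auto

lemma L2_integrable_norm:
  assumes "f \<in> L2 M" shows "integrable M (\<lambda>x. norm (f x))"
  using L2_norm_mult_integrable[OF assms L2_const[of "1::real"]] by simp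

lemma L2_imp_integrable:
  fixes f :: "'a \<Rightarrow> 'b::euclidean_space"
  assumes "f \<in> L2 M" shows "integrable M f"
  using L2_integrable_norm[OF assms] integrable_norm_iff[OF L2_measurable[OF assms]] by simp

lemma l2norm_const_1: "l2norm M (\<lambda>x. 1 :: real) = sqrt (measure M (space M))"
  by (simp add: l2norm_def)

lemma L1_le_L2:
  assumes "f \<in> L2 M"
  shows "(LINT x|M. norm (f x)) \<le> sqrt (measure M (space M)) * l2norm M f"
  using L2_Cauchy_Schwarz_norm[OF assms L2_const[of "1::real"]] l2norm_const_1 by (simp add: mult.commute)

text \<open>On a finite measure space an L2-Cauchy sequence is L1-Cauchy, hence has an almost
  everywhere convergent subsequence. Fatou's lemma along that subsequence bounds the L2 distance of
  the whole sequence to the pointwise limit.\<close>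

lemma L2_complete:
  fixes F :: "nat \<Rightarrow> 'a \<Rightarrow> 'b::euclidean_space"
  assumes F: "\<And>n. F n \<in> L2 M"
    and C: "\<And>e. e > 0 \<Longrightarrow> \<exists>N. \<forall>m\<ge>N. \<forall>n\<ge>N. l2norm M (\<lambda>x. F m x - F n x) < e"
  shows "\<exists>f\<in>L2 M. (\<lambda>n. l2norm M (\<lambda>x. F n x - f x)) \<longlonglongrightarrow> 0"
proof -
  have [measurable]: "F n \<in> borel_measurable M" for n using F L2_measurable by blast
  let ?c = "sqrt (measure M (space M))"
  have "\<exists>N. \<forall>i\<ge>N. \<forall>j\<ge>N. (LINT x|M. norm (F i x - F j x)) < e" if "e > 0" for e
  proof -
    have "e / (?c + 1) > 0" using that by (simp add: add_nonneg_pos)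
    from C[OF this] obtain N where N: "\<And>m n. m \<ge> N \<Longrightarrow> n \<ge> N \<Longrightarrow> l2norm M (\<lambda>x. F m x - F n x) < e / (?c + 1)"
      by blast
    have "(LINT x|M. norm (F i x - F j x)) < e" if "i \<ge> N" "j \<ge> N" for i j
    proof -
      have "(LINT x|M. norm (F i x - F j x)) \<le> ?c * l2norm M (\<lambda>x. F i x - F j x)"
        by (rule L1_le_L2[OF L2_diff[OF F F]])
      also have "\<dots> \<le> ?c * (e / (?c + 1))" using N[OF that] by (intro mult_left_mono) auto
      also have "\<dots> < e" proof -
        have "?c < ?c + 1" "0 < ?c + 1" by (auto simp: add_nonneg_pos)
        then have "?c * e < e * (?c + 1)" using \<open>e > 0\<close> by (simp add: algebra_simps)
        with \<open>0 < ?c + 1\<close> show ?thesis by (simp add: pos_divide_less_eq)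
      qed
      finally show ?thesis .
    qed
    then show ?thesis by blast
  qed
  from cauchy_L1_AE_cauchy_subseq[OF L2_imp_integrable[OF F] this]
  obtain r where r: "strict_mono r" "AE x in M. Cauchy (\<lambda>i. F (r i) x)" by blast
  define f where "f = (\<lambda>x. lim (\<lambda>i. F (r i) x))"
  have [measurable]: "f \<in> borel_measurable M" unfolding f_def by measurable
  have lim: "AE x in M. (\<lambda>i. F (r i) x) \<longlonglongrightarrow> f x"
    using r(2) by eventually_elim (simp add: f_def Cauchy_convergent_iff convergent_LIMSEQ_iff)
  have key: "(\<integral>\<^sup>+x. ennreal ((norm (F n x - f x))\<^sup>2) \<partial>M) \<le> ennreal (e\<^sup>2)"
    if e: "e > 0" and N: "\<forall>m\<ge>N. \<forall>n\<ge>N. l2norm M (\<lambda>x. F m x - F n x) < e" and n: "n \<ge> N" for e N n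
  proof -
    have "(\<integral>\<^sup>+x. ennreal ((norm (F n x - f x))\<^sup>2) \<partial>M)
        = (\<integral>\<^sup>+x. liminf (\<lambda>i. ennreal ((norm (F n x - F (r i) x))\<^sup>2)) \<partial>M)"
    proof (rule nn_integral_cong_AE)
      show "AE x in M. ennreal ((norm (F n x - f x))\<^sup>2) = liminf (\<lambda>i. ennreal ((norm (F n x - F (r i) x))\<^sup>2))"
        using lim
      proof eventually_elim
        case (elim x)
        have "(\<lambda>i. ennreal ((norm (F n x - F (r i) x))\<^sup>2)) \<longlonglongrightarrow> ennreal ((norm (F n x - f x))\<^sup>2)"
          by (intro tendsto_ennrealI tendsto_intros elim)
        from lim_imp_Liminf[OF _ this] show ?case by simp
      qed
    qed
    also have "\<dots> \<le> liminf (\<lambda>i. \<integral>\<^sup>+x. ennreal ((norm (F n x - F (r i) x))\<^sup>2) \<partial>M)"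
      by (rule nn_integral_liminf) measurable
    also have "\<dots> \<le> liminf (\<lambda>i::nat. ennreal (e\<^sup>2))"
    proof (rule Liminf_mono)
      have "(\<integral>\<^sup>+x. ennreal ((norm (F n x - F (r i) x))\<^sup>2) \<partial>M) \<le> ennreal (e\<^sup>2)" if "i \<ge> N" for i
      proof -
        have "l2norm M (\<lambda>x. F n x - F (r i) x) < e"
          using N n order_trans[OF that seq_suble[OF r(1), of i]] by blast
        then have "(l2norm M (\<lambda>x. F n x - F (r i) x))\<^sup>2 \<le> e\<^sup>2" by (intro power_mono) auto
        moreover have "(\<integral>\<^sup>+x. ennreal ((norm (F n x - F (r i) x))\<^sup>2) \<partial>M) = ennreal ((l2norm M (\<lambda>x. F n x - F (r i) x))\<^sup>2)"
          unfolding l2norm_power2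
          by (rule nn_integral_eq_integral[OF L2_integrable[OF L2_diff[OF F F]]]) simp
        ultimately show ?thesis using ennreal_leI by presburger
      qed
      then show "\<forall>\<^sub>F i in sequentially. (\<integral>\<^sup>+x. ennreal ((norm (F n x - F (r i) x))\<^sup>2) \<partial>M) \<le> ennreal (e\<^sup>2)"
        by (auto simp: eventually_sequentially)
    qed
    also have "\<dots> = ennreal (e\<^sup>2)" by (simp add: Liminf_const)
    finally show ?thesis .
  qed
  have inL2: "(\<lambda>x. F n x - f x) \<in> L2 M" if "(\<integral>\<^sup>+x. ennreal ((norm (F n x - f x))\<^sup>2) \<partial>M) \<le> ennreal (e\<^sup>2)" for n e
  proof -
    have "integrable M (\<lambda>x. (norm (F n x - f x))\<^sup>2)"
    proof (rule integrableI_bounded)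
      show "(\<integral>\<^sup>+x. ennreal (norm ((norm (F n x - f x))\<^sup>2)) \<partial>M) < \<infinity>"
        using le_less_trans[OF that ennreal_less_top] by simp
    qed measurable
    then show ?thesis by (simp add: L2_def)
  qed
  \<comment> \<open>The Fatou bound with \<open>e = 1\<close> puts one difference
    \<open>F N - f\<close> into \<open>L2\<close>, and thereby \<open>f\<close> itself.\<close>
  obtain N where N: "\<forall>m\<ge>N. \<forall>n\<ge>N. l2norm M (\<lambda>x. F m x - F n x) < 1"
    using C[OF zero_less_one] ..
  have d: "(\<lambda>x. F N x - f x) \<in> L2 M"
    by (rule inL2[OF key[OF zero_less_one N order_refl]])
  have eq: "(\<lambda>x. F N x - (F N x - f x)) = f" by (rule ext) simp
  have f: "f \<in> L2 M" using L2_diff[OF F[of N] d] unfolding eq .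
  moreover have "(\<lambda>n. l2norm M (\<lambda>x. F n x - f x)) \<longlonglongrightarrow> 0"
  proof (rule LIMSEQ_I)
    fix e :: real assume "e > 0"
    then have e2: "e / 2 > 0" by simp
    obtain N where N: "\<forall>m\<ge>N. \<forall>n\<ge>N. l2norm M (\<lambda>x. F m x - F n x) < e / 2"
      using C[OF e2] ..
    have "l2norm M (\<lambda>x. F n x - f x) < e" if n: "n \<ge> N" for n
    proof -
      have "ennreal ((l2norm M (\<lambda>x. F n x - f x))\<^sup>2) \<le> ennreal ((e / 2)\<^sup>2)"
      proof -
        have "(\<integral>\<^sup>+x. ennreal ((norm (F n x - f x))\<^sup>2) \<partial>M) = ennreal ((l2norm M (\<lambda>x. F n x - f x))\<^sup>2)"
          unfolding l2norm_power2
          by (rule nn_integral_eq_integral[OF L2_integrable[OF L2_diff[OF F f]]]) simp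
        with key[OF e2 N n] show ?thesis by (simp only:)
      qed
      then have "(l2norm M (\<lambda>x. F n x - f x))\<^sup>2 \<le> (e / 2)\<^sup>2" using ennreal_le_iff[OF zero_le_power2] by blast
      then have "l2norm M (\<lambda>x. F n x - f x) \<le> e / 2" by (rule power2_le_imp_le) (use e2 in simp)
      then show ?thesis using \<open>e > 0\<close> by simp
    qed
    then have "\<forall>n\<ge>N. norm (l2norm M (\<lambda>x. F n x - f x) - 0) < e" by simp
    then show "\<exists>N. \<forall>n\<ge>N. norm (l2norm M (\<lambda>x. F n x - f x) - 0) < e" ..
  qed
  ultimately show ?thesis by (intro bexI[of _ f])
qed

end

section \<open>Functions determined by their integrals\<close>

lemma AE_lebesgue_on_iff:
  "\<Omega> \<in> sets lebesgue \<Longrightarrow> (AE x in lebesgue_on \<Omega>. P x) \<longleftrightarrow> (AE x in lebesgue. x \<in> \<Omega> \<longrightarrow> P x)"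
  by (simp add: AE_restrict_space_iff)

text \<open>By Lebesgue's differentiation theorem, almost every value of \<open>f\<close> is a limit
  of averages over cubes with lower corner at the point; these averages are nonnegative.\<close>

lemma AE_nonneg_if_box:
  fixes f :: "'a::euclidean_space \<Rightarrow> real"
  assumes "open \<Omega>"
    and int: "\<And>a b. cbox a b \<subseteq> \<Omega> \<Longrightarrow> f integrable_on cbox a b"
    and nonneg: "\<And>a b. cbox a b \<subseteq> \<Omega> \<Longrightarrow> 0 \<le> integral (cbox a b) f"
  shows "AE x in lebesgue_on \<Omega>. 0 \<le> f x"
proof -
  have box: "negligible {x \<in> box c d. f x < 0}" if cd: "cbox c d \<subseteq> \<Omega>" for c d
  proof -
    \<comment> \<open>Extension by 0 makes the function integrable on every box, as the
      differentiation theorem requires, without changing it inside \<open>cbox c d\<close>.\<close>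
    define g where "g = (\<lambda>x. if x \<in> cbox c d then f x else 0)"
    have "g integrable_on UNIV"
      unfolding g_def using int[OF cd] integrable_restrict_UNIV by blast
    then have "g integrable_on cbox a b" for a b
      using integrable_on_subcbox by blast
    from integrable_ccontinuous_explicit[OF this] obtain N where N: "negligible N"
      "\<And>x e. \<lbrakk>x \<notin> N; 0 < e\<rbrakk> \<Longrightarrow> \<exists>d>0. \<forall>h. 0 < h \<and> h < d \<longrightarrow>
         norm (integral (cbox x (x + h *\<^sub>R One)) g /\<^sub>R h ^ DIM('a) - g x) < e"
      by metis
    have "0 \<le> f x" if x: "x \<in> box c d" "x \<notin> N" for x
    proof (rule ccontr)
      assume "\<not> 0 \<le> f x"
      then have e: "0 < - f x" by simp
      from N(2)[OF x(2) e] obtain \<delta> where d: "\<delta> > 0" "\<And>h. 0 < h \<Longrightarrow> h < \<delta> \<Longrightarrow>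
         norm (integral (cbox x (x + h *\<^sub>R One)) g /\<^sub>R h ^ DIM('a) - g x) < - f x" by blast
      \<comment> \<open>The smallest distance from \<open>x\<close> to the upper faces, so that half
        of it is a step for which the cube stays inside \<open>cbox c d\<close>.\<close>
      define \<eta> where "\<eta> = Min (insert \<delta> ((\<lambda>i. d \<bullet> i - x \<bullet> i) ` Basis))"
      have \<eta>: "\<eta> \<le> \<delta>" "\<And>i. i \<in> Basis \<Longrightarrow> \<eta> \<le> d \<bullet> i - x \<bullet> i"
        unfolding \<eta>_def by (intro Min_le; simp)+
      have "\<eta> > 0" unfolding \<eta>_def using d(1) x(1) by (simp add: mem_box)
      define h where "h = \<eta> / 2"
      have h: "0 < h" "h < \<delta>" using \<eta>(1) \<open>\<eta> > 0\<close> by (auto simp: h_def)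
      have sub: "cbox x (x + h *\<^sub>R One) \<subseteq> cbox c d"
      proof -
        have "c \<bullet> i \<le> x \<bullet> i \<and> (x + h *\<^sub>R One) \<bullet> i \<le> d \<bullet> i" if "i \<in> Basis" for i
          using x(1) \<eta>(2)[OF that] that \<open>\<eta> > 0\<close> by (auto simp: mem_box h_def inner_add_left intro: less_imp_le)
        then show ?thesis by (auto simp: subset_box)
      qed
      have "integral (cbox x (x + h *\<^sub>R One)) g = integral (cbox x (x + h *\<^sub>R One)) f"
        by (rule integral_cong) (use sub in \<open>auto simp: g_def\<close>)
      then have "0 \<le> integral (cbox x (x + h *\<^sub>R One)) g"
        using nonneg[of x "x + h *\<^sub>R One"] sub cd by auto
      then have "0 \<le> integral (cbox x (x + h *\<^sub>R One)) g /\<^sub>R h ^ DIM('a)"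
        using h by simp
      moreover have "g x = f x" using x(1) box_subset_cbox[of c d] by (auto simp: g_def)
      ultimately show False using d(2)[OF h] e by simp
    qed
    then have "{x \<in> box c d. f x < 0} \<subseteq> N" by (auto simp: not_less[symmetric])
    with N(1) show ?thesis using negligible_subset by blast
  qed
  from open_countable_Union_open_cbox[OF assms(1)]
  obtain \<D> where D: "countable \<D>" "\<D> \<subseteq> Pow \<Omega>" "\<And>X. X \<in> \<D> \<Longrightarrow> \<exists>a b. X = cbox a b" "\<Union>\<D> = \<Omega>"
    by metis
  have neg: "negligible (\<Union>X\<in>\<D>. {x \<in> X. f x < 0})"
  proof (rule negligible_countable_Union)
    show "countable ((\<lambda>X. {x \<in> X. f x < 0}) ` \<D>)" using D(1) by simp
    fix Y assume "Y \<in> (\<lambda>X. {x \<in> X. f x < 0}) ` \<D>"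
    then obtain X where X: "X \<in> \<D>" "Y = {x \<in> X. f x < 0}" by blast
    with D(3) obtain c d where cd: "X = cbox c d" by blast
    with X D(2) have "cbox c d \<subseteq> \<Omega>" by auto
    \<comment> \<open>Differentiation was carried out at interior points only; the faces of the box
      are added back as a null set.\<close>
    from negligible_Un[OF box[OF this] negligible_frontier_interval[of c d]]
    show "negligible Y" by (rule negligible_subset) (auto simp: X cd)
  qed
  have "{x. \<not> (x \<in> \<Omega> \<longrightarrow> 0 \<le> f x)} \<subseteq> (\<Union>X\<in>\<D>. {x \<in> X. f x < 0})" using D(4) by auto
  then have "negligible {x. \<not> (x \<in> \<Omega> \<longrightarrow> 0 \<le> f x)}" using neg negligible_subset by blast
  then have "{x. \<not> (x \<in> \<Omega> \<longrightarrow> 0 \<le> f x)} \<in> null_sets lebesgue"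
    by (simp only: negligible_iff_null_sets)
  then have "AE x in lebesgue. x \<in> \<Omega> \<longrightarrow> 0 \<le> f x"
    by (rule AE_I') auto
  with assms(1) show ?thesis by (subst AE_lebesgue_on_iff) auto
qed

lemma lint_lebesgue_on_eq:
  fixes f :: "'a::euclidean_space \<Rightarrow> real"
  assumes "\<Omega> \<in> sets lebesgue"
  shows "(LINT x|lebesgue_on \<Omega>. f x) = (LINT x|lebesgue. indicator \<Omega> x * f x)"
  using integral_restrict_space[of \<Omega> lebesgue f] assms by simp

text \<open>Steepening bumps recover the integral over a box by dominated convergence. Only test
  functions with values in [0,1] are asked for, which later keeps the increments
  \<open>t * \<psi> x\<close> below a prescribed step length.\<close>

lemma AE_nonneg_if_test:
  fixes f :: "'a::euclidean_space \<Rightarrow> real"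
  assumes "open \<Omega>" "f \<in> L1loc \<Omega>"
    and nonneg: "\<And>\<phi>. test_function \<Omega> \<phi> \<Longrightarrow> (\<And>x. 0 \<le> \<phi> x) \<Longrightarrow> (\<And>x. \<phi> x \<le> 1) \<Longrightarrow>
       0 \<le> (LINT x|lebesgue_on \<Omega>. f x * \<phi> x)"
  shows "AE x in lebesgue_on \<Omega>. 0 \<le> f x"
proof (rule AE_nonneg_if_box[OF assms(1)])
  fix a b assume ab: "cbox a b \<subseteq> \<Omega>"
  have S: "\<Omega> \<in> sets lebesgue" using assms(1) by auto
  have abs: "f absolutely_integrable_on cbox a b"
    using assms(2) ab compact_cbox unfolding L1loc_def by blast
  then show "f integrable_on cbox a b" by (rule absolutely_integrable_on_def[THEN iffD1, THEN conjunct1])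
  define F where "F = (\<lambda>x. indicator (cbox a b) x * f x)"
  have F: "integrable lebesgue F" using abs by (simp add: set_integrable_def F_def)
  then have [measurable]: "F \<in> borel_measurable lebesgue" by auto
  let ?b = "\<lambda>n. box_bump (real (Suc n)) a b"
  have b[measurable]: "?b n \<in> borel_measurable lebesgue" for n
    by (rule measurable_completion) (use smooth_borel_measurable[OF smooth_box_bump] in simp)
  have [measurable]: "box a b \<in> sets lebesgue" by simp
  have "(\<lambda>n. LINT x|lebesgue. F x * ?b n x) \<longlonglongrightarrow> (LINT x|lebesgue. F x * indicator (box a b) x)"
  proof (rule integral_dominated_convergence[where w = "\<lambda>x. norm (F x)"])
    show "AE x in lebesgue. (\<lambda>n. F x * ?b n x) \<longlonglongrightarrow> F x * indicator (box a b) x"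
      by (intro AE_I2 tendsto_mult tendsto_const box_bump_tendsto)
    show "AE x in lebesgue. norm (F x * ?b n x) \<le> norm (F x)" for n
      using box_bump_bounds[of "real (Suc n)" a b] by (intro AE_I2) (simp add: abs_mult mult_left_le)
    show "(\<lambda>x. F x * indicator (box a b) x) \<in> borel_measurable lebesgue"
      using F by (intro borel_measurable_times borel_measurable_indicator) auto
    show "(\<lambda>x. F x * ?b n x) \<in> borel_measurable lebesgue" for n
      using F b by (intro borel_measurable_times) auto
  qed (use F in auto)
  moreover have "0 \<le> (LINT x|lebesgue. F x * ?b n x)" for n
  proof -
    have "0 \<le> (LINT x|lebesgue_on \<Omega>. f x * ?b n x)"
      by (rule nonneg[OF test_box_bump[OF ab]]) (auto simp: box_bump_bounds)
    also have "\<dots> = (LINT x|lebesgue. F x * ?b n x)"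
      unfolding lint_lebesgue_on_eq[OF S]
    proof (rule Bochner_Integration.integral_cong[OF refl])
      fix x
      show "indicator \<Omega> x * (f x * ?b n x) = F x * ?b n x"
        using ab box_bump_eq_0[of "real (Suc n)" x a b] box_subset_cbox[of a b]
        by (cases "x \<in> box a b") (auto simp: F_def indicator_def)
    qed
    finally show ?thesis .
  qed
  ultimately have "0 \<le> (LINT x|lebesgue. F x * indicator (box a b) x)"
    by (intro LIMSEQ_le_const[of _ "LINT x|lebesgue. F x * indicator (box a b) x" 0]) auto
  also have "\<dots> = (LINT x|lebesgue. F x)"
  proof (rule integral_cong_AE)
    have "cbox a b - box a b \<in> null_sets lebesgue"
      using negligible_frontier_interval[of a b] by (simp add: negligible_iff_null_sets)
    then have "AE x in lebesgue. x \<notin> cbox a b - box a b" by (rule AE_not_in)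
    then show "AE x in lebesgue. F x * indicator (box a b) x = F x"
      by eventually_elim (auto simp: F_def indicator_def)
    show "(\<lambda>x. F x * indicator (box a b) x) \<in> borel_measurable lebesgue"
      using F by (intro borel_measurable_times borel_measurable_indicator) auto
  qed (use F in auto)
  also have "\<dots> = integral (cbox a b) f"
    using set_lebesgue_integral_eq_integral(2)[OF abs] by (simp add: set_lebesgue_integral_def F_def)
  finally show "0 \<le> integral (cbox a b) f" .
qed

lemma L1loc_uminus: "f \<in> L1loc \<Omega> \<Longrightarrow> (\<lambda>x. - f x) \<in> L1loc \<Omega>"
  by (auto simp: L1loc_def set_integrable_def)

lemma L1loc_diff: "f \<in> L1loc \<Omega> \<Longrightarrow> g \<in> L1loc \<Omega> \<Longrightarrow> (\<lambda>x. f x - g x) \<in> L1loc \<Omega>"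
  by (auto simp: L1loc_def)

lemma AE_zero_if_test:
  fixes f :: "'a::euclidean_space \<Rightarrow> real"
  assumes "open \<Omega>" "f \<in> L1loc \<Omega>"
    and zero: "\<And>\<phi>. test_function \<Omega> \<phi> \<Longrightarrow> (LINT x|lebesgue_on \<Omega>. f x * \<phi> x) = 0"
  shows "AE x in lebesgue_on \<Omega>. f x = 0"
proof -
  have "AE x in lebesgue_on \<Omega>. 0 \<le> f x"
    by (rule AE_nonneg_if_test[OF assms(1,2)]) (simp add: zero)
  moreover have "AE x in lebesgue_on \<Omega>. 0 \<le> - f x"
    by (rule AE_nonneg_if_test[OF assms(1) L1loc_uminus[OF assms(2)]]) (simp add: zero)
  ultimately show ?thesis by eventually_elim simp
qed

section \<open>The space \<open>H\<^sup>1\<^sub>0\<close> as a closure of jets of test functions\<close>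

text \<open>Serves \<open>weak_grad\<close>, which is chosen by \<open>SOME\<close> and known only
  up to a null set: completeness of Lebesgue measure still makes it measurable.\<close>

lemma borel_measurable_lebesgue_on_AE:
  fixes f g :: "'a::euclidean_space \<Rightarrow> 'b::euclidean_space"
  assumes "f \<in> borel_measurable (lebesgue_on S)" "AE x in lebesgue_on S. f x = g x" "S \<in> sets lebesgue"
  shows "g \<in> borel_measurable (lebesgue_on S)"
proof -
  have "(\<lambda>x. indicator S x *\<^sub>R f x) \<in> borel_measurable lebesgue"
    using assms(1,3) by (simp add: borel_measurable_restrict_space_iff)
  moreover have "AE x in lebesgue. indicator S x *\<^sub>R f x = indicator S x *\<^sub>R g x"
    using assms(2) unfolding AE_lebesgue_on_iff[OF assms(3)]
    by eventually_elim (auto simp: indicator_def)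
  ultimately have "(\<lambda>x. indicator S x *\<^sub>R g x) \<in> borel_measurable lebesgue"
    by (rule borel_measurable_AE)
  then show ?thesis using assms(3) by (simp add: borel_measurable_restrict_space_iff)
qed

lemma powr_2_norm: "norm x powr 2 = (norm x)\<^sup>2" for x :: "'b::real_normed_vector"
  by (cases "norm x = 0") (auto simp: powr_numeral)

lemma Lp_2_eq: "Lp 2 \<Omega> = L2 (lebesgue_on \<Omega>)"
  by (simp add: Lp_def L2_def powr_2_norm)

text \<open>Pairing a function with its gradient turns the Sobolev norm into the plain
  \<open>l2norm\<close> of one map into \<open>real \<times> 'a\<close>, so completeness and
  Cauchy-Schwarz for \<open>L2\<close> apply verbatim.\<close>

definition jet :: "('a::euclidean_space \<Rightarrow> real) \<Rightarrow> 'a \<Rightarrow> real \<times> 'a" where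
  "jet \<phi> x = (\<phi> x, grad \<phi> x)"

lemma norm_Pair_power2: "(norm (a, b))\<^sup>2 = (norm a)\<^sup>2 + (norm b)\<^sup>2"
  by (simp add: norm_Pair)

lemma assumes U: "U \<in> L2 M"
  shows L2_fst: "(\<lambda>x. fst (U x)) \<in> L2 M"
    and l2norm_fst: "l2norm M (\<lambda>x. fst (U x)) \<le> l2norm M U"
proof -
  have "(\<lambda>x. fst (U x)) \<in> borel_measurable M"
    by (rule borel_measurable_continuous_on[OF _ L2_measurable[OF U]]) (intro continuous_intros)
  note * = L2_dominated[OF this U AE_I2]
  show "(\<lambda>x. fst (U x)) \<in> L2 M" "l2norm M (\<lambda>x. fst (U x)) \<le> l2norm M U"
    by (rule *; metis norm_fst_le prod.collapse)+
qed

lemma assumes U: "U \<in> L2 M"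
  shows L2_snd: "(\<lambda>x. snd (U x)) \<in> L2 M"
    and l2norm_snd: "l2norm M (\<lambda>x. snd (U x)) \<le> l2norm M U"
proof -
  have "(\<lambda>x. snd (U x)) \<in> borel_measurable M"
    by (rule borel_measurable_continuous_on[OF _ L2_measurable[OF U]]) (intro continuous_intros)
  note * = L2_dominated[OF this U AE_I2]
  show "(\<lambda>x. snd (U x)) \<in> L2 M" "l2norm M (\<lambda>x. snd (U x)) \<le> l2norm M U"
    by (rule *; metis norm_snd_le prod.collapse)+
qed

lemma L2_Pair: assumes "u \<in> L2 M" "v \<in> L2 M" shows "(\<lambda>x. (u x, v x)) \<in> L2 M"
proof -
  have "integrable M (\<lambda>x. (norm (u x))\<^sup>2 + (norm (v x))\<^sup>2)"
    using assms by (intro Bochner_Integration.integrable_add L2_integrable)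
  moreover have "(\<lambda>x. (u x, v x)) \<in> borel_measurable M"
    using assms[THEN L2_measurable] by (rule borel_measurable_Pair)
  ultimately show ?thesis by (simp add: L2_def norm_Pair_power2)
qed

lemma l2norm_Pair_power2:
  assumes "u \<in> L2 M" "v \<in> L2 M"
  shows "(l2norm M (\<lambda>x. (u x, v x)))\<^sup>2 = (l2norm M u)\<^sup>2 + (l2norm M v)\<^sup>2"
  using assms by (simp add: l2norm_power2 norm_Pair_power2 L2_integrable)

lemma has_weak_gradientD:
  "has_weak_gradient \<Omega> u v \<Longrightarrow> test_function \<Omega> \<phi> \<Longrightarrow> i \<in> Basis \<Longrightarrow>
    (LINT x|lebesgue_on \<Omega>. u x * partial_deriv i \<phi> x) = - (LINT x|lebesgue_on \<Omega>. (v x \<bullet> i) * \<phi> x)"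
  by (simp add: has_weak_gradient_def)

lemma has_weak_gradient_L1loc:
  "has_weak_gradient \<Omega> u v \<Longrightarrow> u \<in> L1loc \<Omega>" "has_weak_gradient \<Omega> u v \<Longrightarrow> v \<in> L1loc \<Omega>"
  by (simp_all add: has_weak_gradient_def)

locale bounded_open =
  fixes \<Omega> :: "'a::euclidean_space set"
  assumes open_domain: "open \<Omega>" and bounded_domain: "bounded \<Omega>"
begin

abbreviation "M \<equiv> lebesgue_on \<Omega>"

lemma sets_domain [simp, measurable]: "\<Omega> \<in> sets lebesgue"
  using open_domain by simp

lemma lmeasurable_domain: "\<Omega> \<in> lmeasurable"
  using bounded_domain by (intro bounded_set_imp_lmeasurable) auto

sublocale finite_measure M
  by (rule finite_measure_lebesgue_on[OF lmeasurable_domain])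

lemma borel_measurable_M: "f \<in> borel_measurable borel \<Longrightarrow> f \<in> borel_measurable M"
  by (rule measurable_restrict_space1) (rule measurable_completion, simp)

lemma continuous_L2:
  fixes f :: "'a \<Rightarrow> 'b::euclidean_space"
  assumes "continuous_on UNIV f" shows "f \<in> L2 M"
proof -
  obtain B where "\<And>x. x \<in> \<Omega> \<Longrightarrow> norm (f x) \<le> B"
    using continuous_bounded_on[OF assms bounded_domain] by metis
  then show ?thesis
    by (intro L2_bounded[of f B] AE_I2 borel_measurable_M borel_measurable_continuous_onI assms) auto
qed

lemma smooth_L2: "smooth f \<Longrightarrow> f \<in> L2 M"
  by (intro continuous_L2 smooth_continuous_on)

lemma smooth_grad_L2: "smooth f \<Longrightarrow> grad f \<in> L2 M"
  by (intro continuous_L2 smooth_grad_continuous_on)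

lemma test_L2: "test_function \<Omega> \<phi> \<Longrightarrow> \<phi> \<in> L2 M"
  by (intro smooth_L2 test_smooth)

lemma test_grad_L2: "test_function \<Omega> \<phi> \<Longrightarrow> grad \<phi> \<in> L2 M"
  by (intro smooth_grad_L2 test_smooth)

lemma jet_L2: "test_function \<Omega> \<phi> \<Longrightarrow> jet \<phi> \<in> L2 M"
  unfolding jet_def[abs_def] by (intro L2_Pair test_L2 test_grad_L2)

lemma l2norm_jet: "test_function \<Omega> \<phi> \<Longrightarrow> (l2norm M (jet \<phi>))\<^sup>2 = (l2norm M \<phi>)\<^sup>2 + (l2norm M (grad \<phi>))\<^sup>2"
  unfolding jet_def[abs_def] by (intro l2norm_Pair_power2 test_L2 test_grad_L2)

text \<open>This is the Sobolev space with zero boundary values, its elements carrying a gradient as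
  second component. Linear combinations then involve no choice of a weak gradient;
  \<open>W_imp_H10\<close> and \<open>H10_imp_W\<close> translate to \<open>H10\<close>.\<close>

definition W :: "('a \<Rightarrow> real \<times> 'a) set" where
  "W = {U \<in> L2 M. \<exists>\<phi>. (\<forall>n. test_function \<Omega> (\<phi> n)) \<and> (\<lambda>n. l2norm M (\<lambda>x. U x - jet (\<phi> n) x)) \<longlonglongrightarrow> 0}"

lemma W_L2: "U \<in> W \<Longrightarrow> U \<in> L2 M" by (simp add: W_def)

lemma W_approx:
  "U \<in> W \<Longrightarrow> \<exists>\<phi>. (\<forall>n. test_function \<Omega> (\<phi> n)) \<and> (\<lambda>n. l2norm M (\<lambda>x. U x - jet (\<phi> n) x)) \<longlonglongrightarrow> 0"
  by (simp add: W_def)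

lemma jet_W: "test_function \<Omega> \<phi> \<Longrightarrow> jet \<phi> \<in> W"
  unfolding W_def by (auto intro!: jet_L2 exI[of _ "\<lambda>n. \<phi>"] simp: l2norm_def)

lemma L2_L1loc: assumes "f \<in> L2 M" shows "f \<in> L1loc \<Omega>"
  unfolding L1loc_def
proof safe
  fix K assume K: "compact K" "K \<subseteq> \<Omega>"
  have "set_integrable lebesgue \<Omega> f"
    using L2_imp_integrable[OF assms] by (simp add: set_integrable_def integrable_restrict_space)
  then show "f absolutely_integrable_on K"
    by (rule set_integrable_subset) (use K in \<open>auto simp: compact_imp_closed\<close>)
qed

lemma L1loc_test_integrable:
  fixes f :: "'a \<Rightarrow> real"
  assumes "f \<in> L1loc \<Omega>" "test_function \<Omega> \<phi>"
  shows "integrable M (\<lambda>x. f x * \<phi> x)"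
proof -
  define K where "K = closure {x. \<phi> x \<noteq> 0}"
  have K: "compact K" "K \<subseteq> \<Omega>" using assms(2) by (auto simp: test_function_def K_def)
  have out: "\<phi> x = 0" if "x \<notin> K" for x using that closure_subset[of "{x. \<phi> x \<noteq> 0}"] unfolding K_def by auto
  obtain B where B: "B > 0" "\<And>x. \<bar>\<phi> x\<bar> \<le> B" using test_bounded[OF assms(2)] by metis
  have F: "integrable lebesgue (\<lambda>x. indicator K x * f x)"
    using assms(1) K by (simp add: L1loc_def set_integrable_def)
  have phi: "\<phi> \<in> borel_measurable lebesgue"
    by (rule measurable_completion) (use smooth_borel_measurable[OF test_smooth[OF assms(2)]] in simp)
  have "integrable lebesgue (\<lambda>x. \<phi> x * (indicator K x * f x))"
  proof (rule Bochner_Integration.integrable_bound[of _ "\<lambda>x. B * (indicator K x * f x)"])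
    show "integrable lebesgue (\<lambda>x. B * (indicator K x * f x))"
      by (rule integrable_mult_right[OF F])
    show "(\<lambda>x. \<phi> x * (indicator K x * f x)) \<in> borel_measurable lebesgue"
      by (rule borel_measurable_times[OF phi borel_measurable_integrable[OF F]])
    show "AE x in lebesgue. norm (\<phi> x * (indicator K x * f x)) \<le> norm (B * (indicator K x * f x))"
    proof (rule AE_I2)
      fix x
      have "\<bar>\<phi> x\<bar> * \<bar>indicator K x * f x\<bar> \<le> B * \<bar>indicator K x * f x\<bar>"
        by (rule mult_right_mono[OF B(2)]) (rule abs_ge_zero)
      then show "norm (\<phi> x * (indicator K x * f x)) \<le> norm (B * (indicator K x * f x))"
        using B(1) by (simp only: real_norm_def abs_mult abs_of_pos)
    qed
  qed
  moreover have "(\<lambda>x. indicator \<Omega> x *\<^sub>R (f x * \<phi> x)) = (\<lambda>x. \<phi> x * (indicator K x * f x))"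
    using K(2) out by (auto simp: fun_eq_iff indicator_def)
  ultimately show ?thesis by (simp add: integrable_restrict_space)
qed

lemma L1loc_inner:
  fixes v :: "'a \<Rightarrow> 'b::euclidean_space"
  assumes "v \<in> L1loc \<Omega>" shows "(\<lambda>x. v x \<bullet> i) \<in> L1loc \<Omega>"
proof -
  have "(\<lambda>x. v x \<bullet> i) absolutely_integrable_on K" if "v absolutely_integrable_on K" for K
  proof -
    have "integrable lebesgue (\<lambda>x. (indicator K x *\<^sub>R v x) \<bullet> i)"
      using that unfolding set_integrable_def by (intro integrable_inner_left) auto
    then show ?thesis by (simp add: set_integrable_def)
  qed
  with assms show ?thesis by (simp add: L1loc_def)
qed

lemma weak_gradient_unique:
  assumes "has_weak_gradient \<Omega> u v" "has_weak_gradient \<Omega> u v'"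
  shows "AE x in M. v x = v' x"
proof -
  note L = has_weak_gradient_L1loc(2)[OF assms(1)] has_weak_gradient_L1loc(2)[OF assms(2)]
  have "AE x in M. v x \<bullet> i - v' x \<bullet> i = 0" if i: "i \<in> Basis" for i
  proof (rule AE_zero_if_test[OF open_domain])
    show "(\<lambda>x. v x \<bullet> i - v' x \<bullet> i) \<in> L1loc \<Omega>" by (intro L1loc_diff L1loc_inner L)
    fix \<phi> assume phi: "test_function \<Omega> \<phi>"
    note I = L1loc_test_integrable[OF L1loc_inner[OF L(1)] phi, of i]
      L1loc_test_integrable[OF L1loc_inner[OF L(2)] phi, of i]
    have "(LINT x|M. (v x \<bullet> i) * \<phi> x) = (LINT x|M. (v' x \<bullet> i) * \<phi> x)"
      using has_weak_gradientD[OF assms(1) phi i] has_weak_gradientD[OF assms(2) phi i] by linarith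
    then show "(LINT x|M. (v x \<bullet> i - v' x \<bullet> i) * \<phi> x) = 0"
      using I by (simp add: left_diff_distrib)
  qed
  then have "AE x in M. \<forall>i\<in>Basis. v x \<bullet> i - v' x \<bullet> i = 0"
    by (rule AE_finite_allI[OF finite_Basis])
  then show ?thesis by eventually_elim (rule euclidean_eqI, simp)
qed

lemma weak_gradient_diff:
  assumes "has_weak_gradient \<Omega> u v" "has_weak_gradient \<Omega> u' v'"
  shows "has_weak_gradient \<Omega> (\<lambda>x. u x - u' x) (\<lambda>x. v x - v' x)"
proof -
  note L = has_weak_gradient_L1loc(2)[OF assms(1)] has_weak_gradient_L1loc(2)[OF assms(2)]
    has_weak_gradient_L1loc(1)[OF assms(1)] has_weak_gradient_L1loc(1)[OF assms(2)]
  have L': "(\<lambda>x. v x - v' x) \<in> L1loc \<Omega>" using L(1,2) by (auto simp: L1loc_def)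
  show ?thesis
    unfolding has_weak_gradient_def
  proof (intro conjI allI impI ballI)
    show "(\<lambda>x. u x - u' x) \<in> L1loc \<Omega>" by (rule L1loc_diff[OF L(3,4)])
    show "(\<lambda>x. v x - v' x) \<in> L1loc \<Omega>" by (rule L')
    fix \<phi> i assume phi: "test_function \<Omega> \<phi>" and i: "i \<in> (Basis::'a set)"
    have 1: "(LINT x|M. u x * partial_deriv i \<phi> x) = - (LINT x|M. (v x \<bullet> i) * \<phi> x)"
      "(LINT x|M. u' x * partial_deriv i \<phi> x) = - (LINT x|M. (v' x \<bullet> i) * \<phi> x)"
      by (rule has_weak_gradientD[OF assms(1) phi i], rule has_weak_gradientD[OF assms(2) phi i])
    have "(LINT x|M. (u x - u' x) * partial_deriv i \<phi> x) =
        (LINT x|M. u x * partial_deriv i \<phi> x) - (LINT x|M. u' x * partial_deriv i \<phi> x)"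
      using L1loc_test_integrable[OF L(3) test_partial_deriv[OF phi i]]
        L1loc_test_integrable[OF L(4) test_partial_deriv[OF phi i]]
      by (simp add: left_diff_distrib)
    moreover have "(LINT x|M. ((v x - v' x) \<bullet> i) * \<phi> x) =
        (LINT x|M. (v x \<bullet> i) * \<phi> x) - (LINT x|M. (v' x \<bullet> i) * \<phi> x)"
      using L1loc_test_integrable[OF L1loc_inner[OF L(1)] phi, of i]
        L1loc_test_integrable[OF L1loc_inner[OF L(2)] phi, of i]
      by (simp add: left_diff_distrib inner_diff_left)
    ultimately show "(LINT x|M. (u x - u' x) * partial_deriv i \<phi> x) = - (LINT x|M. ((v x - v' x) \<bullet> i) * \<phi> x)"
      using 1 by simp
  qed
qed

lemma lint_M_eq_lborel:
  assumes "f \<in> borel_measurable borel" "\<And>x. x \<notin> \<Omega> \<Longrightarrow> f x = (0::real)"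
  shows "(LINT x|M. f x) = (LINT x|lborel. f x)"
  using integral_lebesgue_on_eq_lborel[OF assms sets_domain] .

lemma integral_by_parts_M:
  assumes f: "test_function \<Omega> f" and g: "smooth g" and i: "i \<in> Basis"
  shows "(LINT x|M. f x * partial_deriv i g x) = - (LINT x|M. partial_deriv i f x * g x)"
proof -
  have m: "h \<in> borel_measurable borel" if "smooth h" for h :: "'a \<Rightarrow> real"
    by (rule smooth_borel_measurable[OF that])
  have "(LINT x|M. f x * partial_deriv i g x) = (LINT x|lborel. f x * partial_deriv i g x)"
    by (intro lint_M_eq_lborel borel_measurable_times m test_smooth[OF f] smooth_partial_deriv[OF g i])
       (simp add: test_outside[OF f])
  moreover have "(LINT x|M. partial_deriv i f x * g x) = (LINT x|lborel. partial_deriv i f x * g x)"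
    by (intro lint_M_eq_lborel borel_measurable_times m g test_smooth[OF test_partial_deriv[OF f i]])
       (simp add: test_outside[OF test_partial_deriv[OF f i]])
  ultimately show ?thesis using integral_by_parts[OF assms] by simp
qed

text \<open>For jets this is classical integration by parts, and the identity survives L2 limits
  because it says that an inner product with a fixed square integrable map vanishes.\<close>

lemma W_weak_gradient:
  assumes "U \<in> W" shows "has_weak_gradient \<Omega> (\<lambda>x. fst (U x)) (\<lambda>x. snd (U x))"
  unfolding has_weak_gradient_def
proof (intro conjI allI impI ballI)
  show "(\<lambda>x. fst (U x)) \<in> L1loc \<Omega>" "(\<lambda>x. snd (U x)) \<in> L1loc \<Omega>"
    using W_L2[OF assms] by (auto intro!: L2_L1loc L2_fst L2_snd)
  fix \<psi> i assume psi: "test_function \<Omega> \<psi>" and i: "i \<in> (Basis::'a set)"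
  obtain \<phi> where phi: "\<And>n. test_function \<Omega> (\<phi> n)" "(\<lambda>n. l2norm M (\<lambda>x. U x - jet (\<phi> n) x)) \<longlonglongrightarrow> 0"
    using W_approx[OF assms] by metis
  \<comment> \<open>Packs both sides of the integration by parts formula into a single inner product
    on \<open>real \<times> 'a\<close>.\<close>
  let ?g = "\<lambda>x. (partial_deriv i \<psi> x, \<psi> x *\<^sub>R i)"
  have p: "\<psi> \<in> L2 M" "partial_deriv i \<psi> \<in> L2 M" using psi test_partial_deriv[OF psi i] by (auto intro: test_L2)
  have ps: "(\<lambda>x. \<psi> x *\<^sub>R i) \<in> L2 M"
    by (intro continuous_L2 continuous_on_scaleR smooth_continuous_on[OF test_smooth[OF psi]] continuous_on_const)
  have g: "?g \<in> L2 M" by (intro L2_Pair p ps)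
  have zero: "(LINT x|M. jet (\<phi> n) x \<bullet> ?g x) = 0" for n
  proof -
    have "(LINT x|M. jet (\<phi> n) x \<bullet> ?g x) = (LINT x|M. \<phi> n x * partial_deriv i \<psi> x + partial_deriv i (\<phi> n) x * \<psi> x)"
      by (simp add: jet_def grad_inner_Basis[OF i] mult.commute)
    also have "\<dots> = (LINT x|M. \<phi> n x * partial_deriv i \<psi> x) + (LINT x|M. partial_deriv i (\<phi> n) x * \<psi> x)"
      by (intro Bochner_Integration.integral_add L2_mult_integrable p test_L2 test_partial_deriv phi i)
    finally show ?thesis using integral_by_parts_M[OF phi(1) test_smooth[OF psi] i] by simp
  qed
  have "(\<lambda>n. LINT x|M. jet (\<phi> n) x \<bullet> ?g x) \<longlonglongrightarrow> (LINT x|M. U x \<bullet> ?g x)"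
    by (rule L2_inner_tendsto[OF jet_L2[OF phi(1)] W_L2[OF assms] g])
       (subst l2norm_minus_commute, rule phi(2))
  then have "(LINT x|M. U x \<bullet> ?g x) = 0" unfolding zero using LIMSEQ_unique[OF tendsto_const] by metis
  moreover have "(LINT x|M. U x \<bullet> ?g x) = (LINT x|M. fst (U x) * partial_deriv i \<psi> x) + (LINT x|M. (snd (U x) \<bullet> i) * \<psi> x)"
  proof -
    have "(LINT x|M. U x \<bullet> ?g x) = (LINT x|M. fst (U x) * partial_deriv i \<psi> x + (snd (U x) \<bullet> i) * \<psi> x)"
      by (intro Bochner_Integration.integral_cong) (auto simp: inner_prod_def)
    also have "\<dots> = (LINT x|M. fst (U x) * partial_deriv i \<psi> x) + (LINT x|M. (snd (U x) \<bullet> i) * \<psi> x)"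
      by (intro Bochner_Integration.integral_add L1loc_test_integrable[OF _ test_partial_deriv[OF psi i]]
          L1loc_test_integrable[OF _ psi] L1loc_inner L2_L1loc L2_fst L2_snd W_L2 assms)
    finally show ?thesis .
  qed
  ultimately show "(LINT x|M. fst (U x) * partial_deriv i \<psi> x) = - (LINT x|M. (snd (U x) \<bullet> i) * \<psi> x)"
    by simp
qed

lemma weak_grad_AE:
  assumes "has_weak_gradient \<Omega> u v" shows "AE x in M. weak_grad \<Omega> u x = v x"
proof -
  have "has_weak_gradient \<Omega> u (weak_grad \<Omega> u)"
    unfolding weak_grad_def by (rule someI[of "has_weak_gradient \<Omega> u", OF assms])
  from weak_gradient_unique[OF this assms] show ?thesis .
qed

lemma lint_weak_grad:
  assumes "has_weak_gradient \<Omega> u v" "v \<in> L2 M"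
  shows "(LINT x|M. (norm (weak_grad \<Omega> u x))\<^sup>2) = (l2norm M v)\<^sup>2"
proof -
  have ae: "AE x in M. v x = weak_grad \<Omega> u x" using weak_grad_AE[OF assms(1)] by eventually_elim simp
  have m: "weak_grad \<Omega> u \<in> borel_measurable M"
    by (rule borel_measurable_lebesgue_on_AE[OF L2_measurable[OF assms(2)] ae sets_domain])
  show ?thesis
    using l2norm_cong_AE[OF L2_measurable[OF assms(2)] m ae] by (simp add: l2norm_power2[symmetric])
qed

lemma H1_norm_eq:
  assumes "has_weak_gradient \<Omega> u v" "u \<in> L2 M" "v \<in> L2 M"
  shows "H1_norm \<Omega> u = l2norm M (\<lambda>x. (u x, v x))"
proof -
  have "(LINT x|M. (u x)\<^sup>2) = (l2norm M u)\<^sup>2" by (simp add: l2norm_power2)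
  then have "H1_norm \<Omega> u = sqrt ((l2norm M (\<lambda>x. (u x, v x)))\<^sup>2)"
    unfolding H1_norm_def lint_weak_grad[OF assms(1,3)] l2norm_Pair_power2[OF assms(2,3)] by simp
  then show ?thesis by simp
qed

lemma test_weak_gradient: "test_function \<Omega> \<phi> \<Longrightarrow> has_weak_gradient \<Omega> \<phi> (grad \<phi>)"
  using W_weak_gradient[OF jet_W, of \<phi>] by (simp add: jet_def)

lemma W_imp_H10: assumes "U \<in> W" shows "(\<lambda>x. fst (U x)) \<in> H10 \<Omega>"
proof -
  have L: "(\<lambda>x. fst (U x)) \<in> L2 M" "(\<lambda>x. snd (U x)) \<in> L2 M"
    using W_L2[OF assms] by (auto intro: L2_fst L2_snd)
  obtain \<phi> where phi: "\<And>n. test_function \<Omega> (\<phi> n)" "(\<lambda>n. l2norm M (\<lambda>x. U x - jet (\<phi> n) x)) \<longlonglongrightarrow> 0"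
    using W_approx[OF assms] by metis
  have "\<exists>\<psi>. test_function \<Omega> \<psi> \<and> H1_norm \<Omega> (\<lambda>x. fst (U x) - \<psi> x) < \<epsilon>" if "\<epsilon> > 0" for \<epsilon>
  proof -
    have "eventually (\<lambda>n. l2norm M (\<lambda>x. U x - jet (\<phi> n) x) < \<epsilon>) sequentially"
      using order_tendstoD(2)[OF phi(2) that] .
    then obtain n where n: "l2norm M (\<lambda>x. U x - jet (\<phi> n) x) < \<epsilon>"
      by (auto simp: eventually_sequentially)
    have "H1_norm \<Omega> (\<lambda>x. fst (U x) - \<phi> n x) = l2norm M (\<lambda>x. (fst (U x) - \<phi> n x, snd (U x) - grad (\<phi> n) x))"
      by (intro H1_norm_eq weak_gradient_diff W_weak_gradient assms test_weak_gradient phi L2_diff L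
          test_L2 test_grad_L2)
    also have "(\<lambda>x. (fst (U x) - \<phi> n x, snd (U x) - grad (\<phi> n) x)) = (\<lambda>x. U x - jet (\<phi> n) x)"
      by (auto simp: jet_def fun_eq_iff prod_eq_iff)
    finally show ?thesis using n by (intro exI[of _ "\<phi> n"] conjI phi(1)) simp
  qed
  moreover have "(\<lambda>x. fst (U x)) \<in> H1 \<Omega>"
    unfolding H1_def Lp_2_eq using L W_weak_gradient[OF assms] by blast
  ultimately show ?thesis by (simp add: H10_def)
qed

text \<open>The approximating test functions are those in the definition of \<open>H10\<close>. By
  \<open>H1_norm_eq\<close> the Sobolev norm there may be computed with any square integrable weak
  gradient instead of the chosen one.\<close>

lemma H10_imp_W: assumes "u \<in> H10 \<Omega>" obtains v where "(\<lambda>x. (u x, v x)) \<in> W"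
proof -
  obtain v where v: "u \<in> L2 M" "v \<in> L2 M" "has_weak_gradient \<Omega> u v"
    using assms by (auto simp: H10_def H1_def Lp_2_eq)
  have "\<forall>n::nat. \<exists>\<phi>. test_function \<Omega> \<phi> \<and> H1_norm \<Omega> (\<lambda>x. u x - \<phi> x) < 1 / real (Suc n)"
    using assms by (auto simp: H10_def)
  then obtain \<phi> where phi: "\<And>n. test_function \<Omega> (\<phi> n)" "\<And>n. H1_norm \<Omega> (\<lambda>x. u x - \<phi> n x) < 1 / real (Suc n)"
    by metis
  have "H1_norm \<Omega> (\<lambda>x. u x - \<phi> n x) = l2norm M (\<lambda>x. (u x, v x) - jet (\<phi> n) x)" for n
  proof -
    have "H1_norm \<Omega> (\<lambda>x. u x - \<phi> n x) = l2norm M (\<lambda>x. (u x - \<phi> n x, v x - grad (\<phi> n) x))"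
      by (intro H1_norm_eq weak_gradient_diff v test_weak_gradient phi L2_diff test_L2 test_grad_L2)
    then show ?thesis by (simp add: jet_def)
  qed
  then have "norm (l2norm M (\<lambda>x. (u x, v x) - jet (\<phi> n) x)) \<le> 1 / real (Suc n)" for n
    using phi(2)[of n] by simp
  then have "(\<lambda>n. l2norm M (\<lambda>x. (u x, v x) - jet (\<phi> n) x)) \<longlonglongrightarrow> 0"
    by (intro Lim_null_comparison[OF always_eventually LIMSEQ_Suc[OF lim_1_over_n]] allI)
  then have "(\<lambda>x. (u x, v x)) \<in> W"
    unfolding W_def using phi(1) L2_Pair[OF v(1,2)] by blast
  then show ?thesis by (rule that)
qed

end

section \<open>Rellich compactness\<close>

lemma nn_integral_lborel_translation:
  fixes f :: "'a::euclidean_space \<Rightarrow> ennreal"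
  assumes [measurable]: "f \<in> borel_measurable borel"
  shows "(\<integral>\<^sup>+x. f (x + c) \<partial>lborel) = (\<integral>\<^sup>+x. f x \<partial>lborel)"
proof -
  have "(\<integral>\<^sup>+x. f x \<partial>lborel) = (\<integral>\<^sup>+x. f x \<partial>distr lborel borel ((+) c))"
    by (simp add: lborel_distr_plus)
  also have "\<dots> = (\<integral>\<^sup>+x. f (c + x) \<partial>lborel)" by (rule nn_integral_distr) auto
  finally show ?thesis by (simp add: add.commute)
qed

text \<open>The fundamental theorem of calculus along the segment from \<open>x\<close> to
  \<open>x + h\<close>, followed by Cauchy-Schwarz on the unit interval.\<close>

lemma translation_difference_le:
  fixes \<phi> :: "'a::euclidean_space \<Rightarrow> real"
  assumes "smooth \<phi>"
  shows "ennreal ((\<phi> (x + h) - \<phi> x)\<^sup>2) \<le>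
    (\<integral>\<^sup>+t. indicator {0..1::real} t * ennreal ((norm h)\<^sup>2 * (norm (grad \<phi> (x + t *\<^sub>R h)))\<^sup>2) \<partial>lborel)"
proof -
  define F where "F = (\<lambda>t. \<phi> (x + t *\<^sub>R h))"
  define f where "f = (\<lambda>t. grad \<phi> (x + t *\<^sub>R h) \<bullet> h)"
  have cont: "continuous_on S f" for S
    unfolding f_def
    by (intro continuous_on_inner continuous_on_const continuous_on_compose2[OF smooth_grad_continuous_on[OF assms, of UNIV]] continuous_intros) auto
  then have [measurable]: "f \<in> borel_measurable borel" by (intro borel_measurable_continuous_onI)
  have "(F has_vector_derivative f t) (at t)" for t
  proof -
    have "((\<lambda>t. \<phi> (x + t *\<^sub>R h)) has_derivative (\<lambda>u. grad \<phi> (x + t *\<^sub>R h) \<bullet> (u *\<^sub>R h))) (at t)"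
      by (rule has_derivative_compose[OF _ smooth_has_derivative[OF assms]]) (auto intro!: derivative_eq_intros)
    then show ?thesis by (simp add: has_vector_derivative_def F_def f_def)
  qed
  then have "has_bochner_integral lborel (\<lambda>t. indicator {0..1} t *\<^sub>R f t) (F 1 - F 0)"
    by (intro has_bochner_integral_FTC_Icc cont) (auto intro: has_vector_derivative_at_within)
  then have "ennreal (norm (F 1 - F 0)) \<le> (\<integral>\<^sup>+t. ennreal (norm (indicator {0..1} t *\<^sub>R f t)) \<partial>lborel)"
    using integral_norm_bound_ennreal by (metis has_bochner_integral_iff)
  \<comment> \<open>The indicator is doubled so that one copy becomes the second factor in
    Cauchy-Schwarz, with integral 1.\<close>
  also have "\<dots> = (\<integral>\<^sup>+t. ennreal (norm (f t)) * indicator {0..1} t * indicator {0..1} t \<partial>lborel)"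
    by (intro nn_integral_cong) (auto simp: indicator_def)
  finally have "ennreal (norm (F 1 - F 0)) ^ 2 \<le> (\<integral>\<^sup>+t. ennreal (norm (f t)) * indicator {0..1} t * indicator {0..1} t \<partial>lborel) ^ 2"
    by (rule power_mono) simp
  also have "\<dots> \<le> (\<integral>\<^sup>+t. (ennreal (norm (f t)) * indicator {0..1} t) ^ 2 \<partial>lborel) * (\<integral>\<^sup>+t. (indicator {0..1::real} t) ^ 2 \<partial>lborel)"
    by (rule Cauchy_Schwarz_nn_integral) measurable
  also have "(\<integral>\<^sup>+t. (indicator {0..1::real} t) ^ 2 \<partial>lborel) = (1::ennreal)"
  proof -
    have "(\<integral>\<^sup>+t. (indicator {0..1::real} t) ^ 2 \<partial>lborel) = (\<integral>\<^sup>+t. indicator {0..1::real} t \<partial>lborel)"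
      by (intro nn_integral_cong) (simp add: indicator_def)
    then show ?thesis by simp
  qed
  also have "(\<integral>\<^sup>+t. (ennreal (norm (f t)) * indicator {0..1} t) ^ 2 \<partial>lborel) * 1 \<le>
    (\<integral>\<^sup>+t. indicator {0..1::real} t * ennreal ((norm h)\<^sup>2 * (norm (grad \<phi> (x + t *\<^sub>R h)))\<^sup>2) \<partial>lborel)"
    unfolding mult_1_right
  proof (rule nn_integral_mono)
    fix t
    have "(norm (f t))\<^sup>2 \<le> (norm (grad \<phi> (x + t *\<^sub>R h)) * norm h)\<^sup>2"
      unfolding f_def by (intro power_mono) (auto simp: Cauchy_Schwarz_ineq2)
    then have "(ennreal (norm (f t))) ^ 2 \<le> ennreal ((norm h)\<^sup>2 * (norm (grad \<phi> (x + t *\<^sub>R h)))\<^sup>2)"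
      unfolding ennreal_power[OF norm_ge_zero] by (intro ennreal_leI) (simp add: power_mult_distrib mult.commute)
    then show "(ennreal (norm (f t)) * indicator {0..1} t) ^ 2 \<le> indicator {0..1::real} t * ennreal ((norm h)\<^sup>2 * (norm (grad \<phi> (x + t *\<^sub>R h)))\<^sup>2)"
      by (auto simp: indicator_def)
  qed
  finally show ?thesis by (simp add: F_def ennreal_power)
qed

lemma translation_L2_le:
  fixes \<phi> :: "'a::euclidean_space \<Rightarrow> real"
  assumes "smooth \<phi>"
  shows "(\<integral>\<^sup>+x. ennreal ((\<phi> (x + h) - \<phi> x)\<^sup>2) \<partial>lborel) \<le>
    ennreal ((norm h)\<^sup>2) * (\<integral>\<^sup>+x. ennreal ((norm (grad \<phi> x))\<^sup>2) \<partial>lborel)"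
proof -
  let ?g = "\<lambda>x. ennreal ((norm h)\<^sup>2 * (norm (grad \<phi> x))\<^sup>2)"
  have [measurable]: "grad \<phi> \<in> borel_measurable borel" by (rule smooth_grad_measurable[OF assms])
  have "(\<integral>\<^sup>+x. ennreal ((\<phi> (x + h) - \<phi> x)\<^sup>2) \<partial>lborel) \<le>
     (\<integral>\<^sup>+x. (\<integral>\<^sup>+t. indicator {0..1::real} t * ?g (x + t *\<^sub>R h) \<partial>lborel) \<partial>lborel)"
    by (intro nn_integral_mono translation_difference_le assms)
  also have "\<dots> = (\<integral>\<^sup>+t. (\<integral>\<^sup>+x. indicator {0..1::real} t * ?g (x + t *\<^sub>R h) \<partial>lborel) \<partial>lborel)"
    by (rule lborel_pair.Fubini') measurable
  also have "\<dots> = (\<integral>\<^sup>+t. indicator {0..1::real} t * (\<integral>\<^sup>+x. ?g x \<partial>lborel) \<partial>lborel)"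
  proof (rule nn_integral_cong)
    fix t :: real
    have "(\<integral>\<^sup>+x. indicator {0..1::real} t * ?g (x + t *\<^sub>R h) \<partial>lborel) = indicator {0..1::real} t * (\<integral>\<^sup>+x. ?g (x + t *\<^sub>R h) \<partial>lborel)"
      by (rule nn_integral_cmult) measurable
    also have "(\<integral>\<^sup>+x. ?g (x + t *\<^sub>R h) \<partial>lborel) = (\<integral>\<^sup>+x. ?g x \<partial>lborel)"
      by (rule nn_integral_lborel_translation) measurable
    finally show "(\<integral>\<^sup>+x. indicator {0..1::real} t * ?g (x + t *\<^sub>R h) \<partial>lborel) = indicator {0..1::real} t * (\<integral>\<^sup>+x. ?g x \<partial>lborel)" .
  qed
  also have "\<dots> = (\<integral>\<^sup>+x. ?g x \<partial>lborel)"
    by (simp add: nn_integral_multc)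
  also have "\<dots> = ennreal ((norm h)\<^sup>2) * (\<integral>\<^sup>+x. ennreal ((norm (grad \<phi> x))\<^sup>2) \<partial>lborel)"
    by (simp add: ennreal_mult nn_integral_cmult)
  finally show ?thesis .
qed

section \<open>Averages over the cubes of a grid\<close>

definition lattice_corner :: "real \<Rightarrow> 'a::euclidean_space \<Rightarrow> 'a" where
  "lattice_corner s x = (\<Sum>i\<in>Basis. (s * of_int \<lfloor>x \<bullet> i / s\<rfloor>) *\<^sub>R i)"

definition lattice_cube :: "real \<Rightarrow> 'a::euclidean_space \<Rightarrow> 'a set" where
  "lattice_cube s x = cbox (lattice_corner s x) (lattice_corner s x + s *\<^sub>R One)"

text \<open>A step function that depends on \<open>f\<close> only through countably many numbers,
  one for each cube of the grid. Hence a diagonal subsequence makes the averages of a bounded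
  sequence converge at every point simultaneously.\<close>

definition cube_average :: "real \<Rightarrow> ('a::euclidean_space \<Rightarrow> real) \<Rightarrow> 'a \<Rightarrow> real" where
  "cube_average s f x = (LINT y|lborel. indicator (lattice_cube s x) y * f y) / s ^ DIM('a)"

lemma lattice_corner_inner: "i \<in> Basis \<Longrightarrow> lattice_corner s x \<bullet> i = s * of_int \<lfloor>x \<bullet> i / s\<rfloor>"
  by (simp add: lattice_corner_def)

lemma mem_lattice_cube:
  "y \<in> lattice_cube s x \<longleftrightarrow> (\<forall>i\<in>Basis. s * of_int \<lfloor>x \<bullet> i / s\<rfloor> \<le> y \<bullet> i \<and> y \<bullet> i \<le> s * of_int \<lfloor>x \<bullet> i / s\<rfloor> + s)"
  by (simp add: lattice_cube_def mem_box lattice_corner_inner inner_add_left)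

lemma lattice_cube_diff:
  assumes "s > 0" "y \<in> lattice_cube s x" "i \<in> Basis"
  shows "\<bar>(y - x) \<bullet> i\<bar> \<le> s"
proof -
  have 1: "s * of_int \<lfloor>x \<bullet> i / s\<rfloor> \<le> x \<bullet> i" "x \<bullet> i \<le> s * of_int \<lfloor>x \<bullet> i / s\<rfloor> + s"
  proof -
    have "of_int \<lfloor>x \<bullet> i / s\<rfloor> \<le> x \<bullet> i / s" "x \<bullet> i / s \<le> of_int \<lfloor>x \<bullet> i / s\<rfloor> + 1" by linarith+
    then show "s * of_int \<lfloor>x \<bullet> i / s\<rfloor> \<le> x \<bullet> i" "x \<bullet> i \<le> s * of_int \<lfloor>x \<bullet> i / s\<rfloor> + s"
      using assms(1) by (simp_all only: pos_le_divide_eq pos_divide_le_eq) (simp_all add: algebra_simps)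
  qed
  have 2: "s * of_int \<lfloor>x \<bullet> i / s\<rfloor> \<le> y \<bullet> i" "y \<bullet> i \<le> s * of_int \<lfloor>x \<bullet> i / s\<rfloor> + s"
    using assms(2,3) by (auto simp: mem_lattice_cube)
  show ?thesis unfolding inner_diff_left using 1 2 by linarith
qed

lemma emeasure_lattice_cube: "s > 0 \<Longrightarrow> emeasure lborel (lattice_cube s (x::'a::euclidean_space)) = ennreal (s ^ DIM('a))"
  unfolding lattice_cube_def by (simp add: emeasure_lborel_cbox_eq inner_add_left)

lemma countable_lattice_cubes: "countable (range (lattice_cube s :: 'a::euclidean_space \<Rightarrow> 'a set))"
proof -
  let ?F = "PiE (Basis::'a set) (\<lambda>_. UNIV :: int set)"
  let ?q = "\<lambda>k. (\<Sum>i\<in>(Basis::'a set). (s * of_int (k i)) *\<^sub>R i)"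
  have F: "countable ?F" by (rule countable_PiE) auto
  have "lattice_cube s x \<in> (\<lambda>k. cbox (?q k) (?q k + s *\<^sub>R One)) ` ?F" for x :: 'a
  proof
    show "lattice_cube s x = cbox (?q (restrict (\<lambda>i. \<lfloor>x \<bullet> i / s\<rfloor>) Basis)) (?q (restrict (\<lambda>i. \<lfloor>x \<bullet> i / s\<rfloor>) Basis) + s *\<^sub>R One)"
      by (simp add: lattice_cube_def lattice_corner_def)
  qed auto
  then have "range (lattice_cube s) \<subseteq> (\<lambda>k. cbox (?q k) (?q k + s *\<^sub>R One)) ` ?F"
    by (rule image_subsetI)
  then show ?thesis by (rule countable_subset[OF _ countable_image[OF F]])
qed

lemma measurable_lattice_cube [measurable]:
  "(\<lambda>p. indicator (lattice_cube s (fst p)) (snd p) :: real) \<in> borel_measurable (borel \<Otimes>\<^sub>M (borel :: 'a::euclidean_space measure))"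
proof -
  have "{p \<in> space (borel \<Otimes>\<^sub>M borel). snd p \<in> lattice_cube s (fst p :: 'a)} \<in> sets (borel \<Otimes>\<^sub>M borel)"
    unfolding mem_lattice_cube by measurable
  then have "(\<lambda>p. indicator {p. snd p \<in> lattice_cube s (fst p :: 'a)} p :: real) \<in> borel_measurable (borel \<Otimes>\<^sub>M borel)"
    by (intro borel_measurable_indicator) (simp add: space_pair_measure)
  then show ?thesis by (simp add: indicator_def)
qed

lemma cube_average_measurable:
  assumes [measurable]: "f \<in> borel_measurable borel"
  shows "cube_average s f \<in> borel_measurable (borel :: 'a::euclidean_space measure)"
proof -
  have "(\<lambda>p. indicator (lattice_cube s (fst p)) (snd p) * f (snd p)) \<in> borel_measurable (borel \<Otimes>\<^sub>M (lborel :: 'a measure))"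
    by measurable
  then have "(\<lambda>x. LINT y|lborel. indicator (lattice_cube s x) y * f y) \<in> borel_measurable (borel :: 'a measure)"
    by (intro lborel.borel_measurable_lebesgue_integral) (simp add: case_prod_beta)
  then show ?thesis unfolding cube_average_def[abs_def] by measurable
qed

text \<open>The error is the mean of \<open>\<phi> x - \<phi> y\<close> over the cube, and
  Cauchy-Schwarz squares it. Writing y = x + h and enlarging the range of \<open>h\<close> to a
  fixed box removes the dependence of the domain of integration on \<open>x\<close>, so that
  Tonelli's theorem can be applied next.\<close>

lemma cube_average_error_pointwise:
  fixes \<phi> :: "'a::euclidean_space \<Rightarrow> real"
  assumes [measurable]: "\<phi> \<in> borel_measurable borel" and int: "integrable lborel \<phi>" and s: "s > 0"
  shows "ennreal ((\<phi> x - cube_average s \<phi> x)\<^sup>2) \<le> ennreal (1 / s ^ DIM('a)) *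
    (\<integral>\<^sup>+h. indicator (cbox (- s *\<^sub>R One) (s *\<^sub>R One)) h * ennreal ((\<phi> (x + h) - \<phi> x)\<^sup>2) \<partial>lborel)"
proof -
  let ?Q = "lattice_cube s x" and ?D = "s ^ DIM('a)"
  have D: "?D > 0" using s by simp
  have Q[measurable]: "?Q \<in> sets borel" by (simp add: lattice_cube_def)
  have iQ: "integrable lborel (\<lambda>y. indicator ?Q y * \<phi> y)"
    using integrable_mult_indicator[OF _ int, of ?Q] by simp
  have iQ1: "integrable lborel (\<lambda>y. indicator ?Q y * \<phi> x)"
    using emeasure_lattice_cube[OF s, of x] by (intro integrable_mult_left integrable_real_indicator) auto
  have mQ: "(LINT y|lborel. indicator ?Q y * \<phi> x) = ?D * \<phi> x"
    using emeasure_lattice_cube[OF s, of x] D by (simp add: measure_def)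
  have "\<phi> x - cube_average s \<phi> x = (LINT y|lborel. indicator ?Q y * (\<phi> x - \<phi> y)) / ?D"
  proof -
    have "(LINT y|lborel. indicator ?Q y * (\<phi> x - \<phi> y)) = ?D * \<phi> x - (LINT y|lborel. indicator ?Q y * \<phi> y)"
      unfolding right_diff_distrib mQ[symmetric] by (rule Bochner_Integration.integral_diff[OF iQ1 iQ])
    then show ?thesis using s by (simp add: cube_average_def diff_divide_distrib)
  qed
  then have eq: "?D * \<bar>\<phi> x - cube_average s \<phi> x\<bar> = norm (LINT y|lborel. indicator ?Q y * (\<phi> x - \<phi> y))"
    using s by simp
  have "ennreal (?D * \<bar>\<phi> x - cube_average s \<phi> x\<bar>) \<le> (\<integral>\<^sup>+y. ennreal (norm (indicator ?Q y * (\<phi> x - \<phi> y))) \<partial>lborel)"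
    unfolding eq using iQ iQ1 by (intro integral_norm_bound_ennreal) (simp add: right_diff_distrib)
  also have "\<dots> = (\<integral>\<^sup>+y. (ennreal \<bar>\<phi> x - \<phi> y\<bar> * indicator ?Q y) * indicator ?Q y \<partial>lborel)"
    by (intro nn_integral_cong) (auto simp: indicator_def)
  finally have "(ennreal (?D * \<bar>\<phi> x - cube_average s \<phi> x\<bar>))\<^sup>2 \<le> (\<integral>\<^sup>+y. (ennreal \<bar>\<phi> x - \<phi> y\<bar> * indicator ?Q y) * indicator ?Q y \<partial>lborel)\<^sup>2"
    by (rule power_mono) simp
  also have "\<dots> \<le> (\<integral>\<^sup>+y. (ennreal \<bar>\<phi> x - \<phi> y\<bar> * indicator ?Q y)\<^sup>2 \<partial>lborel) * (\<integral>\<^sup>+y. (indicator ?Q y)\<^sup>2 \<partial>lborel)"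
    by (rule Cauchy_Schwarz_nn_integral) measurable
  also have "(\<integral>\<^sup>+y. (indicator ?Q y)\<^sup>2 \<partial>lborel) = ennreal ?D"
  proof -
    have "(\<integral>\<^sup>+y. (indicator ?Q y)\<^sup>2 \<partial>lborel) = (\<integral>\<^sup>+y. indicator ?Q y \<partial>lborel)"
      by (intro nn_integral_cong) (simp add: indicator_def)
    then show ?thesis using emeasure_lattice_cube[OF s, of x] by simp
  qed
  also have "(\<integral>\<^sup>+y. (ennreal \<bar>\<phi> x - \<phi> y\<bar> * indicator ?Q y)\<^sup>2 \<partial>lborel)
      = (\<integral>\<^sup>+h. (ennreal \<bar>\<phi> x - \<phi> (h + x)\<bar> * indicator ?Q (h + x))\<^sup>2 \<partial>lborel)"
    by (rule nn_integral_lborel_translation[symmetric]) measurable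
  also have "\<dots> \<le> (\<integral>\<^sup>+h. indicator (cbox (- s *\<^sub>R One) (s *\<^sub>R One)) h * ennreal ((\<phi> (x + h) - \<phi> x)\<^sup>2) \<partial>lborel)" (is "_ \<le> ?I")
  proof (rule nn_integral_mono)
    fix h
    have "h \<in> cbox (- s *\<^sub>R One) (s *\<^sub>R One)" if "h + x \<in> ?Q"
      using lattice_cube_diff[OF s that] by (auto simp: mem_box abs_le_iff minus_le_iff)
    moreover have "(ennreal \<bar>\<phi> x - \<phi> (h + x)\<bar>)\<^sup>2 = ennreal ((\<phi> (x + h) - \<phi> x)\<^sup>2)"
      by (simp add: ennreal_power add.commute power2_commute)
    ultimately show "(ennreal \<bar>\<phi> x - \<phi> (h + x)\<bar> * indicator ?Q (h + x))\<^sup>2 \<le>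
       indicator (cbox (- s *\<^sub>R One) (s *\<^sub>R One)) h * ennreal ((\<phi> (x + h) - \<phi> x)\<^sup>2)"
      by (auto simp: indicator_def)
  qed
  finally have main: "(ennreal (?D * \<bar>\<phi> x - cube_average s \<phi> x\<bar>))\<^sup>2 \<le> ?I * ennreal ?D"
    by (simp add: mult_right_mono)
  have "ennreal ((\<phi> x - cube_average s \<phi> x)\<^sup>2) = ennreal (1 / ?D ^ 2) * (ennreal (?D * \<bar>\<phi> x - cube_average s \<phi> x\<bar>))\<^sup>2"
    using s by (simp add: ennreal_power ennreal_mult[symmetric] power_mult_distrib)
  also have "\<dots> \<le> ennreal (1 / ?D ^ 2) * (?I * ennreal ?D)"
    using main by (rule mult_left_mono) simp
  also have "\<dots> = (ennreal (1 / ?D ^ 2) * ennreal ?D) * ?I" by (simp only: mult_ac)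
  also have "ennreal (1 / ?D ^ 2) * ennreal ?D = ennreal (1 / ?D)"
    using D by (subst ennreal_mult[symmetric]) (auto simp: power2_eq_square)
  finally show ?thesis .
qed

text \<open>After Tonelli each \<open>h\<close> contributes a translation estimate. The box of side
  2s against the factor \<open>1 / s ^ DIM('a)\<close> leaves \<open>2 ^ DIM('a)\<close>, and
  \<open>s * DIM('a)\<close> bounds \<open>norm h\<close> through the sum of its
  coordinates.\<close>

lemma cube_average_error:
  fixes \<phi> :: "'a::euclidean_space \<Rightarrow> real"
  assumes phi: "smooth \<phi>" and int: "integrable lborel \<phi>" and s: "s > 0"
  shows "(\<integral>\<^sup>+x. ennreal ((\<phi> x - cube_average s \<phi> x)\<^sup>2) \<partial>lborel) \<le>
    ennreal (2 ^ DIM('a) * (s * DIM('a))\<^sup>2) * (\<integral>\<^sup>+x. ennreal ((norm (grad \<phi> x))\<^sup>2) \<partial>lborel)"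
proof -
  let ?B = "cbox (- s *\<^sub>R One) (s *\<^sub>R One) :: 'a set" and ?D = "s ^ DIM('a)"
  let ?G = "\<integral>\<^sup>+x. ennreal ((norm (grad \<phi> x))\<^sup>2) \<partial>lborel"
  have D: "?D > 0" using s by simp
  have m[measurable]: "\<phi> \<in> borel_measurable borel" by (rule smooth_borel_measurable[OF phi])
  have "(\<integral>\<^sup>+x. ennreal ((\<phi> x - cube_average s \<phi> x)\<^sup>2) \<partial>lborel) \<le>
     (\<integral>\<^sup>+x. ennreal (1 / ?D) * (\<integral>\<^sup>+h. indicator ?B h * ennreal ((\<phi> (x + h) - \<phi> x)\<^sup>2) \<partial>lborel) \<partial>lborel)"
    by (intro nn_integral_mono cube_average_error_pointwise m int s)
  also have "\<dots> = ennreal (1 / ?D) * (\<integral>\<^sup>+x. (\<integral>\<^sup>+h. indicator ?B h * ennreal ((\<phi> (x + h) - \<phi> x)\<^sup>2) \<partial>lborel) \<partial>lborel)"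
    by (rule nn_integral_cmult) measurable
  also have "(\<integral>\<^sup>+x. (\<integral>\<^sup>+h. indicator ?B h * ennreal ((\<phi> (x + h) - \<phi> x)\<^sup>2) \<partial>lborel) \<partial>lborel)
     = (\<integral>\<^sup>+h. (\<integral>\<^sup>+x. indicator ?B h * ennreal ((\<phi> (x + h) - \<phi> x)\<^sup>2) \<partial>lborel) \<partial>lborel)"
    by (rule lborel_pair.Fubini') measurable
  also have "\<dots> \<le> (\<integral>\<^sup>+h. indicator ?B h * (ennreal ((s * DIM('a))\<^sup>2) * ?G) \<partial>lborel)"
  proof (rule nn_integral_mono)
    fix h :: 'a
    have "(\<integral>\<^sup>+x. ennreal ((\<phi> (x + h) - \<phi> x)\<^sup>2) \<partial>lborel) \<le> ennreal ((s * DIM('a))\<^sup>2) * ?G" if h: "h \<in> ?B"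
    proof -
      have "norm h \<le> (\<Sum>i\<in>Basis. \<bar>h \<bullet> i\<bar>)" by (rule norm_le_l1)
      also have "\<dots> \<le> (\<Sum>i\<in>(Basis::'a set). s)"
        using h by (intro sum_mono) (auto simp: mem_box abs_le_iff minus_le_iff)
      finally have "norm h \<le> s * DIM('a)" by (simp add: mult.commute)
      then have "(norm h)\<^sup>2 \<le> (s * DIM('a))\<^sup>2" by (intro power_mono) auto
      then have "ennreal ((norm h)\<^sup>2) * ?G \<le> ennreal ((s * DIM('a))\<^sup>2) * ?G"
        by (intro mult_right_mono ennreal_leI) auto
      with translation_L2_le[OF phi, of h] show ?thesis by (rule order_trans)
    qed
    then show "(\<integral>\<^sup>+x. indicator ?B h * ennreal ((\<phi> (x + h) - \<phi> x)\<^sup>2) \<partial>lborel) \<le> indicator ?B h * (ennreal ((s * DIM('a))\<^sup>2) * ?G)"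
      by (cases "h \<in> ?B") auto
  qed
  also have "\<dots> = emeasure lborel ?B * (ennreal ((s * DIM('a))\<^sup>2) * ?G)"
    by (simp add: nn_integral_multc)
  also have "emeasure lborel ?B = ennreal ((2 * s) ^ DIM('a))"
    using s by (simp add: emeasure_lborel_cbox_eq inner_diff_left inner_add_left power_mult_distrib)
  finally have "(\<integral>\<^sup>+x. ennreal ((\<phi> x - cube_average s \<phi> x)\<^sup>2) \<partial>lborel) \<le>
     ennreal (1 / ?D) * (ennreal ((2 * s) ^ DIM('a)) * (ennreal ((s * DIM('a))\<^sup>2) * ?G))"
    by (simp add: mult_left_mono)
  also have "\<dots> = (ennreal (1 / ?D) * ennreal ((2 * s) ^ DIM('a)) * ennreal ((s * DIM('a))\<^sup>2)) * ?G"
    by (simp only: mult_ac)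
  also have "ennreal (1 / ?D) * ennreal ((2 * s) ^ DIM('a)) * ennreal ((s * DIM('a))\<^sup>2) = ennreal (2 ^ DIM('a) * (s * DIM('a))\<^sup>2)"
    using s by (simp add: ennreal_mult[symmetric] power_mult_distrib)
  finally show ?thesis .
qed

context bounded_open
begin

lemma nn_integral_M_le:
  assumes [measurable]: "f \<in> borel_measurable borel"
  shows "(\<integral>\<^sup>+x. f x \<partial>M) \<le> (\<integral>\<^sup>+x. f x \<partial>lborel)"
proof -
  have "(\<integral>\<^sup>+x. f x \<partial>M) = (\<integral>\<^sup>+x. f x * indicator \<Omega> x \<partial>lebesgue)"
    by (rule nn_integral_restrict_space) simp
  also have "\<dots> \<le> (\<integral>\<^sup>+x. f x \<partial>lebesgue)" by (intro nn_integral_mono) (simp add: indicator_def)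
  also have "\<dots> = (\<integral>\<^sup>+x. f x \<partial>lborel)" by (rule nn_integral_completion)
  finally show ?thesis .
qed

lemma L2_M_if_nn_integral_lborel:
  fixes f :: "'a \<Rightarrow> real"
  assumes f: "f \<in> borel_measurable borel" and le: "(\<integral>\<^sup>+x. ennreal ((f x)\<^sup>2) \<partial>lborel) \<le> ennreal c" and c: "0 \<le> c"
  shows "f \<in> L2 M" "(l2norm M f)\<^sup>2 \<le> c"
proof -
  have m: "f \<in> borel_measurable M" by (rule borel_measurable_M[OF f])
  have "(\<lambda>x. ennreal ((f x)\<^sup>2)) \<in> borel_measurable borel" using f by measurable
  from nn_integral_M_le[OF this] le have le': "(\<integral>\<^sup>+x. ennreal ((f x)\<^sup>2) \<partial>M) \<le> ennreal c"
    by (rule order_trans)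
  have i: "integrable M (\<lambda>x. (f x)\<^sup>2)"
  proof (rule integrableI_bounded)
    show "(\<lambda>x. (f x)\<^sup>2) \<in> borel_measurable M" using m by measurable
    show "(\<integral>\<^sup>+x. ennreal (norm ((f x)\<^sup>2)) \<partial>M) < \<infinity>" using le_less_trans[OF le' ennreal_less_top] by simp
  qed
  then show "f \<in> L2 M" using m by (simp add: L2_def)
  have "ennreal ((l2norm M f)\<^sup>2) \<le> ennreal c"
    using le' nn_integral_eq_integral[OF i] by (simp add: l2norm_power2)
  with c show "(l2norm M f)\<^sup>2 \<le> c" by (simp add: ennreal_le_iff)
qed

lemma nn_integral_grad_test:
  assumes "test_function \<Omega> \<phi>"
  shows "(\<integral>\<^sup>+x. ennreal ((norm (grad \<phi> x))\<^sup>2) \<partial>lborel) = ennreal ((l2norm M (grad \<phi>))\<^sup>2)"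
proof -
  have g: "(\<lambda>x. ennreal ((norm (grad \<phi> x))\<^sup>2)) \<in> borel_measurable borel"
    using smooth_grad_measurable[OF test_smooth[OF assms]] by measurable
  have "(\<integral>\<^sup>+x. ennreal ((norm (grad \<phi> x))\<^sup>2) \<partial>M) = (\<integral>\<^sup>+x. ennreal ((norm (grad \<phi> x))\<^sup>2) * indicator \<Omega> x \<partial>lebesgue)"
    by (rule nn_integral_restrict_space) simp
  also have "\<dots> = (\<integral>\<^sup>+x. ennreal ((norm (grad \<phi> x))\<^sup>2) \<partial>lebesgue)"
    by (intro nn_integral_cong) (auto simp: indicator_def test_grad_outside[OF assms])
  also have "\<dots> = (\<integral>\<^sup>+x. ennreal ((norm (grad \<phi> x))\<^sup>2) \<partial>lborel)" by (rule nn_integral_completion)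
  finally show ?thesis
    using nn_integral_eq_integral[OF L2_integrable[OF test_grad_L2[OF assms]]] by (simp add: l2norm_power2)
qed

text \<open>The gradient bound makes the distance to the cube averages small uniformly in
  \<open>n\<close>, of the order of the mesh. For a fixed mesh the averages along a subsequence
  converge pointwise and boundedly, hence in L2. Three-term splitting then gives the Cauchy
  property.\<close>

lemma rellich:
  fixes \<phi> :: "nat \<Rightarrow> 'a \<Rightarrow> real"
  assumes test: "\<And>n. test_function \<Omega> (\<phi> n)" and B: "\<And>n. l2norm M (jet (\<phi> n)) \<le> B"
  shows "\<exists>r. strict_mono (r :: nat \<Rightarrow> nat) \<and>
    (\<forall>e>0. \<exists>N. \<forall>m\<ge>N. \<forall>n\<ge>N. l2norm M (\<lambda>x. \<phi> (r m) x - \<phi> (r n) x) < e)"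
proof -
  let ?s = "\<lambda>k. 1 / real (Suc k)"
  define S where "S = (\<Union>k. range (lattice_cube (?s k) :: 'a \<Rightarrow> 'a set))"
  define c where "c = sqrt (measure M (space M))"
  have B0: "0 \<le> B" using order_trans[OF l2norm_nonneg B] .
  have c0: "0 \<le> c" by (simp add: c_def)
  have meas[measurable]: "\<phi> n \<in> borel_measurable borel" for n
    by (rule smooth_borel_measurable[OF test_smooth[OF test]])
  have int: "integrable lborel (\<phi> n)" for n by (rule test_integrable[OF test])
  have pow: "(l2norm M (\<phi> n))\<^sup>2 \<le> B\<^sup>2" "(l2norm M (grad (\<phi> n)))\<^sup>2 \<le> B\<^sup>2" for n
  proof -
    have "(l2norm M (\<phi> n))\<^sup>2 + (l2norm M (grad (\<phi> n)))\<^sup>2 \<le> B\<^sup>2"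
      unfolding l2norm_jet[OF test, symmetric] by (rule power_mono[OF B l2norm_nonneg])
    then show "(l2norm M (\<phi> n))\<^sup>2 \<le> B\<^sup>2" "(l2norm M (grad (\<phi> n)))\<^sup>2 \<le> B\<^sup>2"
      using zero_le_power2[of "l2norm M (\<phi> n)"] zero_le_power2[of "l2norm M (grad (\<phi> n))"] by linarith+
  qed
  have L1: "(LINT y|lborel. \<bar>\<phi> n y\<bar>) \<le> c * B" for n
  proof -
    have "(LINT y|lborel. \<bar>\<phi> n y\<bar>) = (LINT y|M. \<bar>\<phi> n y\<bar>)"
      by (rule lint_M_eq_lborel[symmetric]) (auto simp: test_outside[OF test])
    also have "\<dots> \<le> c * l2norm M (\<phi> n)" using L1_le_L2[OF test_L2[OF test]] by (simp add: c_def)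
    also have "\<dots> \<le> c * B" using power2_le_imp_le[OF pow(1) B0] c0 by (rule mult_left_mono)
    finally show ?thesis .
  qed
  have bd: "norm (LINT y|lborel. indicator Q y * \<phi> n y) \<le> c * B" if [measurable]: "Q \<in> sets borel" for n Q
  proof -
    have "norm (LINT y|lborel. indicator Q y * \<phi> n y) \<le> (LINT y|lborel. \<bar>\<phi> n y\<bar>)"
    proof -
      have i: "integrable lborel (\<lambda>y. indicator Q y * \<phi> n y)"
        using integrable_mult_indicator[OF _ int, of Q n] by simp
      have "norm (LINT y|lborel. indicator Q y * \<phi> n y) \<le> (LINT y|lborel. norm (indicator Q y * \<phi> n y))"
        by (rule integral_norm_bound)
      also have "\<dots> \<le> (LINT y|lborel. \<bar>\<phi> n y\<bar>)"
        by (rule integral_mono[OF integrable_norm[OF i] integrable_abs[OF int]]) (simp add: indicator_def)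
      finally show ?thesis .
    qed
    with L1[of n] show ?thesis by linarith
  qed
  have "countable S" unfolding S_def by (intro countable_UN countable_lattice_cubes) auto
  moreover have "norm (LINT y|lborel. indicator Q y * \<phi> n y) \<le> c * B" if "Q \<in> S" for n Q
    using that by (intro bd) (auto simp: S_def lattice_cube_def)
  \<comment> \<open>The grids of all meshes 1/(k+1) together have countably many cubes, so one
    subsequence serves every mesh.\<close>
  ultimately obtain r :: "nat \<Rightarrow> nat" where r: "strict_mono r"
    and lim: "\<And>Q. Q \<in> S \<Longrightarrow> \<exists>l. (\<lambda>n. LINT y|lborel. indicator Q y * \<phi> (r n) y) \<longlonglongrightarrow> l"
    using function_convergent_subsequence[of S "\<lambda>n Q. LINT y|lborel. indicator Q y * \<phi> n y" "c * B"] by metis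
  define A where "A = (\<lambda>k n. cube_average (?s k) (\<phi> (r n)))"
  define A\<^sub>0 where "A\<^sub>0 = (\<lambda>k x. lim (\<lambda>n. A k n x))"
  have A_meas[measurable]: "A k n \<in> borel_measurable M" for k n
    unfolding A_def by (intro borel_measurable_M cube_average_measurable meas)
  have A_bd: "\<bar>A k n x\<bar> \<le> c * B / ?s k ^ DIM('a)" for k n x
  proof -
    have "\<bar>A k n x\<bar> = norm (LINT y|lborel. indicator (lattice_cube (?s k) x) y * \<phi> (r n) y) / ?s k ^ DIM('a)"
      by (simp add: A_def cube_average_def abs_divide)
    also have "\<dots> \<le> c * B / ?s k ^ DIM('a)"
      by (intro divide_right_mono bd) (auto simp: lattice_cube_def)
    finally show ?thesis .
  qed
  have A_lim: "(\<lambda>n. A k n x) \<longlonglongrightarrow> A\<^sub>0 k x" for k x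
  proof -
    obtain l where "(\<lambda>n. LINT y|lborel. indicator (lattice_cube (?s k) x) y * \<phi> (r n) y) \<longlonglongrightarrow> l"
      using lim[of "lattice_cube (?s k) x"] by (auto simp: S_def)
    then have "(\<lambda>n. A k n x) \<longlonglongrightarrow> l / ?s k ^ DIM('a)"
      unfolding A_def cube_average_def by (intro tendsto_divide tendsto_const) auto
    then show ?thesis unfolding A\<^sub>0_def by (metis limI)
  qed
  have A0_meas[measurable]: "A\<^sub>0 k \<in> borel_measurable M" for k
    by (rule borel_measurable_LIMSEQ_real[of M "A k", OF A_lim A_meas])
  have A0_bd: "\<bar>A\<^sub>0 k x\<bar> \<le> c * B / ?s k ^ DIM('a)" for k x
    by (rule tendsto_upperbound[OF tendsto_rabs[OF A_lim] always_eventually]) (use A_bd in auto)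
  have A_L2: "A k n \<in> L2 M" "A\<^sub>0 k \<in> L2 M" for k n
    using A_bd A0_bd by (auto intro!: L2_bounded[of _ "c * B / ?s k ^ DIM('a)"])
  have A_conv: "(\<lambda>n. l2norm M (\<lambda>x. A k n x - A\<^sub>0 k x)) \<longlonglongrightarrow> 0" for k
  proof -
    have "(\<lambda>n. LINT x|M. (norm (A k n x - A\<^sub>0 k x))\<^sup>2) \<longlonglongrightarrow> (LINT x|M. 0)"
    proof (rule integral_dominated_convergence[where w = "\<lambda>x. (2 * (c * B / ?s k ^ DIM('a)))\<^sup>2"])
      show "AE x in M. (\<lambda>n. (norm (A k n x - A\<^sub>0 k x))\<^sup>2) \<longlonglongrightarrow> 0"
      proof (rule AE_I2)
        fix x
        have "(\<lambda>n. (norm (A k n x - A\<^sub>0 k x))\<^sup>2) \<longlonglongrightarrow> (norm (A\<^sub>0 k x - A\<^sub>0 k x))\<^sup>2"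
          by (intro tendsto_intros A_lim)
        then show "(\<lambda>n. (norm (A k n x - A\<^sub>0 k x))\<^sup>2) \<longlonglongrightarrow> 0" by simp
      qed
      show "AE x in M. norm ((norm (A k n x - A\<^sub>0 k x))\<^sup>2) \<le> (2 * (c * B / ?s k ^ DIM('a)))\<^sup>2" for n
      proof (rule AE_I2)
        fix x
        have "\<bar>A k n x - A\<^sub>0 k x\<bar> \<le> 2 * (c * B / ?s k ^ DIM('a))"
          using A_bd[of k n x] A0_bd[of k x] by linarith
        from power_mono[OF this abs_ge_zero, of 2]
        show "norm ((norm (A k n x - A\<^sub>0 k x))\<^sup>2) \<le> (2 * (c * B / ?s k ^ DIM('a)))\<^sup>2" by simp
      qed
      show "(\<lambda>x. (norm (A k n x - A\<^sub>0 k x))\<^sup>2) \<in> borel_measurable M" for n by measurable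
    qed auto
    from tendsto_real_sqrt[OF this] show ?thesis by (simp add: l2norm_def)
  qed
  have err: "l2norm M (\<lambda>x. \<phi> (r n) x - A k n x) \<le> sqrt (2 ^ DIM('a)) * (?s k * DIM('a)) * B" for k n
  proof -
    have "(\<integral>\<^sup>+x. ennreal ((\<phi> (r n) x - A k n x)\<^sup>2) \<partial>lborel) \<le>
        ennreal (2 ^ DIM('a) * (?s k * DIM('a))\<^sup>2) * ennreal ((l2norm M (grad (\<phi> (r n))))\<^sup>2)"
      unfolding A_def nn_integral_grad_test[OF test, symmetric]
      by (rule cube_average_error[OF test_smooth[OF test] int]) simp
    also have "\<dots> \<le> ennreal (2 ^ DIM('a) * (?s k * DIM('a))\<^sup>2) * ennreal (B\<^sup>2)"
      by (intro mult_left_mono ennreal_leI pow) auto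
    also have "\<dots> = ennreal (2 ^ DIM('a) * (?s k * DIM('a))\<^sup>2 * B\<^sup>2)"
      by (subst ennreal_mult) auto
    finally have le: "(\<integral>\<^sup>+x. ennreal ((\<phi> (r n) x - A k n x)\<^sup>2) \<partial>lborel) \<le> ennreal (2 ^ DIM('a) * (?s k * DIM('a))\<^sup>2 * B\<^sup>2)" .
    have m: "(\<lambda>x. \<phi> (r n) x - A k n x) \<in> borel_measurable borel"
      unfolding A_def by (intro borel_measurable_diff cube_average_measurable meas)
    have "(l2norm M (\<lambda>x. \<phi> (r n) x - A k n x))\<^sup>2 \<le> 2 ^ DIM('a) * (?s k * DIM('a))\<^sup>2 * B\<^sup>2"
      by (rule L2_M_if_nn_integral_lborel(2)[OF m le]) simp
    also have "\<dots> = (sqrt (2 ^ DIM('a)) * (?s k * DIM('a)) * B)\<^sup>2"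
      by (simp only: power_mult_distrib real_sqrt_pow2_iff) simp
    finally show ?thesis by (rule power2_le_imp_le) (use B0 in auto)
  qed
  show ?thesis
  proof (intro exI[of _ r] conjI r allI impI)
    fix e :: real assume e: "e > 0"
    define C where "C = sqrt (2 ^ DIM('a)) * DIM('a) * B"
    have C0: "0 \<le> C" using B0 by (simp add: C_def)
    have "0 < e / (4 * (C + 1))" using e C0 by simp
    from reals_Archimedean[OF this] obtain k where k: "inverse (real (Suc k)) < e / (4 * (C + 1))" by blast
    have small: "sqrt (2 ^ DIM('a)) * (?s k * DIM('a)) * B < e / 4"
    proof -
      have "sqrt (2 ^ DIM('a)) * (?s k * DIM('a)) * B = C * inverse (real (Suc k))"
        by (simp add: C_def field_simps)
      also have "\<dots> \<le> C * (e / (4 * (C + 1)))" using k C0 by (intro mult_left_mono) auto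
      also have "\<dots> < e / 4" using C0 e by (simp add: field_simps)
      finally show ?thesis .
    qed
    have "eventually (\<lambda>n. l2norm M (\<lambda>x. A k n x - A\<^sub>0 k x) < e / 4) sequentially"
      using order_tendstoD(2)[OF A_conv, of "e / 4" k] e by simp
    then obtain N where N: "\<And>n. n \<ge> N \<Longrightarrow> l2norm M (\<lambda>x. A k n x - A\<^sub>0 k x) < e / 4"
      by (auto simp: eventually_sequentially)
    have half: "l2norm M (\<lambda>x. \<phi> (r n) x - A\<^sub>0 k x) < e / 2" if "n \<ge> N" for n
      using l2norm_triangle3[OF test_L2[OF test[of "r n"]] A_L2(1)[of k n] A_L2(2)[of k]] err[of n k] small N[OF that]
      by linarith
    have "l2norm M (\<lambda>x. \<phi> (r m) x - \<phi> (r n) x) < e" if "m \<ge> N" "n \<ge> N" for m n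
      using l2norm_triangle3[OF test_L2[OF test[of "r m"]] A_L2(2)[of k] test_L2[OF test[of "r n"]]]
        half[OF that(1)] half[OF that(2)] l2norm_minus_commute[of M "A\<^sub>0 k" "\<phi> (r n)"] by linarith
    then show "\<exists>N. \<forall>m\<ge>N. \<forall>n\<ge>N. l2norm M (\<lambda>x. \<phi> (r m) x - \<phi> (r n) x) < e"
      by (intro exI[of _ N] allI impI)
  qed
qed

subsection \<open>Minimising sequences\<close>

text \<open>The growing factor admits quadratic functionals. What matters is that the estimate
  involves no gradient: after Rellich such a functional is nearly constant along the tail of a
  subsequence.\<close>

definition L2_lipschitz :: "(('a \<Rightarrow> real) \<Rightarrow> real) \<Rightarrow> real \<Rightarrow> bool" where
  "L2_lipschitz P K \<longleftrightarrow> 0 \<le> K \<and> (\<forall>f\<in>L2 M. \<forall>g\<in>L2 M. \<bar>P f - P g\<bar> \<le> K * (1 + l2norm M f + l2norm M g) * l2norm M (\<lambda>x. f x - g x))"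

lemma L2_lipschitzD:
  "L2_lipschitz P K \<Longrightarrow> f \<in> L2 M \<Longrightarrow> g \<in> L2 M \<Longrightarrow> \<bar>P f - P g\<bar> \<le> K * (1 + l2norm M f + l2norm M g) * l2norm M (\<lambda>x. f x - g x)"
  by (simp add: L2_lipschitz_def)

definition energy :: "(('a \<Rightarrow> real) \<Rightarrow> real) \<Rightarrow> ('a \<Rightarrow> real \<times> 'a) \<Rightarrow> real" where
  "energy P U = (l2norm M (\<lambda>x. snd (U x)))\<^sup>2 / 2 + P (\<lambda>x. fst (U x))"

lemma energy_jet: "energy P (jet \<phi>) = (l2norm M (grad \<phi>))\<^sup>2 / 2 + P \<phi>"
  by (simp add: energy_def jet_def)

lemma energy_tendsto:
  assumes P: "L2_lipschitz P K" and F: "\<And>n. F n \<in> L2 M" and U: "U \<in> L2 M"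
    and lim: "(\<lambda>n. l2norm M (\<lambda>x. F n x - U x)) \<longlonglongrightarrow> 0"
  shows "(\<lambda>n. energy P (F n)) \<longlonglongrightarrow> energy P U"
proof -
  note L = L2_fst[OF F] L2_snd[OF F] L2_fst[OF U] L2_snd[OF U]
  have nonneg: "0 \<le> K" using P by (simp add: L2_lipschitz_def)
  have fst0: "(\<lambda>n. l2norm M (\<lambda>x. fst (F n x) - fst (U x))) \<longlonglongrightarrow> 0"
    using l2norm_fst[OF L2_diff[OF F U]]
    by (intro Lim_null_comparison[OF always_eventually lim] allI) simp
  have snd0: "(\<lambda>n. l2norm M (\<lambda>x. snd (F n x) - snd (U x))) \<longlonglongrightarrow> 0"
    using l2norm_snd[OF L2_diff[OF F U]]
    by (intro Lim_null_comparison[OF always_eventually lim] allI) simp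
  have "(\<lambda>n. K * (1 + l2norm M (\<lambda>x. fst (F n x)) + l2norm M (\<lambda>x. fst (U x))) * l2norm M (\<lambda>x. fst (F n x) - fst (U x)))
     \<longlonglongrightarrow> K * (1 + l2norm M (\<lambda>x. fst (U x)) + l2norm M (\<lambda>x. fst (U x))) * 0"
    by (intro tendsto_intros l2norm_tendsto L fst0)
  then have null: "(\<lambda>n. K * (1 + l2norm M (\<lambda>x. fst (F n x)) + l2norm M (\<lambda>x. fst (U x))) * l2norm M (\<lambda>x. fst (F n x) - fst (U x))) \<longlonglongrightarrow> 0"
    unfolding mult_zero_right .
  have bound: "norm (P (\<lambda>x. fst (F n x)) - P (\<lambda>x. fst (U x))) \<le>
      K * (1 + l2norm M (\<lambda>x. fst (F n x)) + l2norm M (\<lambda>x. fst (U x))) * l2norm M (\<lambda>x. fst (F n x) - fst (U x))" for n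
    unfolding real_norm_def by (rule L2_lipschitzD[OF P L(1,3)])
  have "(\<lambda>n. P (\<lambda>x. fst (F n x)) - P (\<lambda>x. fst (U x))) \<longlonglongrightarrow> 0"
    by (rule Lim_null_comparison[OF always_eventually null]) (rule allI, rule bound)
  then have "(\<lambda>n. P (\<lambda>x. fst (F n x))) \<longlonglongrightarrow> P (\<lambda>x. fst (U x))" by (simp add: LIM_zero_iff)
  then show ?thesis unfolding energy_def by (intro tendsto_intros l2norm_tendsto L snd0) auto
qed

lemma jet_add_cmult:
  assumes "test_function \<Omega> \<phi>" "test_function \<Omega> \<psi>"
  shows "jet (\<lambda>x. \<phi> x + t * \<psi> x) x = jet \<phi> x + t *\<^sub>R jet \<psi> x"
  using smooth_differentiable[OF test_smooth[OF assms(1)]] smooth_differentiable[OF test_smooth[OF assms(2)]]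
    smooth_differentiable[OF test_smooth[OF test_cmult[OF assms(2)]]]
  by (simp add: jet_def grad_add grad_cmult)

text \<open>Convexity is required of the gradient term alone. Rellich controls \<open>P\<close>
  along a subsequence, and comparison with midpoints, whose energy is at least \<open>I\<close>,
  then forces the gradients to be Cauchy. Strong convergence of the jets carries both the minimum
  and the comparison with \<open>U + t jet \<psi>\<close> to the limit.\<close>

theorem minimizer_exists:
  fixes \<phi> :: "nat \<Rightarrow> 'a \<Rightarrow> real"
  assumes P: "L2_lipschitz P K"
    and lower: "\<And>\<psi>. test_function \<Omega> \<psi> \<Longrightarrow> I \<le> energy P (jet \<psi>)"
    and test: "\<And>n. test_function \<Omega> (\<phi> n)" and B: "\<And>n. l2norm M (jet (\<phi> n)) \<le> B"
    and lim: "(\<lambda>n. energy P (jet (\<phi> n))) \<longlonglongrightarrow> I"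
  shows "\<exists>U r. U \<in> W \<and> strict_mono (r :: nat \<Rightarrow> nat) \<and> energy P U = I \<and>
    (\<lambda>n. l2norm M (\<lambda>x. jet (\<phi> (r n)) x - U x)) \<longlonglongrightarrow> 0 \<and>
    (\<forall>\<psi> t. test_function \<Omega> \<psi> \<longrightarrow> I \<le> energy P (\<lambda>x. U x + t *\<^sub>R jet \<psi> x))"
proof -
  have B0: "0 \<le> B" using order_trans[OF l2norm_nonneg B] .
  have K0: "0 \<le> K" using P by (simp add: L2_lipschitz_def)
  obtain r :: "nat \<Rightarrow> nat" where rc: "strict_mono r \<and>
    (\<forall>e>0. \<exists>N. \<forall>m\<ge>N. \<forall>n\<ge>N. l2norm M (\<lambda>x. \<phi> (r m) x - \<phi> (r n) x) < e)"
    using rellich[of \<phi> B, OF test B] ..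
  note r = conjunct1[OF rc]
  define f where "f = (\<lambda>n. \<phi> (r n))"
  have tf: "test_function \<Omega> (f n)" for n by (simp add: f_def test)
  have df: "f n differentiable (at x)" for n x by (rule smooth_differentiable[OF test_smooth[OF tf]])
  have fB: "l2norm M (f n) \<le> B" for n
  proof (rule order_trans[OF _ B[of "r n"]], rule power2_le_imp_le)
    show "(l2norm M (f n))\<^sup>2 \<le> (l2norm M (jet (\<phi> (r n))))\<^sup>2"
      unfolding l2norm_jet[OF test] by (simp add: f_def)
  qed simp
  have limf: "(\<lambda>n. energy P (jet (f n))) \<longlonglongrightarrow> I"
    using LIMSEQ_subseq_LIMSEQ[OF lim r] by (simp add: f_def comp_def)
  \<comment> \<open>The midpoint \<theta> is a test function with energy at least \<open>I\<close>,
    so the gradient distance is at most the excess of the two energies over 2 I plus the oscillation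
    of \<open>P\<close> between \<theta> and its endpoints.\<close>
  have parallelogram: "(l2norm M (\<lambda>x. grad (f m) x - grad (f n) x))\<^sup>2 \<le>
     4 * (energy P (jet (f m)) + energy P (jet (f n)) - 2 * I + K * (1 + 2 * B) * l2norm M (\<lambda>x. f m x - f n x))" for m n
  proof -
    define \<theta> where "\<theta> = (\<lambda>x. f m x / 2 + (1 / 2) * f n x)"
    have th: "test_function \<Omega> (\<lambda>x. f m x / 2)" using test_cmult[OF tf, of "1 / 2" m] by simp
    have tchi: "test_function \<Omega> \<theta>" unfolding \<theta>_def by (rule test_add[OF th test_cmult[OF tf]])
    have grad_chi: "grad \<theta> = (\<lambda>x. (1 / 2) *\<^sub>R (grad (f m) x + grad (f n) x))"
    proof
      fix x
      have "\<theta> = (\<lambda>x. (1 / 2) * (f m x + f n x))" by (simp add: \<theta>_def fun_eq_iff)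
      moreover have "grad (\<lambda>x. (1 / 2) * (f m x + f n x)) x = (1 / 2) *\<^sub>R grad (\<lambda>x. f m x + f n x) x"
        by (rule grad_cmult[OF smooth_differentiable[OF test_smooth[OF test_add[OF tf tf]]]])
      moreover have "grad (\<lambda>x. f m x + f n x) x = grad (f m) x + grad (f n) x"
        by (rule grad_add[OF df df])
      ultimately show "grad \<theta> x = (1 / 2) *\<^sub>R (grad (f m) x + grad (f n) x)" by (simp only:)
    qed
    note G = test_grad_L2[OF tf[of m]] test_grad_L2[OF tf[of n]]
    have half: "l2norm M (\<lambda>x. (c / 2) * h x) = l2norm M h / 2" if "\<bar>c\<bar> = 1" for h :: "'a \<Rightarrow> real" and c :: real
      using l2norm_cmult[of M "c / 2" h] that by simp
    have half': "l2norm M (\<lambda>x. h x / 2) = l2norm M h / 2" for h :: "'a \<Rightarrow> real"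
      using half[of 1 h] by simp
    have chiB: "l2norm M \<theta> \<le> B"
      unfolding \<theta>_def
      using l2norm_triangle[OF test_L2[OF th] test_L2[OF test_cmult[OF tf, of "1/2" n]]] half'[of "f m"] half[of 1 "f n"] fB[of m] fB[of n]
      by simp
    have dist: "l2norm M (\<lambda>x. \<theta> x - f m x) = l2norm M (\<lambda>x. f m x - f n x) / 2"
      "l2norm M (\<lambda>x. \<theta> x - f n x) = l2norm M (\<lambda>x. f m x - f n x) / 2"
    proof -
      have "(\<lambda>x. \<theta> x - f m x) = (\<lambda>x. (-1 / 2) * (f m x - f n x))" "(\<lambda>x. \<theta> x - f n x) = (\<lambda>x. (1 / 2) * (f m x - f n x))"
        by (auto simp: \<theta>_def fun_eq_iff field_simps)
      then show "l2norm M (\<lambda>x. \<theta> x - f m x) = l2norm M (\<lambda>x. f m x - f n x) / 2"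
        "l2norm M (\<lambda>x. \<theta> x - f n x) = l2norm M (\<lambda>x. f m x - f n x) / 2"
        using half[of "-1" "\<lambda>x. f m x - f n x"] half[of 1 "\<lambda>x. f m x - f n x"] by simp_all
    qed
    have Pclose: "\<bar>P \<theta> - P (f k)\<bar> \<le> K * (1 + 2 * B) * l2norm M (\<lambda>x. f m x - f n x) / 2"
      if "l2norm M (\<lambda>x. \<theta> x - f k x) = l2norm M (\<lambda>x. f m x - f n x) / 2" for k
    proof -
      have "\<bar>P \<theta> - P (f k)\<bar> \<le> K * (1 + l2norm M \<theta> + l2norm M (f k)) * (l2norm M (\<lambda>x. f m x - f n x) / 2)"
        using L2_lipschitzD[OF P test_L2[OF tchi] test_L2[OF tf[of k]]] that by simp
      also have "\<dots> \<le> K * (1 + 2 * B) * (l2norm M (\<lambda>x. f m x - f n x) / 2)"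
        using chiB fB[of k] K0 by (intro mult_right_mono mult_left_mono) auto
      finally show ?thesis by simp
    qed
    have sum: "(l2norm M (grad \<theta>))\<^sup>2 = ((l2norm M (grad (f m)))\<^sup>2 + 2 * (LINT x|M. grad (f m) x \<bullet> grad (f n) x) + (l2norm M (grad (f n)))\<^sup>2) / 4"
      unfolding grad_chi l2norm_cmult power_mult_distrib l2norm_add_power2[OF G] by (simp add: power2_eq_square)
    have diff: "(l2norm M (\<lambda>x. grad (f m) x - grad (f n) x))\<^sup>2 = (l2norm M (grad (f m)))\<^sup>2 - 2 * (LINT x|M. grad (f m) x \<bullet> grad (f n) x) + (l2norm M (grad (f n)))\<^sup>2"
      using l2norm_add_power2[OF G(1) L2_cmult[OF G(2), of "-1"]] l2norm_cmult[of M "-1" "grad (f n)"] by simp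
    have "I \<le> (l2norm M (grad \<theta>))\<^sup>2 / 2 + P \<theta>" using lower[OF tchi] by (simp add: energy_jet)
    note low = this
    define Q where "Q = K * (1 + 2 * B) * l2norm M (\<lambda>x. f m x - f n x)"
    have Q: "P \<theta> \<le> P (f m) + Q / 2" "P \<theta> \<le> P (f n) + Q / 2"
      using abs_le_D1[OF Pclose[OF dist(1), folded Q_def]] abs_le_D1[OF Pclose[OF dist(2), folded Q_def]]
      by (simp_all only: diff_le_eq add.commute)
    have arith: "D \<le> 4 * (a / 2 + p + (b / 2 + q) - 2 * I + Q)"
      if "I \<le> T / 2 + s" "s \<le> p + Q / 2" "s \<le> q + Q / 2" "T = (a + 2 * c + b) / 4" "D = a - 2 * c + b" for a b c p q s T D :: real
      using that by (simp add: field_simps)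
    show ?thesis unfolding energy_jet Q_def[symmetric] by (rule arith[OF low Q sum diff])
  qed
  have jc: "\<exists>N. \<forall>m\<ge>N. \<forall>n\<ge>N. l2norm M (\<lambda>x. jet (f m) x - jet (f n) x) < e" if e: "e > 0" for e
  proof -
    \<comment> \<open>Each energy exceeds \<open>I\<close> by less than d and the Lipschitz term is
      at most d, so the gradients contribute less than 12 d = 3/8 of the squared tolerance. The
      functions contribute at most 1/16 of it.\<close>
    define d :: real where "d = e\<^sup>2 / 32"
    define d' where "d' = min (e / 4) (d / (K * (1 + 2 * B) + 1))"
    have KB: "0 \<le> K * (1 + 2 * B)" using K0 B0 by simp
    have d: "d > 0" "d' > 0" using e KB by (auto simp: d_def d'_def add_nonneg_pos)
    obtain N1 where N1: "\<forall>m\<ge>N1. \<forall>n\<ge>N1. l2norm M (\<lambda>x. f m x - f n x) < d'"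
      using conjunct2[OF rc, rule_format, OF d(2)] unfolding f_def ..
    have "eventually (\<lambda>n. energy P (jet (f n)) < I + d) sequentially"
      using order_tendstoD(2)[OF limf, of "I + d"] d by simp
    then obtain N2 where N2: "\<And>n. n \<ge> N2 \<Longrightarrow> energy P (jet (f n)) < I + d" by (auto simp: eventually_sequentially)
    have "l2norm M (\<lambda>x. jet (f m) x - jet (f n) x) < e" if "m \<ge> max N1 N2" "n \<ge> max N1 N2" for m n
    proof -
      have a: "l2norm M (\<lambda>x. f m x - f n x) < d'" using N1 that by simp
      have "K * (1 + 2 * B) * l2norm M (\<lambda>x. f m x - f n x) \<le> K * (1 + 2 * B) * (d / (K * (1 + 2 * B) + 1))"
        using a KB by (intro mult_left_mono) (auto simp: d'_def)
      also have "\<dots> \<le> d" using KB d(1) by (simp add: field_simps add_nonneg_pos)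
      finally have "(l2norm M (\<lambda>x. grad (f m) x - grad (f n) x))\<^sup>2 < 4 * (3 * d)"
        using parallelogram[of m n] N2[of m] N2[of n] that by simp
      moreover have "(l2norm M (\<lambda>x. f m x - f n x))\<^sup>2 \<le> (e / 4)\<^sup>2"
        using a by (intro power_mono) (auto simp: d'_def)
      moreover have "(l2norm M (\<lambda>x. jet (f m) x - jet (f n) x))\<^sup>2 = (l2norm M (\<lambda>x. f m x - f n x))\<^sup>2 + (l2norm M (\<lambda>x. grad (f m) x - grad (f n) x))\<^sup>2"
        using l2norm_Pair_power2[OF L2_diff[OF test_L2[OF tf[of m]] test_L2[OF tf[of n]]] L2_diff[OF test_grad_L2[OF tf[of m]] test_grad_L2[OF tf[of n]]]]
        by (simp add: jet_def)
      moreover have "(e / 4)\<^sup>2 = e\<^sup>2 / 16" "e\<^sup>2 > 0" using e by (simp_all add: power_divide)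
      moreover have "J < s" if "A < 4 * (3 * d)" "F \<le> q" "J = F + A" "q = s / 16" "s > 0" "d = s / 32" for A F J q s d :: real
        using that by linarith
      ultimately have "(l2norm M (\<lambda>x. jet (f m) x - jet (f n) x))\<^sup>2 < e\<^sup>2"
        using d_def by blast
      then show ?thesis by (rule power2_less_imp_less) (use e in simp)
    qed
    then have "\<forall>m\<ge>max N1 N2. \<forall>n\<ge>max N1 N2. l2norm M (\<lambda>x. jet (f m) x - jet (f n) x) < e" by blast
    then show ?thesis ..
  qed
  obtain U where U: "U \<in> L2 M" "(\<lambda>n. l2norm M (\<lambda>x. jet (f n) x - U x)) \<longlonglongrightarrow> 0"
    using L2_complete[of "\<lambda>n. jet (f n)", OF jet_L2[OF tf] jc] ..
  show ?thesis
  proof (intro exI[of _ U] exI[of _ r] conjI r allI impI)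
    show "U \<in> W"
      unfolding W_def using U tf l2norm_minus_commute[of M U] by (intro CollectI conjI exI[of _ f]) auto
    show "energy P U = I"
      using LIMSEQ_unique[OF energy_tendsto[OF P jet_L2[OF tf] U] limf] .
    show "(\<lambda>n. l2norm M (\<lambda>x. jet (\<phi> (r n)) x - U x)) \<longlonglongrightarrow> 0" using U(2) by (simp add: f_def)
    fix \<psi> t assume psi: "test_function \<Omega> \<psi>"
    have t: "test_function \<Omega> (\<lambda>x. f n x + t * \<psi> x)" for n by (intro test_add test_cmult tf psi)
    have "(\<lambda>n. energy P (jet (\<lambda>x. f n x + t * \<psi> x))) \<longlonglongrightarrow> energy P (\<lambda>x. U x + t *\<^sub>R jet \<psi> x)"
    proof (rule energy_tendsto[OF P jet_L2[OF t] L2_add[OF U(1) L2_cmult[OF jet_L2[OF psi]]]])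
      show "(\<lambda>n. l2norm M (\<lambda>x. jet (\<lambda>x. f n x + t * \<psi> x) x - (U x + t *\<^sub>R jet \<psi> x))) \<longlonglongrightarrow> 0"
        using U(2) by (simp add: jet_add_cmult[OF tf psi])
    qed
    then show "I \<le> energy P (\<lambda>x. U x + t *\<^sub>R jet \<psi> x)"
      by (rule LIMSEQ_le_const) (use lower[OF t] in blast)
  qed
qed

end

section \<open>The first eigenvalue\<close>

lemma l2norm_mult: "l2norm M (\<lambda>x. c * f x) = \<bar>c\<bar> * l2norm M f" for f :: "'x \<Rightarrow> real"
  using l2norm_cmult[of M c f] by simp

text \<open>The step from minimality to an Euler equation: near t = 0 the linear term dominates, and
  it would change sign with t.\<close>

lemma quadratic_nonneg_imp_linear_zero:
  fixes b c :: real
  assumes "\<And>t. 0 \<le> t * b + t\<^sup>2 * c"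
  shows "b = 0"
proof (rule ccontr)
  assume "b \<noteq> 0"
  define d where "d = \<bar>c\<bar> + 1"
  have d: "d > 0" "c < d" by (auto simp: d_def)
  have "0 \<le> (- b / d) * b + (- b / d)\<^sup>2 * c" by (rule assms)
  also have "\<dots> = (b\<^sup>2 / d) * (c / d - 1)" using d by (simp add: power2_eq_square field_simps)
  also have "\<dots> < 0" using d \<open>b \<noteq> 0\<close> by (intro mult_pos_neg) auto
  finally show False by simp
qed

context bounded_open
begin

lemma W_approx_components:
  assumes U: "U \<in> L2 M" and test: "\<And>n. test_function \<Omega> (\<phi> n)"
    and lim: "(\<lambda>n. l2norm M (\<lambda>x. jet (\<phi> n) x - U x)) \<longlonglongrightarrow> 0"
  shows "(\<lambda>n. l2norm M (\<lambda>x. \<phi> n x - fst (U x))) \<longlonglongrightarrow> 0"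
    and "(\<lambda>n. l2norm M (\<lambda>x. grad (\<phi> n) x - snd (U x))) \<longlonglongrightarrow> 0"
proof -
  note D = L2_diff[OF jet_L2[OF test] U]
  show "(\<lambda>n. l2norm M (\<lambda>x. \<phi> n x - fst (U x))) \<longlonglongrightarrow> 0"
    by (rule Lim_null_comparison[OF always_eventually lim]) (use l2norm_fst[OF D] in \<open>simp add: jet_def\<close>)
  show "(\<lambda>n. l2norm M (\<lambda>x. grad (\<phi> n) x - snd (U x))) \<longlonglongrightarrow> 0"
    by (rule Lim_null_comparison[OF always_eventually lim]) (use l2norm_snd[OF D] in \<open>simp add: jet_def\<close>)
qed

lemma W_approx_jets: 
  assumes "U \<in> W"
  shows "\<exists>\<phi>. (\<forall>n. test_function \<Omega> (\<phi> n)) \<and> (\<lambda>n. l2norm M (\<lambda>x. jet (\<phi> n) x - U x)) \<longlonglongrightarrow> 0"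
  using W_approx[OF assms] by (simp add: l2norm_minus_commute[of M U])

lemma W_laplacian:
  assumes U: "U \<in> W" and psi: "test_function \<Omega> \<psi>"
  shows "(LINT x|M. fst (U x) * laplacian \<psi> x) = - (LINT x|M. snd (U x) \<bullet> grad \<psi> x)"
proof -
  have L: "(\<lambda>x. fst (U x)) \<in> L1loc \<Omega>" "(\<lambda>x. snd (U x) \<bullet> i) \<in> L1loc \<Omega>" for i
    by (rule L2_L1loc[OF L2_fst[OF W_L2[OF U]]], rule L1loc_inner[OF L2_L1loc[OF L2_snd[OF W_L2[OF U]]]])
  have t: "test_function \<Omega> (partial_deriv i \<psi>)" "test_function \<Omega> (partial_deriv i (partial_deriv i \<psi>))"
    if "i \<in> Basis" for i using that by (intro test_partial_deriv psi; simp)+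
  have "(LINT x|M. fst (U x) * laplacian \<psi> x) = (LINT x|M. (\<Sum>i\<in>Basis. fst (U x) * partial_deriv i (partial_deriv i \<psi>) x))"
    by (simp add: laplacian_def sum_distrib_left)
  also have "\<dots> = (\<Sum>i\<in>Basis. LINT x|M. fst (U x) * partial_deriv i (partial_deriv i \<psi>) x)"
    by (rule Bochner_Integration.integral_sum) (rule L1loc_test_integrable[OF L(1) t(2)])
  also have "\<dots> = (\<Sum>i\<in>Basis. - (LINT x|M. (snd (U x) \<bullet> i) * partial_deriv i \<psi> x))"
    by (rule sum.cong[OF refl]) (rule has_weak_gradientD[OF W_weak_gradient[OF U] t(1)])
  also have "\<dots> = - (\<Sum>i\<in>Basis. LINT x|M. (snd (U x) \<bullet> i) * partial_deriv i \<psi> x)"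
    by (rule sum_negf)
  also have "(\<Sum>i\<in>Basis. LINT x|M. (snd (U x) \<bullet> i) * partial_deriv i \<psi> x) = (LINT x|M. (\<Sum>i\<in>Basis. (snd (U x) \<bullet> i) * partial_deriv i \<psi> x))"
    by (rule Bochner_Integration.integral_sum[symmetric]) (rule L1loc_test_integrable[OF L(2) t(1)])
  also have "\<dots> = (LINT x|M. snd (U x) \<bullet> grad \<psi> x)"
    by (simp add: grad_def inner_sum_right mult.commute)
  finally show ?thesis .
qed

lemma weak_laplacianI:
  assumes U: "U \<in> W" and F: "F \<in> L2 M"
    and eq: "\<And>\<psi>. test_function \<Omega> \<psi> \<Longrightarrow> (LINT x|M. snd (U x) \<bullet> grad \<psi> x) = (LINT x|M. F x * \<psi> x)"
  shows "has_weak_laplacian \<Omega> (\<lambda>x. fst (U x)) (\<lambda>x. - F x)"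
  unfolding has_weak_laplacian_def
proof (intro conjI allI impI)
  show "(\<lambda>x. fst (U x)) \<in> L1loc \<Omega>" by (intro L2_L1loc L2_fst W_L2 U)
  show "(\<lambda>x. - F x) \<in> L1loc \<Omega>" by (intro L1loc_uminus L2_L1loc F)
  fix \<psi> assume "test_function \<Omega> \<psi>"
  then show "(LINT x|M. fst (U x) * laplacian \<psi> x) = (LINT x|M. - F x * \<psi> x)"
    by (simp add: W_laplacian[OF U] eq)
qed

lemma l2norm_snd_add_jet:
  assumes U: "U \<in> L2 M" and psi: "test_function \<Omega> \<psi>"
  shows "(l2norm M (\<lambda>x. snd (U x + t *\<^sub>R jet \<psi> x)))\<^sup>2 = (l2norm M (\<lambda>x. snd (U x)))\<^sup>2
     + 2 * t * (LINT x|M. snd (U x) \<bullet> grad \<psi> x) + t\<^sup>2 * (l2norm M (grad \<psi>))\<^sup>2"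
proof -
  have "(l2norm M (\<lambda>x. snd (U x) + t *\<^sub>R grad \<psi> x))\<^sup>2 = (l2norm M (\<lambda>x. snd (U x)))\<^sup>2
     + 2 * (LINT x|M. snd (U x) \<bullet> (t *\<^sub>R grad \<psi> x)) + (l2norm M (\<lambda>x. t *\<^sub>R grad \<psi> x))\<^sup>2"
    by (rule l2norm_add_power2[OF L2_snd[OF U] L2_cmult[OF test_grad_L2[OF psi]]])
  then show ?thesis by (simp add: jet_def l2norm_cmult power_mult_distrib)
qed

lemma l2norm_fst_add_jet:
  assumes U: "U \<in> L2 M" and psi: "test_function \<Omega> \<psi>"
  shows "(l2norm M (\<lambda>x. fst (U x + t *\<^sub>R jet \<psi> x)))\<^sup>2 = (l2norm M (\<lambda>x. fst (U x)))\<^sup>2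
     + 2 * t * (LINT x|M. fst (U x) * \<psi> x) + t\<^sup>2 * (l2norm M \<psi>)\<^sup>2"
proof -
  have "(l2norm M (\<lambda>x. fst (U x) + t *\<^sub>R \<psi> x))\<^sup>2 = (l2norm M (\<lambda>x. fst (U x)))\<^sup>2
     + 2 * (LINT x|M. fst (U x) \<bullet> (t *\<^sub>R \<psi> x)) + (l2norm M (\<lambda>x. t *\<^sub>R \<psi> x))\<^sup>2"
    by (rule l2norm_add_power2[OF L2_fst[OF U] L2_cmult[OF test_L2[OF psi]]])
  then show ?thesis by (simp add: jet_def l2norm_mult power_mult_distrib mult.left_commute)
qed

lemma L2_lipschitz_square:
  "L2_lipschitz (\<lambda>f. c * (l2norm M f)\<^sup>2) \<bar>c\<bar>"
  unfolding L2_lipschitz_def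
proof (intro conjI ballI)
  fix f g :: "'a \<Rightarrow> real" assume fg: "f \<in> L2 M" "g \<in> L2 M"
  have "\<bar>c * (l2norm M f)\<^sup>2 - c * (l2norm M g)\<^sup>2\<bar> = \<bar>c\<bar> * ((l2norm M f + l2norm M g) * \<bar>l2norm M f - l2norm M g\<bar>)"
  proof -
    have "c * (l2norm M f)\<^sup>2 - c * (l2norm M g)\<^sup>2 = c * ((l2norm M f + l2norm M g) * (l2norm M f - l2norm M g))"
      by (simp add: power2_eq_square algebra_simps)
    then show ?thesis by (simp add: abs_mult)
  qed
  also have "\<dots> \<le> \<bar>c\<bar> * ((1 + l2norm M f + l2norm M g) * l2norm M (\<lambda>x. f x - g x))"
    using l2norm_diff_le[OF fg] by (intro mult_left_mono mult_mono) auto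
  finally show "\<bar>c * (l2norm M f)\<^sup>2 - c * (l2norm M g)\<^sup>2\<bar> \<le> \<bar>c\<bar> * (1 + l2norm M f + l2norm M g) * l2norm M (\<lambda>x. f x - g x)"
    by (simp add: mult.assoc)
qed simp

lemma test_function_nontrivial:
  assumes "\<Omega> \<noteq> {}"
  obtains \<phi> where "test_function \<Omega> \<phi>" "l2norm M \<phi> \<noteq> 0"
proof -
  obtain x where "x \<in> \<Omega>" using assms by blast
  then obtain a b where ab: "cbox a b \<subseteq> \<Omega>" "x \<in> box a b"
    using open_contains_cbox[OF open_domain] by metis
  define \<phi> where "\<phi> = box_bump 1 a b"
  have t: "test_function \<Omega> \<phi>" unfolding \<phi>_def by (rule test_box_bump[OF ab(1)]) simp
  have "l2norm M \<phi> \<noteq> 0"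
  proof
    assume "l2norm M \<phi> = 0"
    then have "AE x in M. (norm (\<phi> x))\<^sup>2 = 0"
      using integral_nonneg_eq_0_iff_AE[OF L2_integrable[OF test_L2[OF t]]] by (simp add: l2norm_def)
    then have "AE x in lebesgue. x \<in> \<Omega> \<longrightarrow> \<phi> x = 0" by (simp add: AE_lebesgue_on_iff)
    then have "AE x in lebesgue. x \<notin> box a b"
    proof eventually_elim
      case (elim x)
      then show ?case using ab(1) box_subset_cbox[of a b] box_bump_pos[of 1 x a b] by (auto simp: \<phi>_def)
    qed
    then have "box a b \<in> null_sets lebesgue"
      by (simp add: completion.AE_iff_null_sets)
    then have "negligible (box a b)" by (simp add: negligible_iff_null_sets)
    then show False using ab(2) unfolding negligible_interval by blast
  qed
  then show ?thesis by (rule that[OF t])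
qed

text \<open>\<open>lambda1\<close> is a \<open>LEAST\<close> over the reals, so it has content only
  once a least eigenvalue is known to exist. The infimum of the Rayleigh quotient is shown to be
  attained, the minimiser is an eigenfunction, and every other eigenvalue is itself a Rayleigh
  quotient.\<close>

theorem lambda1_poincare:
  assumes ne: "\<Omega> \<noteq> {}" and test: "test_function \<Omega> \<phi>"
  shows "lambda1 \<Omega> * (l2norm M \<phi>)\<^sup>2 \<le> (l2norm M (grad \<phi>))\<^sup>2"
proof -
  define R where "R = {(l2norm M (grad \<phi>))\<^sup>2 / (l2norm M \<phi>)\<^sup>2 | \<phi>. test_function \<Omega> \<phi> \<and> l2norm M \<phi> \<noteq> 0}"
  define m where "m = Inf R"
  obtain \<phi>\<^sub>0 where "test_function \<Omega> \<phi>\<^sub>0" "l2norm M \<phi>\<^sub>0 \<noteq> 0"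
    using test_function_nontrivial[OF ne] by blast
  then have R: "R \<noteq> {}" "bdd_below R"
    by (auto simp: R_def intro!: bdd_belowI[of _ 0])
  have m0: "0 \<le> m" unfolding m_def by (rule cInf_greatest[OF R(1)]) (auto simp: R_def)
  have rayleigh: "m * (l2norm M \<phi>)\<^sup>2 \<le> (l2norm M (grad \<phi>))\<^sup>2" if "test_function \<Omega> \<phi>" for \<phi>
  proof (cases "l2norm M \<phi> = 0")
    case False
    then have "m \<le> (l2norm M (grad \<phi>))\<^sup>2 / (l2norm M \<phi>)\<^sup>2"
      unfolding m_def using that by (intro cInf_lower[OF _ R(2)]) (auto simp: R_def)
    with False show ?thesis by (simp add: pos_le_divide_eq)
  qed simp
  \<comment> \<open>With this potential the constrained Rayleigh problem becomes unconstrained: the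
    energy is nonnegative on all test functions and tends to 0 along a normalised minimising
    sequence.\<close>
  define P where "P = (\<lambda>f::'a \<Rightarrow> real. (- m / 2) * (l2norm M f)\<^sup>2)"
  have P: "L2_lipschitz P \<bar>- m / 2\<bar>" unfolding P_def by (rule L2_lipschitz_square)
  have "\<exists>\<phi>. test_function \<Omega> \<phi> \<and> l2norm M \<phi> = 1 \<and> (l2norm M (grad \<phi>))\<^sup>2 < m + 1 / real (Suc n)" for n
  proof -
    have "\<exists>q\<in>R. q < m + 1 / real (Suc n)"
      unfolding m_def by (rule cInf_lessD[OF R(1)]) simp
    then obtain \<phi> where p: "test_function \<Omega> \<phi>" "l2norm M \<phi> \<noteq> 0" "(l2norm M (grad \<phi>))\<^sup>2 / (l2norm M \<phi>)\<^sup>2 < m + 1 / real (Suc n)"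
      by (auto simp: R_def)
    define c where "c = 1 / l2norm M \<phi>"
    have c: "c * l2norm M \<phi> = 1" "\<bar>c\<bar> = c" using p(2) by (auto simp: c_def)
    have "grad (\<lambda>x. c * \<phi> x) = (\<lambda>x. c *\<^sub>R grad \<phi> x)"
      using grad_cmult smooth_differentiable[OF test_smooth[OF p(1)]] by blast
    then have "(l2norm M (grad (\<lambda>x. c * \<phi> x)))\<^sup>2 = (l2norm M (grad \<phi>))\<^sup>2 / (l2norm M \<phi>)\<^sup>2"
      by (simp add: l2norm_cmult c_def power_divide)
    moreover have "l2norm M (\<lambda>x. c * \<phi> x) = 1" using l2norm_cmult[of M c \<phi>] c by simp
    ultimately show ?thesis using test_cmult[OF p(1), of c] p(3) by (intro exI[of _ "\<lambda>x. c * \<phi> x"]) simp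
  qed
  then obtain \<phi> where phi: "\<And>n::nat. test_function \<Omega> (\<phi> n)" "\<And>n. l2norm M (\<phi> n) = 1"
    "\<And>n. (l2norm M (grad (\<phi> n)))\<^sup>2 < m + 1 / real (Suc n)" by metis
  have lower: "0 \<le> energy P (jet \<psi>)" if "test_function \<Omega> \<psi>" for \<psi>
    using rayleigh[OF that] by (simp add: energy_jet P_def)
  have bound: "l2norm M (jet (\<phi> n)) \<le> sqrt (m + 2)" for n
  proof (rule real_le_rsqrt)
    have "1 / real (Suc n) \<le> 1" by simp
    then have "(l2norm M (grad (\<phi> n)))\<^sup>2 \<le> m + 1" using phi(3)[of n] by linarith
    then show "(l2norm M (jet (\<phi> n)))\<^sup>2 \<le> m + 2" by (simp add: l2norm_jet[OF phi(1)] phi(2))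
  qed
  have "norm (energy P (jet (\<phi> n))) \<le> 1 / real (Suc n)" for n
  proof -
    have "energy P (jet (\<phi> n)) = ((l2norm M (grad (\<phi> n)))\<^sup>2 - m) / 2"
      by (simp add: energy_jet P_def phi(2) diff_divide_distrib)
    moreover have "0 \<le> 1 / real (Suc n)" by simp
    ultimately show ?thesis using phi(3)[of n] lower[OF phi(1), of n] by simp
  qed
  then have lim: "(\<lambda>n. energy P (jet (\<phi> n))) \<longlonglongrightarrow> 0"
    by (intro Lim_null_comparison[OF always_eventually LIMSEQ_Suc[OF lim_1_over_n]] allI)
  have "\<exists>U r. U \<in> W \<and> strict_mono (r :: nat \<Rightarrow> nat) \<and> energy P U = 0 \<and>
    (\<lambda>n. l2norm M (\<lambda>x. jet (\<phi> (r n)) x - U x)) \<longlonglongrightarrow> 0 \<and>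
    (\<forall>\<psi> t. test_function \<Omega> \<psi> \<longrightarrow> 0 \<le> energy P (\<lambda>x. U x + t *\<^sub>R jet \<psi> x))"
    by (rule minimizer_exists[OF P lower phi(1) bound lim])
  then obtain U where "\<exists>r. U \<in> W \<and> strict_mono (r :: nat \<Rightarrow> nat) \<and> energy P U = 0 \<and>
    (\<lambda>n. l2norm M (\<lambda>x. jet (\<phi> (r n)) x - U x)) \<longlonglongrightarrow> 0 \<and>
    (\<forall>\<psi> t. test_function \<Omega> \<psi> \<longrightarrow> 0 \<le> energy P (\<lambda>x. U x + t *\<^sub>R jet \<psi> x))" ..
  then obtain r where Ur: "U \<in> W \<and> strict_mono (r :: nat \<Rightarrow> nat) \<and> energy P U = 0 \<and>
    (\<lambda>n. l2norm M (\<lambda>x. jet (\<phi> (r n)) x - U x)) \<longlonglongrightarrow> 0 \<and>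
    (\<forall>\<psi> t. test_function \<Omega> \<psi> \<longrightarrow> 0 \<le> energy P (\<lambda>x. U x + t *\<^sub>R jet \<psi> x))" ..
  have U: "U \<in> W" "energy P U = 0" "(\<lambda>n. l2norm M (\<lambda>x. jet (\<phi> (r n)) x - U x)) \<longlonglongrightarrow> 0"
    using Ur by simp_all
  have UL: "U \<in> L2 M" by (rule W_L2[OF U(1)])
  \<comment> \<open>The normalisation survives convergence in L2, so the limit is a nontrivial
    function.\<close>
  have "(\<lambda>n. l2norm M (\<phi> (r n))) \<longlonglongrightarrow> l2norm M (\<lambda>x. fst (U x))"
    by (rule l2norm_tendsto[OF test_L2[OF phi(1)] L2_fst[OF UL] W_approx_components(1)[OF UL phi(1) U(3)]])
  then have norm1: "l2norm M (\<lambda>x. fst (U x)) = 1"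
    unfolding phi(2) by (rule LIMSEQ_unique[OF _ tendsto_const])
  have EL: "(LINT x|M. snd (U x) \<bullet> grad \<psi> x) = (LINT x|M. m * fst (U x) * \<psi> x)" if psi: "test_function \<Omega> \<psi>" for \<psi>
  proof -
    have "0 \<le> t * ((LINT x|M. snd (U x) \<bullet> grad \<psi> x) - m * (LINT x|M. fst (U x) * \<psi> x)) + t\<^sup>2 * energy P (jet \<psi>)" for t
    proof -
      have "0 \<le> energy P (\<lambda>x. U x + t *\<^sub>R jet \<psi> x)" using Ur psi by blast
      also have "\<dots> = energy P U + (t * ((LINT x|M. snd (U x) \<bullet> grad \<psi> x) - m * (LINT x|M. fst (U x) * \<psi> x)) + t\<^sup>2 * energy P (jet \<psi>))"
        unfolding energy_def P_def l2norm_snd_add_jet[OF UL psi] l2norm_fst_add_jet[OF UL psi]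
        by (simp add: jet_def algebra_simps add_divide_distrib diff_divide_distrib)
      finally show ?thesis using U(2) by simp
    qed
    from quadratic_nonneg_imp_linear_zero[OF this] show ?thesis by (simp add: mult.assoc)
  qed
  have "has_weak_laplacian \<Omega> (\<lambda>x. fst (U x)) (\<lambda>x. - (m * fst (U x)))"
    by (rule weak_laplacianI[OF U(1)]) (use EL L2_cmult[OF L2_fst[OF UL], of m] in auto)
  moreover have "\<not> (AE x in M. fst (U x) = 0)"
  proof
    assume "AE x in M. fst (U x) = 0"
    then have "l2norm M (\<lambda>x. fst (U x)) = l2norm M (\<lambda>x. 0 :: real)"
      by (intro l2norm_cong_AE L2_measurable[OF L2_fst[OF UL]]) auto
    with norm1 show False by (simp add: l2norm_def)
  qed
  ultimately have eig: "dirichlet_eigenvalue \<Omega> m"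
    unfolding dirichlet_eigenvalue_def using W_imp_H10[OF U(1)] by (intro bexI[of _ "\<lambda>x. fst (U x)"]) auto
  \<comment> \<open>The eigenfunction may not be tested with itself directly. Its approximating test
    functions are inserted instead, and the identity between the squared norms, as well as the
    Rayleigh bound, passes to the limit.\<close>
  have least: "m \<le> l" if l: "dirichlet_eigenvalue \<Omega> l" for l
  proof -
    obtain u where u: "u \<in> H10 \<Omega>" "\<not> (AE x in M. u x = 0)" "has_weak_laplacian \<Omega> u (\<lambda>x. - l * u x)"
      using l unfolding dirichlet_eigenvalue_def by blast
    obtain v where v: "(\<lambda>x. (u x, v x)) \<in> W" using H10_imp_W[OF u(1)] by blast
    note L = W_L2[OF v]
    have uL: "u \<in> L2 M" and vL: "v \<in> L2 M" using L2_fst[OF L] L2_snd[OF L] by simp_all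
    have eq: "(LINT x|M. grad \<psi> x \<bullet> v x) = l * (LINT x|M. \<psi> x \<bullet> u x)" if "test_function \<Omega> \<psi>" for \<psi>
    proof -
      have "(LINT x|M. u x * laplacian \<psi> x) = (LINT x|M. - l * u x * \<psi> x)"
        using u(3) that by (simp add: has_weak_laplacian_def)
      moreover have "(LINT x|M. - l * u x * \<psi> x) = - l * (LINT x|M. \<psi> x \<bullet> u x)"
        by (simp only: inner_real_def mult.assoc mult.commute[of "u _"] integral_mult_right_zero)
      moreover have "(LINT x|M. v x \<bullet> grad \<psi> x) = (LINT x|M. grad \<psi> x \<bullet> v x)"
        by (simp only: inner_commute)
      ultimately show ?thesis using W_laplacian[OF v that] by simp
    qed
    obtain \<psi> where psi: "\<And>n. test_function \<Omega> (\<psi> n)" "(\<lambda>n. l2norm M (\<lambda>x. jet (\<psi> n) x - (u x, v x))) \<longlonglongrightarrow> 0"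
      using W_approx_jets[OF v] by auto
    have c1: "(\<lambda>n. l2norm M (\<lambda>x. \<psi> n x - u x)) \<longlonglongrightarrow> 0" and c2: "(\<lambda>n. l2norm M (\<lambda>x. grad (\<psi> n) x - v x)) \<longlonglongrightarrow> 0"
      using W_approx_components[OF L psi] by simp_all
    have "(\<lambda>n. LINT x|M. grad (\<psi> n) x \<bullet> v x) \<longlonglongrightarrow> (LINT x|M. v x \<bullet> v x)"
      by (rule L2_inner_tendsto[OF test_grad_L2[OF psi(1)] vL vL c2])
    moreover have "(\<lambda>n. LINT x|M. grad (\<psi> n) x \<bullet> v x) \<longlonglongrightarrow> l * (LINT x|M. u x \<bullet> u x)"
      unfolding eq[OF psi(1)] by (intro tendsto_mult tendsto_const L2_inner_tendsto[OF test_L2[OF psi(1)] uL uL c1])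
    ultimately have "(LINT x|M. v x \<bullet> v x) = l * (LINT x|M. u x \<bullet> u x)" by (rule LIMSEQ_unique)
    then have vl: "(l2norm M v)\<^sup>2 = l * (l2norm M u)\<^sup>2"
      unfolding l2norm_power2 power2_norm_eq_inner .
    have "m * (l2norm M u)\<^sup>2 \<le> (l2norm M v)\<^sup>2"
    proof (rule LIMSEQ_le)
      show "(\<lambda>n. m * (l2norm M (\<psi> n))\<^sup>2) \<longlonglongrightarrow> m * (l2norm M u)\<^sup>2"
        by (intro tendsto_intros l2norm_tendsto[OF test_L2[OF psi(1)] uL c1])
      show "(\<lambda>n. (l2norm M (grad (\<psi> n)))\<^sup>2) \<longlonglongrightarrow> (l2norm M v)\<^sup>2"
        by (intro tendsto_intros l2norm_tendsto[OF test_grad_L2[OF psi(1)] vL c2])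
    qed (use rayleigh[OF psi(1)] in blast)
    moreover have "0 < (l2norm M u)\<^sup>2"
    proof -
      have "l2norm M u \<noteq> 0"
      proof
        assume "l2norm M u = 0"
        then have "AE x in M. (norm (u x))\<^sup>2 = 0"
          using integral_nonneg_eq_0_iff_AE[OF L2_integrable[OF uL]] by (simp add: l2norm_def)
        with u(2) show False by simp
      qed
      then show ?thesis by simp
    qed
    ultimately show ?thesis unfolding vl by simp
  qed
  have "lambda1 \<Omega> = m" unfolding lambda1_def by (rule Least_equality) (rule eig, rule least)
  with rayleigh[OF test] show ?thesis by simp
qed

end

section \<open>Representation of functionals and one-sided derivatives\<close>

context bounded_open
begin

text \<open>The functional \<open>L\<close> is given on test functions only, so it is represented by
  minimising half the squared norm minus \<open>L\<close>. The parallelogram identity makes a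
  minimising sequence Cauchy, and its L2 limit is the representing function.\<close>

lemma riesz_test_functions:
  fixes L :: "('a \<Rightarrow> real) \<Rightarrow> real"
  assumes lin: "\<And>\<phi> \<psi> t. test_function \<Omega> \<phi> \<Longrightarrow> test_function \<Omega> \<psi> \<Longrightarrow> L (\<lambda>x. \<phi> x + t * \<psi> x) = L \<phi> + t * L \<psi>"
    and bound: "\<And>\<phi>. test_function \<Omega> \<phi> \<Longrightarrow> \<bar>L \<phi>\<bar> \<le> C * l2norm M \<phi>"
  shows "\<exists>w\<in>L2 M. \<forall>\<phi>. test_function \<Omega> \<phi> \<longrightarrow> L \<phi> = (LINT x|M. w x * \<phi> x)"
proof -
  define R where "R = (\<lambda>\<phi>. (l2norm M \<phi>)\<^sup>2 / 2 - L \<phi>)"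
  define I where "I = Inf (R ` {\<phi>. test_function \<Omega> \<phi>})"
  have ne: "R ` {\<phi>. test_function \<Omega> \<phi>} \<noteq> {}" using test_zero by blast
  have lowerC: "- (C\<^sup>2 / 2) \<le> R \<phi>" if "test_function \<Omega> \<phi>" for \<phi>
  proof -
    have "L \<phi> \<le> C * l2norm M \<phi>" using abs_le_D1[OF bound[OF that]] .
    moreover have "0 \<le> (l2norm M \<phi> - C)\<^sup>2" by simp
    ultimately show ?thesis unfolding R_def by (simp add: power2_diff algebra_simps)
  qed
  have bdd: "bdd_below (R ` {\<phi>. test_function \<Omega> \<phi>})"
    by (rule bdd_belowI[of _ "- (C\<^sup>2 / 2)"]) (use lowerC in auto)
  have lower: "I \<le> R \<phi>" if "test_function \<Omega> \<phi>" for \<phi>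
    unfolding I_def using that by (intro cInf_lower bdd) auto
  have "\<exists>\<phi>. test_function \<Omega> \<phi> \<and> R \<phi> < I + 1 / real (Suc n)" for n
  proof -
    have "\<exists>y\<in>R ` {\<phi>. test_function \<Omega> \<phi>}. y < I + 1 / real (Suc n)"
      by (rule cInf_lessD[OF ne]) (simp add: I_def)
    then show ?thesis by auto
  qed
  then obtain \<phi> where phi: "\<And>n::nat. test_function \<Omega> (\<phi> n)" "\<And>n. R (\<phi> n) < I + 1 / real (Suc n)" by metis
  have expand: "R (\<lambda>x. \<phi> x + t * \<psi> x) = R \<phi> + t * ((LINT x|M. \<phi> x * \<psi> x) - L \<psi>) + t\<^sup>2 * ((l2norm M \<psi>)\<^sup>2 / 2)"
    if "test_function \<Omega> \<phi>" "test_function \<Omega> \<psi>" for \<phi> \<psi> t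
  proof -
    have "(l2norm M (\<lambda>x. \<phi> x + t * \<psi> x))\<^sup>2 = (l2norm M \<phi>)\<^sup>2 + 2 * (LINT x|M. \<phi> x \<bullet> (t * \<psi> x)) + (l2norm M (\<lambda>x. t * \<psi> x))\<^sup>2"
      by (rule l2norm_add_power2[OF test_L2[OF that(1)] test_L2[OF test_cmult[OF that(2)]]])
    moreover have "(LINT x|M. \<phi> x \<bullet> (t * \<psi> x)) = t * (LINT x|M. \<phi> x * \<psi> x)"
      by (simp add: mult.left_commute)
    ultimately show ?thesis
      unfolding R_def lin[OF that] by (simp add: l2norm_mult power_mult_distrib algebra_simps add_divide_distrib)
  qed
  \<comment> \<open>Compares with the midpoint: its value is the mean of the two values minus one
    eighth of the squared distance, and must not fall below \<open>I\<close>. This is the origin of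
    the factor 8.\<close>
  have close: "(l2norm M (\<lambda>x. \<phi> m x - \<phi> n x))\<^sup>2 \<le> 8 / real (Suc N)" if mn: "m \<ge> N" "n \<ge> N" for m n N
  proof -
    let ?d = "\<lambda>x. \<phi> m x - \<phi> n x"
    have td: "test_function \<Omega> ?d" by (intro test_diff phi)
    have "(\<lambda>x. \<phi> n x + 1 * ?d x) = \<phi> m" by (simp add: fun_eq_iff)
    then have 1: "R (\<phi> m) = R (\<phi> n) + 1 * ((LINT x|M. \<phi> n x * ?d x) - L ?d) + 1\<^sup>2 * ((l2norm M ?d)\<^sup>2 / 2)"
      using expand[OF phi(1)[of n] td, of 1] by simp
    have 2: "I \<le> R (\<phi> n) + (1/2) * ((LINT x|M. \<phi> n x * ?d x) - L ?d) + (1/2)\<^sup>2 * ((l2norm M ?d)\<^sup>2 / 2)"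
      using lower[OF test_add[OF phi(1)[of n] test_cmult[OF td, of "1/2"]]] unfolding expand[OF phi(1) td] .
    have "R (\<phi> k) < I + 1 / real (Suc N)" if "k \<ge> N" for k
    proof -
      have "1 / real (Suc k) \<le> 1 / real (Suc N)" using that by (intro divide_left_mono) auto
      with phi(2)[of k] show ?thesis by linarith
    qed
    from this[OF mn(1)] this[OF mn(2)]
    have 3: "R (\<phi> m) < I + 1 / real (Suc N)" "R (\<phi> n) < I + 1 / real (Suc N)" .
    have arith: "D \<le> 8 * e" if "Rm = Rn + 1 * B + 1\<^sup>2 * (D / 2)" "I \<le> Rn + (1/2) * B + (1/2)\<^sup>2 * (D / 2)" "Rm < I + e" "Rn < I + e"
      for Rm Rn B D e :: real using that by (simp add: power2_eq_square)
    show ?thesis using arith[OF 1 2 3] by simp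
  qed
  have cauchy: "\<exists>N. \<forall>m\<ge>N. \<forall>n\<ge>N. l2norm M (\<lambda>x. \<phi> m x - \<phi> n x) < e" if e: "e > 0" for e
  proof -
    have "0 < e\<^sup>2 / 8" using e by simp
    from reals_Archimedean[OF this] obtain N where N: "inverse (real (Suc N)) < e\<^sup>2 / 8" ..
    have "l2norm M (\<lambda>x. \<phi> m x - \<phi> n x) < e" if "m \<ge> N" "n \<ge> N" for m n
    proof (rule power2_less_imp_less)
      show "(l2norm M (\<lambda>x. \<phi> m x - \<phi> n x))\<^sup>2 < e\<^sup>2"
        using close[OF that] N by (simp add: inverse_eq_divide)
    qed (use e in simp)
    then have "\<forall>m\<ge>N. \<forall>n\<ge>N. l2norm M (\<lambda>x. \<phi> m x - \<phi> n x) < e" by blast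
    then show ?thesis ..
  qed
  obtain w where w: "w \<in> L2 M" "(\<lambda>n. l2norm M (\<lambda>x. \<phi> n x - w x)) \<longlonglongrightarrow> 0"
    using L2_complete[of \<phi>, OF test_L2[OF phi(1)] cauchy] ..
  have limR: "(\<lambda>n. R (\<phi> n)) \<longlonglongrightarrow> I"
  proof (rule tendsto_sandwich[OF always_eventually always_eventually tendsto_const])
    show "(\<lambda>n. I + 1 / real (Suc n)) \<longlonglongrightarrow> I"
      using tendsto_add[OF tendsto_const[of I] LIMSEQ_Suc[OF lim_1_over_n]] by simp
  qed (use lower[OF phi(1)] phi(2) in \<open>auto intro: less_imp_le\<close>)
  have "L \<psi> = (LINT x|M. w x * \<psi> x)" if psi: "test_function \<Omega> \<psi>" for \<psi>
  proof -
    have "0 \<le> t * ((LINT x|M. w x * \<psi> x) - L \<psi>) + t\<^sup>2 * ((l2norm M \<psi>)\<^sup>2 / 2)" for t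
    proof -
      have "(\<lambda>n. LINT x|M. \<phi> n x \<bullet> \<psi> x) \<longlonglongrightarrow> (LINT x|M. w x \<bullet> \<psi> x)"
        by (rule L2_inner_tendsto[OF test_L2[OF phi(1)] w(1) test_L2[OF psi] w(2)])
      then have "(\<lambda>n. LINT x|M. \<phi> n x * \<psi> x) \<longlonglongrightarrow> (LINT x|M. w x * \<psi> x)" by simp
      then have "(\<lambda>n. R (\<lambda>x. \<phi> n x + t * \<psi> x)) \<longlonglongrightarrow> I + t * ((LINT x|M. w x * \<psi> x) - L \<psi>) + t\<^sup>2 * ((l2norm M \<psi>)\<^sup>2 / 2)"
        unfolding expand[OF phi(1) psi] by (intro tendsto_intros limR)
      then have "I \<le> I + t * ((LINT x|M. w x * \<psi> x) - L \<psi>) + t\<^sup>2 * ((l2norm M \<psi>)\<^sup>2 / 2)"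
        by (rule LIMSEQ_le_const) (use lower[OF test_add[OF phi(1) test_cmult[OF psi]]] in blast)
      then show ?thesis by simp
    qed
    from quadratic_nonneg_imp_linear_zero[OF this] show ?thesis by simp
  qed
  with w(1) show ?thesis by blast
qed

text \<open>The infimum of the difference quotients is taken over rational steps to keep it measurable;
  continuity of \<open>\<Gamma>\<close> extends the resulting bound to all steps.\<close>

lemma one_sided_derivative_le:
  fixes \<Gamma> :: "'a \<Rightarrow> real \<Rightarrow> real" and L :: "('a \<Rightarrow> real) \<Rightarrow> real"
  assumes meas: "(\<lambda>p. \<Gamma> (fst p) (snd p)) \<in> borel_measurable (borel \<Otimes>\<^sub>M borel)"
    and lip: "\<And>x s t. \<bar>\<Gamma> x s - \<Gamma> x t\<bar> \<le> K * \<bar>s - t\<bar>"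
    and u: "u \<in> L2 M" and w: "w \<in> L2 M"
    and variation: "\<And>\<psi> t. test_function \<Omega> \<psi> \<Longrightarrow>
      (LINT x|M. \<Gamma> x (u x + t * \<psi> x) - \<Gamma> x (u x)) \<le> t * (LINT x|M. w x * \<psi> x) + t\<^sup>2 * c \<psi>"
    and eps: "\<epsilon> > 0"
  shows "AE x in M. \<forall>m. (\<forall>h. 0 < h \<longrightarrow> h < \<epsilon> \<longrightarrow> m * h \<le> \<Gamma> x (u x + h) - \<Gamma> x (u x)) \<longrightarrow> m \<le> w x"
proof -
  define S where "S = {h \<in> \<rat>. 0 < h \<and> h < \<epsilon>}"
  define Q where "Q = (\<lambda>x h. (\<Gamma> x (u x + h) - \<Gamma> x (u x)) / h)"
  define q where "q = (\<lambda>x. INF h\<in>S. Q x h)"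
  have S: "countable S" unfolding S_def by (rule countable_subset[OF _ countable_rat]) auto
  have Sne: "S \<noteq> {}" using Rats_dense_in_real[OF eps] by (auto simp: S_def)
  have K: "0 \<le> K" using order_trans[OF abs_ge_zero lip[of undefined 1 0]] by simp
  have Qb: "\<bar>Q x h\<bar> \<le> K" if "h > 0" for x h
    using lip[of x "u x + h" "u x"] that by (simp add: Q_def abs_divide pos_divide_le_eq)
  have bdd: "bdd_below (Q x ` S)" for x
    by (rule bdd_belowI[of _ "- K"]) (use Qb[of _ x] in \<open>force simp: S_def abs_le_iff\<close>)
  have um: "u \<in> borel_measurable M" by (rule L2_measurable[OF u])
  have comp: "(\<lambda>x. \<Gamma> x (f x)) \<in> borel_measurable M" if f: "f \<in> borel_measurable M" for f
  proof -
    have "(\<lambda>x. (x, f x)) \<in> M \<rightarrow>\<^sub>M (borel \<Otimes>\<^sub>M borel)"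
      by (rule measurable_Pair[OF borel_measurable_M f]) simp
    from measurable_compose[OF this meas] show ?thesis by simp
  qed
  have Qm: "(\<lambda>x. Q x h) \<in> borel_measurable M" for h
    unfolding Q_def by (intro borel_measurable_divide borel_measurable_diff comp borel_measurable_add um) auto
  have qm: "q \<in> borel_measurable M" unfolding q_def by (rule borel_measurable_cINF[OF S Qm bdd])
  have qle: "q x \<le> Q x h" if "h \<in> S" for x h unfolding q_def by (rule cINF_lower[OF bdd that])
  have qb: "\<bar>q x\<bar> \<le> K" for x
  proof -
    obtain h where h: "h \<in> S" using Sne by blast
    then have "q x \<le> K" using qle[OF h, of x] abs_le_D1[OF Qb[of h x]] by (simp add: S_def)
    moreover have "- K \<le> q x"
      unfolding q_def by (rule cINF_greatest[OF Sne]) (use Qb[of _ x] in \<open>force simp: S_def abs_le_iff\<close>)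
    ultimately show ?thesis by (simp add: abs_le_iff)
  qed
  have qL: "q \<in> L2 M" by (rule L2_bounded[OF qm, of K]) (use qb in auto)
  have step: "q x * h \<le> \<Gamma> x (u x + h) - \<Gamma> x (u x)" if h: "0 < h" "h < \<epsilon>" for x h
  proof (rule field_le_epsilon)
    fix e :: real assume e: "e > 0"
    define d where "d = min (\<epsilon> - h) (e / (2 * K + 1))"
    have d: "d > 0" using h e K by (auto simp: d_def add_nonneg_pos)
    obtain r where r: "r \<in> \<rat>" "h < r" "r < h + d" using Rats_dense_in_real[of h "h + d"] d by auto
    have rS: "r \<in> S" using r h by (auto simp: S_def d_def)
    have "q x * r \<le> \<Gamma> x (u x + r) - \<Gamma> x (u x)"
      using qle[OF rS, of x] rS by (simp add: Q_def S_def pos_le_divide_eq)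
    moreover have "\<Gamma> x (u x + r) - \<Gamma> x (u x + h) \<le> K * (r - h)"
      using abs_le_D1[OF lip[of x "u x + r" "u x + h"]] r by simp
    moreover have "q x * h - q x * r \<le> K * (r - h)"
    proof -
      have "- q x \<le> K" using abs_le_D2[OF qb[of x]] .
      then have "- q x * (r - h) \<le> K * (r - h)" using r by (intro mult_right_mono) auto
      then show ?thesis by (simp add: algebra_simps)
    qed
    moreover have "2 * (K * (r - h)) \<le> e"
    proof -
      have "(2 * K) * (r - h) \<le> (2 * K + 1) * (e / (2 * K + 1))"
        using r K e by (intro mult_mono) (auto simp: d_def)
      also have "\<dots> = e" using K by simp
      finally show ?thesis by simp
    qed
    ultimately show "q x * h \<le> \<Gamma> x (u x + h) - \<Gamma> x (u x) + e" by linarith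
  qed
  have "AE x in M. 0 \<le> w x - q x"
  proof (rule AE_nonneg_if_test[OF open_domain L2_L1loc[OF L2_diff[OF w qL]]])
    fix \<psi> assume psi: "test_function \<Omega> \<psi>" "\<And>x. 0 \<le> \<psi> x" "\<And>x. \<psi> x \<le> 1"
    note pL = test_L2[OF psi(1)]
    have pm: "\<psi> \<in> borel_measurable M" by (rule L2_measurable[OF pL])
    define A where "A = (LINT x|M. (w x - q x) * \<psi> x)"
    \<comment> \<open>Each increment \<open>t * \<psi> x\<close> is either 0 or an admissible step,
      because \<open>\<psi> x \<le> 1\<close>. Dividing the variation inequality by t leaves an
      error proportional to t, which disappears in the limit.\<close>
    have "- (t * c \<psi>) \<le> A" if t: "0 < t" "t < \<epsilon>" for t
    proof -
      have "t * (LINT x|M. q x * \<psi> x) = (LINT x|M. q x * (t * \<psi> x))"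
        by (simp add: mult.left_commute)
      also have "\<dots> \<le> (LINT x|M. \<Gamma> x (u x + t * \<psi> x) - \<Gamma> x (u x))"
      proof (rule integral_mono)
        show "integrable M (\<lambda>x. q x * (t * \<psi> x))"
          by (intro L2_mult_integrable qL test_L2 test_cmult psi)
        show "integrable M (\<lambda>x. \<Gamma> x (u x + t * \<psi> x) - \<Gamma> x (u x))"
        proof (rule L2_imp_integrable, rule L2_bounded[where B = "K * t"])
          show "(\<lambda>x. \<Gamma> x (u x + t * \<psi> x) - \<Gamma> x (u x)) \<in> borel_measurable M"
            by (intro borel_measurable_diff comp borel_measurable_add borel_measurable_times um pm) auto
          show "AE x in M. norm (\<Gamma> x (u x + t * \<psi> x) - \<Gamma> x (u x)) \<le> K * t"
          proof (rule AE_I2)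
            fix x
            have "norm (\<Gamma> x (u x + t * \<psi> x) - \<Gamma> x (u x)) \<le> K * (t * \<psi> x)"
              using lip[of x "u x + t * \<psi> x" "u x"] t psi(2)[of x] by simp
            also have "\<dots> \<le> K * t" using t psi(3)[of x] K by (intro mult_left_mono) auto
            finally show "norm (\<Gamma> x (u x + t * \<psi> x) - \<Gamma> x (u x)) \<le> K * t" .
          qed
        qed
        show "q x * (t * \<psi> x) \<le> \<Gamma> x (u x + t * \<psi> x) - \<Gamma> x (u x)" for x
        proof (cases "\<psi> x = 0")
          case False
          then have "0 < t * \<psi> x" using t psi(2)[of x] by simp
          moreover have "t * \<psi> x < \<epsilon>" using t psi(3)[of x] mult_left_le[of "\<psi> x" t] by linarith
          ultimately show ?thesis by (rule step)
        qed simp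
      qed
      also have "\<dots> \<le> t * (LINT x|M. w x * \<psi> x) + t\<^sup>2 * c \<psi>" by (rule variation[OF psi(1)])
      finally have "0 \<le> t * ((LINT x|M. w x * \<psi> x) - (LINT x|M. q x * \<psi> x) + t * c \<psi>)"
        by (simp add: power2_eq_square algebra_simps)
      then have "0 \<le> (LINT x|M. w x * \<psi> x) - (LINT x|M. q x * \<psi> x) + t * c \<psi>"
        using t by (simp add: zero_le_mult_iff)
      moreover have "A = (LINT x|M. w x * \<psi> x) - (LINT x|M. q x * \<psi> x)"
        unfolding A_def left_diff_distrib
        by (rule Bochner_Integration.integral_diff[OF L2_mult_integrable[OF w pL] L2_mult_integrable[OF qL pL]])
      ultimately show ?thesis by simp
    qed
    note tA = this
    have "(\<lambda>n. - (\<epsilon> / 2 * (1 / real (Suc n)) * c \<psi>)) \<longlonglongrightarrow> - (\<epsilon> / 2 * 0 * c \<psi>)"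
      by (intro tendsto_intros LIMSEQ_Suc[OF lim_1_over_n])
    then have "- (\<epsilon> / 2 * 0 * c \<psi>) \<le> A"
    proof (rule LIMSEQ_le_const2)
      have "- (\<epsilon> / 2 * (1 / real (Suc n)) * c \<psi>) \<le> A" for n
      proof (rule tA)
        have "\<epsilon> / 2 * (1 / real (Suc n)) \<le> \<epsilon> / 2 * 1" using eps by (intro mult_left_mono) auto
        then show "\<epsilon> / 2 * (1 / real (Suc n)) < \<epsilon>" using eps by linarith
      qed (use eps in simp)
      then show "\<exists>N. \<forall>n\<ge>N. - (\<epsilon> / 2 * (1 / real (Suc n)) * c \<psi>) \<le> A" by blast
    qed
    then show "0 \<le> (LINT x|M. (w x - q x) * \<psi> x)" by (simp add: A_def)
  qed
  then show ?thesis
  proof eventually_elim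
    case (elim x)
    show ?case
    proof (intro allI impI)
      fix m assume m: "\<forall>h. 0 < h \<longrightarrow> h < \<epsilon> \<longrightarrow> m * h \<le> \<Gamma> x (u x + h) - \<Gamma> x (u x)"
      have "m \<le> q x" unfolding q_def
      proof (rule cINF_greatest[OF Sne])
        fix h assume "h \<in> S"
        then show "m \<le> Q x h" using m by (simp add: Q_def S_def pos_le_divide_eq)
      qed
      with elim show "m \<le> w x" by linarith
    qed
  qed
qed

end

section \<open>A bound on subsolutions\<close>

text \<open>After rescaling, the gap \<open>ln 2\<close> becomes \<open>ln 2 / k\<close>, so
  \<open>ln (cosh (k * t)) / k\<close> tends to \<bar>t\<bar> uniformly.\<close>

lemma ln_cosh_bounds: "\<bar>x\<bar> - ln 2 \<le> ln (cosh x)" "ln (cosh x) \<le> \<bar>x\<bar>" for x :: real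
proof -
  have 1: "cosh x = (exp x + exp (- x)) / 2" by (simp add: cosh_def)
  have 2: "exp \<bar>x\<bar> \<le> exp x + exp (- x)" by (simp add: abs_if)
  have 3: "exp x + exp (- x) \<le> 2 * exp \<bar>x\<bar>" using exp_le_cancel_iff[of x "\<bar>x\<bar>"] exp_le_cancel_iff[of "- x" "\<bar>x\<bar>"] by linarith
  have "ln (exp \<bar>x\<bar> / 2) \<le> ln (cosh x)" using 1 2 by (subst ln_le_cancel_iff) auto
  then show "\<bar>x\<bar> - ln 2 \<le> ln (cosh x)" by (simp add: ln_div)
  have "ln (cosh x) \<le> ln (exp \<bar>x\<bar>)" using 1 3 by (subst ln_le_cancel_iff) auto
  then show "ln (cosh x) \<le> \<bar>x\<bar>" by simp
qed

lemma smooth_cmult: "smooth f \<Longrightarrow> smooth (\<lambda>x. c * f x)"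
  using smooth_mult[OF smooth_const[of c]] by blast

lemma smooth_laplacian: "smooth \<eta> \<Longrightarrow> smooth (laplacian \<eta>)"
  unfolding laplacian_def[abs_def] by (intro smooth_sum smooth_partial_deriv) auto

context bounded_open
begin

lemma integral_by_parts_grad:
  assumes f: "test_function \<Omega> f" and g: "smooth g"
  shows "(LINT x|M. grad f x \<bullet> grad g x) = - (LINT x|M. f x * laplacian g x)"
proof -
  have i1: "integrable M (\<lambda>x. f x * partial_deriv i (partial_deriv i g) x)"
    and i2: "integrable M (\<lambda>x. partial_deriv i f x * partial_deriv i g x)" if "i \<in> Basis" for i
    by (rule L2_mult_integrable[OF test_L2[OF f] smooth_L2[OF smooth_partial_deriv[OF smooth_partial_deriv[OF g that] that]]],
      rule L2_mult_integrable[OF test_L2[OF test_partial_deriv[OF f that]] smooth_L2[OF smooth_partial_deriv[OF g that]]])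
  have "grad f x \<bullet> grad g x = (\<Sum>i\<in>Basis. partial_deriv i f x * partial_deriv i g x)" for x
    unfolding euclidean_inner[of "grad f x" "grad g x"] by (rule sum.cong[OF refl]) (simp only: grad_inner_Basis)
  then have "(LINT x|M. grad f x \<bullet> grad g x) = (LINT x|M. (\<Sum>i\<in>Basis. partial_deriv i f x * partial_deriv i g x))"
    by simp
  also have "\<dots> = (\<Sum>i\<in>Basis. LINT x|M. partial_deriv i f x * partial_deriv i g x)"
    by (rule Bochner_Integration.integral_sum[OF i2])
  also have "\<dots> = (\<Sum>i\<in>Basis. - (LINT x|M. f x * partial_deriv i (partial_deriv i g) x))"
    by (rule sum.cong[OF refl]) (simp add: integral_by_parts_M[OF f smooth_partial_deriv[OF g]])
  also have "\<dots> = - (LINT x|M. (\<Sum>i\<in>Basis. f x * partial_deriv i (partial_deriv i g) x))"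
    by (subst Bochner_Integration.integral_sum[OF i1]) (simp_all add: sum_negf)
  finally show ?thesis by (simp add: laplacian_def sum_distrib_left)
qed

text \<open>Testing the equation with \<open>\<eta> tanh (k u)\<close>, a smooth substitute for \<open>\<eta> sgn u\<close>, shows that \<open>\<bar>u\<bar>\<close>
  is a subsolution across the boundary of \<open>\<Omega>\<close>: \<open>\<eta>\<close> need not vanish there.\<close>

lemma kato_inequality:
  assumes U: "U \<in> W" and f: "f \<in> L2 M"
    and eq: "\<And>\<psi>. test_function \<Omega> \<psi> \<Longrightarrow> (LINT x|M. snd (U x) \<bullet> grad \<psi> x) = (LINT x|M. f x * \<psi> x)"
    and eta: "smooth \<eta>" "\<And>x. 0 \<le> \<eta> x"
  shows "- (LINT x|M. \<bar>fst (U x)\<bar> * laplacian \<eta> x) \<le> (LINT x|M. \<bar>f x\<bar> * \<eta> x)"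
proof -
  define u where "u = (\<lambda>x. fst (U x))"
  define v where "v = (\<lambda>x. snd (U x))"
  have uL: "u \<in> L2 M" and vL: "v \<in> L2 M"
    unfolding u_def v_def by (intro L2_fst L2_snd W_L2 U)+
  obtain \<phi> where phi: "\<And>n. test_function \<Omega> (\<phi> n)" "(\<lambda>n. l2norm M (\<lambda>x. jet (\<phi> n) x - U x)) \<longlonglongrightarrow> 0"
    using W_approx_jets[OF U] by auto
  have c1: "(\<lambda>n. l2norm M (\<lambda>x. \<phi> n x - u x)) \<longlonglongrightarrow> 0" and c2: "(\<lambda>n. l2norm M (\<lambda>x. grad (\<phi> n) x - v x)) \<longlonglongrightarrow> 0"
    using W_approx_components[OF W_L2[OF U] phi] by (simp_all add: u_def v_def)
  have lap: "laplacian \<eta> \<in> L2 M" by (rule smooth_L2[OF smooth_laplacian[OF eta(1)]])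
  have etaL: "\<eta> \<in> L2 M" by (rule smooth_L2[OF eta(1)])
  obtain B where B: "B > 0" "\<And>x. x \<in> \<Omega> \<Longrightarrow> norm (\<eta> x) \<le> B"
    using continuous_bounded_on[OF smooth_continuous_on[OF eta(1)] bounded_domain] by blast
  define Z where "Z = (LINT x|M. \<bar>laplacian \<eta> x\<bar>)"
  have uabs: "(\<lambda>x. \<bar>u x\<bar>) \<in> L2 M" using L2_norm[OF uL] by simp
  have fabs: "(\<lambda>x. \<bar>f x\<bar>) \<in> L2 M" using L2_norm[OF f] by simp
  \<comment> \<open>The computation is done with the smooth approximants of u, for which the
    composed function is a genuine test function. The order of limits matters: the norm of its
    gradient is bounded by a multiple of \<open>k\<close>, so first n tends to infinity for fixed
    \<open>k\<close>, and only then \<open>k\<close>.\<close>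
  have key: "- (LINT x|M. \<bar>u x\<bar> * laplacian \<eta> x) \<le> (LINT x|M. \<bar>f x\<bar> * \<eta> x)
      + l2norm M (\<lambda>x. grad (\<phi> n) x - v x) * (l2norm M (grad \<eta>) + (B * k) * l2norm M (grad (\<phi> n)))
      + l2norm M (\<lambda>x. \<phi> n x - u x) * l2norm M (laplacian \<eta>) + (ln 2 / k) * Z" if k: "k > 0" for k n
  proof -
    define T where "T = (\<lambda>x. tanh (k * \<phi> n x))"
    \<comment> \<open>A smooth version of the modulus of \<open>\<phi> n\<close>, normalised so that
      its gradient is exactly \<open>T x *\<^sub>R grad (\<phi> n) x\<close>.\<close>
    define F where "F = (\<lambda>x. 1 / k * ln (cosh (k * \<phi> n x)))"
    define \<psi> where "\<psi> = (\<lambda>x. T x * \<eta> x)"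
    note sp = test_smooth[OF phi(1)[of n]]
    note dp = smooth_differentiable[OF sp]
    have T1: "\<bar>T x\<bar> \<le> 1" for x
      using tanh_real_lt_1[of "k * \<phi> n x"] tanh_real_gt_neg1[of "k * \<phi> n x"] by (simp add: T_def abs_le_iff)
    have sk: "smooth (\<lambda>x. k * \<phi> n x)" by (rule smooth_cmult[OF sp])
    have tT: "test_function \<Omega> T"
      unfolding T_def by (rule test_function_mono_support[OF phi(1)[of n] smooth_tanh[OF sk]]) simp
    have tF: "test_function \<Omega> F"
      unfolding F_def by (rule test_function_mono_support[OF phi(1)[of n] smooth_cmult[OF smooth_ln_cosh[OF sk]]]) simp
    have tpsi: "test_function \<Omega> \<psi>" unfolding \<psi>_def by (rule test_mult[OF tT eta(1)])
    have gF: "grad F x = T x *\<^sub>R grad (\<phi> n) x" for x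
      unfolding F_def T_def
    proof (rule grad_chain[OF dp])
      have "((\<lambda>y. ln (cosh (k * y))) has_real_derivative tanh (k * \<phi> n x) * k) (at (\<phi> n x))"
        by (rule DERIV_chain2[OF has_derivative_ln_cosh]) (auto intro!: derivative_eq_intros)
      from DERIV_cmult[OF this, of "1 / k"]
      show "((\<lambda>y. 1 / k * ln (cosh (k * y))) has_real_derivative tanh (k * \<phi> n x)) (at (\<phi> n x))"
        using k by simp
    qed
    have gT: "grad T x = (k * (1 - (T x)\<^sup>2)) *\<^sub>R grad (\<phi> n) x" for x
      unfolding T_def
      by (rule grad_chain[OF dp]) (auto intro!: derivative_eq_intros)
    have gpsi: "grad \<psi> x = T x *\<^sub>R grad \<eta> x + (\<eta> x * (k * (1 - (T x)\<^sup>2))) *\<^sub>R grad (\<phi> n) x" for x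
      unfolding \<psi>_def grad_mult[OF smooth_differentiable[OF test_smooth[OF tT]] smooth_differentiable[OF eta(1)]] gT
      by simp
    have T2: "0 \<le> 1 - (T x)\<^sup>2" "1 - (T x)\<^sup>2 \<le> 1" for x
      using power_mono[OF T1[of x] abs_ge_zero, of 2] by simp_all
    have G: "l2norm M (grad \<psi>) \<le> l2norm M (grad \<eta>) + (B * k) * l2norm M (grad (\<phi> n))"
    proof -
      let ?h = "\<lambda>x. norm (grad \<eta> x) + (B * k) * norm (grad (\<phi> n) x)"
      have h1: "(\<lambda>x. norm (grad \<eta> x)) \<in> L2 M" by (intro L2_norm smooth_grad_L2 eta)
      have h2: "(\<lambda>x. (B * k) * norm (grad (\<phi> n) x)) \<in> L2 M"
        using L2_cmult[OF L2_norm[OF test_grad_L2[OF phi(1)[of n]]], of "B * k"] by simp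
      have "l2norm M (grad \<psi>) \<le> l2norm M ?h"
      proof (rule L2_dominated(2)[OF L2_measurable[OF test_grad_L2[OF tpsi]] L2_add[OF h1 h2] AE_I2])
        fix x assume "x \<in> space M"
        then have x: "x \<in> \<Omega>" by simp
        have "norm (grad \<psi> x) \<le> norm (T x *\<^sub>R grad \<eta> x) + norm ((\<eta> x * (k * (1 - (T x)\<^sup>2))) *\<^sub>R grad (\<phi> n) x)"
          unfolding gpsi by (rule norm_triangle_ineq)
        also have "\<dots> \<le> norm (grad \<eta> x) + (B * k) * norm (grad (\<phi> n) x)"
        proof (rule add_mono)
          show "norm (T x *\<^sub>R grad \<eta> x) \<le> norm (grad \<eta> x)"
            using mult_right_mono[OF T1[of x] norm_ge_zero[of "grad \<eta> x"]] by simp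
          have "\<eta> x * (k * (1 - (T x)\<^sup>2)) \<le> B * (k * 1)"
            using B(2)[OF x] eta(2)[of x] k T2[of x] B(1) by (intro mult_mono) auto
          moreover have "0 \<le> \<eta> x * (k * (1 - (T x)\<^sup>2))" using eta(2)[of x] k T2(1)[of x] by simp
          ultimately have "\<bar>\<eta> x * (k * (1 - (T x)\<^sup>2))\<bar> \<le> B * k" by simp
          then show "norm ((\<eta> x * (k * (1 - (T x)\<^sup>2))) *\<^sub>R grad (\<phi> n) x) \<le> (B * k) * norm (grad (\<phi> n) x)"
            unfolding norm_scaleR by (rule mult_right_mono) simp
        qed
        also have "\<dots> \<le> norm (?h x)" by simp
        finally show "norm (grad \<psi> x) \<le> norm (?h x)" .
      qed
      also have "\<dots> \<le> l2norm M (\<lambda>x. norm (grad \<eta> x)) + l2norm M (\<lambda>x. (B * k) * norm (grad (\<phi> n) x))"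
        by (rule l2norm_triangle[OF h1 h2])
      also have "\<dots> = l2norm M (grad \<eta>) + (B * k) * l2norm M (grad (\<phi> n))"
        unfolding l2norm_mult l2norm_norm using B(1) k by simp
      finally show ?thesis .
    qed
    have I1: "(LINT x|M. f x * \<psi> x) \<le> (LINT x|M. \<bar>f x\<bar> * \<eta> x)"
    proof (rule integral_mono[OF L2_mult_integrable[OF f test_L2[OF tpsi]] L2_mult_integrable[OF fabs etaL]])
      fix x
      have "f x * T x \<le> \<bar>f x\<bar> * 1"
        using mult_mono[OF order_refl[of "\<bar>f x\<bar>"] T1[of x]] abs_ge_self[of "f x * T x"] by (simp add: abs_mult)
      then show "f x * \<psi> x \<le> \<bar>f x\<bar> * \<eta> x"
        using mult_right_mono[OF _ eta(2)[of x], of "f x * T x" "\<bar>f x\<bar>"] by (simp add: \<psi>_def mult.assoc)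
    qed
    \<comment> \<open>The only place where equality is lost: the term with the derivative of
      \<open>tanh\<close> is a nonnegative multiple of the squared gradient and is dropped.\<close>
    have I2: "(LINT x|M. grad F x \<bullet> grad \<eta> x) \<le> (LINT x|M. grad (\<phi> n) x \<bullet> grad \<psi> x)"
    proof (rule integral_mono)
      show "integrable M (\<lambda>x. grad F x \<bullet> grad \<eta> x)"
        by (intro L2_inner_integrable test_grad_L2 tF smooth_grad_L2 eta)
      show "integrable M (\<lambda>x. grad (\<phi> n) x \<bullet> grad \<psi> x)"
        by (intro L2_inner_integrable test_grad_L2 phi tpsi)
      fix x
      have "0 \<le> (\<eta> x * (k * (1 - (T x)\<^sup>2))) * (grad (\<phi> n) x \<bullet> grad (\<phi> n) x)"
        using eta(2)[of x] k T2(1)[of x] by simp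
      then show "grad F x \<bullet> grad \<eta> x \<le> grad (\<phi> n) x \<bullet> grad \<psi> x"
        unfolding gF gpsi by (simp add: inner_add_right)
    qed
    have I3: "(LINT x|M. v x \<bullet> grad \<psi> x) = (LINT x|M. grad (\<phi> n) x \<bullet> grad \<psi> x) - (LINT x|M. (grad (\<phi> n) x - v x) \<bullet> grad \<psi> x)"
    proof -
      have "(LINT x|M. (grad (\<phi> n) x - v x) \<bullet> grad \<psi> x) = (LINT x|M. grad (\<phi> n) x \<bullet> grad \<psi> x) - (LINT x|M. v x \<bullet> grad \<psi> x)"
        unfolding inner_diff_left
        by (intro Bochner_Integration.integral_diff L2_inner_integrable test_grad_L2 phi tpsi vL)
      then show ?thesis by simp
    qed
    have I4: "(LINT x|M. (grad (\<phi> n) x - v x) \<bullet> grad \<psi> x) \<le>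
       l2norm M (\<lambda>x. grad (\<phi> n) x - v x) * (l2norm M (grad \<eta>) + (B * k) * l2norm M (grad (\<phi> n)))"
    proof -
      have "(LINT x|M. (grad (\<phi> n) x - v x) \<bullet> grad \<psi> x) \<le> l2norm M (\<lambda>x. grad (\<phi> n) x - v x) * l2norm M (grad \<psi>)"
        by (rule abs_le_D1[OF L2_Cauchy_Schwarz[OF L2_diff[OF test_grad_L2[OF phi(1)] vL] test_grad_L2[OF tpsi]]])
      also have "\<dots> \<le> l2norm M (\<lambda>x. grad (\<phi> n) x - v x) * (l2norm M (grad \<eta>) + (B * k) * l2norm M (grad (\<phi> n)))"
        by (rule mult_left_mono[OF G]) simp
      finally show ?thesis .
    qed
    have I5: "- (LINT x|M. \<bar>u x\<bar> * laplacian \<eta> x) \<le> - (LINT x|M. F x * laplacian \<eta> x)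
        + (l2norm M (\<lambda>x. \<phi> n x - u x) * l2norm M (laplacian \<eta>) + (ln 2 / k) * Z)"
    proof -
      have FL: "F \<in> L2 M" by (rule test_L2[OF tF])
      have dL: "(\<lambda>x. \<phi> n x - u x) \<in> L2 M" by (intro L2_diff test_L2 phi uL)
      have iZ: "integrable M (\<lambda>x. (ln 2 / k) * \<bar>laplacian \<eta> x\<bar>)"
        using L2_integrable_norm[OF lap] by simp
      have iD: "integrable M (\<lambda>x. norm (\<phi> n x - u x) * norm (laplacian \<eta> x))"
        by (rule L2_norm_mult_integrable[OF dL lap])
      have "(LINT x|M. F x * laplacian \<eta> x) - (LINT x|M. \<bar>u x\<bar> * laplacian \<eta> x) = (LINT x|M. F x * laplacian \<eta> x - \<bar>u x\<bar> * laplacian \<eta> x)"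
        by (rule Bochner_Integration.integral_diff[symmetric]; intro L2_mult_integrable FL uabs lap)
      also have "\<dots> \<le> (LINT x|M. norm (\<phi> n x - u x) * norm (laplacian \<eta> x) + (ln 2 / k) * \<bar>laplacian \<eta> x\<bar>)"
      proof (rule integral_mono)
        show "integrable M (\<lambda>x. F x * laplacian \<eta> x - \<bar>u x\<bar> * laplacian \<eta> x)"
          by (intro Bochner_Integration.integrable_diff L2_mult_integrable FL uabs lap)
        show "integrable M (\<lambda>x. norm (\<phi> n x - u x) * norm (laplacian \<eta> x) + (ln 2 / k) * \<bar>laplacian \<eta> x\<bar>)"
          by (rule Bochner_Integration.integrable_add[OF iD iZ])
        fix x
        have "\<bar>\<phi> n x\<bar> - ln 2 / k \<le> F x" "F x \<le> \<bar>\<phi> n x\<bar>"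
          using divide_right_mono[OF ln_cosh_bounds(1)[of "k * \<phi> n x"] less_imp_le[OF k]]
            divide_right_mono[OF ln_cosh_bounds(2)[of "k * \<phi> n x"] less_imp_le[OF k]] k
          by (simp_all add: F_def abs_mult diff_divide_distrib)
        then have "\<bar>F x - \<bar>u x\<bar>\<bar> \<le> \<bar>\<phi> n x - u x\<bar> + ln 2 / k" by linarith
        then have "\<bar>F x - \<bar>u x\<bar>\<bar> * \<bar>laplacian \<eta> x\<bar> \<le> (\<bar>\<phi> n x - u x\<bar> + ln 2 / k) * \<bar>laplacian \<eta> x\<bar>"
          by (rule mult_right_mono) simp
        moreover have "(F x - \<bar>u x\<bar>) * laplacian \<eta> x \<le> \<bar>F x - \<bar>u x\<bar>\<bar> * \<bar>laplacian \<eta> x\<bar>"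
          unfolding abs_mult[symmetric] by (rule abs_ge_self)
        ultimately show "F x * laplacian \<eta> x - \<bar>u x\<bar> * laplacian \<eta> x \<le> norm (\<phi> n x - u x) * norm (laplacian \<eta> x) + (ln 2 / k) * \<bar>laplacian \<eta> x\<bar>"
          by (simp add: algebra_simps)
      qed
      also have "\<dots> = (LINT x|M. norm (\<phi> n x - u x) * norm (laplacian \<eta> x)) + (ln 2 / k) * Z"
        unfolding Z_def using iD iZ by simp
      also have "\<dots> \<le> l2norm M (\<lambda>x. \<phi> n x - u x) * l2norm M (laplacian \<eta>) + (ln 2 / k) * Z"
        using L2_Cauchy_Schwarz_norm[OF dL lap] by simp
      finally show ?thesis by linarith
    qed
    have I6: "(LINT x|M. v x \<bullet> grad \<psi> x) = (LINT x|M. f x * \<psi> x)" unfolding v_def by (rule eq[OF tpsi])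
    show ?thesis using I1 I2 I3 I4 I5 I6 integral_by_parts_grad[OF tF eta(1)] by linarith
  qed
  have "- (LINT x|M. \<bar>u x\<bar> * laplacian \<eta> x) \<le> (LINT x|M. \<bar>f x\<bar> * \<eta> x) + (ln 2 / k) * Z" if k: "k > 0" for k
  proof -
    have "(\<lambda>n. (LINT x|M. \<bar>f x\<bar> * \<eta> x)
      + l2norm M (\<lambda>x. grad (\<phi> n) x - v x) * (l2norm M (grad \<eta>) + (B * k) * l2norm M (grad (\<phi> n)))
      + l2norm M (\<lambda>x. \<phi> n x - u x) * l2norm M (laplacian \<eta>) + (ln 2 / k) * Z)
      \<longlonglongrightarrow> (LINT x|M. \<bar>f x\<bar> * \<eta> x) + 0 * (l2norm M (grad \<eta>) + (B * k) * l2norm M v) + 0 * l2norm M (laplacian \<eta>) + (ln 2 / k) * Z"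
      by (intro tendsto_intros c1 c2 l2norm_tendsto[OF test_grad_L2[OF phi(1)] vL])
    from LIMSEQ_le_const[OF this] key[OF k] show ?thesis by simp
  qed
  then have "- (LINT x|M. \<bar>u x\<bar> * laplacian \<eta> x) \<le> (LINT x|M. \<bar>f x\<bar> * \<eta> x) + (ln 2 * (1 / real (Suc n))) * Z" for n
    using of_nat_0_less_iff[of "Suc n"] by (metis times_divide_eq_right mult.right_neutral zero_less_Suc)
  moreover have "(\<lambda>n. (LINT x|M. \<bar>f x\<bar> * \<eta> x) + (ln 2 * (1 / real (Suc n))) * Z) \<longlonglongrightarrow> (LINT x|M. \<bar>f x\<bar> * \<eta> x) + (ln 2 * 0) * Z"
    by (intro tendsto_intros LIMSEQ_Suc[OF lim_1_over_n])
  ultimately have "- (LINT x|M. \<bar>u x\<bar> * laplacian \<eta> x) \<le> (LINT x|M. \<bar>f x\<bar> * \<eta> x) + (ln 2 * 0) * Z"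
    by (intro LIMSEQ_le_const[where X = "\<lambda>n. (LINT x|M. \<bar>f x\<bar> * \<eta> x) + (ln 2 * (1 / real (Suc n))) * Z"]) auto
  then show ?thesis by (simp add: u_def)
qed

end

subsection \<open>The heat kernel\<close>

text \<open>The normalising power of \<open>4\<pi>\<close> is omitted; the mass is then \<open>heat_mass\<close> at all times.\<close>

definition heat :: "'a::euclidean_space \<Rightarrow> real \<Rightarrow> 'a \<Rightarrow> real" where
  "heat y t x = t powr (- real DIM('a) / 2) * exp (- (1 / (4 * t)) * ((x - y) \<bullet> (x - y)))"

lemma heat_nonneg: "0 \<le> heat y t x" by (simp add: heat_def)

lemma smooth_heat: "smooth (heat y t :: 'a::euclidean_space \<Rightarrow> real)"
proof -
  have "smooth (\<lambda>x::'a. (x - y) \<bullet> i)" for i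
    using smooth_add[OF smooth_inner[of i] smooth_const[of "- (y \<bullet> i)"]] by (simp add: inner_diff_left)
  then have "smooth (\<lambda>x::'a. \<Sum>i\<in>Basis. ((x - y) \<bullet> i) * ((x - y) \<bullet> i))"
    by (intro smooth_sum smooth_mult) auto
  then have "smooth (\<lambda>x::'a. (x - y) \<bullet> (x - y))" by (simp only: euclidean_inner[symmetric])
  then show ?thesis unfolding heat_def[abs_def] by (intro smooth_mult smooth_const smooth_exp)
qed

lemma laplacian_heat:
  fixes x y :: "'a::euclidean_space"
  assumes t: "t > 0"
  shows "laplacian (heat y t) x = heat y t x * (((x - y) \<bullet> (x - y)) / (4 * t\<^sup>2) - real DIM('a) / (2 * t))"
proof -
  have d: "heat y t differentiable (at x)" for x :: 'a by (rule smooth_differentiable[OF smooth_heat])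
  have p: "partial_deriv i (heat y t) = (\<lambda>x. heat y t x * ((- 1 / (2 * t)) * ((x - y) \<bullet> i)))" if i: "i \<in> Basis" for i :: 'a
  proof
    fix x :: 'a
    have "(heat y t has_derivative (\<lambda>h. heat y t x * (- (1 / (4 * t)) * (2 * ((x - y) \<bullet> h))))) (at x)"
      unfolding heat_def using t by (auto intro!: derivative_eq_intros simp: inner_commute algebra_simps)
    from partial_deriv_eq[OF this, of i] show "partial_deriv i (heat y t) x = heat y t x * ((- 1 / (2 * t)) * ((x - y) \<bullet> i))"
      by simp
  qed
  have q: "partial_deriv i (\<lambda>x. (- 1 / (2 * t)) * ((x - y) \<bullet> i)) x = - 1 / (2 * t)"
    "(\<lambda>x. (- 1 / (2 * t)) * ((x - y) \<bullet> i)) differentiable (at x)" if i: "i \<in> Basis" for i x :: 'a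
  proof -
    have D: "((\<lambda>x. (- 1 / (2 * t)) * ((x - y) \<bullet> i)) has_derivative (\<lambda>h. (- 1 / (2 * t)) * (h \<bullet> i))) (at x)"
      using t by (auto intro!: derivative_eq_intros)
    show "partial_deriv i (\<lambda>x. (- 1 / (2 * t)) * ((x - y) \<bullet> i)) x = - 1 / (2 * t)"
      using partial_deriv_eq[OF D, of i] i by simp
    show "(\<lambda>x. (- 1 / (2 * t)) * ((x - y) \<bullet> i)) differentiable (at x)" using D differentiable_def by blast
  qed
  have "partial_deriv i (partial_deriv i (heat y t)) x = heat y t x * (((x - y) \<bullet> i) * ((x - y) \<bullet> i) / (4 * t\<^sup>2) - 1 / (2 * t))"
    if i: "i \<in> Basis" for i
    unfolding p[OF i] partial_deriv_mult[OF d q(2)[OF i]] q(1)[OF i] p[OF i, THEN fun_cong]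
    using t by (simp add: field_simps power2_eq_square)
  then have "laplacian (heat y t) x = (\<Sum>i\<in>Basis. heat y t x * (((x - y) \<bullet> i) * ((x - y) \<bullet> i) / (4 * t\<^sup>2) - 1 / (2 * t)))"
    unfolding laplacian_def by simp
  also have "\<dots> = heat y t x * ((\<Sum>i\<in>Basis. ((x - y) \<bullet> i) * ((x - y) \<bullet> i)) / (4 * t\<^sup>2) - real DIM('a) / (2 * t))"
    by (simp add: sum_distrib_left[symmetric] sum_subtractf sum_divide_distrib[symmetric])
  finally show ?thesis by (simp only: euclidean_inner[symmetric])
qed

text \<open>The heat equation with an integrating factor built in, so that a Gronwall argument
  becomes one application of the fundamental theorem of calculus.\<close>

lemma heat_has_derivative:
  fixes x y :: "'a::euclidean_space"
  assumes t: "t > 0"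
  shows "((\<lambda>t. exp (c * t) * heat y t x) has_real_derivative exp (c * t) * (c * heat y t x + laplacian (heat y t) x)) (at t)"
proof -
  let ?r = "(x - y) \<bullet> (x - y)" and ?N = "- real DIM('a) / 2"
  have 1: "((\<lambda>t. t powr ?N) has_real_derivative ?N * t powr (?N - 1)) (at t)"
    by (rule has_real_derivative_powr[OF t])
  have 2: "((\<lambda>t. exp (- (1 / (4 * t)) * ?r)) has_real_derivative exp (- (1 / (4 * t)) * ?r) * (?r / (4 * t\<^sup>2))) (at t)"
    using t by (auto intro!: derivative_eq_intros simp: power2_eq_square)
  have pw: "t powr (?N - 1) = t powr ?N / t" using t by (simp add: powr_diff)
  have h: "((\<lambda>t. heat y t x) has_real_derivative laplacian (heat y t) x) (at t)"
  proof -
    have "((\<lambda>t. t powr ?N * exp (- (1 / (4 * t)) * ?r)) has_real_derivative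
       (?N * t powr (?N - 1)) * exp (- (1 / (4 * t)) * ?r) + (exp (- (1 / (4 * t)) * ?r) * (?r / (4 * t\<^sup>2))) * t powr ?N) (at t)"
      by (rule DERIV_mult[OF 1 2])
    also have "(?N * t powr (?N - 1)) * exp (- (1 / (4 * t)) * ?r) + (exp (- (1 / (4 * t)) * ?r) * (?r / (4 * t\<^sup>2))) * t powr ?N = laplacian (heat y t) x"
      unfolding laplacian_heat[OF t] pw heat_def using t by (simp add: field_simps)
    finally show ?thesis unfolding heat_def .
  qed
  have e: "((\<lambda>t. exp (c * t)) has_real_derivative exp (c * t) * c) (at t)"
    by (auto intro!: derivative_eq_intros)
  show ?thesis using DERIV_mult[OF e h] by (simp add: algebra_simps)
qed

lemma mult_liminf_le_ennreal:
  fixes c :: ennreal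
  shows "c * liminf f \<le> liminf (\<lambda>n. c * f n)"
  unfolding liminf_SUP_INF SUP_mult_left_ennreal
  by (intro SUP_mono' INF_greatest mult_left_mono INF_lower) auto

definition heat_mass :: "'a::euclidean_space itself \<Rightarrow> ennreal" where
  "heat_mass _ = (\<integral>\<^sup>+z. ennreal (exp (- (z \<bullet> z) / 4)) \<partial>(lborel :: 'a measure))"

lemma heat_mass_finite: "heat_mass TYPE('a::euclidean_space) < \<infinity>"
proof -
  have 1: "(\<integral>\<^sup>+s. ennreal (exp (- (s * s) / 4)) \<partial>(lborel :: real measure)) < \<infinity>"
  proof -
    \<comment> \<open>Up to the factor sqrt(4 pi) the integrand is the normal density of variance
      2.\<close>
    have "integrable lborel (\<lambda>s::real. sqrt (4 * pi) * normal_density 0 (sqrt 2) s)"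
      by (intro integrable_mult_right integrable_normal_density) simp
    moreover have "sqrt (4 * pi) * normal_density 0 (sqrt 2) s = exp (- (s * s) / 4)" for s :: real
      by (simp add: normal_density_def power2_eq_square)
    ultimately have "integrable lborel (\<lambda>s::real. exp (- (s * s) / 4))" by simp
    then show ?thesis by (simp add: integrable_iff_bounded)
  qed
  have "exp (- (z \<bullet> z) / 4) = (\<Prod>b\<in>Basis. exp (- ((z \<bullet> b) * (z \<bullet> b)) / 4))" for z :: 'a
  proof -
    have "- (z \<bullet> z) / 4 = (\<Sum>b\<in>Basis. - ((z \<bullet> b) * (z \<bullet> b)) / 4)"
      unfolding euclidean_inner[of z z] by (simp add: sum_divide_distrib sum_negf)
    then show ?thesis by (simp add: exp_sum)
  qed
  then have "heat_mass TYPE('a) = (\<integral>\<^sup>+z. (\<Prod>b\<in>Basis. ennreal (exp (- ((z \<bullet> b) * (z \<bullet> b)) / 4))) \<partial>(lborel :: 'a measure))"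
    unfolding heat_mass_def by (simp add: prod_ennreal)
  also have "\<dots> = (\<Prod>b\<in>(Basis::'a set). (\<integral>\<^sup>+s. ennreal (exp (- (s * s) / 4)) \<partial>lborel))"
    by (rule nn_integral_lborel_prod) auto
  also have "\<dots> < \<infinity>"
    using 1 by (simp add: power_less_top_ennreal)
  finally show ?thesis .
qed

lemma heat_mass_pos: "0 < heat_mass TYPE('a::euclidean_space)"
proof -
  have "heat_mass TYPE('a) \<noteq> 0"
  proof
    assume "heat_mass TYPE('a) = 0"
    then have "AE z in (lborel :: 'a measure). ennreal (exp (- (z \<bullet> z) / 4)) = 0"
      unfolding heat_mass_def by (subst (asm) nn_integral_0_iff_AE) auto
    then have "AE z in (lborel :: 'a measure). False" by eventually_elim (simp add: ennreal_eq_0_iff not_le)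
    then have "ae_filter (lborel :: 'a measure) = bot" by (simp only: eventually_False)
    then show False by (simp add: ae_filter_eq_bot_iff emeasure_lborel_UNIV)
  qed
  then show ?thesis by (simp only: zero_less_iff_neq_zero not_False_eq_True)
qed

lemma nn_integral_lborel_scale:
  fixes f :: "'a::euclidean_space \<Rightarrow> ennreal"
  assumes [measurable]: "f \<in> borel_measurable borel" and s: "s > 0"
  shows "(\<integral>\<^sup>+x. f x \<partial>lborel) = ennreal (s ^ DIM('a)) * (\<integral>\<^sup>+z. f (y + s *\<^sub>R z) \<partial>lborel)"
proof -
  let ?T = "\<lambda>x::'a. y + (\<Sum>j\<in>Basis. (s * (x \<bullet> j)) *\<^sub>R j)"
  have T: "?T = (\<lambda>x. y + s *\<^sub>R x)"
  proof
    fix x :: 'a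
    have "(\<Sum>j\<in>Basis. (s * (x \<bullet> j)) *\<^sub>R j) = s *\<^sub>R (\<Sum>j\<in>Basis. (x \<bullet> j) *\<^sub>R j)"
      by (simp add: scaleR_sum_right)
    then show "?T x = y + s *\<^sub>R x" by (simp only: euclidean_representation)
  qed
  have "lborel = density (distr lborel borel ?T) (\<lambda>_. (\<Prod>j\<in>(Basis::'a set). \<bar>s\<bar>))"
    using s by (intro lborel_affine_euclidean) simp
  then have "(\<integral>\<^sup>+x. f x \<partial>lborel) = (\<integral>\<^sup>+x. f x \<partial>density (distr lborel borel (\<lambda>x. y + s *\<^sub>R x)) (\<lambda>_. ennreal (s ^ DIM('a))))"
    using s unfolding T by simp
  also have "\<dots> = (\<integral>\<^sup>+x. ennreal (s ^ DIM('a)) * f x \<partial>distr lborel borel (\<lambda>x. y + s *\<^sub>R x))"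
    by (rule nn_integral_density) auto
  also have "\<dots> = (\<integral>\<^sup>+z. ennreal (s ^ DIM('a)) * f (y + s *\<^sub>R z) \<partial>lborel)"
    by (rule nn_integral_distr) auto
  also have "\<dots> = ennreal (s ^ DIM('a)) * (\<integral>\<^sup>+z. f (y + s *\<^sub>R z) \<partial>lborel)"
    by (rule nn_integral_cmult) auto
  finally show ?thesis .
qed

text \<open>Parabolic scaling x = y + sqrt(t) z: the Jacobian cancels the power of \<open>t\<close>
  in \<open>heat\<close> and leaves a fixed Gaussian. In this form the concentration at
  \<open>y\<close> as t tends to 0 is visible in the argument of \<open>f\<close>.\<close>

lemma nn_integral_heat_mult:
  fixes f :: "'a::euclidean_space \<Rightarrow> ennreal"
  assumes [measurable]: "f \<in> borel_measurable borel" and t: "t > 0"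
  shows "(\<integral>\<^sup>+x. f x * ennreal (heat y t x) \<partial>lborel) = (\<integral>\<^sup>+z. f (y + sqrt t *\<^sub>R z) * ennreal (exp (- (z \<bullet> z) / 4)) \<partial>lborel)"
proof -
  have hm[measurable]: "heat y t \<in> borel_measurable borel" by (rule smooth_borel_measurable[OF smooth_heat])
  have one: "sqrt t ^ DIM('a) * t powr (- real DIM('a) / 2) = 1"
  proof -
    have "sqrt t ^ DIM('a) = t powr (real DIM('a) / 2)"
      using t by (simp add: powr_half_sqrt[symmetric] powr_powr powr_realpow[symmetric] mult.commute)
    then show ?thesis using t by (simp add: powr_add[symmetric])
  qed
  have h: "ennreal (sqrt t ^ DIM('a)) * ennreal (heat y t (y + sqrt t *\<^sub>R z)) = ennreal (exp (- (z \<bullet> z) / 4))" for z :: 'a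
  proof -
    have "sqrt t ^ DIM('a) * heat y t (y + sqrt t *\<^sub>R z) = (sqrt t ^ DIM('a) * t powr (- real DIM('a) / 2)) * exp (- (z \<bullet> z) / 4)"
      using t by (simp add: heat_def mult.assoc[symmetric])
    then have "sqrt t ^ DIM('a) * heat y t (y + sqrt t *\<^sub>R z) = exp (- (z \<bullet> z) / 4)" unfolding one by simp
    then show ?thesis using t by (simp add: ennreal_mult[symmetric] heat_nonneg)
  qed
  have "(\<integral>\<^sup>+x. f x * ennreal (heat y t x) \<partial>lborel) =
    ennreal (sqrt t ^ DIM('a)) * (\<integral>\<^sup>+z. f (y + sqrt t *\<^sub>R z) * ennreal (heat y t (y + sqrt t *\<^sub>R z)) \<partial>lborel)"
    by (rule nn_integral_lborel_scale) (use t in auto)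
  also have "\<dots> = (\<integral>\<^sup>+z. ennreal (sqrt t ^ DIM('a)) * (f (y + sqrt t *\<^sub>R z) * ennreal (heat y t (y + sqrt t *\<^sub>R z))) \<partial>lborel)"
    by (rule nn_integral_cmult[symmetric]) measurable
  also have "\<dots> = (\<integral>\<^sup>+z. f (y + sqrt t *\<^sub>R z) * ennreal (exp (- (z \<bullet> z) / 4)) \<partial>lborel)"
    unfolding h[symmetric] by (simp only: mult.left_commute)
  finally show ?thesis .
qed

lemma heat_sym: "heat y t x = heat x t y"
  by (simp add: heat_def inner_diff_left inner_diff_right inner_commute algebra_simps)

context bounded_open
begin

lemma heat_integral_M:
  assumes t: "t > 0"
  shows "(LINT x|M. heat y t x) \<le> enn2real (heat_mass TYPE('a))"
proof -
  have i: "integrable M (heat y t)" by (rule L2_imp_integrable[OF smooth_L2[OF smooth_heat]])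
  have "ennreal (LINT x|M. heat y t x) = (\<integral>\<^sup>+x. ennreal (heat y t x) \<partial>M)"
    by (rule nn_integral_eq_integral[symmetric, OF i]) (simp add: heat_nonneg)
  also have "\<dots> \<le> (\<integral>\<^sup>+x. ennreal (heat y t x) \<partial>lborel)"
    by (rule nn_integral_M_le) (use smooth_borel_measurable[OF smooth_heat] in measurable)
  also have "\<dots> = heat_mass TYPE('a)"
    unfolding heat_mass_def using nn_integral_heat_mult[of "\<lambda>_. 1" t y] t by simp
  finally have le: "ennreal (LINT x|M. heat y t x) \<le> heat_mass TYPE('a)" .
  have "0 \<le> (LINT x|M. heat y t x)" by (rule Bochner_Integration.integral_nonneg) (rule heat_nonneg)
  then show ?thesis using enn2real_mono[OF le] heat_mass_finite by simp
qed

text \<open>With \<open>H(t) = \<integral> \<bar>u\<bar> heat(t)\<close>, Kato's inequality says \<open>H' \<ge> - \<Lambda> H - \<delta> c\<close>; it is integrated from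
  \<open>s\<close> to \<open>1\<close>.\<close>

lemma heat_average_bound:
  fixes u :: "'a \<Rightarrow> real"
  assumes uL: "u \<in> L2 M" and nonneg: "0 \<le> \<Lambda>" "0 \<le> \<delta>" and s: "0 < s" "s < 1"
    and sub: "\<And>t. 0 < t \<Longrightarrow> - (LINT x|M. \<bar>u x\<bar> * laplacian (heat y t) x) \<le> (LINT x|M. (\<Lambda> * \<bar>u x\<bar> + \<delta>) * heat y t x)"
  shows "(LINT x|M. \<bar>u x\<bar> * heat y s x) \<le> exp \<Lambda> * ((LINT x|M. \<bar>u x\<bar>) + \<delta> * enn2real (heat_mass TYPE('a)))"
proof -
  define c where "c = enn2real (heat_mass TYPE('a))"
  define G where "G = (\<lambda>t x. exp (\<Lambda> * t) * (\<Lambda> * heat y t x + laplacian (heat y t) x))"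
  have c0: "0 \<le> c" by (simp add: c_def)
  have uabs: "(\<lambda>x. \<bar>u x\<bar>) \<in> L2 M" using L2_norm[OF uL] by simp
  have um[measurable]: "u \<in> borel_measurable M" by (rule L2_measurable[OF uL])
  have lapL: "laplacian (heat y t) \<in> L2 M" for t by (rule smooth_L2[OF smooth_laplacian[OF smooth_heat]])
  have hL: "heat y t \<in> L2 M" for t by (rule smooth_L2[OF smooth_heat])
  have Gformula: "G t x = exp (\<Lambda> * t) * heat y t x * (\<Lambda> + ((x - y) \<bullet> (x - y)) / (4 * t\<^sup>2) - real DIM('a) / (2 * t))" if "t > 0" for t x
    unfolding G_def laplacian_heat[OF that] by (simp add: algebra_simps)
  obtain R where R: "R > 0" "\<And>x. x \<in> \<Omega> \<Longrightarrow> norm ((x - y) \<bullet> (x - y)) \<le> R"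
  proof (rule continuous_bounded_on[of "\<lambda>x. (x - y) \<bullet> (x - y)", OF _ bounded_domain])
    show "continuous_on UNIV (\<lambda>x. (x - y) \<bullet> (x - y))" by (intro continuous_intros)
  qed blast
  \<comment> \<open>Bounds the time derivative uniformly on the domain and on [s,1]. It deteriorates
    as s tends to 0, but it only justifies exchanging the integrals and does not enter the final
    estimate.\<close>
  define C where "C = exp \<Lambda> * s powr (- real DIM('a) / 2) * (\<Lambda> + R / (4 * s\<^sup>2) + real DIM('a) / (2 * s))"
  have heat_le: "heat y t x \<le> s powr (- real DIM('a) / 2)" if "s \<le> t" for t x
  proof -
    have "t powr (- real DIM('a) / 2) \<le> s powr (- real DIM('a) / 2)"
      using s that by (intro powr_mono2') auto
    moreover have "exp (- (1 / (4 * t)) * ((x - y) \<bullet> (x - y))) \<le> 1" using s that by simp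
    ultimately have "t powr (- real DIM('a) / 2) * exp (- (1 / (4 * t)) * ((x - y) \<bullet> (x - y))) \<le> s powr (- real DIM('a) / 2) * 1"
      by (intro mult_mono) auto
    then show ?thesis by (simp add: heat_def)
  qed
  have Gb: "\<bar>G t x\<bar> \<le> C" if "x \<in> \<Omega>" "t \<in> {s..1}" for t x
  proof -
    have t: "0 < t" "s \<le> t" "t \<le> 1" using that s by auto
    let ?r = "(x - y) \<bullet> (x - y)"
    have "?r / (4 * t\<^sup>2) \<le> R / (4 * s\<^sup>2)"
      using R(2)[OF that(1)] t s R(1) by (intro frac_le mult_left_mono power_mono) auto
    moreover have "real DIM('a) / (2 * t) \<le> real DIM('a) / (2 * s)"
      using t s by (intro divide_left_mono) auto
    moreover have "0 \<le> ?r / (4 * t\<^sup>2)" "0 \<le> real DIM('a) / (2 * t)" using t by auto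
    ultimately have 1: "\<bar>\<Lambda> + ?r / (4 * t\<^sup>2) - real DIM('a) / (2 * t)\<bar> \<le> \<Lambda> + R / (4 * s\<^sup>2) + real DIM('a) / (2 * s)"
      using nonneg(1) by linarith
    have "\<Lambda> * t \<le> \<Lambda> * 1" using t nonneg(1) by (intro mult_left_mono) auto
    then have 2: "exp (\<Lambda> * t) * heat y t x \<le> exp \<Lambda> * s powr (- real DIM('a) / 2)"
      using heat_le[OF t(2), of x] by (intro mult_mono) (auto simp: heat_nonneg)
    have "\<bar>G t x\<bar> = (exp (\<Lambda> * t) * heat y t x) * \<bar>\<Lambda> + ?r / (4 * t\<^sup>2) - real DIM('a) / (2 * t)\<bar>"
      unfolding Gformula[OF t(1)] by (simp add: abs_mult heat_nonneg)
    also have "\<dots> \<le> C" unfolding C_def by (rule mult_mono[OF 2 1]) auto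
    finally show ?thesis .
  qed
  have FTC: "(LINT t|lborel. indicator {s..1} t * G t x) = exp \<Lambda> * heat y 1 x - exp (\<Lambda> * s) * heat y s x"
    and FTCi: "integrable lborel (\<lambda>t. indicator {s..1} t * G t x)" for x
  proof -
    have d: "((\<lambda>t. exp (\<Lambda> * t) * heat y t x) has_vector_derivative G t x) (at t within {s..1})" if "s \<le> t" "t \<le> 1" for t
    proof -
      have "0 < t" using s that by linarith
      from heat_has_derivative[OF this, of \<Lambda> y x] show ?thesis
        unfolding has_real_derivative_iff_has_vector_derivative G_def by (rule has_vector_derivative_at_within)
    qed
    have "continuous_on {s..1} (\<lambda>t. exp (\<Lambda> * t) * heat y t x * (\<Lambda> + ((x - y) \<bullet> (x - y)) / (4 * t\<^sup>2) - real DIM('a) / (2 * t)))"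
      unfolding heat_def using s by (intro continuous_intros) auto
    then have cont: "continuous_on {s..1} (\<lambda>t. G t x)"
      by (rule continuous_on_eq) (use s Gformula in auto)
    have "has_bochner_integral lborel (\<lambda>t. indicator {s..1} t *\<^sub>R G t x) (exp (\<Lambda> * 1) * heat y 1 x - exp (\<Lambda> * s) * heat y s x)"
      by (rule has_bochner_integral_FTC_Icc[OF _ d cont]) (use s in auto)
    then show "(LINT t|lborel. indicator {s..1} t * G t x) = exp \<Lambda> * heat y 1 x - exp (\<Lambda> * s) * heat y s x"
      "integrable lborel (\<lambda>t. indicator {s..1} t * G t x)"
      by (simp_all add: has_bochner_integral_iff)
  qed
  have iI: "integrable lborel (indicator {s..1} :: real \<Rightarrow> real)"
    using s by (intro integrable_real_indicator) auto
  interpret P: pair_sigma_finite M "lborel :: real measure" ..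
  let ?f = "\<lambda>p. \<bar>u (fst p)\<bar> * (indicator {s..1} (snd p) * G (snd p) (fst p))"
  have fm: "?f \<in> borel_measurable (M \<Otimes>\<^sub>M lborel)"
  proof -
    have id: "(\<lambda>p. fst p) \<in> (M \<Otimes>\<^sub>M lborel) \<rightarrow>\<^sub>M (borel :: 'a measure)"
      by (rule measurable_compose[OF measurable_fst borel_measurable_M]) simp
    have sn: "(\<lambda>p. snd p) \<in> (M \<Otimes>\<^sub>M (lborel :: real measure)) \<rightarrow>\<^sub>M (borel :: real measure)" by simp
    have um': "(\<lambda>p. u (fst p)) \<in> borel_measurable (M \<Otimes>\<^sub>M lborel)" by measurable
    have "(\<lambda>p. \<bar>u (fst p)\<bar> * (indicator {s..1} (snd p) * (exp (\<Lambda> * snd p) * heat y (snd p) (fst p) * (\<Lambda> + ((fst p - y) \<bullet> (fst p - y)) / (4 * (snd p)\<^sup>2) - real DIM('a) / (2 * snd p))))) \<in> borel_measurable (M \<Otimes>\<^sub>M lborel)"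
      unfolding heat_def using id sn um' by measurable
    also have "(\<lambda>p. \<bar>u (fst p)\<bar> * (indicator {s..1} (snd p) * (exp (\<Lambda> * snd p) * heat y (snd p) (fst p) * (\<Lambda> + ((fst p - y) \<bullet> (fst p - y)) / (4 * (snd p)\<^sup>2) - real DIM('a) / (2 * snd p))))) = ?f"
    proof
      fix p :: "'a \<times> real"
      show "\<bar>u (fst p)\<bar> * (indicator {s..1} (snd p) * (exp (\<Lambda> * snd p) * heat y (snd p) (fst p) * (\<Lambda> + ((fst p - y) \<bullet> (fst p - y)) / (4 * (snd p)\<^sup>2) - real DIM('a) / (2 * snd p)))) = ?f p"
        using s Gformula[of "snd p" "fst p"] by (cases "snd p \<in> {s..1}") auto
    qed
    finally show ?thesis .
  qed
  have fi: "integrable (M \<Otimes>\<^sub>M lborel) ?f"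
  proof (rule P.Fubini_integrable[OF fm])
    have iu: "integrable M (\<lambda>x. \<bar>u x\<bar> * C)" using L2_integrable_norm[OF uL] by simp
    show "AE x in M. integrable lborel (\<lambda>t. ?f (x, t))" using FTCi by simp
    show "integrable M (\<lambda>x. LINT t|lborel. norm (?f (x, t)))"
    proof (rule Bochner_Integration.integrable_bound[OF iu])
      show "(\<lambda>x. LINT t|lborel. norm (?f (x, t))) \<in> borel_measurable M"
        using fm by (intro lborel.borel_measurable_lebesgue_integral) (simp add: case_prod_beta)
      show "AE x in M. norm (LINT t|lborel. norm (?f (x, t))) \<le> norm (\<bar>u x\<bar> * C)"
      proof (rule AE_I2)
        fix x assume "x \<in> space M"
        then have x: "x \<in> \<Omega>" by simp
        have C0: "0 \<le> C" using order_trans[OF abs_ge_zero Gb[OF x, of 1]] s by simp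
        have "(LINT t|lborel. norm (?f (x, t))) \<le> (LINT t|lborel. (\<bar>u x\<bar> * C) * indicator {s..1} t)"
        proof (rule integral_mono)
          show "integrable lborel (\<lambda>t. norm (?f (x, t)))" using FTCi[of x] by simp
          show "integrable lborel (\<lambda>t. (\<bar>u x\<bar> * C) * indicator {s..1} t)"
            by (rule integrable_mult_right[OF iI])
          show "norm (?f (x, t)) \<le> (\<bar>u x\<bar> * C) * indicator {s..1} t" for t
            using Gb[OF x, of t] by (cases "t \<in> {s..1}") (auto simp: abs_mult intro: mult_left_mono)
        qed
        also have "\<dots> = (\<bar>u x\<bar> * C) * (1 - s)" using s by simp
        also have "\<dots> \<le> (\<bar>u x\<bar> * C) * 1" using s C0 by (intro mult_left_mono) auto
        finally have "(LINT t|lborel. norm (?f (x, t))) \<le> \<bar>u x\<bar> * C" by simp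
        moreover have "0 \<le> (LINT t|lborel. norm (?f (x, t)))" by (rule Bochner_Integration.integral_nonneg) simp
        ultimately show "norm (LINT t|lborel. norm (?f (x, t))) \<le> norm (\<bar>u x\<bar> * C)" using C0 by simp
      qed
    qed
  qed
  have lower: "- (exp \<Lambda> * (\<delta> * c)) * indicator {s..1} t \<le> (LINT x|M. ?f (x, t))" for t
  proof (cases "t \<in> {s..1}")
    case True
    then have t: "0 < t" "t \<le> 1" using s by auto
    have i1: "integrable M (\<lambda>x. \<bar>u x\<bar> * heat y t x)" "integrable M (\<lambda>x. \<bar>u x\<bar> * laplacian (heat y t) x)" "integrable M (heat y t)"
      by (intro L2_mult_integrable uabs hL lapL L2_imp_integrable)+
    have "(LINT x|M. ?f (x, t)) = (LINT x|M. exp (\<Lambda> * t) * (\<Lambda> * (\<bar>u x\<bar> * heat y t x) + \<bar>u x\<bar> * laplacian (heat y t) x))"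
      using True by (intro Bochner_Integration.integral_cong) (auto simp: G_def algebra_simps)
    also have "\<dots> = exp (\<Lambda> * t) * (\<Lambda> * (LINT x|M. \<bar>u x\<bar> * heat y t x) + (LINT x|M. \<bar>u x\<bar> * laplacian (heat y t) x))"
      using i1 by simp
    finally have eq: "(LINT x|M. ?f (x, t)) = exp (\<Lambda> * t) * (\<Lambda> * (LINT x|M. \<bar>u x\<bar> * heat y t x) + (LINT x|M. \<bar>u x\<bar> * laplacian (heat y t) x))" .
    have "(LINT x|M. (\<Lambda> * \<bar>u x\<bar> + \<delta>) * heat y t x) = \<Lambda> * (LINT x|M. \<bar>u x\<bar> * heat y t x) + \<delta> * (LINT x|M. heat y t x)"
      using i1 by (simp add: distrib_right mult.assoc)
    moreover have "\<delta> * (LINT x|M. heat y t x) \<le> \<delta> * c"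
      unfolding c_def by (rule mult_left_mono[OF heat_integral_M[OF t(1)] nonneg(2)])
    ultimately have "- (\<delta> * c) \<le> \<Lambda> * (LINT x|M. \<bar>u x\<bar> * heat y t x) + (LINT x|M. \<bar>u x\<bar> * laplacian (heat y t) x)"
      using sub[OF t(1)] by linarith
    then have "exp (\<Lambda> * t) * (- (\<delta> * c)) \<le> (LINT x|M. ?f (x, t))" unfolding eq by (rule mult_left_mono) simp
    moreover have "exp (\<Lambda> * t) * (\<delta> * c) \<le> exp \<Lambda> * (\<delta> * c)"
    proof (rule mult_right_mono)
      have "\<Lambda> * t \<le> \<Lambda> * 1" using t nonneg(1) by (intro mult_left_mono) auto
      then show "exp (\<Lambda> * t) \<le> exp \<Lambda>" by simp
    qed (use nonneg c0 in simp)
    ultimately show ?thesis using True by simp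
  qed simp
  have iu1: "integrable M (\<lambda>x. \<bar>u x\<bar> * heat y t x)" for t by (intro L2_mult_integrable uabs hL)
  have "- (exp \<Lambda> * (\<delta> * c)) \<le> - (exp \<Lambda> * (\<delta> * c)) * (1 - s)"
  proof -
    have "(exp \<Lambda> * (\<delta> * c)) * (1 - s) \<le> (exp \<Lambda> * (\<delta> * c)) * 1" using s nonneg c0 by (intro mult_left_mono) auto
    then show ?thesis by simp
  qed
  also have "\<dots> = (LINT t|lborel. - (exp \<Lambda> * (\<delta> * c)) * indicator {s..1} t)" using s by simp
  also have "\<dots> \<le> (LINT t|lborel. LINT x|M. ?f (x, t))"
  proof (rule integral_mono[OF _ _ lower])
    show "integrable lborel (\<lambda>t. - (exp \<Lambda> * (\<delta> * c)) * indicator {s..1} t)"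
      by (rule integrable_mult_right[OF iI])
    show "integrable lborel (\<lambda>t. LINT x|M. ?f (x, t))"
      by (rule P.integrable_snd[of "\<lambda>x t. ?f (x, t)"]) (use fi in \<open>simp add: case_prod_beta'\<close>)
  qed
  also have "\<dots> = (LINT x|M. LINT t|lborel. ?f (x, t))"
    by (rule P.Fubini_integral[of "\<lambda>x t. ?f (x, t)"]) (use fi in \<open>simp add: case_prod_beta'\<close>)
  also have "\<dots> = (LINT x|M. exp \<Lambda> * (\<bar>u x\<bar> * heat y 1 x) - exp (\<Lambda> * s) * (\<bar>u x\<bar> * heat y s x))"
    by (intro Bochner_Integration.integral_cong refl)
       (simp only: fst_conv snd_conv integral_mult_right_zero FTC right_diff_distrib mult.left_commute)
  also have "\<dots> = exp \<Lambda> * (LINT x|M. \<bar>u x\<bar> * heat y 1 x) - exp (\<Lambda> * s) * (LINT x|M. \<bar>u x\<bar> * heat y s x)"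
    using iu1[of 1] iu1[of s] by simp
  finally have main: "exp (\<Lambda> * s) * (LINT x|M. \<bar>u x\<bar> * heat y s x) \<le> exp \<Lambda> * ((LINT x|M. \<bar>u x\<bar> * heat y 1 x) + \<delta> * c)"
    by (simp add: algebra_simps)
  have "0 \<le> (LINT x|M. \<bar>u x\<bar> * heat y s x)" by (rule Bochner_Integration.integral_nonneg) (simp add: heat_nonneg)
  moreover have "1 \<le> exp (\<Lambda> * s)" using s nonneg by simp
  ultimately have "(LINT x|M. \<bar>u x\<bar> * heat y s x) \<le> exp (\<Lambda> * s) * (LINT x|M. \<bar>u x\<bar> * heat y s x)"
    using mult_right_mono[of 1 "exp (\<Lambda> * s)" "LINT x|M. \<bar>u x\<bar> * heat y s x"] by simp
  also note main
  also have "exp \<Lambda> * ((LINT x|M. \<bar>u x\<bar> * heat y 1 x) + \<delta> * c) \<le> exp \<Lambda> * ((LINT x|M. \<bar>u x\<bar>) + \<delta> * c)"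
  proof (intro mult_left_mono add_right_mono)
    \<comment> \<open>At time 1 the unnormalised kernel is at most 1, so the heat average is bounded
      by the L1 norm, independently of \<open>y\<close>.\<close>
    have "heat y 1 x \<le> 1" for x by (simp add: heat_def)
    then show "(LINT x|M. \<bar>u x\<bar> * heat y 1 x) \<le> (LINT x|M. \<bar>u x\<bar>)"
      by (intro integral_mono iu1) (use L2_integrable_norm[OF uL] in \<open>auto intro: mult_left_le\<close>)
  qed simp
  finally show ?thesis by (simp add: c_def)
qed

lemma integral_cbox_eq_M:
  fixes f :: "'a \<Rightarrow> real"
  assumes f: "f \<in> L2 M" and sub: "cbox a b \<subseteq> \<Omega>"
  shows "f integrable_on cbox a b" "integral (cbox a b) f = (LINT x|M. indicator (box a b) x * f x)"
proof -
  have abs: "f absolutely_integrable_on cbox a b"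
    using L2_L1loc[OF f] sub compact_cbox unfolding L1loc_def by blast
  then show "f integrable_on cbox a b" by (rule absolutely_integrable_on_def[THEN iffD1, THEN conjunct1])
  define F where "F = (\<lambda>x. indicator (cbox a b) x * f x)"
  have F: "integrable lebesgue F" using abs by (simp add: set_integrable_def F_def)
  have "(LINT x|M. indicator (box a b) x * f x) = (LINT x|lebesgue. indicator \<Omega> x * (indicator (box a b) x * f x))"
    by (rule lint_lebesgue_on_eq) simp
  also have "\<dots> = (LINT x|lebesgue. F x * indicator (box a b) x)"
    by (rule Bochner_Integration.integral_cong[OF refl])
       (use sub box_subset_cbox[of a b] in \<open>auto simp: F_def indicator_def\<close>)
  also have "\<dots> = (LINT x|lebesgue. F x)"
  proof (rule integral_cong_AE)
    have "cbox a b - box a b \<in> null_sets lebesgue"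
      using negligible_frontier_interval[of a b] by (simp add: negligible_iff_null_sets)
    then have "AE x in lebesgue. x \<notin> cbox a b - box a b" by (rule AE_not_in)
    then show "AE x in lebesgue. F x * indicator (box a b) x = F x"
      by eventually_elim (auto simp: F_def indicator_def)
    show "(\<lambda>x. F x * indicator (box a b) x) \<in> borel_measurable lebesgue"
      using F by (intro borel_measurable_times borel_measurable_indicator) auto
  qed (use F in auto)
  also have "\<dots> = integral (cbox a b) f"
    using set_lebesgue_integral_eq_integral(2)[OF abs] by (simp add: set_lebesgue_integral_def F_def)
  finally show "integral (cbox a b) f = (LINT x|M. indicator (box a b) x * f x)" by simp
qed

text \<open>Averages of \<open>\<bar>u\<bar>\<close> over boxes are recovered from heat averages as \<open>t \<rightarrow> 0\<close>, by Fatou's lemma.\<close>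

lemma AE_le_if_heat_average_le:
  fixes u :: "'a \<Rightarrow> real"
  assumes uL: "u \<in> L2 M" and D: "0 \<le> D"
    and avg: "\<And>y s. 0 < s \<Longrightarrow> s < 1 \<Longrightarrow> (LINT x|M. \<bar>u x\<bar> * heat y s x) \<le> D"
  shows "AE x in M. enn2real (heat_mass TYPE('a)) * \<bar>u x\<bar> \<le> D"
proof -
  define c where "c = enn2real (heat_mass TYPE('a))"
  have c0: "0 \<le> c" by (simp add: c_def)
  have cm: "ennreal c = heat_mass TYPE('a)" unfolding c_def using heat_mass_finite[where 'a = 'a] by simp
  have um[measurable]: "u \<in> borel_measurable M" by (rule L2_measurable[OF uL])
  have uabs: "(\<lambda>x. \<bar>u x\<bar>) \<in> L2 M" using L2_norm[OF uL] by simp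
  have id: "(\<lambda>x. x) \<in> M \<rightarrow>\<^sub>M (borel :: 'a measure)" by (rule borel_measurable_M) simp
  let ?e = "\<lambda>z::'a. ennreal (exp (- (z \<bullet> z) / 4))"
  \<comment> \<open>The offset 2 keeps every time strictly between 0 and 1, as \<open>avg\<close>
    demands.\<close>
  let ?s = "\<lambda>n. 1 / real (n + 2)"
  have L2': "(\<lambda>x. D - c * \<bar>u x\<bar>) \<in> L2 M"
    using L2_diff[OF L2_const[of D] L2_cmult[OF uabs, of c]] by simp
  have "AE x in M. 0 \<le> D - c * \<bar>u x\<bar>"
  proof (rule AE_nonneg_if_box[OF open_domain])
    fix a b :: 'a assume ab: "cbox a b \<subseteq> \<Omega>"
    let ?A = "box a b"
    show "(\<lambda>x. D - c * \<bar>u x\<bar>) integrable_on cbox a b" by (rule integral_cbox_eq_M(1)[OF L2' ab])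
    \<comment> \<open>Undoing the scaling, exchanging the integrals and using the symmetry of the
      kernel turns the left side into an integral over the box of heat averages of \<bar>u\<bar>,
      each at most \<open>D\<close>.\<close>
    have est: "(\<integral>\<^sup>+x. ennreal \<bar>u x\<bar> * (\<integral>\<^sup>+z. indicator ?A (x + sqrt (?s n) *\<^sub>R z) * ?e z \<partial>lborel) \<partial>M) \<le> ennreal D * emeasure lborel ?A" for n
    proof -
      have s: "0 < ?s n" "?s n < 1" by auto
      have "(\<integral>\<^sup>+x. ennreal \<bar>u x\<bar> * (\<integral>\<^sup>+z. indicator ?A (x + sqrt (?s n) *\<^sub>R z) * ?e z \<partial>lborel) \<partial>M)
          = (\<integral>\<^sup>+x. (\<integral>\<^sup>+y. ennreal \<bar>u x\<bar> * (indicator ?A y * ennreal (heat x (?s n) y)) \<partial>lborel) \<partial>M)"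
      proof (rule nn_integral_cong)
        fix x
        have "(\<integral>\<^sup>+z. indicator ?A (x + sqrt (?s n) *\<^sub>R z) * ?e z \<partial>lborel) = (\<integral>\<^sup>+y. indicator ?A y * ennreal (heat x (?s n) y) \<partial>lborel)"
          by (rule nn_integral_heat_mult[symmetric]) (use s in auto)
        moreover have "(\<lambda>y. indicator ?A y * ennreal (heat x (?s n) y)) \<in> borel_measurable lborel"
        proof -
          have [measurable]: "heat x (?s n) \<in> borel_measurable borel"
            by (rule smooth_borel_measurable[OF smooth_heat])
          show ?thesis by measurable
        qed
        ultimately show "ennreal \<bar>u x\<bar> * (\<integral>\<^sup>+z. indicator ?A (x + sqrt (?s n) *\<^sub>R z) * ?e z \<partial>lborel) = (\<integral>\<^sup>+y. ennreal \<bar>u x\<bar> * (indicator ?A y * ennreal (heat x (?s n) y)) \<partial>lborel)"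
          by (simp add: nn_integral_cmult)
      qed
      also have "\<dots> = (\<integral>\<^sup>+y. (\<integral>\<^sup>+x. ennreal \<bar>u x\<bar> * (indicator ?A y * ennreal (heat x (?s n) y)) \<partial>M) \<partial>lborel)"
      proof -
        interpret P: pair_sigma_finite M "lborel :: 'a measure" ..
        have "(\<lambda>p. ennreal \<bar>u (fst p)\<bar> * (indicator ?A (snd p) * ennreal (heat (fst p) (?s n) (snd p)))) \<in> borel_measurable (M \<Otimes>\<^sub>M lborel)"
        proof -
          have id1: "(\<lambda>p. fst p) \<in> (M \<Otimes>\<^sub>M lborel) \<rightarrow>\<^sub>M (borel :: 'a measure)"
            by (rule measurable_compose[OF measurable_fst id])
          have id2: "(\<lambda>p. snd p) \<in> (M \<Otimes>\<^sub>M lborel) \<rightarrow>\<^sub>M (borel :: 'a measure)" by simp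
          show ?thesis unfolding heat_def using id1 id2 by measurable
        qed
        then show ?thesis
          using P.Fubini'[of "\<lambda>x y. ennreal \<bar>u x\<bar> * (indicator ?A y * ennreal (heat x (?s n) y))"] by (simp add: case_prod_beta)
      qed
      also have "\<dots> \<le> (\<integral>\<^sup>+y. ennreal D * indicator ?A y \<partial>lborel)"
      proof (rule nn_integral_mono)
        fix y
        have hL: "heat y (?s n) \<in> L2 M" by (rule smooth_L2[OF smooth_heat])
        have "(\<integral>\<^sup>+x. ennreal \<bar>u x\<bar> * (indicator ?A y * ennreal (heat x (?s n) y)) \<partial>M) = (\<integral>\<^sup>+x. indicator ?A y * ennreal (\<bar>u x\<bar> * heat y (?s n) x) \<partial>M)"
          by (intro nn_integral_cong) (simp add: heat_sym[of _ _ y] ennreal_mult heat_nonneg mult.left_commute)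
        also have "\<dots> = indicator ?A y * (\<integral>\<^sup>+x. ennreal (\<bar>u x\<bar> * heat y (?s n) x) \<partial>M)"
          by (rule nn_integral_cmult) (use um L2_measurable[OF hL] in measurable)
        also have "(\<integral>\<^sup>+x. ennreal (\<bar>u x\<bar> * heat y (?s n) x) \<partial>M) = ennreal (LINT x|M. \<bar>u x\<bar> * heat y (?s n) x)"
          by (rule nn_integral_eq_integral[OF L2_mult_integrable[OF uabs hL]]) (simp add: heat_nonneg)
        also have "indicator ?A y * \<dots> \<le> indicator ?A y * ennreal D"
          using avg[OF s, of y] by (intro mult_left_mono ennreal_leI) auto
        finally show "(\<integral>\<^sup>+x. ennreal \<bar>u x\<bar> * (indicator ?A y * ennreal (heat x (?s n) y)) \<partial>M) \<le> ennreal D * indicator ?A y"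
          by (simp add: mult.commute)
      qed
      also have "\<dots> = ennreal D * emeasure lborel ?A" by (rule nn_integral_cmult_indicator) simp
      finally show ?thesis .
    qed
    \<comment> \<open>The indicator of an open box is lower semicontinuous, which is exactly what
      Fatou's lemma uses: for x in the box the shifted points lie in it eventually, and the whole
      Gaussian mass is recovered.\<close>
    have inner: "indicator ?A x * ennreal c \<le> liminf (\<lambda>n. \<integral>\<^sup>+z. indicator ?A (x + sqrt (?s n) *\<^sub>R z) * ?e z \<partial>lborel)" for x
    proof -
      have "indicator ?A x * ennreal c = (\<integral>\<^sup>+z. indicator ?A x * ?e z \<partial>lborel)"
        unfolding cm heat_mass_def by (rule nn_integral_cmult[symmetric]) measurable
      also have "\<dots> \<le> (\<integral>\<^sup>+z. liminf (\<lambda>n. indicator ?A (x + sqrt (?s n) *\<^sub>R z) * ?e z) \<partial>lborel)"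
      proof (rule nn_integral_mono)
        fix z
        show "indicator ?A x * ?e z \<le> liminf (\<lambda>n. indicator ?A (x + sqrt (?s n) *\<^sub>R z) * ?e z)"
        proof (cases "x \<in> ?A")
          case True
          have "(\<lambda>n. x + sqrt (?s n) *\<^sub>R z) \<longlonglongrightarrow> x + sqrt 0 *\<^sub>R z"
            by (intro tendsto_intros LIMSEQ_ignore_initial_segment[OF lim_1_over_n])
          then have "eventually (\<lambda>n. x + sqrt (?s n) *\<^sub>R z \<in> ?A) sequentially"
            using True by (intro topological_tendstoD[where l = x]) (auto simp: open_box)
          then show ?thesis by (intro Liminf_bounded) (auto elim!: eventually_mono simp: True)
        qed simp
      qed
      also have "\<dots> \<le> liminf (\<lambda>n. \<integral>\<^sup>+z. indicator ?A (x + sqrt (?s n) *\<^sub>R z) * ?e z \<partial>lborel)"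
        by (rule nn_integral_liminf) measurable
      finally show ?thesis .
    qed
    have "(\<integral>\<^sup>+x. ennreal \<bar>u x\<bar> * (indicator ?A x * ennreal c) \<partial>M)
        \<le> (\<integral>\<^sup>+x. liminf (\<lambda>n. ennreal \<bar>u x\<bar> * (\<integral>\<^sup>+z. indicator ?A (x + sqrt (?s n) *\<^sub>R z) * ?e z \<partial>lborel)) \<partial>M)"
    proof (rule nn_integral_mono)
      fix x
      have "ennreal \<bar>u x\<bar> * (indicator ?A x * ennreal c) \<le> ennreal \<bar>u x\<bar> * liminf (\<lambda>n. \<integral>\<^sup>+z. indicator ?A (x + sqrt (?s n) *\<^sub>R z) * ?e z \<partial>lborel)"
        by (rule mult_left_mono[OF inner]) simp
      also have "\<dots> \<le> liminf (\<lambda>n. ennreal \<bar>u x\<bar> * (\<integral>\<^sup>+z. indicator ?A (x + sqrt (?s n) *\<^sub>R z) * ?e z \<partial>lborel))"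
        by (rule mult_liminf_le_ennreal)
      finally show "ennreal \<bar>u x\<bar> * (indicator ?A x * ennreal c) \<le> liminf (\<lambda>n. ennreal \<bar>u x\<bar> * (\<integral>\<^sup>+z. indicator ?A (x + sqrt (?s n) *\<^sub>R z) * ?e z \<partial>lborel))" .
    qed
    also have "\<dots> \<le> liminf (\<lambda>n. \<integral>\<^sup>+x. ennreal \<bar>u x\<bar> * (\<integral>\<^sup>+z. indicator ?A (x + sqrt (?s n) *\<^sub>R z) * ?e z \<partial>lborel) \<partial>M)"
    proof (rule nn_integral_liminf)
      show "(\<lambda>x. ennreal \<bar>u x\<bar> * (\<integral>\<^sup>+z. indicator ?A (x + sqrt (?s n) *\<^sub>R z) * ?e z \<partial>lborel)) \<in> borel_measurable M" for n
      proof -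
        have "(\<lambda>x. \<integral>\<^sup>+z. indicator ?A (x + sqrt (?s n) *\<^sub>R z) * ?e z \<partial>lborel) \<in> borel_measurable (borel :: 'a measure)"
          by measurable
        from measurable_compose[OF id this] show ?thesis using um by measurable
      qed
    qed
    also have "\<dots> \<le> ennreal D * emeasure lborel ?A"
    proof -
      have "liminf (\<lambda>n. \<integral>\<^sup>+x. ennreal \<bar>u x\<bar> * (\<integral>\<^sup>+z. indicator ?A (x + sqrt (?s n) *\<^sub>R z) * ?e z \<partial>lborel) \<partial>M) \<le> liminf (\<lambda>n::nat. ennreal D * emeasure lborel ?A)"
        by (rule Liminf_mono) (use est in simp)
      then show ?thesis by (simp add: Liminf_const)
    qed
    finally have le: "(\<integral>\<^sup>+x. ennreal \<bar>u x\<bar> * (indicator ?A x * ennreal c) \<partial>M) \<le> ennreal D * emeasure lborel ?A" .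
    have bm[measurable]: "?A \<in> sets M" using ab box_subset_cbox[of a b] by (auto simp: sets_restrict_space_iff)
    have iA: "integrable M (\<lambda>x. indicator ?A x * (c * \<bar>u x\<bar>))"
      using integrable_mult_indicator[OF bm L2_imp_integrable[OF L2_cmult[OF uabs, of c]]] by simp
    have "ennreal (LINT x|M. indicator ?A x * (c * \<bar>u x\<bar>)) = (\<integral>\<^sup>+x. ennreal (indicator ?A x * (c * \<bar>u x\<bar>)) \<partial>M)"
      by (rule nn_integral_eq_integral[symmetric, OF iA]) (simp add: c0)
    also have "\<dots> = (\<integral>\<^sup>+x. ennreal \<bar>u x\<bar> * (indicator ?A x * ennreal c) \<partial>M)"
      by (intro nn_integral_cong) (auto simp: indicator_def ennreal_mult c0 mult.commute)
    also note le
    also have "ennreal D * emeasure lborel ?A = ennreal (D * measure M ?A)"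
    proof -
      have "emeasure lborel ?A = emeasure M ?A"
        using ab box_subset_cbox[of a b] by (subst emeasure_restrict_space) (auto simp: emeasure_completion)
      then show ?thesis using D by (simp add: emeasure_eq_measure ennreal_mult)
    qed
    finally have "(LINT x|M. indicator ?A x * (c * \<bar>u x\<bar>)) \<le> D * measure M ?A"
      using D by (subst (asm) ennreal_le_iff) auto
    moreover have "(LINT x|M. indicator ?A x * (D - c * \<bar>u x\<bar>)) = D * measure M ?A - (LINT x|M. indicator ?A x * (c * \<bar>u x\<bar>))"
    proof -
      have iD: "integrable M (\<lambda>x. indicator ?A x * D)" using integrable_mult_indicator[OF bm integrable_const[of D]] by simp
      have "(LINT x|M. indicator ?A x * D) = D * measure M ?A"
        using bm sets.sets_into_space[OF bm] by (simp add: Int_absorb2 mult.commute)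
      then show ?thesis unfolding right_diff_distrib using Bochner_Integration.integral_diff[OF iD iA] by simp
    qed
    ultimately show "0 \<le> integral (cbox a b) (\<lambda>x. D - c * \<bar>u x\<bar>)"
      unfolding integral_cbox_eq_M(2)[OF L2' ab] by simp
  qed
  then show ?thesis by (simp add: c_def)
qed

text \<open>Kato's inequality with the heat kernel as weight gives a differential inequality for
  heat averages; these are bounded uniformly up to time 0, where they dominate \<bar>u\<bar>. The
  bound is linear in the L1 norm and in \<open>\<delta>\<close>, so smallness of the data carries
  over to the supremum.\<close>

theorem sup_bound:
  assumes U: "U \<in> W" and f: "f \<in> L2 M"
    and eq: "\<And>\<psi>. test_function \<Omega> \<psi> \<Longrightarrow> (LINT x|M. snd (U x) \<bullet> grad \<psi> x) = (LINT x|M. f x * \<psi> x)"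
    and nonneg: "0 \<le> \<Lambda>" "0 \<le> \<delta>"
    and le: "AE x in M. \<bar>f x\<bar> \<le> \<Lambda> * \<bar>fst (U x)\<bar> + \<delta>"
  shows "AE x in M. enn2real (heat_mass TYPE('a)) * \<bar>fst (U x)\<bar> \<le>
    exp \<Lambda> * ((LINT x|M. \<bar>fst (U x)\<bar>) + \<delta> * enn2real (heat_mass TYPE('a)))"
proof (rule AE_le_if_heat_average_le)
  show uL: "(\<lambda>x. fst (U x)) \<in> L2 M" by (rule L2_fst[OF W_L2[OF U]])
  from L2_norm[OF this] have uabs: "(\<lambda>x. \<bar>fst (U x)\<bar>) \<in> L2 M" by simp
  have fabs: "(\<lambda>x. \<bar>f x\<bar>) \<in> L2 M" using L2_norm[OF f] by simp
  have gL: "(\<lambda>x. \<Lambda> * \<bar>fst (U x)\<bar> + \<delta>) \<in> L2 M"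
    using L2_add[OF L2_cmult[OF uabs, of \<Lambda>] L2_const[of \<delta>]] by simp
  have hL: "heat y t \<in> L2 M" for y t by (rule smooth_L2[OF smooth_heat])
  show "0 \<le> exp \<Lambda> * ((LINT x|M. \<bar>fst (U x)\<bar>) + \<delta> * enn2real (heat_mass TYPE('a)))"
    using nonneg by (intro mult_nonneg_nonneg add_nonneg_nonneg Bochner_Integration.integral_nonneg) auto
  fix y s assume s: "0 < s" "s < (1::real)"
  show "(LINT x|M. \<bar>fst (U x)\<bar> * heat y s x) \<le> exp \<Lambda> * ((LINT x|M. \<bar>fst (U x)\<bar>) + \<delta> * enn2real (heat_mass TYPE('a)))"
  proof (rule heat_average_bound[OF uL nonneg s])
    fix t :: real assume "0 < t"
    have "- (LINT x|M. \<bar>fst (U x)\<bar> * laplacian (heat y t) x) \<le> (LINT x|M. \<bar>f x\<bar> * heat y t x)"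
      by (rule kato_inequality[OF U f eq smooth_heat heat_nonneg])
    also have "\<dots> \<le> (LINT x|M. (\<Lambda> * \<bar>fst (U x)\<bar> + \<delta>) * heat y t x)"
    proof (rule integral_mono_AE[OF L2_mult_integrable[OF fabs hL] L2_mult_integrable[OF gL hL]])
      show "AE x in M. \<bar>f x\<bar> * heat y t x \<le> (\<Lambda> * \<bar>fst (U x)\<bar> + \<delta>) * heat y t x"
        using le by eventually_elim (rule mult_right_mono, simp_all add: heat_nonneg)
    qed
    finally show "- (LINT x|M. \<bar>fst (U x)\<bar> * laplacian (heat y t) x) \<le> (LINT x|M. (\<Lambda> * \<bar>fst (U x)\<bar> + \<delta>) * heat y t x)" .
  qed
qed

end

section \<open>The variational solution\<close>

context bounded_open
begin

lemma L2_mult_bounded: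
  fixes a f :: "'a \<Rightarrow> real"
  assumes a: "a \<in> borel_measurable M" "AE x in M. \<bar>a x\<bar> \<le> A" and A: "0 \<le> A" and f: "f \<in> L2 M"
  shows "(\<lambda>x. a x * f x) \<in> L2 M" "l2norm M (\<lambda>x. a x * f x) \<le> A * l2norm M f"
proof -
  have m: "(\<lambda>x. a x * f x) \<in> borel_measurable M" by (rule borel_measurable_times[OF a(1) L2_measurable[OF f]])
  have Af: "(\<lambda>x. A * f x) \<in> L2 M" using L2_cmult[OF f, of A] by simp
  have ae: "AE x in M. norm (a x * f x) \<le> norm (A * f x)"
    using a(2) by eventually_elim (use A in \<open>simp add: abs_mult mult_right_mono\<close>)
  show "(\<lambda>x. a x * f x) \<in> L2 M" by (rule L2_dominated(1)[OF m Af ae])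
  show "l2norm M (\<lambda>x. a x * f x) \<le> A * l2norm M f"
    using L2_dominated(2)[OF m Af ae] A by (simp add: l2norm_mult)
qed

definition lower_order :: "('a \<Rightarrow> real) \<Rightarrow> ('a \<Rightarrow> real) \<Rightarrow> ('a \<Rightarrow> real \<Rightarrow> real) \<Rightarrow> ('a \<Rightarrow> real) \<Rightarrow> real" where
  "lower_order a b \<Gamma> f = (LINT x|M. a x * f x * f x) / 2 + (LINT x|M. b x * f x) - (LINT x|M. \<Gamma> x (f x))"

text \<open>The direct method. \<open>\<Gamma>\<close> need not be differentiable, so the equation
  is obtained by representing the first variation of the remaining terms by \<open>w\<close>;
  minimality then relates \<open>w\<close> to difference quotients of \<open>\<Gamma>\<close>
  separately for positive and negative steps. The norm bound comes from comparison with the zero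
  function.\<close>

theorem variational_solution:
  fixes \<Gamma> :: "'a \<Rightarrow> real \<Rightarrow> real" and a b :: "'a \<Rightarrow> real"
  assumes meas: "(\<lambda>p. \<Gamma> (fst p) (snd p)) \<in> borel_measurable (borel \<Otimes>\<^sub>M borel)"
    and lip: "\<And>x s t. \<bar>\<Gamma> x s - \<Gamma> x t\<bar> \<le> K * \<bar>s - t\<bar>"
    and quad: "\<And>x t. \<bar>\<Gamma> x t\<bar> \<le> C * t\<^sup>2 / 2"
    and a: "a \<in> borel_measurable M" "AE x in M. \<bar>a x\<bar> \<le> A" "0 \<le> A"
    and b: "b \<in> borel_measurable M" "AE x in M. \<bar>b x\<bar> \<le> \<delta>" "0 \<le> \<delta>"
    and \<kappa>: "0 < \<kappa>"
    and coercive: "\<And>\<phi>. test_function \<Omega> \<phi> \<Longrightarrow>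
      \<kappa> * (l2norm M (jet \<phi>))\<^sup>2 \<le> (l2norm M (grad \<phi>))\<^sup>2 + (LINT x|M. a x * \<phi> x * \<phi> x) - C * (l2norm M \<phi>)\<^sup>2"
  shows "\<exists>U w. U \<in> W \<and> w \<in> L2 M \<and>
    (\<forall>\<psi>. test_function \<Omega> \<psi> \<longrightarrow> (LINT x|M. snd (U x) \<bullet> grad \<psi> x) = (LINT x|M. (w x - a x * fst (U x) - b x) * \<psi> x)) \<and>
    l2norm M (\<lambda>x. fst (U x)) \<le> 2 * (\<delta> * sqrt (measure M (space M))) / \<kappa> \<and>
    (\<forall>\<epsilon>>0. AE x in M. \<forall>m. (\<forall>h. 0 < h \<longrightarrow> h < \<epsilon> \<longrightarrow> m * h \<le> \<Gamma> x (fst (U x) + h) - \<Gamma> x (fst (U x))) \<longrightarrow> m \<le> w x) \<and>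
    (\<forall>\<epsilon>>0. AE x in M. \<forall>m. (\<forall>h. 0 < h \<longrightarrow> h < \<epsilon> \<longrightarrow> m * h \<le> \<Gamma> x (fst (U x) - h) - \<Gamma> x (fst (U x))) \<longrightarrow> m \<le> - w x)"
proof -
  define P where "P = lower_order a b \<Gamma>"
  define c where "c = sqrt (measure M (space M))"
  define \<beta> where "\<beta> = \<delta> * c"
  have c0: "0 \<le> c" by (simp add: c_def)
  have beta0: "0 \<le> \<beta>" using b(3) c0 by (simp add: \<beta>_def)
  have K0: "0 \<le> K" using order_trans[OF abs_ge_zero lip[of undefined 1 0]] by simp
  have G0: "\<Gamma> x 0 = 0" for x using quad[of x 0] by simp
  have comp: "(\<lambda>x. \<Gamma> x (f x)) \<in> borel_measurable M" if f: "f \<in> borel_measurable M" for f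
  proof -
    have "(\<lambda>x. (x, f x)) \<in> M \<rightarrow>\<^sub>M (borel \<Otimes>\<^sub>M borel)"
      by (rule measurable_Pair[OF borel_measurable_M f]) simp
    from measurable_compose[OF this meas] show ?thesis by simp
  qed
  have GL: "(\<lambda>x. \<Gamma> x (f x)) \<in> L2 M" if f: "f \<in> L2 M" for f
  proof (rule L2_dominated(1)[OF comp[OF L2_measurable[OF f]] L2_cmult[OF f, of K] AE_I2])
    show "norm (\<Gamma> x (f x)) \<le> norm (K *\<^sub>R f x)" for x
      using lip[of x "f x" 0] K0 by (simp add: G0 abs_mult)
  qed
  note aL = L2_mult_bounded[OF a]
  have bL: "b \<in> L2 M" by (rule L2_bounded[OF b(1)]) (use b(2) in simp)
  have bnorm: "l2norm M b \<le> \<beta>"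
    using L2_dominated(2)[OF b(1) L2_const[of \<delta>]] b l2norm_mult[of M \<delta> "\<lambda>_. 1"]
    by (simp add: l2norm_const_1 \<beta>_def c_def)
  have intA: "integrable M (\<lambda>x. a x * f x * g x)" if "f \<in> L2 M" "g \<in> L2 M" for f g
    by (rule L2_mult_integrable[OF aL(1)[OF that(1)] that(2)])
  have intb: "integrable M (\<lambda>x. b x * f x)" if "f \<in> L2 M" for f by (rule L2_mult_integrable[OF bL that])
  have intG: "integrable M (\<lambda>x. \<Gamma> x (f x))" if "f \<in> L2 M" for f by (rule L2_imp_integrable[OF GL[OF that]])
  have Gdiff: "\<bar>(LINT x|M. \<Gamma> x (f x) - \<Gamma> x (g x))\<bar> \<le> K * c * l2norm M (\<lambda>x. f x - g x)" if fg: "f \<in> L2 M" "g \<in> L2 M" for f g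
  proof -
    have "\<bar>(LINT x|M. \<Gamma> x (f x) - \<Gamma> x (g x))\<bar> \<le> (LINT x|M. \<bar>\<Gamma> x (f x) - \<Gamma> x (g x)\<bar>)"
      using integral_norm_bound[of M "\<lambda>x. \<Gamma> x (f x) - \<Gamma> x (g x)"] by simp
    also have "\<dots> \<le> (LINT x|M. K * norm (f x - g x))"
    proof (rule integral_mono)
      show "integrable M (\<lambda>x. \<bar>\<Gamma> x (f x) - \<Gamma> x (g x)\<bar>)"
        by (intro integrable_abs Bochner_Integration.integrable_diff intG fg)
      show "integrable M (\<lambda>x. K * norm (f x - g x))"
        by (intro integrable_mult_right L2_integrable_norm L2_diff fg)
    qed (use lip in simp)
    also have "\<dots> = K * (LINT x|M. norm (f x - g x))" by simp
    also have "\<dots> \<le> K * (c * l2norm M (\<lambda>x. f x - g x))"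
      unfolding c_def by (rule mult_left_mono[OF L1_le_L2[OF L2_diff[OF fg]] K0])
    finally show ?thesis by (simp add: mult.assoc)
  qed
  \<comment> \<open>The three summands of the constant belong to the quadratic form of
    \<open>a\<close>, to \<open>b\<close>, and to \<open>\<Gamma>\<close>, whose pointwise Lipschitz
    bound passes from L1 to L2 at the cost of \<open>c\<close>.\<close>
  have P: "L2_lipschitz P (A / 2 + \<beta> + K * c)"
    unfolding L2_lipschitz_def
  proof (intro conjI ballI)
    show "0 \<le> A / 2 + \<beta> + K * c" using a(3) beta0 K0 c0 by simp
    fix f g :: "'a \<Rightarrow> real" assume fg: "f \<in> L2 M" "g \<in> L2 M"
    let ?d = "l2norm M (\<lambda>x. f x - g x)" and ?s = "l2norm M f + l2norm M g"
    have dL: "(\<lambda>x. f x - g x) \<in> L2 M" and sL: "(\<lambda>x. f x + g x) \<in> L2 M"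
      by (rule L2_diff[OF fg], rule L2_add[OF fg])
    have 1: "\<bar>(LINT x|M. a x * f x * f x) - (LINT x|M. a x * g x * g x)\<bar> \<le> A * ?s * ?d"
    proof -
      have "(LINT x|M. a x * f x * f x) - (LINT x|M. a x * g x * g x) = (LINT x|M. a x * f x * f x - a x * g x * g x)"
        by (rule Bochner_Integration.integral_diff[symmetric, OF intA[OF fg(1,1)] intA[OF fg(2,2)]])
      also have "\<dots> = (LINT x|M. (a x * (f x - g x)) \<bullet> (f x + g x))"
        by (intro Bochner_Integration.integral_cong refl) (simp add: algebra_simps)
      finally have "\<bar>(LINT x|M. a x * f x * f x) - (LINT x|M. a x * g x * g x)\<bar> \<le> l2norm M (\<lambda>x. a x * (f x - g x)) * l2norm M (\<lambda>x. f x + g x)"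
        using L2_Cauchy_Schwarz[OF aL(1)[OF dL] sL] by simp
      also have "\<dots> \<le> (A * ?d) * ?s"
        by (intro mult_mono aL(2)[OF dL] l2norm_triangle[OF fg]) (use a(3) in auto)
      finally show ?thesis by (simp add: mult_ac)
    qed
    have 2: "\<bar>(LINT x|M. b x * f x) - (LINT x|M. b x * g x)\<bar> \<le> \<beta> * ?d"
    proof -
      have "(LINT x|M. b x * f x) - (LINT x|M. b x * g x) = (LINT x|M. b x * f x - b x * g x)"
        by (rule Bochner_Integration.integral_diff[symmetric, OF intb[OF fg(1)] intb[OF fg(2)]])
      also have "\<dots> = (LINT x|M. b x \<bullet> (f x - g x))"
        by (intro Bochner_Integration.integral_cong refl) (simp add: algebra_simps)
      finally have "\<bar>(LINT x|M. b x * f x) - (LINT x|M. b x * g x)\<bar> \<le> l2norm M b * ?d"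
        using L2_Cauchy_Schwarz[OF bL dL] by simp
      also have "\<dots> \<le> \<beta> * ?d" by (rule mult_right_mono[OF bnorm]) simp
      finally show ?thesis .
    qed
    have 3: "\<bar>(LINT x|M. \<Gamma> x (f x)) - (LINT x|M. \<Gamma> x (g x))\<bar> \<le> K * c * ?d"
      using Gdiff[OF fg] Bochner_Integration.integral_diff[OF intG[OF fg(1)] intG[OF fg(2)]] by simp
    have triangle: "\<bar>(a1 / 2 + b1 - g1) - (a2 / 2 + b2 - g2)\<bar> \<le> p / 2 + q + r"
      if "\<bar>a1 - a2\<bar> \<le> p" "\<bar>b1 - b2\<bar> \<le> q" "\<bar>g1 - g2\<bar> \<le> r" for a1 a2 b1 b2 g1 g2 p q r :: real
      using that by linarith
    have "\<bar>P f - P g\<bar> \<le> A * ?s * ?d / 2 + \<beta> * ?d + K * c * ?d"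
      unfolding P_def lower_order_def by (rule triangle[OF 1 2 3])
    also have "\<dots> = (A / 2 * ?s + \<beta> + K * c) * ?d" by (simp add: distrib_right)
    also have "\<dots> \<le> ((A / 2 + \<beta> + K * c) * (1 + ?s)) * ?d"
    proof (rule mult_right_mono)
      have "0 \<le> A / 2" "0 \<le> (\<beta> + K * c) * ?s" using a(3) beta0 K0 c0 by simp_all
      then show "A / 2 * ?s + \<beta> + K * c \<le> (A / 2 + \<beta> + K * c) * (1 + ?s)" by (simp add: algebra_simps)
    qed simp
    finally show "\<bar>P f - P g\<bar> \<le> (A / 2 + \<beta> + K * c) * (1 + l2norm M f + l2norm M g) * ?d"
      by (simp add: add.assoc)
  qed
  \<comment> \<open>The quadratic bound on \<open>\<Gamma>\<close> costs half of
    \<open>C * (l2norm M \<phi>)\<^sup>2\<close>, precisely the amount already subtracted in the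
    coercivity hypothesis.\<close>
  have coerc: "\<kappa> / 2 * (l2norm M (jet \<phi>))\<^sup>2 - \<beta> * l2norm M (jet \<phi>) \<le> energy P (jet \<phi>)" if t: "test_function \<Omega> \<phi>" for \<phi>
  proof -
    note L = test_L2[OF t]
    have "(LINT x|M. \<Gamma> x (\<phi> x)) \<le> (LINT x|M. C / 2 * (norm (\<phi> x))\<^sup>2)"
    proof (rule integral_mono[OF intG[OF L]])
      show "integrable M (\<lambda>x. C / 2 * (norm (\<phi> x))\<^sup>2)" by (intro integrable_mult_right L2_integrable L)
      show "\<Gamma> x (\<phi> x) \<le> C / 2 * (norm (\<phi> x))\<^sup>2" for x using abs_le_D1[OF quad[of x "\<phi> x"]] by simp
    qed
    then have 1: "(LINT x|M. \<Gamma> x (\<phi> x)) \<le> C / 2 * (l2norm M \<phi>)\<^sup>2" by (simp add: l2norm_power2)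
    have "l2norm M \<phi> \<le> l2norm M (jet \<phi>)" using l2norm_fst[OF jet_L2[OF t]] by (simp add: jet_def)
    then have "l2norm M b * l2norm M \<phi> \<le> \<beta> * l2norm M (jet \<phi>)" by (intro mult_mono bnorm) (auto simp: beta0)
    then have 2: "- (\<beta> * l2norm M (jet \<phi>)) \<le> (LINT x|M. b x * \<phi> x)"
      using L2_Cauchy_Schwarz[OF bL L] by (simp add: abs_le_iff)
    have arith: "\<kappa> / 2 * N - \<beta>' \<le> g / 2 + (a' / 2 + b' - G)"
      if "G \<le> C / 2 * f" "- \<beta>' \<le> b'" "\<kappa> * N \<le> g + a' - C * f" for N \<beta>' g a' b' G f :: real
      using that by (simp add: algebra_simps)
    show ?thesis unfolding energy_jet P_def lower_order_def by (rule arith[OF 1 2 coercive[OF t]])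
  qed
  define S where "S = energy P ` jet ` {\<phi>. test_function \<Omega> \<phi>}"
  define I where "I = Inf S"
  have zero: "energy P (jet (\<lambda>x. 0)) = 0"
  proof -
    have "grad (\<lambda>x. 0) = (\<lambda>x. 0 :: 'a)" by (simp add: grad_def partial_deriv_const fun_eq_iff)
    then show ?thesis by (simp add: energy_jet P_def lower_order_def l2norm_def G0)
  qed
  have S0: "0 \<in> S"
    unfolding S_def
    by (rule image_eqI[of 0 "energy P" "jet (\<lambda>x. 0)", OF zero[symmetric]]) (rule imageI, simp add: test_zero)
  have lowS: "- (\<beta>\<^sup>2 / (2 * \<kappa>)) \<le> energy P (jet \<phi>)" if "test_function \<Omega> \<phi>" for \<phi>
  proof -
    have "0 \<le> \<kappa> / 2 * (l2norm M (jet \<phi>) - \<beta> / \<kappa>)\<^sup>2" using \<kappa> by simp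
    also have "\<dots> = \<kappa> / 2 * (l2norm M (jet \<phi>))\<^sup>2 - \<beta> * l2norm M (jet \<phi>) + \<beta>\<^sup>2 / (2 * \<kappa>)"
      using \<kappa> by (simp add: power2_eq_square field_simps)
    finally show ?thesis using coerc[OF that] by linarith
  qed
  have bdd: "bdd_below S" unfolding S_def by (rule bdd_belowI[of _ "- (\<beta>\<^sup>2 / (2 * \<kappa>))"]) (use lowS in auto)
  have lower: "I \<le> energy P (jet \<phi>)" if "test_function \<Omega> \<phi>" for \<phi>
    unfolding I_def by (rule cInf_lower[OF _ bdd]) (use that in \<open>auto simp: S_def\<close>)
  have I0: "I \<le> 0" unfolding I_def by (rule cInf_lower[OF S0 bdd])
  have "\<exists>\<phi>. test_function \<Omega> \<phi> \<and> energy P (jet \<phi>) < I + 1 / real (Suc n)" for n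
  proof -
    have "\<exists>y\<in>S. y < I + 1 / real (Suc n)"
      by (rule cInf_lessD) (use S0 in \<open>auto simp: I_def\<close>)
    then show ?thesis by (auto simp: S_def)
  qed
  then obtain \<phi> where phi: "\<And>n::nat. test_function \<Omega> (\<phi> n)" "\<And>n. energy P (jet (\<phi> n)) < I + 1 / real (Suc n)" by metis
  have lim: "(\<lambda>n. energy P (jet (\<phi> n))) \<longlonglongrightarrow> I"
  proof (rule tendsto_sandwich[OF always_eventually always_eventually tendsto_const])
    show "(\<lambda>n. I + 1 / real (Suc n)) \<longlonglongrightarrow> I"
      using tendsto_add[OF tendsto_const[of I] LIMSEQ_Suc[OF lim_1_over_n]] by simp
  qed (use lower[OF phi(1)] phi(2) in \<open>auto intro: less_imp_le\<close>)
  \<comment> \<open>For a norm N above 1 the excess 1/(n+1) of the energy is absorbed into N, and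
    the quadratic inequality can be divided by N.\<close>
  have bound: "l2norm M (jet (\<phi> n)) \<le> 1 + 2 * (1 + \<beta>) / \<kappa>" for n
  proof (cases "l2norm M (jet (\<phi> n)) \<le> 1")
    case True
    moreover have "0 \<le> 2 * (1 + \<beta>) / \<kappa>" using beta0 \<kappa> by simp
    ultimately show ?thesis by linarith
  next
    case False
    define N where "N = l2norm M (jet (\<phi> n))"
    have N: "1 < N" using False by (simp add: N_def)
    have "1 / real (Suc n) \<le> 1" by simp
    then have "\<kappa> / 2 * N\<^sup>2 - \<beta> * N \<le> 1"
      using coerc[OF phi(1), of n] phi(2)[of n] I0 unfolding N_def by linarith
    then have "(\<kappa> / 2 * N) * N \<le> (1 + \<beta>) * N" using N by (simp add: power2_eq_square algebra_simps)
    then have "\<kappa> / 2 * N \<le> 1 + \<beta>" using N by (simp add: mult_le_cancel_right)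
    then have "N \<le> 2 * (1 + \<beta>) / \<kappa>" using \<kappa> by (simp add: field_simps)
    then show ?thesis by (simp add: N_def)
  qed
  have "\<exists>U r. U \<in> W \<and> strict_mono (r :: nat \<Rightarrow> nat) \<and> energy P U = I \<and>
    (\<lambda>n. l2norm M (\<lambda>x. jet (\<phi> (r n)) x - U x)) \<longlonglongrightarrow> 0 \<and>
    (\<forall>\<psi> t. test_function \<Omega> \<psi> \<longrightarrow> I \<le> energy P (\<lambda>x. U x + t *\<^sub>R jet \<psi> x))"
    by (rule minimizer_exists[OF P lower phi(1) bound lim])
  then obtain U where "\<exists>r. U \<in> W \<and> strict_mono (r :: nat \<Rightarrow> nat) \<and> energy P U = I \<and>
    (\<lambda>n. l2norm M (\<lambda>x. jet (\<phi> (r n)) x - U x)) \<longlonglongrightarrow> 0 \<and>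
    (\<forall>\<psi> t. test_function \<Omega> \<psi> \<longrightarrow> I \<le> energy P (\<lambda>x. U x + t *\<^sub>R jet \<psi> x))" ..
  then obtain r where Ur: "U \<in> W \<and> strict_mono (r :: nat \<Rightarrow> nat) \<and> energy P U = I \<and>
    (\<lambda>n. l2norm M (\<lambda>x. jet (\<phi> (r n)) x - U x)) \<longlonglongrightarrow> 0 \<and>
    (\<forall>\<psi> t. test_function \<Omega> \<psi> \<longrightarrow> I \<le> energy P (\<lambda>x. U x + t *\<^sub>R jet \<psi> x))" ..
  have U: "U \<in> W" "strict_mono r" "energy P U = I" "(\<lambda>n. l2norm M (\<lambda>x. jet (\<phi> (r n)) x - U x)) \<longlonglongrightarrow> 0"
    using Ur by simp_all
  have UL: "U \<in> L2 M" by (rule W_L2[OF U(1)])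
  define u where "u = (\<lambda>x. fst (U x))"
  define v where "v = (\<lambda>x. snd (U x))"
  have uL: "u \<in> L2 M" and vL: "v \<in> L2 M" unfolding u_def v_def by (rule L2_fst[OF UL], rule L2_snd[OF UL])
  \<comment> \<open>The minimum is at most 0, the energy of the zero function, so the quadratic
    coercive term cannot exceed the linear term coming from \<open>b\<close>.\<close>
  have small: "l2norm M u \<le> 2 * \<beta> / \<kappa>"
  proof -
    define N where "N = l2norm M U"
    have "\<kappa> / 2 * N\<^sup>2 - \<beta> * N \<le> I"
    proof (rule LIMSEQ_le)
      show "(\<lambda>n. \<kappa> / 2 * (l2norm M (jet (\<phi> (r n))))\<^sup>2 - \<beta> * l2norm M (jet (\<phi> (r n)))) \<longlonglongrightarrow> \<kappa> / 2 * N\<^sup>2 - \<beta> * N"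
        unfolding N_def by (intro tendsto_intros l2norm_tendsto[OF jet_L2[OF phi(1)] UL U(4)])
      show "(\<lambda>n. energy P (jet (\<phi> (r n)))) \<longlonglongrightarrow> I"
        using LIMSEQ_subseq_LIMSEQ[OF lim U(2)] by (simp add: comp_def)
    qed (use coerc[OF phi(1)] in blast)
    then have "N * (\<kappa> / 2 * N - \<beta>) \<le> 0" using I0 by (simp add: power2_eq_square algebra_simps)
    moreover have "0 \<le> N" by (simp add: N_def)
    ultimately have "N \<le> 2 * \<beta> / \<kappa>"
    proof (cases "N = 0")
      case True
      then show ?thesis using beta0 \<kappa> by simp
    next
      case False
      then have "\<kappa> / 2 * N - \<beta> \<le> 0" using \<open>N * (\<kappa> / 2 * N - \<beta>) \<le> 0\<close> \<open>0 \<le> N\<close> by (simp add: mult_le_0_iff)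
      then show ?thesis using \<kappa> by (simp add: field_simps)
    qed
    moreover have "l2norm M u \<le> N" unfolding u_def N_def by (rule l2norm_fst[OF UL])
    ultimately show ?thesis by linarith
  qed
  \<comment> \<open>First variation at u of everything except the \<open>\<Gamma>\<close> term;
    \<open>q\<close> is the coefficient of the second-order remainder.\<close>
  define L where "L = (\<lambda>\<psi>. (LINT x|M. v x \<bullet> grad \<psi> x) + (LINT x|M. a x * u x * \<psi> x) + (LINT x|M. b x * \<psi> x))"
  define q where "q = (\<lambda>\<psi>. ((l2norm M (grad \<psi>))\<^sup>2 + (LINT x|M. a x * \<psi> x * \<psi> x)) / 2)"
  have variation: "(LINT x|M. \<Gamma> x (u x + t * \<psi> x) - \<Gamma> x (u x)) \<le> t * L \<psi> + t\<^sup>2 * q \<psi>" if psi: "test_function \<Omega> \<psi>" for \<psi> t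
  proof -
    note pL = test_L2[OF psi]
    have upL: "(\<lambda>x. u x + t * \<psi> x) \<in> L2 M" by (rule L2_add[OF uL test_L2[OF test_cmult[OF psi]]])
    have 1: "(LINT x|M. a x * (u x + t * \<psi> x) * (u x + t * \<psi> x)) = (LINT x|M. a x * u x * u x) + 2 * t * (LINT x|M. a x * u x * \<psi> x) + t\<^sup>2 * (LINT x|M. a x * \<psi> x * \<psi> x)"
    proof -
      have "(LINT x|M. a x * (u x + t * \<psi> x) * (u x + t * \<psi> x)) = (LINT x|M. (a x * u x * u x + 2 * t * (a x * u x * \<psi> x)) + t\<^sup>2 * (a x * \<psi> x * \<psi> x))"
        by (intro Bochner_Integration.integral_cong refl) (simp add: algebra_simps power2_eq_square)
      then show ?thesis using intA[OF uL uL] intA[OF uL pL] intA[OF pL pL] by simp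
    qed
    have 2: "(LINT x|M. b x * (u x + t * \<psi> x)) = (LINT x|M. b x * u x) + t * (LINT x|M. b x * \<psi> x)"
    proof -
      have "(LINT x|M. b x * (u x + t * \<psi> x)) = (LINT x|M. b x * u x + t * (b x * \<psi> x))"
        by (intro Bochner_Integration.integral_cong refl) (simp add: algebra_simps)
      then show ?thesis using intb[OF uL] intb[OF pL] by simp
    qed
    have 3: "(LINT x|M. \<Gamma> x (u x + t * \<psi> x) - \<Gamma> x (u x)) = (LINT x|M. \<Gamma> x (u x + t * \<psi> x)) - (LINT x|M. \<Gamma> x (u x))"
      by (rule Bochner_Integration.integral_diff[OF intG[OF upL] intG[OF uL]])
    have f: "(\<lambda>x. fst (U x + t *\<^sub>R jet \<psi> x)) = (\<lambda>x. u x + t * \<psi> x)" by (simp add: jet_def u_def)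
    have "energy P U \<le> energy P (\<lambda>x. U x + t *\<^sub>R jet \<psi> x)" using Ur psi by simp
    then have "(l2norm M v)\<^sup>2 / 2 + P u \<le> ((l2norm M v)\<^sup>2 + 2 * t * (LINT x|M. v x \<bullet> grad \<psi> x) + t\<^sup>2 * (l2norm M (grad \<psi>))\<^sup>2) / 2 + P (\<lambda>x. u x + t * \<psi> x)"
      unfolding energy_def f l2norm_snd_add_jet[OF UL psi] by (simp add: u_def v_def)
    then show ?thesis unfolding P_def lower_order_def 1 2 3 L_def q_def by (simp add: algebra_simps add_divide_distrib)
  qed
  have Llin: "L (\<lambda>x. \<phi> x + t * \<psi> x) = L \<phi> + t * L \<psi>" if tt: "test_function \<Omega> \<phi>" "test_function \<Omega> \<psi>" for \<phi> \<psi> t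
  proof -
    have g: "grad (\<lambda>x. \<phi> x + t * \<psi> x) x = grad \<phi> x + t *\<^sub>R grad \<psi> x" for x
      using jet_add_cmult[OF tt, of t x] by (simp add: jet_def)
    note i = L2_inner_integrable[OF vL test_grad_L2[OF tt(1)]] L2_inner_integrable[OF vL test_grad_L2[OF tt(2)]]
      intA[OF uL test_L2[OF tt(1)]] intA[OF uL test_L2[OF tt(2)]] intb[OF test_L2[OF tt(1)]] intb[OF test_L2[OF tt(2)]]
    have "(LINT x|M. v x \<bullet> grad (\<lambda>x. \<phi> x + t * \<psi> x) x) = (LINT x|M. v x \<bullet> grad \<phi> x) + t * (LINT x|M. v x \<bullet> grad \<psi> x)"
      unfolding g using i(1,2) by (simp add: inner_add_right)
    moreover have "(LINT x|M. a x * u x * (\<phi> x + t * \<psi> x)) = (LINT x|M. a x * u x * \<phi> x) + t * (LINT x|M. a x * u x * \<psi> x)"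
    proof -
      have "(LINT x|M. a x * u x * (\<phi> x + t * \<psi> x)) = (LINT x|M. a x * u x * \<phi> x + t * (a x * u x * \<psi> x))"
        by (intro Bochner_Integration.integral_cong refl) (simp add: algebra_simps)
      then show ?thesis using i(3,4) by simp
    qed
    moreover have "(LINT x|M. b x * (\<phi> x + t * \<psi> x)) = (LINT x|M. b x * \<phi> x) + t * (LINT x|M. b x * \<psi> x)"
    proof -
      have "(LINT x|M. b x * (\<phi> x + t * \<psi> x)) = (LINT x|M. b x * \<phi> x + t * (b x * \<psi> x))"
        by (intro Bochner_Integration.integral_cong refl) (simp add: algebra_simps)
      then show ?thesis using i(5,6) by simp
    qed
    ultimately show ?thesis by (simp add: L_def algebra_simps)
  qed
  \<comment> \<open>Minimality bounds \<open>L\<close> below by the change of the Lipschitz term.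
    Applied to \<psi> and to its negative this makes \<open>L\<close> continuous in the L2 norm
    alone, although it contains a gradient, so that a Riesz representation applies.\<close>
  have Llow: "- (K * c * l2norm M \<psi>) \<le> L \<psi>" if psi: "test_function \<Omega> \<psi>" for \<psi>
  proof -
    have step: "- (K * c * l2norm M \<psi>) \<le> L \<psi> + t * q \<psi>" if t: "t > 0" for t
    proof -
      have upL: "(\<lambda>x. u x + t * \<psi> x) \<in> L2 M" by (rule L2_add[OF uL test_L2[OF test_cmult[OF psi]]])
      have "- (K * c * (t * l2norm M \<psi>)) \<le> (LINT x|M. \<Gamma> x (u x + t * \<psi> x) - \<Gamma> x (u x))"
        using abs_le_D2[OF Gdiff[OF upL uL]] t by (simp add: l2norm_mult)
      also note variation[OF psi]
      finally have "0 \<le> t * (L \<psi> + t * q \<psi> + K * c * l2norm M \<psi>)" by (simp add: power2_eq_square algebra_simps)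
      then show ?thesis using t by (simp add: zero_le_mult_iff)
    qed
    have "(\<lambda>n. L \<psi> + (1 / real (Suc n)) * q \<psi>) \<longlonglongrightarrow> L \<psi> + 0 * q \<psi>"
      by (intro tendsto_intros LIMSEQ_Suc[OF lim_1_over_n])
    then have "- (K * c * l2norm M \<psi>) \<le> L \<psi> + 0 * q \<psi>"
      by (rule LIMSEQ_le_const) (intro exI allI impI step, simp)
    then show ?thesis by simp
  qed
  have Lbound: "\<bar>L \<psi>\<bar> \<le> (K * c) * l2norm M \<psi>" if psi: "test_function \<Omega> \<psi>" for \<psi>
  proof -
    have "L (\<lambda>x. 0) = 0"
    proof -
      have "L (\<lambda>x. 0 + 1 * 0) = L (\<lambda>x. 0) + 1 * L (\<lambda>x. 0)" by (rule Llin[OF test_zero test_zero])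
      then show ?thesis by simp
    qed
    then have neg: "L (\<lambda>x. - \<psi> x) = - L \<psi>" using Llin[OF test_zero psi, of "-1"] by simp
    have "l2norm M (\<lambda>x. - \<psi> x) = l2norm M \<psi>" by (simp add: l2norm_def)
    then have "- (K * c * l2norm M \<psi>) \<le> - L \<psi>"
      using Llow[OF test_cmult[OF psi, of "-1"]] by (simp add: neg)
    with Llow[OF psi] show ?thesis by (simp add: abs_le_iff)
  qed
  obtain w where w: "w \<in> L2 M" "\<forall>\<psi>. test_function \<Omega> \<psi> \<longrightarrow> L \<psi> = (LINT x|M. w x * \<psi> x)"
    using riesz_test_functions[of L "K * c", OF Llin Lbound] ..
  have wL: "L \<psi> = (LINT x|M. w x * \<psi> x)" if "test_function \<Omega> \<psi>" for \<psi> using w(2) that by simp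
  have equation: "(LINT x|M. v x \<bullet> grad \<psi> x) = (LINT x|M. (w x - a x * u x - b x) * \<psi> x)" if psi: "test_function \<Omega> \<psi>" for \<psi>
  proof -
    note i = L2_mult_integrable[OF w(1) test_L2[OF psi]] intA[OF uL test_L2[OF psi]] intb[OF test_L2[OF psi]]
    have "(LINT x|M. (w x - a x * u x - b x) * \<psi> x) = (LINT x|M. (w x * \<psi> x - a x * u x * \<psi> x) - b x * \<psi> x)"
      by (intro Bochner_Integration.integral_cong refl) (simp add: algebra_simps)
    also have "\<dots> = (LINT x|M. w x * \<psi> x) - (LINT x|M. a x * u x * \<psi> x) - (LINT x|M. b x * \<psi> x)"
      using i by simp
    finally show ?thesis using wL[OF psi] by (simp add: L_def)
  qed
  have var1: "(LINT x|M. \<Gamma> x (u x + t * \<psi> x) - \<Gamma> x (u x)) \<le> t * (LINT x|M. w x * \<psi> x) + t\<^sup>2 * q \<psi>" if "test_function \<Omega> \<psi>" for \<psi> t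
    using variation[OF that] by (simp add: wL[OF that])
  have up: "AE x in M. \<forall>m. (\<forall>h. 0 < h \<longrightarrow> h < \<epsilon> \<longrightarrow> m * h \<le> \<Gamma> x (u x + h) - \<Gamma> x (u x)) \<longrightarrow> m \<le> w x" if "\<epsilon> > 0" for \<epsilon>
    by (rule one_sided_derivative_le[OF meas lip uL w(1) var1 that])
  \<comment> \<open>Steps to the left are steps to the right for the reflected data
    \<open>\<Gamma> x (- s)\<close>, - u and - w, to which the same lemma applies.\<close>
  have down: "AE x in M. \<forall>m. (\<forall>h. 0 < h \<longrightarrow> h < \<epsilon> \<longrightarrow> m * h \<le> \<Gamma> x (u x - h) - \<Gamma> x (u x)) \<longrightarrow> m \<le> - w x" if "\<epsilon> > 0" for \<epsilon>
  proof -
    have meas': "(\<lambda>p. \<Gamma> (fst p) (- snd p)) \<in> borel_measurable (borel \<Otimes>\<^sub>M borel)"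
    proof -
      have "(\<lambda>p. (fst p, - snd p)) \<in> (borel \<Otimes>\<^sub>M borel) \<rightarrow>\<^sub>M ((borel :: 'a measure) \<Otimes>\<^sub>M (borel :: real measure))"
        by measurable
      from measurable_compose[OF this meas] show ?thesis by simp
    qed
    have lip': "\<bar>\<Gamma> x (- s) - \<Gamma> x (- t)\<bar> \<le> K * \<bar>s - t\<bar>" for x s t
      using lip[of x "- s" "- t"] by (simp add: abs_minus_commute)
    have uL': "(\<lambda>x. - u x) \<in> L2 M" "(\<lambda>x. - w x) \<in> L2 M"
      using L2_cmult[OF uL, of "-1"] L2_cmult[OF w(1), of "-1"] by simp_all
    have var': "(LINT x|M. \<Gamma> x (- (- u x + t * \<psi> x)) - \<Gamma> x (- (- u x))) \<le> t * (LINT x|M. - w x * \<psi> x) + t\<^sup>2 * q \<psi>"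
      if "test_function \<Omega> \<psi>" for \<psi> t
      using var1[OF that, of "- t"] by simp
    have "AE x in M. \<forall>m. (\<forall>h. 0 < h \<longrightarrow> h < \<epsilon> \<longrightarrow> m * h \<le> \<Gamma> x (- (- u x + h)) - \<Gamma> x (- (- u x))) \<longrightarrow> m \<le> - w x"
      by (rule one_sided_derivative_le[of "\<lambda>x s. \<Gamma> x (- s)" K "\<lambda>x. - u x" "\<lambda>x. - w x" q \<epsilon>, OF meas' lip' uL' var' that])
    then show ?thesis by simp
  qed
  show ?thesis
  proof (intro exI[of _ U] exI[of _ w] conjI allI impI)
    show "U \<in> W" "w \<in> L2 M" by (rule U(1), rule w(1))
    show "l2norm M (\<lambda>x. fst (U x)) \<le> 2 * (\<delta> * sqrt (measure M (space M))) / \<kappa>"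
      using small by (simp add: u_def \<beta>_def c_def)
  qed (use equation up down in \<open>simp_all add: u_def v_def\<close>)
qed

end

section \<open>Envelopes and primitives\<close>

abbreviation local_essinf :: "(real \<Rightarrow> real) \<Rightarrow> real \<Rightarrow> real \<Rightarrow> ereal" where
  "local_essinf f t \<eta> \<equiv> essinf (lebesgue_on {s. \<bar>t - s\<bar> < \<eta>}) (\<lambda>s. ereal (f s))"

lemma interval_sets: "{s::real. \<bar>t - s\<bar> < \<eta>} \<in> sets lebesgue"
proof -
  have "{s. \<bar>t - s\<bar> < \<eta>} = ball t \<eta>" by (auto simp: dist_real_def)
  then show ?thesis by simp
qed

lemma local_essinf_AE: "AE s in lebesgue. \<bar>t - s\<bar> < \<eta> \<longrightarrow> local_essinf f t \<eta> \<le> ereal (f s)"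
proof -
  have "AE s in lebesgue_on {s. \<bar>t - s\<bar> < \<eta>}. - ereal (f s) \<le> esssup (lebesgue_on {s. \<bar>t - s\<bar> < \<eta>}) (\<lambda>s. - ereal (f s))"
    by (rule esssup_AE)
  then have "AE s in lebesgue. s \<in> {s. \<bar>t - s\<bar> < \<eta>} \<longrightarrow> - ereal (f s) \<le> esssup (lebesgue_on {s. \<bar>t - s\<bar> < \<eta>}) (\<lambda>s. - ereal (f s))"
    by (rule AE_lebesgue_on_iff[OF interval_sets, THEN iffD1])
  then show ?thesis
    unfolding essinf_def by eventually_elim (simp add: ereal_uminus_le_reorder)
qed

lemma local_essinf_greatest:
  assumes f: "f \<in> borel_measurable lebesgue" and ae: "AE s in lebesgue. \<bar>t - s\<bar> < \<eta> \<longrightarrow> c \<le> ereal (f s)"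
  shows "c \<le> local_essinf f t \<eta>"
proof -
  have m: "(\<lambda>s. - ereal (f s)) \<in> borel_measurable (lebesgue_on {s. \<bar>t - s\<bar> < \<eta>})"
    by (rule measurable_restrict_space1) (use f in measurable)
  have "AE s in lebesgue. s \<in> {s. \<bar>t - s\<bar> < \<eta>} \<longrightarrow> - ereal (f s) \<le> - c"
    using ae by eventually_elim (simp only: ereal_minus_le_minus mem_Collect_eq)
  then have "AE s in lebesgue_on {s. \<bar>t - s\<bar> < \<eta>}. - ereal (f s) \<le> - c"
    by (rule AE_lebesgue_on_iff[OF interval_sets, THEN iffD2])
  from esssup_I[OF m this] have "- (- c) \<le> local_essinf f t \<eta>"
    unfolding essinf_def by (simp only: ereal_minus_le_minus)
  then show ?thesis by simp
qed

lemma local_essinf_antimono: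
  assumes f: "f \<in> borel_measurable lebesgue" and "\<eta>' \<le> \<eta>"
  shows "local_essinf f t \<eta> \<le> local_essinf f t \<eta>'"
proof (rule local_essinf_greatest[OF f])
  show "AE s in lebesgue. \<bar>t - s\<bar> < \<eta>' \<longrightarrow> local_essinf f t \<eta> \<le> ereal (f s)"
    using local_essinf_AE[of t \<eta> f] by eventually_elim (use assms(2) in auto)
qed

lemma antimono_tendsto_SUP_at_right:
  fixes F :: "real \<Rightarrow> ereal"
  assumes anti: "\<And>\<eta> \<eta>'. 0 < \<eta>' \<Longrightarrow> \<eta>' \<le> \<eta> \<Longrightarrow> F \<eta> \<le> F \<eta>'"
  shows "(F \<longlongrightarrow> (SUP \<eta>\<in>{0<..}. F \<eta>)) (at_right 0)"
proof (rule order_tendstoI)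
  fix a assume "a < (SUP \<eta>\<in>{0<..}. F \<eta>)"
  then obtain \<eta> where e: "0 < \<eta>" "a < F \<eta>" by (auto simp: less_SUP_iff)
  show "eventually (\<lambda>\<eta>. a < F \<eta>) (at_right 0)"
    unfolding eventually_at_right_field
  proof (intro exI[of _ \<eta>] conjI allI impI)
    fix y assume "0 < y" "y < \<eta>"
    then show "a < F y" using less_le_trans[OF e(2) anti[of y \<eta>]] by simp
  qed (rule e(1))
next
  fix a assume a: "(SUP \<eta>\<in>{0<..}. F \<eta>) < a"
  show "eventually (\<lambda>\<eta>. F \<eta> < a) (at_right 0)"
    unfolding eventually_at_right_field
  proof (intro exI[of _ 1] conjI allI impI)
    fix y :: real assume "0 < y"
    then have "F y \<le> (SUP \<eta>\<in>{0<..}. F \<eta>)" by (intro SUP_upper) simp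
    with a show "F y < a" by (rule order.strict_trans1[rotated])
  qed simp
qed

lemma lower_env_tendsto:
  assumes "g x \<in> borel_measurable lebesgue"
  shows "(local_essinf (g x) t \<longlongrightarrow> lower_env g x t) (at_right 0)"
    and "lower_env g x t = (SUP \<eta>\<in>{0<..}. local_essinf (g x) t \<eta>)"
proof -
  have lim: "(local_essinf (g x) t \<longlongrightarrow> (SUP \<eta>\<in>{0<..}. local_essinf (g x) t \<eta>)) (at_right 0)"
    by (rule antimono_tendsto_SUP_at_right) (rule local_essinf_antimono[OF assms])
  have eq: "lower_env g x t = (SUP \<eta>\<in>{0<..}. local_essinf (g x) t \<eta>)"
    unfolding lower_env_def by (rule tendsto_Lim[OF _ lim]) simp
  then show "lower_env g x t = (SUP \<eta>\<in>{0<..}. local_essinf (g x) t \<eta>)" .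
  show "(local_essinf (g x) t \<longlongrightarrow> lower_env g x t) (at_right 0)" unfolding eq by (rule lim)
qed

lemma upper_env_eq:
  assumes "g x \<in> borel_measurable lebesgue"
  shows "upper_env g x t = - lower_env (\<lambda>x s. - g x s) x t"
proof -
  have m: "(\<lambda>s. - g x s) \<in> borel_measurable lebesgue" using assms by measurable
  have "((\<lambda>\<eta>. - local_essinf (\<lambda>s. - g x s) t \<eta>) \<longlongrightarrow> - lower_env (\<lambda>x s. - g x s) x t) (at_right 0)"
    using lower_env_tendsto(1)[of "\<lambda>x s. - g x s" x t, OF m] by (intro tendsto_uminus_ereal)
  then have "((\<lambda>\<eta>. esssup (lebesgue_on {s. \<bar>t - s\<bar> < \<eta>}) (\<lambda>s. ereal (g x s))) \<longlongrightarrow> - lower_env (\<lambda>x s. - g x s) x t) (at_right 0)"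
    by (simp add: essinf_def)
  then show ?thesis unfolding upper_env_def by (rule tendsto_Lim[rotated]) simp
qed

lemma lower_env_le:
  assumes m: "g x \<in> borel_measurable lebesgue" and \<eta>\<^sub>0: "0 < \<eta>\<^sub>0"
    and key: "\<And>m \<eta>. 0 < \<eta> \<Longrightarrow> \<eta> \<le> \<eta>\<^sub>0 \<Longrightarrow> (AE s in lebesgue. \<bar>t - s\<bar> < \<eta> \<longrightarrow> m \<le> g x s) \<Longrightarrow> m \<le> w"
  shows "lower_env g x t \<le> ereal w"
proof (rule tendsto_upperbound[OF lower_env_tendsto(1)[of g x t, OF m]])
  have "local_essinf (g x) t \<eta> \<le> ereal w" if e: "0 < \<eta>" "\<eta> \<le> \<eta>\<^sub>0" for \<eta>
  proof (rule ccontr)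
    assume "\<not> local_essinf (g x) t \<eta> \<le> ereal w"
    then have "ereal w < local_essinf (g x) t \<eta>" by simp
    then obtain c where c: "ereal w < ereal c" "ereal c < local_essinf (g x) t \<eta>"
      using ereal_dense2 by blast
    have "AE s in lebesgue. \<bar>t - s\<bar> < \<eta> \<longrightarrow> c \<le> g x s"
      using local_essinf_AE[of t \<eta> "g x"]
    proof eventually_elim
      case (elim s)
      show ?case
      proof
        assume "\<bar>t - s\<bar> < \<eta>"
        with elim have "local_essinf (g x) t \<eta> \<le> ereal (g x s)" by simp
        with c(2) have "ereal c < ereal (g x s)" by (rule less_le_trans)
        then show "c \<le> g x s" by simp
      qed
    qed
    from key[OF e this] c(1) show False by simp
  qed
  then show "eventually (\<lambda>\<eta>. local_essinf (g x) t \<eta> \<le> ereal w) (at_right 0)"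
    unfolding eventually_at_right_field by (intro exI[of _ \<eta>\<^sub>0]) (use \<eta>\<^sub>0 in auto)
qed simp

lemma upper_env_ge:
  assumes m: "g x \<in> borel_measurable lebesgue" and \<eta>\<^sub>0: "0 < \<eta>\<^sub>0"
    and key: "\<And>m \<eta>. 0 < \<eta> \<Longrightarrow> \<eta> \<le> \<eta>\<^sub>0 \<Longrightarrow> (AE s in lebesgue. \<bar>t - s\<bar> < \<eta> \<longrightarrow> g x s \<le> m) \<Longrightarrow> w \<le> m"
  shows "ereal w \<le> upper_env g x t"
proof -
  have "lower_env (\<lambda>x s. - g x s) x t \<le> ereal (- w)"
  proof (rule lower_env_le[OF _ \<eta>\<^sub>0])
    show "(\<lambda>s. - g x s) \<in> borel_measurable lebesgue" using m by measurable
    fix c \<eta> assume e: "0 < \<eta>" "\<eta> \<le> \<eta>\<^sub>0" and "AE s in lebesgue. \<bar>t - s\<bar> < \<eta> \<longrightarrow> c \<le> - g x s"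
    then have "AE s in lebesgue. \<bar>t - s\<bar> < \<eta> \<longrightarrow> g x s \<le> - c" by (auto elim: eventually_mono)
    from key[OF e this] show "c \<le> - w" by simp
  qed
  then have "- ereal (- w) \<le> - lower_env (\<lambda>x s. - g x s) x t" by (simp only: ereal_minus_le_minus)
  then show ?thesis unfolding upper_env_eq[of g x t, OF m] by simp
qed

section \<open>Primitives of integrable functions of one variable\<close>

lemma AE_lebesgue_iff_lborel: "(AE s in lebesgue. P s) \<longleftrightarrow> (AE s in lborel. P s)"
  by (simp add: AE_completion_iff)

text \<open>For integrable \<open>\<gamma>\<close> this is the oriented integral from 0. Half-lines
  avoid a case distinction on the sign of \<open>t\<close> and make joint measurability in
  \<open>t\<close> and a parameter immediate.\<close>

definition prim :: "(real \<Rightarrow> real) \<Rightarrow> real \<Rightarrow> real" where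
  "prim \<gamma> t = (LINT s|lborel. indicator {..t} s * \<gamma> s) - (LINT s|lborel. indicator {..0} s * \<gamma> s)"

lemma prim_0: "prim \<gamma> 0 = 0" by (simp add: prim_def)

lemma prim_diff:
  assumes i: "integrable lborel \<gamma>" and st: "s \<le> t"
  shows "prim \<gamma> t - prim \<gamma> s = (LINT r|lborel. indicator {s<..t} r * \<gamma> r)"
proof -
  have I: "integrable lborel (\<lambda>r. indicator {..a} r * \<gamma> r)" for a
    using integrable_mult_indicator[OF _ i, of "{..a}"] by simp
  have "prim \<gamma> t - prim \<gamma> s = (LINT r|lborel. indicator {..t} r * \<gamma> r) - (LINT r|lborel. indicator {..s} r * \<gamma> r)"
    by (simp add: prim_def)
  also have "\<dots> = (LINT r|lborel. indicator {..t} r * \<gamma> r - indicator {..s} r * \<gamma> r)"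
    by (rule Bochner_Integration.integral_diff[symmetric, OF I I])
  also have "\<dots> = (LINT r|lborel. indicator {s<..t} r * \<gamma> r)"
    by (intro Bochner_Integration.integral_cong refl) (use st in \<open>auto simp: indicator_def\<close>)
  finally show ?thesis .
qed

text \<open>Comparison with an explicit antiderivative. Linear ones give the slope bounds
  \<open>prim_ge\<close> and \<open>prim_le\<close>, quadratic ones the growth bound
  \<open>prim_quadratic\<close>.\<close>

lemma prim_compare:
  assumes i: "integrable lborel \<gamma>" and st: "s \<le> t"
    and F: "\<And>r. (F has_real_derivative l r) (at r)" "continuous_on {s..t} l"
  shows "(AE r in lborel. s < r \<and> r < t \<longrightarrow> l r \<le> \<gamma> r) \<Longrightarrow> F t - F s \<le> prim \<gamma> t - prim \<gamma> s"
    and "(AE r in lborel. s < r \<and> r < t \<longrightarrow> \<gamma> r \<le> l r) \<Longrightarrow> prim \<gamma> t - prim \<gamma> s \<le> F t - F s"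
proof -
  have "has_bochner_integral lborel (\<lambda>r. indicator {s..t} r *\<^sub>R l r) (F t - F s)"
  proof (rule has_bochner_integral_FTC_Icc[OF st _ F(2)])
    show "(F has_vector_derivative l r) (at r within {s..t})" for r
      using F(1)[of r] unfolding has_real_derivative_iff_has_vector_derivative
      by (rule has_vector_derivative_at_within)
  qed
  then have l: "integrable lborel (\<lambda>r. indicator {s..t} r * l r)" "(LINT r|lborel. indicator {s..t} r * l r) = F t - F s"
    by (simp_all add: has_bochner_integral_iff)
  have g: "integrable lborel (\<lambda>r. indicator {s<..t} r * \<gamma> r)"
    using integrable_mult_indicator[OF _ i, of "{s<..t}"] by simp
  have ne: "AE r in lborel. r \<noteq> s" "AE r in lborel. r \<noteq> t" by (rule AE_lborel_singleton)+
  show "F t - F s \<le> prim \<gamma> t - prim \<gamma> s" if "AE r in lborel. s < r \<and> r < t \<longrightarrow> l r \<le> \<gamma> r"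
    unfolding prim_diff[OF i st] l(2)[symmetric]
  proof (rule integral_mono_AE[OF l(1) g])
    show "AE r in lborel. indicator {s..t} r * l r \<le> indicator {s<..t} r * \<gamma> r"
      using that ne by eventually_elim (auto simp: indicator_def)
  qed
  show "prim \<gamma> t - prim \<gamma> s \<le> F t - F s" if "AE r in lborel. s < r \<and> r < t \<longrightarrow> \<gamma> r \<le> l r"
    unfolding prim_diff[OF i st] l(2)[symmetric]
  proof (rule integral_mono_AE[OF g l(1)])
    show "AE r in lborel. indicator {s<..t} r * \<gamma> r \<le> indicator {s..t} r * l r"
      using that ne by eventually_elim (auto simp: indicator_def)
  qed
qed

lemma prim_ge:
  assumes "integrable lborel \<gamma>" "s \<le> t" "AE r in lborel. s < r \<and> r < t \<longrightarrow> m \<le> \<gamma> r"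
  shows "m * (t - s) \<le> prim \<gamma> t - prim \<gamma> s"
proof -
  have "((\<lambda>r. m * r) has_real_derivative m) (at r)" for r by (auto intro!: derivative_eq_intros)
  from prim_compare(1)[OF assms(1,2) this _ assms(3)] show ?thesis by (simp add: right_diff_distrib)
qed

lemma prim_le:
  assumes "integrable lborel \<gamma>" "s \<le> t" "AE r in lborel. s < r \<and> r < t \<longrightarrow> \<gamma> r \<le> m"
  shows "prim \<gamma> t - prim \<gamma> s \<le> m * (t - s)"
proof -
  have "((\<lambda>r. m * r) has_real_derivative m) (at r)" for r by (auto intro!: derivative_eq_intros)
  from prim_compare(2)[OF assms(1,2) this _ assms(3)] show ?thesis by (simp add: right_diff_distrib)
qed

lemma prim_lipschitz:
  assumes i: "integrable lborel \<gamma>" and b: "\<And>r. \<bar>\<gamma> r\<bar> \<le> K"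
  shows "\<bar>prim \<gamma> s - prim \<gamma> t\<bar> \<le> K * \<bar>s - t\<bar>"
proof -
  have *: "\<bar>prim \<gamma> t - prim \<gamma> s\<bar> \<le> K * (t - s)" if "s \<le> t" for s t
    using prim_ge[OF i that, of "- K"] prim_le[OF i that, of K] b by (simp add: abs_le_iff minus_le_iff)
  show ?thesis using *[of s t] *[of t s] by (cases "s \<le> t") (auto simp: abs_minus_commute)
qed

lemma prim_quadratic:
  assumes i: "integrable lborel \<gamma>" and b: "\<And>r. \<bar>\<gamma> r\<bar> \<le> C * \<bar>r\<bar>"
  shows "\<bar>prim \<gamma> t\<bar> \<le> C * t\<^sup>2 / 2"
proof -
  have b': "\<gamma> r \<le> C * \<bar>r\<bar>" "- (C * \<bar>r\<bar>) \<le> \<gamma> r" for r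
    using abs_le_D1[OF b[of r]] abs_le_D2[OF b[of r]] by linarith+
  have b': "0 < r \<Longrightarrow> \<gamma> r \<le> C * r" "0 < r \<Longrightarrow> - (C * r) \<le> \<gamma> r"
    "r < 0 \<Longrightarrow> \<gamma> r \<le> - (C * r)" "r < 0 \<Longrightarrow> C * r \<le> \<gamma> r" for r
    using b'[of r] by simp_all
  have F: "((\<lambda>r. c * r\<^sup>2 / 2) has_real_derivative c * r) (at r)" for c r :: real
    by (auto intro!: derivative_eq_intros)
  have c: "continuous_on A (\<lambda>r. c * r)" for A and c :: real by (intro continuous_intros)
  show ?thesis
  proof (cases "0 \<le> t")
    case True
    have "C * t\<^sup>2 / 2 - C * 0\<^sup>2 / 2 \<ge> prim \<gamma> t - prim \<gamma> 0"
    proof (rule prim_compare(2)[OF i True F c])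
      show "AE r in lborel. 0 < r \<and> r < t \<longrightarrow> \<gamma> r \<le> C * r" by (intro AE_I2) (use b' in auto)
    qed
    moreover have "- C * t\<^sup>2 / 2 - - C * 0\<^sup>2 / 2 \<le> prim \<gamma> t - prim \<gamma> 0"
    proof (rule prim_compare(1)[OF i True F c])
      show "AE r in lborel. 0 < r \<and> r < t \<longrightarrow> - C * r \<le> \<gamma> r" by (intro AE_I2) (use b' in auto)
    qed
    ultimately show ?thesis by (simp add: prim_0 abs_le_iff)
  next
    case False
    then have t: "t \<le> 0" by simp
    have "- C * 0\<^sup>2 / 2 - - C * t\<^sup>2 / 2 \<ge> prim \<gamma> 0 - prim \<gamma> t"
    proof (rule prim_compare(2)[OF i t F c])
      show "AE r in lborel. t < r \<and> r < 0 \<longrightarrow> \<gamma> r \<le> - C * r" by (intro AE_I2) (use b' in auto)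
    qed
    moreover have "C * 0\<^sup>2 / 2 - C * t\<^sup>2 / 2 \<le> prim \<gamma> 0 - prim \<gamma> t"
    proof (rule prim_compare(1)[OF i t F c])
      show "AE r in lborel. t < r \<and> r < 0 \<longrightarrow> C * r \<le> \<gamma> r" by (intro AE_I2) (use b' in auto)
    qed
    ultimately show ?thesis by (simp add: prim_0 abs_le_iff)
  qed
qed

section \<open>Superquadratic growth excludes a linear bound\<close>

text \<open>Continuous induction: the points where \<open>f\<close> is at least \<open>f a\<close>
  form a compact set, and its last point could be moved further right unless it is
  \<open>b\<close>.\<close>

lemma local_increase_imp_le:
  fixes f :: "real \<Rightarrow> real"
  assumes ab: "a \<le> b" and cont: "continuous_on {a..b} f"
    and inc: "\<And>t. a \<le> t \<Longrightarrow> t < b \<Longrightarrow> \<exists>d>0. \<forall>h. 0 < h \<longrightarrow> h < d \<longrightarrow> f t \<le> f (t + h)"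
  shows "f a \<le> f b"
proof -
  define S where "S = {a..b} \<inter> f -` {f a..}"
  have "closed S" unfolding S_def by (rule continuous_closed_preimage[OF cont]) simp_all
  moreover have "bounded S" unfolding S_def by (rule bounded_subset[of "{a..b}"]) auto
  ultimately have "compact S" by (simp add: compact_eq_bounded_closed)
  moreover have "a \<in> S" using ab by (simp add: S_def)
  ultimately obtain t where t: "t \<in> S" "\<forall>y\<in>S. y \<le> t" using compact_attains_sup by (metis empty_iff)
  have "t = b"
  proof (rule ccontr)
    assume "t \<noteq> b"
    then have tb: "a \<le> t" "t < b" using t(1) by (auto simp: S_def)
    obtain d where d: "d > 0" "\<forall>h. 0 < h \<longrightarrow> h < d \<longrightarrow> f t \<le> f (t + h)" using inc[OF tb] by blast
    define h where "h = min (d / 2) (b - t)"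
    have h: "0 < h" "h < d" "t + h \<le> b" using d tb by (auto simp: h_def)
    then have "f t \<le> f (t + h)" using d(2) by simp
    then have "t + h \<in> S" using t(1) h tb by (auto simp: S_def)
    with t(2) have "t + h \<le> t" by blast
    with h(1) show False by simp
  qed
  with t(1) show ?thesis by (simp add: S_def)
qed

text \<open>Formally t G' \<ge> \<mu> G integrates to growth of order \<mu>, above the quadratic
  bound. Here G is known only through lower bounds on short forward increments, so monotonicity of
  ln G - \<nu> ln t is shown for an exponent with 2 < \<nu> < \<mu>, by local increase.\<close>

lemma superquadratic_growth_contradiction:
  fixes f G :: "real \<Rightarrow> real"
  assumes mu: "\<mu> > 2" and T: "T \<ge> 1" and cont: "\<And>b. continuous_on {T..b} G"
    and pos: "\<And>t. t \<ge> T \<Longrightarrow> G t > 0"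
    and upper: "\<And>t. t \<ge> T \<Longrightarrow> G t \<le> D * t\<^sup>2"
    and slope: "\<And>t m. t \<ge> T \<Longrightarrow> m < \<mu> * G t / t \<Longrightarrow> \<exists>d>0. \<forall>h. 0 < h \<longrightarrow> h < d \<longrightarrow> m * h \<le> G (t + h) - G t"
  shows False
proof -
  define \<nu> where "\<nu> = (2 + \<mu>) / 2"
  \<comment> \<open>An intermediate exponent with two margins: its distance to \<mu> gives the
    strict inequality that \<open>slope\<close> asks for, its distance to \<nu> absorbs the
    second-order error of the logarithm.\<close>
  define \<rho> where "\<rho> = (\<nu> + \<mu>) / 2"
  have nu: "2 < \<nu>" "\<nu> < \<rho>" "\<rho> < \<mu>" using mu by (simp_all add: \<nu>_def \<rho>_def)
  define f where "f = (\<lambda>t. ln (G t) - \<nu> * ln t)"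
  have mono: "f T \<le> f t" if t: "T \<le> t" for t
  proof (rule local_increase_imp_le[OF t])
    show "continuous_on {T..t} f"
      unfolding f_def using T pos
      by (intro continuous_intros cont) (auto simp: less_imp_neq[THEN not_sym])
    fix s assume s: "T \<le> s" "s < t"
    have s1: "1 \<le> s" "0 < s" "0 < G s" using s T pos[OF s(1)] by auto
    have "\<rho> * G s / s < \<mu> * G s / s" using nu s1 by (intro divide_strict_right_mono mult_strict_right_mono) auto
    from slope[OF s(1) this] obtain d where d: "d > 0" "\<And>h. 0 < h \<Longrightarrow> h < d \<Longrightarrow> \<rho> * G s / s * h \<le> G (s + h) - G s" by blast
    \<comment> \<open>With x = h/s, the second bound gives \<open>\<rho> * x \<le> 1\<close>, the
      range of the lower estimate for the logarithm; the third makes its quadratic error at most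
      \<open>(\<rho> - \<nu>) * x\<close>.\<close>
    define e where "e = min d (min (s / \<rho>) (s * (\<rho> - \<nu>) / \<rho>\<^sup>2))"
    have e0: "e > 0" unfolding e_def using d(1) s1 nu by simp
    have "f s \<le> f (s + h)" if h: "0 < h" "h < e" for h
    proof -
      define x where "x = h / s"
      have x: "0 < x" using h s1 by (simp add: x_def)
      have hb: "h < d" "h < s / \<rho>" "h < s * (\<rho> - \<nu>) / \<rho>\<^sup>2" using h by (simp_all add: e_def)
      have x1: "\<rho> * x \<le> 1" using hb(2) s1 nu by (simp add: x_def field_simps)
      have x2: "\<rho>\<^sup>2 * x \<le> \<rho> - \<nu>" using hb(3) s1 nu by (simp add: x_def field_simps)
      have "G s * (1 + \<rho> * x) \<le> G (s + h)" using d(2)[OF h(1) hb(1)] s1 by (simp add: x_def field_simps)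
      then have "ln (G s * (1 + \<rho> * x)) \<le> ln (G (s + h))"
        using s1 x nu by (intro ln_mono) (auto intro!: mult_pos_pos add_pos_pos)
      then have 1: "ln (G s) + ln (1 + \<rho> * x) \<le> ln (G (s + h))"
      proof -
        have "0 < 1 + \<rho> * x" using x nu by (simp add: add_pos_pos)
        then have "ln (G s * (1 + \<rho> * x)) = ln (G s) + ln (1 + \<rho> * x)" using s1(3) by (simp add: ln_mult)
        with \<open>ln (G s * (1 + \<rho> * x)) \<le> ln (G (s + h))\<close> show ?thesis by simp
      qed
      have "\<rho> * x - (\<rho> * x)\<^sup>2 \<le> ln (1 + \<rho> * x)"
        using x nu x1 by (intro ln_one_plus_pos_lower_bound) auto
      moreover have "(\<rho> * x)\<^sup>2 \<le> (\<rho> - \<nu>) * x"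
        using mult_right_mono[OF x2 less_imp_le[OF x]] by (simp add: power2_eq_square mult_ac)
      ultimately have 2: "\<nu> * x \<le> ln (1 + \<rho> * x)" by (simp add: algebra_simps)
      have "ln (1 + x) \<le> x" using x by (intro ln_add_one_self_le_self) simp
      then have 3: "\<nu> * ln (1 + x) \<le> \<nu> * x" using nu by simp
      have "s + h = s * (1 + x)" using s1 by (simp add: x_def field_simps)
      then have "ln (s + h) = ln s + ln (1 + x)" using s1 x by (simp add: ln_mult)
      then show ?thesis unfolding f_def using 1 2 3 by (simp add: distrib_left)
    qed
    with e0 show "\<exists>d>0. \<forall>h. 0 < h \<longrightarrow> h < d \<longrightarrow> f s \<le> f (s + h)" by blast
  qed
  have D: "D > 0"
  proof -
    have "0 < D * T\<^sup>2" using pos[of T] upper[of T] by simp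
    then show ?thesis using T by (simp add: zero_less_mult_iff)
  qed
  \<comment> \<open>Chosen so that at any t with ln t \<ge> R the lower bound of order \<nu> exceeds
    the quadratic upper bound by at least 1 on the logarithmic scale.\<close>
  define R where "R = (ln D - f T + 1) / (\<nu> - 2)"
  define t where "t = max T (exp R)"
  have t: "T \<le> t" "exp R \<le> t" "0 < t" using T by (auto simp: t_def)
  have "R \<le> ln t" using t(2,3) by (simp add: ln_ge_iff)
  then have "(\<nu> - 2) * R \<le> (\<nu> - 2) * ln t" using nu by (intro mult_left_mono) auto
  then have a: "ln D - f T + 1 \<le> (\<nu> - 2) * ln t" using nu by (simp add: R_def)
  have "ln (G t) \<le> ln (D * t\<^sup>2)" using upper[OF t(1)] pos[OF t(1)] by (intro ln_mono) auto
  also have "ln (D * t\<^sup>2) = ln D + 2 * ln t" using D t(3) by (simp add: ln_mult ln_realpow)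
  finally have "f T \<le> ln D + 2 * ln t - \<nu> * ln t" using mono[OF t(1)] by (simp add: f_def)
  with a show False by (simp add: left_diff_distrib)
qed

section \<open>The nonlinearity near \<open>0\<close>\<close>

text \<open>Discards also the values that violate the linear bound. Where the bound holds almost
  everywhere this changes nothing but a null set, yet the bound then holds at every point and for
  every parameter.\<close>

definition trunc :: "real \<Rightarrow> real \<Rightarrow> (real \<Rightarrow> real) \<Rightarrow> real \<Rightarrow> real" where
  "trunc N C f s = (if \<bar>s\<bar> \<le> N \<and> \<bar>f s\<bar> \<le> C * \<bar>s\<bar> then f s else 0)"

lemma trunc_le: "0 \<le> C \<Longrightarrow> \<bar>trunc N C f s\<bar> \<le> C * \<bar>s\<bar>"
  by (simp add: trunc_def)

lemma trunc_bounded: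
  assumes "0 \<le> C" "0 \<le> N" shows "\<bar>trunc N C f s\<bar> \<le> C * N"
proof (cases "\<bar>s\<bar> \<le> N")
  case True
  then have "C * \<bar>s\<bar> \<le> C * N" using assms(1) by (rule mult_left_mono)
  with trunc_le[OF assms(1), of N f s] show ?thesis by linarith
qed (use assms in \<open>simp add: trunc_def\<close>)

lemma trunc_measurable:
  assumes [measurable]: "f \<in> borel_measurable borel" shows "trunc N C f \<in> borel_measurable borel"
  unfolding trunc_def[abs_def] by measurable

lemma trunc_integrable:
  assumes "f \<in> borel_measurable borel" "0 \<le> C" "0 \<le> N"
  shows "integrable lborel (trunc N C f)"
proof (rule Bochner_Integration.integrable_bound[of _ "\<lambda>s. (C * N) * indicator {-N..N} s"])
  show "integrable lborel (\<lambda>s. (C * N) * indicator {-N..N} s)"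
    using assms(3) by (intro integrable_mult_right integrable_real_indicator) auto
  show "trunc N C f \<in> borel_measurable lborel" using trunc_measurable[OF assms(1)] by simp
  show "AE s in lborel. norm (trunc N C f s) \<le> norm ((C * N) * indicator {-N..N} s)"
  proof (rule AE_I2)
    fix s
    show "norm (trunc N C f s) \<le> norm ((C * N) * indicator {-N..N} s)"
      using trunc_bounded[OF assms(2,3), of f s] assms(2,3) by (cases "\<bar>s\<bar> \<le> N") (auto simp: trunc_def abs_le_iff)
  qed
qed

text \<open>A linear bound on the section makes its primitive at most quadratic, while the envelope
  condition forces the slope of the primitive to be almost \<mu> times itself over t. The lower
  bound 1 makes the primitive eventually positive, so its logarithm can be taken.\<close>

lemma superquadratic_not_linear:
  fixes g :: "'a \<Rightarrow> real \<Rightarrow> real"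
  assumes sec: "g x \<in> borel_measurable lebesgue"
    and lin: "AE t in lborel. \<bar>g x t\<bar> \<le> D * \<bar>t\<bar>" and D: "0 \<le> D"
    and mu: "\<mu> > 2" and r: "r \<ge> 0"
    and super: "\<And>t. t \<ge> r \<Longrightarrow> ereal (\<mu> * primitive g x t) \<le> ereal t * lower_env g x t"
    and ge1: "\<And>t. t \<ge> r \<Longrightarrow> 1 \<le> g x t"
  shows False
proof -
  obtain f where f: "f \<in> borel_measurable borel" "AE s in lborel. g x s = f s"
    using completion_ex_borel_measurable_real[OF sec] by auto
  let ?F = "\<lambda>N. trunc N D f"
  have F: "integrable lborel (?F N)" if "0 \<le> N" for N by (rule trunc_integrable[OF f(1) D that])
  have eq: "AE s in lborel. \<bar>s\<bar> \<le> N \<longrightarrow> ?F N s = g x s" for N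
    using lin f(2) by eventually_elim (auto simp: trunc_def)
  define G where "G = primitive g x"
  \<comment> \<open>On [0,N] the primitive agrees with that of the section truncated at N; the level
    may thus grow with the interval while each truncated section is integrable on the whole line.
    \<open>primitive\<close> integrates over an open interval, \<open>prim\<close> over a half-open
    one, and the endpoint is null.\<close>
  have Gp: "G t = prim (?F N) t" if t: "0 \<le> t" "t \<le> N" for t N
  proof -
    have N: "0 \<le> N" using t by simp
    have "G t = (LINT s|lebesgue. indicator {0<..<t} s * g x s)"
      unfolding G_def primitive_def interval_lebesgue_integral_def using t
      by (simp add: zero_ereal_def set_lebesgue_integral_def)
    also have "\<dots> = (LINT s|lebesgue. indicator {0<..t} s * ?F N s)"
    proof (rule integral_cong_AE)
      show "(\<lambda>s. indicator {0<..<t} s * g x s) \<in> borel_measurable lebesgue"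
        using sec by (intro borel_measurable_times borel_measurable_indicator) auto
      show "(\<lambda>s. indicator {0<..t} s * ?F N s) \<in> borel_measurable lebesgue"
        using trunc_measurable[OF f(1)] by (intro borel_measurable_times borel_measurable_indicator measurable_completion) auto
      have "AE s in lborel. s \<noteq> t" by (rule AE_lborel_singleton)
      with eq[of N] have "AE s in lborel. indicator {0<..<t} s * g x s = indicator {0<..t} s * ?F N s"
        by eventually_elim (use t in \<open>auto simp: indicator_def\<close>)
      then show "AE s in lebesgue. indicator {0<..<t} s * g x s = indicator {0<..t} s * ?F N s"
        unfolding AE_lebesgue_iff_lborel .
    qed
    also have "\<dots> = (LINT s|lborel. indicator {0<..t} s * ?F N s)"
      by (rule integral_completion) (use borel_measurable_integrable[OF F[OF N]] in measurable)
    also have "\<dots> = prim (?F N) t" using prim_diff[OF F[OF N] t(1)] by (simp add: prim_0)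
    finally show ?thesis .
  qed
  have lipG: "\<bar>G s - G t\<bar> \<le> (D * N) * \<bar>s - t\<bar>" if "0 \<le> s" "s \<le> N" "0 \<le> t" "t \<le> N" for s t N
  proof -
    have N: "0 \<le> N" using that by simp
    show ?thesis unfolding Gp[OF that(1,2)] Gp[OF that(3,4)]
      by (rule prim_lipschitz[OF F[OF N] trunc_bounded[OF D N]])
  qed
  have inc: "m * (t - s) \<le> G t - G s" if st: "0 \<le> s" "s \<le> t" and ae: "AE y in lborel. s < y \<and> y < t \<longrightarrow> m \<le> g x y" for s t m
  proof -
    have t0: "0 \<le> t" using st by simp
    have "AE y in lborel. s < y \<and> y < t \<longrightarrow> m \<le> ?F t y"
      using ae eq[of t] by eventually_elim (use st in auto)
    from prim_ge[OF F[OF t0] st(2) this] show ?thesis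
      unfolding Gp[OF st(1) st(2)] Gp[OF t0 order_refl] .
  qed
  \<comment> \<open>Beyond this point \<open>G t \<ge> G r + (t - r)\<close> is positive whatever
    the sign of \<open>G r\<close>, and \<open>T\<close> is at least 1.\<close>
  define T where "T = max r 1 + \<bar>G r\<bar> + 1"
  have T: "1 \<le> T" "r \<le> T" by (auto simp: T_def)
  show False
  proof (rule superquadratic_growth_contradiction[OF mu T(1), of G D])
    show "continuous_on {T..b} G" for b
    proof (rule lipschitz_on_continuous_on[OF lipschitz_onI])
      fix s t assume "s \<in> {T..b}" "t \<in> {T..b}"
      then show "dist (G s) (G t) \<le> (D * max b 0) * dist s t"
        unfolding dist_real_def using T by (intro lipG) auto
    qed (use D in simp)
    fix t assume t: "T \<le> t"
    then have t0: "0 < t" "r \<le> t" using T by auto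
    have "1 * (t - r) \<le> G t - G r"
      by (rule inc[OF r t0(2)]) (use ge1 in auto)
    then show "0 < G t" using t unfolding T_def by (auto simp: abs_if max_def split: if_splits)
    have "\<bar>G t\<bar> \<le> D * t\<^sup>2 / 2"
      unfolding Gp[OF less_imp_le[OF t0(1)] order_refl]
      by (rule prim_quadratic[OF F[OF less_imp_le[OF t0(1)]] trunc_le[OF D]])
    moreover have "0 \<le> D * t\<^sup>2" using D by simp
    ultimately show "G t \<le> D * t\<^sup>2" by linarith
    fix m assume m: "m < \<mu> * G t / t"
    have "ereal m < lower_env g x t"
    proof (rule ccontr)
      assume "\<not> ereal m < lower_env g x t"
      then have "ereal t * lower_env g x t \<le> ereal t * ereal m"
        using t0(1) by (intro ereal_mult_left_mono) auto
      from order_trans[OF super[OF t0(2)] this] have "ereal (\<mu> * G t) \<le> ereal (t * m)" by (simp add: G_def)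
      with m t0(1) show False by (simp add: pos_less_divide_eq mult.commute)
    qed
    then obtain \<eta> where e: "0 < \<eta>" "ereal m < local_essinf (g x) t \<eta>"
      unfolding lower_env_tendsto(2)[of g x t, OF sec] by (auto simp: less_SUP_iff)
    have ae: "AE s in lborel. \<bar>t - s\<bar> < \<eta> \<longrightarrow> m \<le> g x s"
      using local_essinf_AE[of t \<eta> "g x"] unfolding AE_lebesgue_iff_lborel
    proof eventually_elim
      case (elim s)
      show ?case
      proof
        assume "\<bar>t - s\<bar> < \<eta>"
        with elim have "local_essinf (g x) t \<eta> \<le> ereal (g x s)" by simp
        with e(2) have "ereal m < ereal (g x s)" by (rule less_le_trans)
        then show "m \<le> g x s" by simp
      qed
    qed
    have "m * h \<le> G (t + h) - G t" if h: "0 < h" "h < \<eta>" for h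
    proof -
      have "AE y in lborel. t < y \<and> y < t + h \<longrightarrow> m \<le> g x y"
        using ae by eventually_elim (use h in auto)
      from inc[OF _ _ this] show ?thesis using t0 h by simp
    qed
    then show "\<exists>d>0. \<forall>h. 0 < h \<longrightarrow> h < d \<longrightarrow> m * h \<le> G (t + h) - G t" using e(1) by blast
  qed
qed

section \<open>Sections of functions measurable on a product\<close>

lemma AE_lebesgue_on_times:
  fixes \<Omega> :: "'a::euclidean_space set"
  assumes \<Omega>: "open \<Omega>" and ae: "AE p in lebesgue_on (\<Omega> \<times> (UNIV :: real set)). Q p"
  shows "AE x in lebesgue_on \<Omega>. AE t in lborel. Q (x, t)"
proof -
  have "open (\<Omega> \<times> (UNIV :: real set))" using \<Omega> by (intro open_Times) auto
  then have "AE p in lebesgue. p \<in> \<Omega> \<times> (UNIV :: real set) \<longrightarrow> Q p"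
    using ae by (subst (asm) AE_lebesgue_on_iff) auto
  then have "AE p in (lborel :: ('a \<times> real) measure). p \<in> \<Omega> \<times> UNIV \<longrightarrow> Q p"
    by (simp add: AE_completion_iff)
  then have "AE p in (lborel :: 'a measure) \<Otimes>\<^sub>M (lborel :: real measure). p \<in> \<Omega> \<times> UNIV \<longrightarrow> Q p"
    by (simp only: lborel_prod)
  from pair_sigma_finite.AE_pair[OF _ this] have "AE x in (lborel :: 'a measure). AE t in (lborel :: real measure). (x, t) \<in> \<Omega> \<times> UNIV \<longrightarrow> Q (x, t)"
    by (simp add: pair_sigma_finite_def sigma_finite_lborel)
  then have "AE x in lborel. x \<in> \<Omega> \<longrightarrow> (AE t in lborel. Q (x, t))"
  proof eventually_elim
    case (elim x)
    show ?case
    proof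
      assume "x \<in> \<Omega>"
      with elim show "AE t in lborel. Q (x, t)" by simp
    qed
  qed
  then have "AE x in lebesgue. x \<in> \<Omega> \<longrightarrow> (AE t in lborel. Q (x, t))"
    by (simp add: AE_completion_iff)
  then show ?thesis by (rule AE_lebesgue_on_iff[THEN iffD2, rotated]) (use \<Omega> in auto)
qed

text \<open>Lebesgue measurability on the product is lost on restriction to the graph of a function,
  which may be a null set; a Borel version behaves well there. For almost every x the two sections
  differ on a null set only, which neither envelopes nor primitives can detect.\<close>

lemma borel_version_times:
  fixes \<Omega> :: "'a::euclidean_space set" and g :: "'a \<Rightarrow> real \<Rightarrow> real"
  assumes \<Omega>: "open \<Omega>" and g: "(\<lambda>(x, t). g x t) \<in> borel_measurable (lebesgue_on (\<Omega> \<times> UNIV))"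
  shows "\<exists>g'\<in>borel_measurable borel. AE x in lebesgue_on \<Omega>. AE t in lborel. g x t = g' (x, t)"
proof -
  have o: "open (\<Omega> \<times> (UNIV :: real set))" using \<Omega> by (intro open_Times) auto
  let ?h = "\<lambda>p. indicator (\<Omega> \<times> (UNIV :: real set)) p *\<^sub>R (case p of (x, t) \<Rightarrow> g x t)"
  have "?h \<in> borel_measurable lebesgue"
    using g o by (subst (asm) borel_measurable_restrict_space_iff) auto
  then obtain g' where g': "g' \<in> borel_measurable lborel" "AE p in lborel. ?h p = g' p"
    using completion_ex_borel_measurable_real by blast
  have "AE p in lebesgue. ?h p = g' p" using g'(2) by (simp add: AE_completion_iff)
  then have "AE p in lebesgue. p \<in> \<Omega> \<times> UNIV \<longrightarrow> (case p of (x, t) \<Rightarrow> g x t) = g' p"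
    by eventually_elim (auto simp: indicator_def split: if_splits)
  then have "AE p in lebesgue_on (\<Omega> \<times> UNIV). (case p of (x, t) \<Rightarrow> g x t) = g' p"
    using o by (subst AE_lebesgue_on_iff) auto
  from AE_lebesgue_on_times[OF \<Omega> this] g'(1) show ?thesis by auto
qed

lemma section_lebesgue_measurable:
  assumes "(\<lambda>p. g' p) \<in> borel_measurable (borel :: ('a::euclidean_space \<times> real) measure)"
    and "AE t in lborel. f t = (g' (x, t) :: real)"
  shows "f \<in> borel_measurable lebesgue"
proof -
  have "(\<lambda>t. (x, t)) \<in> borel \<rightarrow>\<^sub>M (borel :: ('a \<times> real) measure)"
    by (rule borel_measurable_continuous_onI) (intro continuous_intros)
  from measurable_compose[OF this assms(1)] have m: "(\<lambda>t. g' (x, t)) \<in> borel_measurable lebesgue"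
    by (intro measurable_completion) simp
  have "AE t in lebesgue. g' (x, t) = f t"
    unfolding AE_lebesgue_iff_lborel using assms(2) by eventually_elim simp
  from borel_measurable_AE[OF m this] show ?thesis .
qed

text \<open>Converts contradictions found for almost every point into outright ones, since a
  nonempty open set is not null.\<close>

lemma (in bounded_open) ex_in_domain:
  assumes "\<Omega> \<noteq> {}" "AE x in M. Q x" shows "\<exists>x\<in>\<Omega>. Q x"
proof (rule ccontr)
  assume "\<not> (\<exists>x\<in>\<Omega>. Q x)"
  with assms(2) have "AE x in lebesgue. x \<notin> \<Omega>"
    unfolding AE_lebesgue_on_iff[OF sets_domain] by (auto elim: eventually_mono)
  then have "negligible \<Omega>"
    by (simp add: negligible_iff_null_sets completion.AE_iff_null_sets)
  then show False using open_not_negligible[OF open_domain assms(1)] by simp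
qed

lemma Linf_AE_bound:
  assumes "f \<in> Linf \<Omega>"
  shows "f \<in> borel_measurable (lebesgue_on \<Omega>)" "\<exists>A\<ge>0. AE x in lebesgue_on \<Omega>. \<bar>f x\<bar> \<le> A"
proof -
  show "f \<in> borel_measurable (lebesgue_on \<Omega>)" using assms by (simp add: Linf_def)
  have "Linf_norm \<Omega> f < \<infinity>" using assms by (simp add: Linf_def)
  then obtain A where A: "Linf_norm \<Omega> f < ereal A" using less_PInf_Ex_of_nat by auto
  have "AE x in lebesgue_on \<Omega>. ereal \<bar>f x\<bar> \<le> Linf_norm \<Omega> f" unfolding Linf_norm_def by (rule esssup_AE)
  then have "AE x in lebesgue_on \<Omega>. \<bar>f x\<bar> \<le> max A 0"
  proof eventually_elim
    case (elim x)
    then have "ereal \<bar>f x\<bar> < ereal A" using A by (rule le_less_trans)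
    then show ?case by simp
  qed
  then show "\<exists>A\<ge>0. AE x in lebesgue_on \<Omega>. \<bar>f x\<bar> \<le> A" by (intro exI[of _ "max A 0"]) simp
qed

lemma AE_abs_le_if_Linf_norm_less:
  assumes "Linf_norm \<Omega> b < ereal \<delta>" shows "AE x in lebesgue_on \<Omega>. \<bar>b x\<bar> \<le> \<delta>"
proof -
  have "AE x in lebesgue_on \<Omega>. ereal \<bar>b x\<bar> \<le> Linf_norm \<Omega> b" unfolding Linf_norm_def by (rule esssup_AE)
  then show ?thesis
  proof eventually_elim
    case (elim x)
    then have "ereal \<bar>b x\<bar> < ereal \<delta>" using assms by (rule le_less_trans)
    then show ?case by simp
  qed
qed

context bounded_open
begin

text \<open>The factor \<open>\<alpha>\<close> in the coercivity hypothesis is what pays for the linear part of \<open>g\<close>: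
  \<open>1 - 1 / \<alpha> = C\<^sub>1 / \<lambda>\<^sub>1\<close>, and Poincare's inequality absorbs \<open>C\<^sub>1 \<integral> \<phi>\<^sup>2\<close>.\<close>

lemma coercive_test:
  assumes ne: "\<Omega> \<noteq> {}" and C1: "0 < C\<^sub>1" "C\<^sub>1 < lambda1 \<Omega>"
    and alpha: "\<alpha> = lambda1 \<Omega> / (lambda1 \<Omega> - C\<^sub>1)"
    and coercive: "coercive_op \<Omega> (\<lambda>x. \<alpha> * a x)"
  shows "\<exists>\<kappa>>0. \<forall>\<phi>. test_function \<Omega> \<phi> \<longrightarrow>
    \<kappa> * (l2norm M (jet \<phi>))\<^sup>2 \<le> (l2norm M (grad \<phi>))\<^sup>2 + (LINT x|M. a x * \<phi> x * \<phi> x) - C\<^sub>1 * (l2norm M \<phi>)\<^sup>2"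
proof -
  obtain \<kappa> where k: "\<kappa> > 0" "\<And>u. u \<in> H10 \<Omega> \<Longrightarrow>
     (LINT x|M. (norm (weak_grad \<Omega> u x))\<^sup>2) + (LINT x|M. \<alpha> * a x * (u x)\<^sup>2) \<ge> \<kappa> * (H1_norm \<Omega> u)\<^sup>2"
    using coercive unfolding coercive_op_def by blast
  let ?l = "lambda1 \<Omega>"
  have l: "0 < ?l" "0 < ?l - C\<^sub>1" using C1 by auto
  have al: "0 < \<alpha>" unfolding alpha using l by simp
  have "\<kappa> / \<alpha> * (l2norm M (jet \<phi>))\<^sup>2 \<le> (l2norm M (grad \<phi>))\<^sup>2 + (LINT x|M. a x * \<phi> x * \<phi> x) - C\<^sub>1 * (l2norm M \<phi>)\<^sup>2"
    if t: "test_function \<Omega> \<phi>" for \<phi>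
  proof -
    let ?g = "(l2norm M (grad \<phi>))\<^sup>2" and ?A = "LINT x|M. a x * \<phi> x * \<phi> x" and ?f = "(l2norm M \<phi>)\<^sup>2" and ?N = "(l2norm M (jet \<phi>))\<^sup>2"
    have H: "\<phi> \<in> H10 \<Omega>" using W_imp_H10[OF jet_W[OF t]] by (simp add: jet_def)
    have h1: "H1_norm \<Omega> \<phi> = l2norm M (jet \<phi>)"
      using H1_norm_eq[OF test_weak_gradient[OF t] test_L2[OF t] test_grad_L2[OF t]] by (simp add: jet_def[abs_def])
    have "(LINT x|M. \<alpha> * a x * (\<phi> x)\<^sup>2) = (LINT x|M. \<alpha> * (a x * \<phi> x * \<phi> x))"
      by (intro Bochner_Integration.integral_cong refl) (simp add: power2_eq_square)
    then have "\<kappa> * ?N \<le> ?g + \<alpha> * ?A"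
      using k(2)[OF H] unfolding h1 lint_weak_grad[OF test_weak_gradient[OF t] test_grad_L2[OF t]] by simp
    \<comment> \<open>Dividing by \<alpha> leaves the full potential term and the fraction
      1/\<alpha> of the gradient term; the rest of the gradient is free for Poincare's
      inequality.\<close>
    then have "(\<kappa> * ?N) / \<alpha> \<le> (?g + \<alpha> * ?A) / \<alpha>" using al by (intro divide_right_mono) auto
    also have "(?g + \<alpha> * ?A) / \<alpha> = ?g / \<alpha> + ?A" using al by (simp add: add_divide_distrib)
    also have "?g / \<alpha> = ?g - (C\<^sub>1 / ?l) * ?g" unfolding alpha using l by (simp add: field_simps)
    finally have 1: "\<kappa> / \<alpha> * ?N \<le> ?g - (C\<^sub>1 / ?l) * ?g + ?A" by simp
    have "(C\<^sub>1 / ?l) * (?l * ?f) \<le> (C\<^sub>1 / ?l) * ?g"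
      using C1 l by (intro mult_left_mono lambda1_poincare[OF ne t]) auto
    moreover have "(C\<^sub>1 / ?l) * (?l * ?f) = C\<^sub>1 * ?f" using l by simp
    ultimately show ?thesis using 1 by linarith
  qed
  then show ?thesis using k(1) al by (intro exI[of _ "\<kappa> / \<alpha>"]) simp
qed

end

section \<open>Small solutions\<close>

text \<open>The nonsmooth substitute for \<open>w = \<gamma> t\<close>. The steps are bounded by \<open>1 / (n + 1)\<close> instead of
  an arbitrary \<open>\<epsilon> > 0\<close> so that countably many null sets suffice.\<close>

definition multiplier :: "(real \<Rightarrow> real) \<Rightarrow> real \<Rightarrow> real \<Rightarrow> bool" where
  "multiplier \<gamma> t w \<longleftrightarrow> (\<forall>n::nat.
    (\<forall>m. (\<forall>h. 0 < h \<longrightarrow> h < 1 / real (Suc n) \<longrightarrow> m * h \<le> prim \<gamma> (t + h) - prim \<gamma> t) \<longrightarrow> m \<le> w) \<and>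
    (\<forall>m. (\<forall>h. 0 < h \<longrightarrow> h < 1 / real (Suc n) \<longrightarrow> m * h \<le> prim \<gamma> (t - h) - prim \<gamma> t) \<longrightarrow> m \<le> - w))"

lemma multiplier_ge:
  assumes mult: "multiplier \<gamma> t w" and i: "integrable lborel \<gamma>" and \<eta>: "0 < \<eta>"
    and ae: "AE s in lborel. \<bar>t - s\<bar> < \<eta> \<longrightarrow> m \<le> \<gamma> s"
  shows "m \<le> w"
proof -
  obtain n where n: "1 / real (Suc n) < \<eta>" using nat_approx_posE[OF \<eta>] by auto
  have "m * h \<le> prim \<gamma> (t + h) - prim \<gamma> t" if h: "0 < h" "h < 1 / real (Suc n)" for h
  proof -
    have "AE s in lborel. t < s \<and> s < t + h \<longrightarrow> m \<le> \<gamma> s"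
      using ae by eventually_elim (use h n in auto)
    from prim_ge[OF i _ this] show ?thesis using h by simp
  qed
  then show ?thesis using mult unfolding multiplier_def by blast
qed

lemma multiplier_le:
  assumes mult: "multiplier \<gamma> t w" and i: "integrable lborel \<gamma>" and \<eta>: "0 < \<eta>"
    and ae: "AE s in lborel. \<bar>t - s\<bar> < \<eta> \<longrightarrow> \<gamma> s \<le> m"
  shows "w \<le> m"
proof -
  obtain n where n: "1 / real (Suc n) < \<eta>" using nat_approx_posE[OF \<eta>] by auto
  have "- m * h \<le> prim \<gamma> (t - h) - prim \<gamma> t" if h: "0 < h" "h < 1 / real (Suc n)" for h
  proof -
    have "AE s in lborel. t - h < s \<and> s < t \<longrightarrow> \<gamma> s \<le> m"
      using ae by eventually_elim (use h n in auto)
    from prim_le[OF i _ this] show ?thesis using h by simp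
  qed
  then have "- m \<le> - w" using mult unfolding multiplier_def by blast
  then show ?thesis by simp
qed

text \<open>Near t the function lies between the constants -(C \<bar>t\<bar> + e) and C
  \<bar>t\<bar> + e, and constant bounds pass to the multiplier; then e tends to 0.\<close>

lemma multiplier_abs_le:
  assumes mult: "multiplier \<gamma> t w" and i: "integrable lborel \<gamma>" and C: "0 \<le> C"
    and b: "\<And>s. \<bar>\<gamma> s\<bar> \<le> C * \<bar>s\<bar>"
  shows "\<bar>w\<bar> \<le> C * \<bar>t\<bar>"
proof (rule field_le_epsilon)
  fix e :: real assume e: "0 < e"
  define \<eta> where "\<eta> = e / (C + 1)"
  have \<eta>: "0 < \<eta>" using e C by (simp add: \<eta>_def)
  have "C * \<eta> \<le> (C + 1) * \<eta>" using \<eta> by (intro mult_right_mono) auto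
  then have Ce: "C * \<eta> \<le> e" using C by (simp add: \<eta>_def)
  have near: "\<bar>\<gamma> s\<bar> \<le> C * \<bar>t\<bar> + e" if "\<bar>t - s\<bar> < \<eta>" for s
  proof -
    have "C * \<bar>s\<bar> \<le> C * (\<bar>t\<bar> + \<eta>)" using that C by (intro mult_left_mono) auto
    then show ?thesis using b[of s] Ce unfolding distrib_left by linarith
  qed
  have "w \<le> C * \<bar>t\<bar> + e"
    by (rule multiplier_le[OF mult i \<eta> AE_I2]) (use near in \<open>auto dest: abs_le_D1\<close>)
  moreover have "- (C * \<bar>t\<bar> + e) \<le> w"
  proof (rule multiplier_ge[OF mult i \<eta> AE_I2], intro impI)
    fix s assume "\<bar>t - s\<bar> < \<eta>"
    from abs_le_D2[OF near[OF this]] show "- (C * \<bar>t\<bar> + e) \<le> \<gamma> s" by simp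
  qed
  ultimately show "\<bar>w\<bar> \<le> C * \<bar>t\<bar> + e" by (simp add: abs_le_iff)
qed

text \<open>The inequality \<bar>t\<bar> < \<epsilon> is strict, so a whole neighbourhood of t lies
  where \<open>\<gamma>\<close> and \<open>g x\<close> agree almost everywhere. The envelopes look
  no further.\<close>

lemma multiplier_in_envelopes:
  assumes mult: "multiplier \<gamma> t w" and i: "integrable lborel \<gamma>"
    and sec: "g x \<in> borel_measurable lebesgue" and t: "\<bar>t\<bar> < \<epsilon>"
    and eq: "AE s in lborel. \<bar>s\<bar> \<le> \<epsilon> \<longrightarrow> \<gamma> s = g x s"
  shows "ereal w \<in> {lower_env g x t..upper_env g x t}"
proof -
  have pos: "0 < \<epsilon> - \<bar>t\<bar>" using t by simp
  have near: "\<bar>s\<bar> \<le> \<epsilon>" if "\<bar>t - s\<bar> < \<eta>" "\<eta> \<le> \<epsilon> - \<bar>t\<bar>" for s \<eta> using that by (auto simp: abs_if split: if_splits)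
  have "lower_env g x t \<le> ereal w"
  proof (rule lower_env_le[of g x, OF sec pos])
    fix m \<eta> assume e: "0 < \<eta>" "\<eta> \<le> \<epsilon> - \<bar>t\<bar>" and "AE s in lebesgue. \<bar>t - s\<bar> < \<eta> \<longrightarrow> m \<le> g x s"
    then have "AE s in lborel. \<bar>t - s\<bar> < \<eta> \<longrightarrow> m \<le> g x s" by (simp only: AE_lebesgue_iff_lborel)
    with eq have "AE s in lborel. \<bar>t - s\<bar> < \<eta> \<longrightarrow> m \<le> \<gamma> s"
      by eventually_elim (use near e(2) in auto)
    from multiplier_ge[OF mult i e(1) this] show "m \<le> w" .
  qed
  moreover have "ereal w \<le> upper_env g x t"
  proof (rule upper_env_ge[of g x, OF sec pos])
    fix m \<eta> assume e: "0 < \<eta>" "\<eta> \<le> \<epsilon> - \<bar>t\<bar>" and "AE s in lebesgue. \<bar>t - s\<bar> < \<eta> \<longrightarrow> g x s \<le> m"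
    then have "AE s in lborel. \<bar>t - s\<bar> < \<eta> \<longrightarrow> g x s \<le> m" by (simp only: AE_lebesgue_iff_lborel)
    with eq have "AE s in lborel. \<bar>t - s\<bar> < \<eta> \<longrightarrow> \<gamma> s \<le> m"
      by eventually_elim (use near e(2) in auto)
    from multiplier_le[OF mult i e(1) this] show "w \<le> m" .
  qed
  ultimately show ?thesis by simp
qed

lemma prim_trunc_measurable:
  fixes g' :: "'a::euclidean_space \<times> real \<Rightarrow> real"
  assumes "g' \<in> borel_measurable borel"
  shows "(\<lambda>p. prim (trunc \<epsilon> C (\<lambda>s. g' (fst p, s))) (snd p)) \<in> borel_measurable (borel \<Otimes>\<^sub>M borel)"
proof -
  have [measurable]: "g' \<in> borel_measurable (borel \<Otimes>\<^sub>M borel)" using assms by (simp add: borel_prod)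
  have *: "(\<lambda>p. LINT s|lborel. indicator {..h p} s * trunc \<epsilon> C (\<lambda>s. g' (fst p, s)) s) \<in> borel_measurable (borel \<Otimes>\<^sub>M borel)"
    if [measurable]: "h \<in> borel_measurable (borel \<Otimes>\<^sub>M borel)" for h :: "'a \<times> real \<Rightarrow> real"
  proof (rule lborel.borel_measurable_lebesgue_integral)
    \<comment> \<open>Spelling out the indicator and the truncation as conditions on the triple
      makes joint measurability, with the moving limit \<open>h p\<close>, apparent.\<close>
    have "(\<lambda>(p, s). indicator {..h p} s * trunc \<epsilon> C (\<lambda>s. g' (fst p, s)) s) =
      (\<lambda>z. (if snd z \<le> h (fst z) then 1 else 0) *
        (if \<bar>snd z\<bar> \<le> \<epsilon> \<and> \<bar>g' (fst (fst z), snd z)\<bar> \<le> C * \<bar>snd z\<bar> then g' (fst (fst z), snd z) else 0))"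
      by (auto simp: fun_eq_iff trunc_def indicator_def)
    moreover have "\<dots> \<in> borel_measurable ((borel \<Otimes>\<^sub>M borel) \<Otimes>\<^sub>M lborel)" by measurable
    ultimately show "(\<lambda>(p, s). indicator {..h p} s * trunc \<epsilon> C (\<lambda>s. g' (fst p, s)) s)
      \<in> borel_measurable ((borel \<Otimes>\<^sub>M borel) \<Otimes>\<^sub>M lborel)" by simp
  qed
  show ?thesis unfolding prim_def by (intro borel_measurable_diff *) measurable
qed

text \<open>Coercivity bounds the L1 norm of the minimiser by a multiple of \<open>\<delta>\<close>,
  and \<open>sup_bound\<close> passes this on to the supremum. All constants are fixed before
  \<open>b\<close> appears, so one \<open>\<delta>\<close> serves every \<open>b\<close>.\<close>

lemma (in bounded_open) small_solution:
  fixes g :: "'a \<Rightarrow> real \<Rightarrow> real"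
  assumes g': "g' \<in> borel_measurable borel" "AE x in M. AE t in lborel. g x t = g' (x, t)"
    and lin: "AE x in M. AE t in lborel. \<bar>t\<bar> \<le> \<epsilon> \<longrightarrow> \<bar>g x t\<bar> \<le> C * \<bar>t\<bar>" and pos: "0 < \<epsilon>" "0 \<le> C" "0 < \<kappa>"
    and a: "a \<in> borel_measurable M" "AE x in M. \<bar>a x\<bar> \<le> A" "0 \<le> A"
    and coercive: "\<And>\<phi>. test_function \<Omega> \<phi> \<Longrightarrow>
      \<kappa> * (l2norm M (jet \<phi>))\<^sup>2 \<le> (l2norm M (grad \<phi>))\<^sup>2 + (LINT x|M. a x * \<phi> x * \<phi> x) - C * (l2norm M \<phi>)\<^sup>2"
  shows "\<exists>\<delta>>0. \<forall>b. b \<in> borel_measurable M \<longrightarrow> (AE x in M. \<bar>b x\<bar> \<le> \<delta>) \<longrightarrow>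
    (\<exists>u\<in>H10 \<Omega>. \<exists>w. has_weak_laplacian \<Omega> u w \<and>
      (AE x in M. ereal (- w x + a x * u x + b x) \<in> {lower_env g x (u x)..upper_env g x (u x)}))"
proof -
  define \<gamma> where "\<gamma> = (\<lambda>x. trunc \<epsilon> C (\<lambda>s. g' (x, s)))"
  have sec: "(\<lambda>s. g' (x, s)) \<in> borel_measurable borel" for x
  proof -
    have "(\<lambda>s. (x, s)) \<in> borel \<rightarrow>\<^sub>M (borel :: ('a \<times> real) measure)"
      by (rule borel_measurable_continuous_onI) (intro continuous_intros)
    from measurable_compose[OF this g'(1)] show ?thesis .
  qed
  have int: "integrable lborel (\<gamma> x)" for x
    unfolding \<gamma>_def by (rule trunc_integrable[OF sec]) (use pos in auto)
  have \<gamma>_le: "\<bar>\<gamma> x s\<bar> \<le> C * \<bar>s\<bar>" for x s unfolding \<gamma>_def by (rule trunc_le[OF pos(2)])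
  define c where "c = enn2real (heat_mass TYPE('a))"
  have c: "0 < c" unfolding c_def using heat_mass_pos[where 'a = 'a] heat_mass_finite[where 'a = 'a]
    by (simp add: enn2real_positive_iff)
  define \<Lambda> where "\<Lambda> = C + A"
  have \<Lambda>: "0 \<le> \<Lambda>" unfolding \<Lambda>_def using pos(2) a(3) by simp
  define V where "V = measure M (space M)"
  have V: "0 \<le> V" by (simp add: V_def)
  \<comment> \<open>The L1 norm of u will be at most \<open>\<delta> * (2 * V / \<kappa>)\<close>,
    so the right side of the supremum estimate is at most \<open>\<delta> * B\<close>. The choice of
    \<open>\<delta>\<close> below makes this half of \<open>c * \<epsilon>\<close>, hence
    \<bar>u\<bar> stays strictly below \<open>\<epsilon>\<close>.\<close>
  define B where "B = exp \<Lambda> * (2 * V / \<kappa> + c)"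
  have B: "0 < B" unfolding B_def using V c pos(3) by (intro mult_pos_pos add_nonneg_pos) auto
  define \<delta> where "\<delta> = c * \<epsilon> / (2 * B)"
  have \<delta>: "0 < \<delta>" unfolding \<delta>_def using c pos(1) B by simp
  have "\<exists>u\<in>H10 \<Omega>. \<exists>w. has_weak_laplacian \<Omega> u w \<and>
      (AE x in M. ereal (- w x + a x * u x + b x) \<in> {lower_env g x (u x)..upper_env g x (u x)})"
    if b: "b \<in> borel_measurable M" "AE x in M. \<bar>b x\<bar> \<le> \<delta>" for b
  proof -
    have "\<exists>U w. U \<in> W \<and> w \<in> L2 M \<and>
      (\<forall>\<psi>. test_function \<Omega> \<psi> \<longrightarrow> (LINT x|M. snd (U x) \<bullet> grad \<psi> x) = (LINT x|M. (w x - a x * fst (U x) - b x) * \<psi> x)) \<and>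
      l2norm M (\<lambda>x. fst (U x)) \<le> 2 * (\<delta> * sqrt (measure M (space M))) / \<kappa> \<and>
      (\<forall>\<epsilon>>0. AE x in M. \<forall>m. (\<forall>h. 0 < h \<longrightarrow> h < \<epsilon> \<longrightarrow> m * h \<le> prim (\<gamma> x) (fst (U x) + h) - prim (\<gamma> x) (fst (U x))) \<longrightarrow> m \<le> w x) \<and>
      (\<forall>\<epsilon>>0. AE x in M. \<forall>m. (\<forall>h. 0 < h \<longrightarrow> h < \<epsilon> \<longrightarrow> m * h \<le> prim (\<gamma> x) (fst (U x) - h) - prim (\<gamma> x) (fst (U x))) \<longrightarrow> m \<le> - w x)"
    proof (rule variational_solution[OF _ _ _ a b less_imp_le[OF \<delta>] pos(3) coercive])
      show "(\<lambda>p. prim (\<gamma> (fst p)) (snd p)) \<in> borel_measurable (borel \<Otimes>\<^sub>M borel)"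
        unfolding \<gamma>_def by (rule prim_trunc_measurable[OF g'(1)])
      show "\<bar>prim (\<gamma> x) s - prim (\<gamma> x) t\<bar> \<le> (C * \<epsilon>) * \<bar>s - t\<bar>" for x s t
        by (rule prim_lipschitz[OF int]) (use pos in \<open>auto simp: \<gamma>_def intro!: trunc_bounded\<close>)
      show "\<bar>prim (\<gamma> x) t\<bar> \<le> C * t\<^sup>2 / 2" for x t by (rule prim_quadratic[OF int \<gamma>_le])
    qed
    then obtain U w where U: "U \<in> W" and w: "w \<in> L2 M"
      and eq: "\<And>\<psi>. test_function \<Omega> \<psi> \<Longrightarrow> (LINT x|M. snd (U x) \<bullet> grad \<psi> x) = (LINT x|M. (w x - a x * fst (U x) - b x) * \<psi> x)"
      and small: "l2norm M (\<lambda>x. fst (U x)) \<le> 2 * (\<delta> * sqrt V) / \<kappa>"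
      and up: "\<And>\<epsilon>. 0 < \<epsilon> \<Longrightarrow> AE x in M. \<forall>m. (\<forall>h. 0 < h \<longrightarrow> h < \<epsilon> \<longrightarrow> m * h \<le> prim (\<gamma> x) (fst (U x) + h) - prim (\<gamma> x) (fst (U x))) \<longrightarrow> m \<le> w x"
      and down: "\<And>\<epsilon>. 0 < \<epsilon> \<Longrightarrow> AE x in M. \<forall>m. (\<forall>h. 0 < h \<longrightarrow> h < \<epsilon> \<longrightarrow> m * h \<le> prim (\<gamma> x) (fst (U x) - h) - prim (\<gamma> x) (fst (U x))) \<longrightarrow> m \<le> - w x"
      unfolding V_def by blast
    define u where "u = (\<lambda>x. fst (U x))"
    define f where "f = (\<lambda>x. w x - a x * u x - b x)"
    have u: "u \<in> L2 M" unfolding u_def by (rule L2_fst[OF W_L2[OF U]])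
    have f: "f \<in> L2 M" unfolding f_def
      by (intro L2_diff w L2_mult_bounded(1)[OF a u] L2_bounded[OF b(1)]) (use b(2) in simp)
    have mult: "AE x in M. multiplier (\<gamma> x) (u x) (w x)"
      unfolding multiplier_def AE_all_countable
      by (intro allI AE_conjI) (use up down in \<open>simp_all add: u_def\<close>)
    have f_le: "AE x in M. \<bar>f x\<bar> \<le> \<Lambda> * \<bar>u x\<bar> + \<delta>"
      using mult a(2) b(2)
    proof eventually_elim
      case (elim x)
      have "\<bar>w x\<bar> \<le> C * \<bar>u x\<bar>" by (rule multiplier_abs_le[OF elim(1) int pos(2) \<gamma>_le])
      moreover have "\<bar>a x * u x\<bar> \<le> A * \<bar>u x\<bar>" using elim(2) by (simp add: abs_mult mult_right_mono)
      moreover have "\<bar>f x\<bar> \<le> \<bar>w x\<bar> + \<bar>a x * u x\<bar> + \<bar>b x\<bar>" unfolding f_def by linarith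
      ultimately show ?case using elim(3) unfolding \<Lambda>_def distrib_right by linarith
    qed
    have "(LINT x|M. \<bar>u x\<bar>) \<le> sqrt V * l2norm M u" using L1_le_L2[OF u] by (simp add: V_def)
    also have "\<dots> \<le> sqrt V * (2 * (\<delta> * sqrt V) / \<kappa>)"
      using small V unfolding u_def by (intro mult_left_mono) auto
    also have "\<dots> = \<delta> * (2 * V / \<kappa>)" using V by (simp add: field_simps)
    finally have L1: "(LINT x|M. \<bar>u x\<bar>) + \<delta> * c \<le> \<delta> * (2 * V / \<kappa> + c)" by (simp add: distrib_left)
    have "AE x in M. c * \<bar>u x\<bar> \<le> exp \<Lambda> * ((LINT x|M. \<bar>u x\<bar>) + \<delta> * c)"
      unfolding c_def u_def
      by (rule sup_bound[OF U f _ \<Lambda> less_imp_le[OF \<delta>]]) (use eq f_le in \<open>simp_all add: f_def u_def\<close>)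
    moreover have "exp \<Lambda> * ((LINT x|M. \<bar>u x\<bar>) + \<delta> * c) \<le> c * (\<epsilon> / 2)"
    proof -
      have "exp \<Lambda> * ((LINT x|M. \<bar>u x\<bar>) + \<delta> * c) \<le> exp \<Lambda> * (\<delta> * (2 * V / \<kappa> + c))"
        by (rule mult_left_mono[OF L1]) simp
      also have "\<dots> = \<delta> * B" by (simp add: B_def)
      also have "\<dots> = c * (\<epsilon> / 2)" using B by (simp add: \<delta>_def)
      finally show ?thesis .
    qed
    ultimately have "AE x in M. c * \<bar>u x\<bar> \<le> c * (\<epsilon> / 2)" by (auto elim: eventually_mono)
    then have u_small: "AE x in M. \<bar>u x\<bar> < \<epsilon>"
      by eventually_elim (use c pos(1) in simp)
    have env: "AE x in M. ereal (w x) \<in> {lower_env g x (u x)..upper_env g x (u x)}"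
      using mult u_small g'(2) lin
    proof eventually_elim
      case (elim x)
      have "AE s in lborel. \<bar>s\<bar> \<le> \<epsilon> \<longrightarrow> \<gamma> x s = g x s"
        using elim(3,4) by eventually_elim (auto simp: \<gamma>_def trunc_def)
      from multiplier_in_envelopes[of "\<gamma> x" "u x" "w x" g x, OF elim(1) int section_lebesgue_measurable[OF g'(1) elim(3)] elim(2) this]
      show ?case .
    qed
    have "has_weak_laplacian \<Omega> u (\<lambda>x. - f x)"
      unfolding u_def by (rule weak_laplacianI[OF U f]) (use eq in \<open>simp add: f_def u_def\<close>)
    moreover have "u \<in> H10 \<Omega>" unfolding u_def by (rule W_imp_H10[OF U])
    moreover have "AE x in M. ereal (- (- f x) + a x * u x + b x) \<in> {lower_env g x (u x)..upper_env g x (u x)}"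
      using env by (simp add: f_def)
    ultimately show ?thesis by blast
  qed
  then show ?thesis using \<delta> by blast
qed

theorem theorem28:
  fixes \<Omega> :: "'a::euclidean_space set"
    and g :: "'a \<Rightarrow> real \<Rightarrow> real"
    and a :: "'a \<Rightarrow> real"
    and p q C\<^sub>1 C\<^sub>2 \<alpha> :: real
  assumes domain: "bounded \<Omega>" "open \<Omega>" "Ck_boundary 1 \<Omega>"
    and p_ge: "1 \<le> p"
    and p_subcritical: "DIM('a) \<ge> 3 \<Longrightarrow> p < (real DIM('a) + 2) / (real DIM('a) - 2)"
    and g_measurable: "(\<lambda>(x, t). g x t) \<in> borel_measurable (lebesgue_on (\<Omega> \<times> UNIV))"
    and growth: "\<exists>C>0. AE (x, t) in lebesgue_on (\<Omega> \<times> UNIV). \<bar>g x t\<bar> \<le> C * (1 + \<bar>t\<bar> powr p)"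
    and g_zero: "\<And>x. x \<in> \<Omega> \<Longrightarrow> g x 0 = 0"
    and g_near_zero:
      "Lim (at_right 0) (\<lambda>\<epsilon>::real. esssup (lebesgue_on (\<Omega> \<times> {-\<epsilon>..\<epsilon>})) (\<lambda>(x, t). ereal \<bar>g x t / t\<bar>))
         < ereal (lambda1 \<Omega>)"
    and superquadratic: "\<exists>\<mu>>2. \<exists>r\<ge>0.
         (AE x in lebesgue_on \<Omega>. \<forall>t\<ge>r. ereal (\<mu> * primitive g x t) \<le> ereal t * lower_env g x t) \<and>
         (AE x in lebesgue_on \<Omega>. \<forall>t\<le>-r. ereal (\<mu> * primitive g x t) \<le> ereal t * upper_env g x t) \<and>
         (AE x in lebesgue_on \<Omega>. \<forall>t\<ge>r. g x t \<ge> 1)"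
    and C1: "0 < C\<^sub>1" "C\<^sub>1 < lambda1 \<Omega>"
    and C2: "0 < C\<^sub>2"
    and g_bound: "AE (x, t) in lebesgue_on (\<Omega> \<times> UNIV). \<bar>g x t\<bar> \<le> C\<^sub>1 * \<bar>t\<bar> + C\<^sub>2 * \<bar>t\<bar> powr p"
    and alpha: "\<alpha> = lambda1 \<Omega> / (lambda1 \<Omega> - C\<^sub>1)"
    and a_bounded: "a \<in> Linf \<Omega>"
    and a_coercive: "coercive_op \<Omega> (\<lambda>x. \<alpha> * a x)"
    and conjugate: "1 / (p + 1) + 1 / q = 1"
  shows "\<exists>\<delta>>0. \<forall>b\<in>Lp q \<Omega>. Linf_norm \<Omega> b < ereal \<delta> \<longrightarrow>
    (\<exists>u\<in>H10 \<Omega>. \<exists>w. has_weak_laplacian \<Omega> u w \<and>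
      (AE x in lebesgue_on \<Omega>.
         ereal (- w x + a x * u x + b x) \<in> {lower_env g x (u x)..upper_env g x (u x)}))"
proof -
  interpret bounded_open \<Omega> using domain by unfold_locales
  obtain g' where g': "g' \<in> borel_measurable borel" "AE x in M. AE t in lborel. g x t = g' (x, t)"
    using borel_version_times[OF domain(2) g_measurable] by blast
  have bnd: "AE x in M. AE t in lborel. \<bar>g x t\<bar> \<le> C\<^sub>1 * \<bar>t\<bar> + C\<^sub>2 * \<bar>t\<bar> powr p"
    using AE_lebesgue_on_times[OF domain(2) g_bound] by simp
  obtain A where A: "0 \<le> A" "AE x in M. \<bar>a x\<bar> \<le> A" using Linf_AE_bound(2)[OF a_bounded] by blast
  note am = Linf_AE_bound(1)[OF a_bounded]
  have "\<exists>\<epsilon> C \<kappa>. 0 < \<epsilon> \<and> 0 \<le> C \<and> 0 < \<kappa> \<and>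
    (AE x in M. AE t in lborel. \<bar>t\<bar> \<le> \<epsilon> \<longrightarrow> \<bar>g x t\<bar> \<le> C * \<bar>t\<bar>) \<and>
    (\<forall>\<phi>. test_function \<Omega> \<phi> \<longrightarrow>
      \<kappa> * (l2norm M (jet \<phi>))\<^sup>2 \<le> (l2norm M (grad \<phi>))\<^sup>2 + (LINT x|M. a x * \<phi> x * \<phi> x) - C * (l2norm M \<phi>)\<^sup>2)"
  proof (cases "\<Omega> = {}")
    \<comment> \<open>On the empty domain there is no eigenfunction and \<open>lambda1\<close>
      carries no information; all integrals vanish, so arbitrary constants do.\<close>
    case True
    have "(LINT x|M. h x) = 0" for h :: "'a \<Rightarrow> real"
      using Bochner_Integration.integral_cong[of M M h "\<lambda>_. 0"] True by simp
    moreover have "AE x in M. Q x" for Q by (rule AE_I2) (simp add: True)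
    ultimately show ?thesis by (intro exI[of _ 1]) (simp add: l2norm_def)
  next
    case False
    obtain \<kappa> where \<kappa>: "\<kappa> > 0" "\<And>\<phi>. test_function \<Omega> \<phi> \<Longrightarrow>
      \<kappa> * (l2norm M (jet \<phi>))\<^sup>2 \<le> (l2norm M (grad \<phi>))\<^sup>2 + (LINT x|M. a x * \<phi> x * \<phi> x) - C\<^sub>1 * (l2norm M \<phi>)\<^sup>2"
      using coercive_test[OF False C1 alpha a_coercive] by blast
    have "p \<noteq> 1"
    proof
      assume p: "p = 1"
      obtain \<mu> r where mu: "\<mu> > 2" "r \<ge> 0"
        and sq: "AE x in M. \<forall>t\<ge>r. ereal (\<mu> * primitive g x t) \<le> ereal t * lower_env g x t"
        and ge1: "AE x in M. \<forall>t\<ge>r. g x t \<ge> 1"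
        using superquadratic by blast
      have "AE x in M. False"
        using sq ge1 bnd g'(2)
      proof eventually_elim
        case (elim x)
        have "AE t in lborel. \<bar>g x t\<bar> \<le> (C\<^sub>1 + C\<^sub>2) * \<bar>t\<bar>"
          using elim(3) by eventually_elim (simp add: p distrib_right)
        from superquadratic_not_linear[of g x, OF section_lebesgue_measurable[OF g'(1) elim(4)] this _ mu] elim(1,2) C1(1) C2
        show False by simp
      qed
      from ex_in_domain[OF False this] show False by simp
    qed
    with p_ge have p: "0 < p - 1" by simp
    \<comment> \<open>Below this threshold the superlinear part
      \<open>C\<^sub>2 * \<bar>t\<bar> powr p\<close> is at most
      \<open>\<kappa> / 2 * \<bar>t\<bar>\<close>; solving this for t uses that p - 1 is
      positive.\<close>
    define \<epsilon> where "\<epsilon> = min 1 ((\<kappa> / (2 * C\<^sub>2)) powr (1 / (p - 1)))"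
    have \<epsilon>: "0 < \<epsilon>" using \<kappa>(1) C2 by (simp add: \<epsilon>_def)
    \<comment> \<open>Half of the coercivity constant pays for the superlinear part of
      \<open>g\<close>, the other half remains as the coercivity constant of the truncated
      problem.\<close>
    define C where "C = C\<^sub>1 + \<kappa> / 2"
    have powr_le: "C\<^sub>2 * \<bar>t\<bar> powr p \<le> \<kappa> / 2 * \<bar>t\<bar>" if "\<bar>t\<bar> \<le> \<epsilon>" for t
    proof (cases "t = 0")
      case False
      have "\<bar>t\<bar> powr (p - 1) \<le> ((\<kappa> / (2 * C\<^sub>2)) powr (1 / (p - 1))) powr (p - 1)"
        using that p unfolding \<epsilon>_def by (intro powr_mono2) auto
      also have "\<dots> = \<kappa> / (2 * C\<^sub>2)" using p \<kappa>(1) C2 by (simp add: powr_powr)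
      finally have "C\<^sub>2 * \<bar>t\<bar> powr (p - 1) \<le> \<kappa> / 2" using C2 by (simp add: field_simps)
      then have "C\<^sub>2 * \<bar>t\<bar> powr (p - 1) * \<bar>t\<bar> \<le> \<kappa> / 2 * \<bar>t\<bar>" by (rule mult_right_mono) simp
      moreover have "\<bar>t\<bar> powr p = \<bar>t\<bar> powr (p - 1) * \<bar>t\<bar>" using False by (simp add: powr_diff)
      ultimately show ?thesis by (simp add: mult.assoc)
    qed simp
    have "AE x in M. AE t in lborel. \<bar>t\<bar> \<le> \<epsilon> \<longrightarrow> \<bar>g x t\<bar> \<le> C * \<bar>t\<bar>"
      using bnd
    proof eventually_elim
      case (elim x)
      then show ?case
      proof eventually_elim
        case (elim t)
        then show ?case using powr_le[of t] unfolding C_def distrib_right by linarith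
      qed
    qed
    moreover have "\<kappa> / 2 * (l2norm M (jet \<phi>))\<^sup>2 \<le>
        (l2norm M (grad \<phi>))\<^sup>2 + (LINT x|M. a x * \<phi> x * \<phi> x) - C * (l2norm M \<phi>)\<^sup>2"
      if t: "test_function \<Omega> \<phi>" for \<phi>
    proof -
      have "\<kappa> / 2 * (l2norm M \<phi>)\<^sup>2 \<le> \<kappa> / 2 * (l2norm M (jet \<phi>))\<^sup>2"
        using \<kappa>(1) l2norm_jet[OF t] by (intro mult_left_mono) auto
      moreover have "\<kappa> * (l2norm M (jet \<phi>))\<^sup>2 = \<kappa> / 2 * (l2norm M (jet \<phi>))\<^sup>2 + \<kappa> / 2 * (l2norm M (jet \<phi>))\<^sup>2"
        by simp
      ultimately show ?thesis using \<kappa>(2)[OF t] unfolding C_def distrib_right by linarith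
    qed
    moreover have "0 \<le> C" using \<kappa>(1) C1(1) by (simp add: C_def)
    ultimately show ?thesis using \<epsilon> \<kappa>(1) by (intro exI[of _ \<epsilon>] exI[of _ C] exI[of _ "\<kappa> / 2"]) simp
  qed
  then obtain \<epsilon> C \<kappa> where pos: "0 < \<epsilon>" "0 \<le> C" "0 < \<kappa>"
    and lin: "AE x in M. AE t in lborel. \<bar>t\<bar> \<le> \<epsilon> \<longrightarrow> \<bar>g x t\<bar> \<le> C * \<bar>t\<bar>"
    and coer: "\<And>\<phi>. test_function \<Omega> \<phi> \<Longrightarrow>
      \<kappa> * (l2norm M (jet \<phi>))\<^sup>2 \<le> (l2norm M (grad \<phi>))\<^sup>2 + (LINT x|M. a x * \<phi> x * \<phi> x) - C * (l2norm M \<phi>)\<^sup>2"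
    by blast
  obtain \<delta> where \<delta>: "0 < \<delta>" and sol: "\<And>b. b \<in> borel_measurable M \<Longrightarrow> (AE x in M. \<bar>b x\<bar> \<le> \<delta>) \<Longrightarrow>
    \<exists>u\<in>H10 \<Omega>. \<exists>w. has_weak_laplacian \<Omega> u w \<and>
      (AE x in M. ereal (- w x + a x * u x + b x) \<in> {lower_env g x (u x)..upper_env g x (u x)})"
    using small_solution[OF g' lin pos am A(2,1) coer] by blast
  show ?thesis
  proof (intro exI[of _ \<delta>] conjI ballI impI \<delta>)
    fix b assume b: "b \<in> Lp q \<Omega>" "Linf_norm \<Omega> b < ereal \<delta>"
    show "\<exists>u\<in>H10 \<Omega>. \<exists>w. has_weak_laplacian \<Omega> u w \<and>
      (AE x in M. ereal (- w x + a x * u x + b x) \<in> {lower_env g x (u x)..upper_env g x (u x)})"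
      by (rule sol[OF _ AE_abs_le_if_Linf_norm_less[OF b(2)]]) (use b(1) in \<open>simp add: Lp_def\<close>)
  qed
qed

end
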